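(* Let $F,\mu,\sigma$ satisfy Assumption F (see context), and assume that the obstacle problem $$\min\Big\{-\mathcal{L}^X v-F(\cdot,v,Dv,D^2v),\ v-g\Big\}=0\ \text{ on }[0,T)\times\mathbb{R}^d,\qquad v=g\ \text{ on }\{T\}\times\mathbb{R}^d,$$ has comparison for bounded functions (see context). Let $g:[0,T]\times\mathbb{R}^d\to\mathbb{R}$ be any bounded function that is Lipschitz in $x$ and $\frac12$-Hölder in $t$, and let $v^h$, $h=T/n$, $n\ge 1$, be defined by the backward scheme in the context. Then there exists a bounded function $v:[0,T]\times\mathbb{R}^d\to\mathbb{R}$ such that $v^h\to v$ locally uniformly as $h\to0$. Moreover, $v$ is the unique bounded viscosity solution of the obstacle problem with terminal condition $g$.
   Context: Notation. $T>0$; $A\cdot B=\mathrm{Tr}[A^{\rm T}B]$; $\mathbb{S}_d$ is the set of symmetric $d\times d$ real matrices. For a function $\varphi$ of $(t,x)$, $|\varphi|_\infty$ is the sup norm and $|\varphi|_1=|\varphi|_\infty+\sup\frac{|\varphi(t,x)-\varphi(t',x')|}{|x-x'|+|t-t'|^{1/2}}$ (sup over distinct pairs of points). "Lipschitz in $x$ and $\frac12$-Hölder in $t$" means that this last seminorm is finite. Data. $\mu:[0,T]\times\mathbb{R}^d\to\mathbb{R}^d$, $\sigma:[0,T]\times\mathbb{R}^d\to\mathbb{R}^{d\times d}$, $a=\sigma\sigma^{\rm T}$, $\mathcal{L}^X\varphi=\partial_t\varphi+\mu\cdot D\varphi+\frac12 a\cdot D^2\varphi$, and $F:(t,x,r,p,\gamma)\in[0,T]\times\mathbb{R}^d\times\mathbb{R}\times\mathbb{R}^d\times\mathbb{S}_d\mapsto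 F(t,x,r,p,\gamma)\in\mathbb{R}$. $F_r,F_p,F_\gamma$ are the partial gradients of $F$ in $r,p,\gamma$, and $F_\gamma^-$ is the pseudo-inverse of the nonnegative symmetric matrix $F_\gamma$. Conditions involving these gradients are required wherever the gradients exist. Assumption F. (i) $F$ is Lipschitz in $(x,r,p,\gamma)$ uniformly in $t$, and $|F(\cdot,\cdot,0,0,0)|_\infty<K$ for some constant $K>0$. (ii) $\sigma$ is invertible at every point and $|\mu|_1+|\sigma|_1<\infty$. (iii) $F$ is elliptic (nondecreasing in $\gamma$, so $F_\gamma\ge0$) and $a^{-1}\cdot F_\gamma\le1$. (iv) $F_p\in\mathrm{Image}(F_\gamma)$ and $|F_p^{\rm T}F_\gamma^-F_p|_\infty<K$. (v) $F_r-\frac14F_p^{\rm T}F_\gamma^-F_p\ge0$. Scheme. $W$ is a $d$-dimensional Brownian motion, $h=T/n$, $t_i=ih$. Put $\hat X^{t,x}_h=x+\mu(t,x)h+\sigma(t,x)(W_{t+h}-W_t)$. With $\Delta=W_{t+h}-W_t$ and $\sigma=\sigma(t,x)$, let $H_0^h=1$, $H_1^h=(\sigma^{\rm T})^{-1}\frac{\Delta}{h}$, $H_2^h=(\sigma^{\rm T})^{-1}\frac{\Delta\Delta^{\rm T}-h\mathbf{I}_d}{h^2}\sigma^{-1}$. For a function $\psi$, $\mathcal{D}_h\psi(t,x)=\big(\mathbb{E}[\psi(t+h,\hat X^{t,x}_h)H^h_j]\big)_{j=0,1,2}\in\mathbb{R}\times\mathbb{R}^d\times\mathbb{S}_d$ and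 $\mathbf{T}_h[\psi](t,x)=\mathbb{E}[\psi(t+h,\hat X^{t,x}_h)]+hF(t,x,\mathcal{D}_h\psi(t,x))$. Define $v^h(T,x)=g(T,x)$ and, for $i=n-1,\dots,0$, $v^h(t_i,x)=\max\{\mathbf{T}_h[v^h](t_i,x),g(t_i,x)\}$, $x\in\mathbb{R}^d$. Since $v^h$ is defined at grid times only, $v^h\to v$ locally uniformly means: for every compact $\mathcal{K}\subset[0,T]\times\mathbb{R}^d$, $\sup\{|v^h(t_i,x)-v(t_i,x)|:(t_i,x)\in\mathcal{K}\}\to0$ as $h=T/n\to0$. Viscosity solutions. An upper (resp. lower) semicontinuous $u$ on $[0,T]\times\mathbb{R}^d$ is a viscosity subsolution (resp. supersolution) if for all $(t,x)\in[0,T]\times\mathbb{R}^d$ and smooth $\varphi$ with $0=(u-\varphi)(t,x)=\max_{[0,T]\times\mathbb{R}^d}(u-\varphi)$ (resp. $\min$): if $t<T$, then $\min\{-\mathcal{L}^X\varphi-F(\cdot,\varphi,D\varphi,D^2\varphi),\varphi-g\}(t,x)\le0$ (resp. $\ge0$); if $t=T$, then $(u-g)(T,x)\le0$ (resp. $\ge0$). A viscosity solution is both a sub- and a supersolution. Comparison for bounded functions: for every bounded upper semicontinuous subsolution $\underline v$ and bounded lower semicontinuous supersolution $\overline v$ on $[0,T)\times\mathbb{R}^d$ with $\underline v(T,\cdot)\le\overline v(T,\cdot)$, one has $\underline v\le\overline v$.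
   Formalization: F is additionally assumed continuous in t on [0,T] for fixed (x,r,p,γ); without this the claim fails, e.g. for μ=0, σ=I, g=0 and F=1 at t=0, F=0 for t>0, where no bounded viscosity solution exists. *)

theory Defs
  imports "HOL-Probability.Probability"
begin

section \<open>Norms, semicontinuity, matrices\<close>

abbreviation cylinder :: "real \<Rightarrow> (real \<times> (real^'d)) set" where
  "cylinder T \<equiv> {0..T} \<times> UNIV"

text \<open>All norms of possibly unbounded functions take values in the extended reals, so that
  finiteness is an explicit condition.\<close>

definition sup_norm :: "real \<Rightarrow> (real \<times> (real^'d) \<Rightarrow> 'b::real_normed_vector) \<Rightarrow> ereal" where
  "sup_norm T \<phi> = (SUP z\<in>cylinder T. ereal (norm (\<phi> z)))"

definition par_seminorm :: "real \<Rightarrow> (real \<times> (real^'d) \<Rightarrow> 'b::real_normed_vector) \<Rightarrow> ereal" where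
  "par_seminorm T \<phi> =
     (SUP ((t, x), (t', x')) \<in> {(z, z'). z \<in> cylinder T \<and> z' \<in> cylinder T \<and> z \<noteq> z'}.
        ereal (norm (\<phi> (t, x) - \<phi> (t', x')) / (norm (x - x') + sqrt \<bar>t - t'\<bar>)))"

definition par_norm :: "real \<Rightarrow> (real \<times> (real^'d) \<Rightarrow> 'b::real_normed_vector) \<Rightarrow> ereal" where
  "par_norm T \<phi> = sup_norm T \<phi> + par_seminorm T \<phi>"

definition usc_on :: "'a::topological_space set \<Rightarrow> ('a \<Rightarrow> real) \<Rightarrow> bool" where
  "usc_on S u \<longleftrightarrow> (\<forall>z\<in>S. \<forall>c>u z. eventually (\<lambda>y. u y < c) (at z within S))"

definition lsc_on :: "'a::topological_space set \<Rightarrow> ('a \<Rightarrow> real) \<Rightarrow> bool" where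
  "lsc_on S u \<longleftrightarrow> (\<forall>z\<in>S. \<forall>c<u z. eventually (\<lambda>y. c < u y) (at z within S))"

definition sym_mats :: "(real^'d^'d) set" where
  "sym_mats = {A. transpose A = A}"

text \<open>The product \<open>A \<cdot> B = Tr[A\<^sup>T B]\<close> is the library inner product of the type \<open>real^'d^'d\<close>.\<close>

lemma inner_matrix_eq_trace:
  fixes A B :: "real^'d^'d"
  shows "A \<bullet> B = trace (transpose A ** B)"
  unfolding inner_vec_def trace_def transpose_def matrix_matrix_mult_def
  by (simp, rule sum.swap)

text \<open>Moore--Penrose pseudo-inverse; the four Penrose equations determine it uniquely.\<close>

definition pseudo_inv :: "real^'d^'d \<Rightarrow> real^'d^'d" where
  "pseudo_inv A = (THE B. A ** B ** A = A \<and> B ** A ** B = B \<and>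
     transpose (A ** B) = A ** B \<and> transpose (B ** A) = B ** A)"

definition diffusion :: "(real \<times> (real^'d) \<Rightarrow> real^'d^'d) \<Rightarrow> real \<times> (real^'d) \<Rightarrow> real^'d^'d" where
  "diffusion \<sigma> z = \<sigma> z ** transpose (\<sigma> z)"

section \<open>Assumptions on the nonlinearity\<close>

text \<open>The arguments of \<open>F\<close> are \<open>(t, x)\<close>, \<open>r\<close>, \<open>p\<close>, \<open>\<gamma>\<close>. Only its values for symmetric \<open>\<gamma>\<close> are
  meaningful; accordingly \<open>F\<^sub>\<gamma>\<close> is the symmetric matrix representing the derivative within the
  space of symmetric matrices.\<close>

type_synonym 'd nonlin = "real \<times> (real^'d) \<Rightarrow> real \<Rightarrow> real^'d \<Rightarrow> real^'d^'d \<Rightarrow> real"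

definition has_F_r :: "'d nonlin \<Rightarrow> real \<times> (real^'d) \<Rightarrow> real \<Rightarrow> real^'d \<Rightarrow> real^'d^'d \<Rightarrow> real \<Rightarrow> bool"
  where "has_F_r F z r p \<gamma> R \<longleftrightarrow> ((\<lambda>r. F z r p \<gamma>) has_real_derivative R) (at r)"

definition has_F_p :: "'d nonlin \<Rightarrow> real \<times> (real^'d) \<Rightarrow> real \<Rightarrow> real^'d \<Rightarrow> real^'d^'d \<Rightarrow> real^'d \<Rightarrow> bool"
  where "has_F_p F z r p \<gamma> P \<longleftrightarrow> ((\<lambda>p. F z r p \<gamma>) has_derivative (\<lambda>q. P \<bullet> q)) (at p)"

definition has_F_gamma ::
    "'d nonlin \<Rightarrow> real \<times> (real^'d) \<Rightarrow> real \<Rightarrow> real^'d \<Rightarrow> real^'d^'d \<Rightarrow> real^'d^'d \<Rightarrow> bool"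
  where "has_F_gamma F z r p \<gamma> G \<longleftrightarrow>
    G \<in> sym_mats \<and> (F z r p has_derivative (\<lambda>\<eta>. G \<bullet> \<eta>)) (at \<gamma> within sym_mats)"

definition assumption_F ::
    "real \<Rightarrow> (real \<times> (real^'d) \<Rightarrow> real^'d) \<Rightarrow> (real \<times> (real^'d) \<Rightarrow> real^'d^'d) \<Rightarrow> 'd nonlin \<Rightarrow> bool"
  where "assumption_F T \<mu> \<sigma> F \<longleftrightarrow> (\<exists>K>0.
    (\<exists>L. \<forall>t\<in>{0..T}. L-lipschitz_on (UNIV \<times> UNIV \<times> UNIV \<times> sym_mats)
        (\<lambda>(x, r, p, \<gamma>). F (t, x) r p \<gamma>)) \<and>
    sup_norm T (\<lambda>z. F z 0 0 0) < ereal K \<and>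
    (\<forall>z\<in>cylinder T. invertible (\<sigma> z)) \<and>
    par_norm T \<mu> + par_norm T \<sigma> < \<infinity> \<and>
    (\<forall>z\<in>cylinder T. \<forall>r p. \<forall>\<gamma>\<in>sym_mats. \<forall>\<gamma>'\<in>sym_mats.
        (\<forall>y. y \<bullet> (\<gamma> *v y) \<le> y \<bullet> (\<gamma>' *v y)) \<longrightarrow> F z r p \<gamma> \<le> F z r p \<gamma>') \<and>
    (\<forall>z\<in>cylinder T. \<forall>r p. \<forall>\<gamma>\<in>sym_mats. \<forall>G.
        has_F_gamma F z r p \<gamma> G \<longrightarrow> matrix_inv (diffusion \<sigma> z) \<bullet> G \<le> 1) \<and>
    (\<forall>z\<in>cylinder T. \<forall>r p. \<forall>\<gamma>\<in>sym_mats. \<forall>P G.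
        has_F_p F z r p \<gamma> P \<and> has_F_gamma F z r p \<gamma> G \<longrightarrow> P \<in> range (\<lambda>y. G *v y)) \<and>
    (SUP (P, G) \<in> {(P, G). \<exists>z\<in>cylinder T. \<exists>r p. \<exists>\<gamma>\<in>sym_mats.
        has_F_p F z r p \<gamma> P \<and> has_F_gamma F z r p \<gamma> G}.
        ereal \<bar>P \<bullet> (pseudo_inv G *v P)\<bar>) < ereal K \<and>
    (\<forall>z\<in>cylinder T. \<forall>r p. \<forall>\<gamma>\<in>sym_mats. \<forall>R P G.
        has_F_r F z r p \<gamma> R \<and> has_F_p F z r p \<gamma> P \<and> has_F_gamma F z r p \<gamma> G \<longrightarrow>
        R - 1 / 4 * (P \<bullet> (pseudo_inv G *v P)) \<ge> 0))"

section \<open>Viscosity solutions of the obstacle problem\<close>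

text \<open>\<open>C_diff k\<close> is the class of \<open>k\<close> times continuously differentiable functions. Test functions
  are smooth on the whole space; their restrictions to \<open>[0,T] \<times> \<real>\<^sup>d\<close> are exactly the functions
  smooth up to the boundary, and the derivative in time at \<open>t = 0\<close> is unambiguous.\<close>

primrec C_diff :: "nat \<Rightarrow> ('a::real_normed_vector \<Rightarrow> real) \<Rightarrow> bool" where
  "C_diff 0 = (\<lambda>f. continuous_on UNIV f)"
| "C_diff (Suc k) = (\<lambda>f. (\<forall>x. f differentiable (at x)) \<and>
     (\<forall>v. C_diff k (\<lambda>x. frechet_derivative f (at x) v)))"

definition smooth :: "('a::real_normed_vector \<Rightarrow> real) \<Rightarrow> bool" where
  "smooth f \<longleftrightarrow> (\<forall>k. C_diff k f)"

definition dt :: "(real \<times> (real^'d) \<Rightarrow> real) \<Rightarrow> real \<times> (real^'d) \<Rightarrow> real" where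
  "dt \<phi> = (\<lambda>(t, x). deriv (\<lambda>s. \<phi> (s, x)) t)"

definition Dx :: "(real \<times> (real^'d) \<Rightarrow> real) \<Rightarrow> real \<times> (real^'d) \<Rightarrow> real^'d" where
  "Dx \<phi> = (\<lambda>(t, x). \<chi> i. frechet_derivative (\<lambda>y. \<phi> (t, y)) (at x) (axis i 1))"

definition Dxx :: "(real \<times> (real^'d) \<Rightarrow> real) \<Rightarrow> real \<times> (real^'d) \<Rightarrow> real^'d^'d" where
  "Dxx \<phi> = (\<lambda>(t, x). \<chi> i j. frechet_derivative (\<lambda>y. Dx \<phi> (t, y) $ j) (at x) (axis i 1))"

definition LX :: "(real \<times> (real^'d) \<Rightarrow> real^'d) \<Rightarrow> (real \<times> (real^'d) \<Rightarrow> real^'d^'d) \<Rightarrow>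
    (real \<times> (real^'d) \<Rightarrow> real) \<Rightarrow> real \<times> (real^'d) \<Rightarrow> real" where
  "LX \<mu> \<sigma> \<phi> z = dt \<phi> z + \<mu> z \<bullet> Dx \<phi> z + 1 / 2 * (diffusion \<sigma> z \<bullet> Dxx \<phi> z)"

definition obstacle_op :: "(real \<times> (real^'d) \<Rightarrow> real^'d) \<Rightarrow> (real \<times> (real^'d) \<Rightarrow> real^'d^'d) \<Rightarrow>
    'd nonlin \<Rightarrow> (real \<times> (real^'d) \<Rightarrow> real) \<Rightarrow> (real \<times> (real^'d) \<Rightarrow> real) \<Rightarrow> real \<times> (real^'d) \<Rightarrow> real"
  where "obstacle_op \<mu> \<sigma> F g \<phi> z =
    min (- LX \<mu> \<sigma> \<phi> z - F z (\<phi> z) (Dx \<phi> z) (Dxx \<phi> z)) (\<phi> z - g z)"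

definition touches_above ::
    "real \<Rightarrow> (real \<times> (real^'d) \<Rightarrow> real) \<Rightarrow> (real \<times> (real^'d) \<Rightarrow> real) \<Rightarrow> real \<times> (real^'d) \<Rightarrow> bool"
  where "touches_above T \<phi> u z \<longleftrightarrow> u z - \<phi> z = 0 \<and> (\<forall>y\<in>cylinder T. u y - \<phi> y \<le> u z - \<phi> z)"

definition touches_below ::
    "real \<Rightarrow> (real \<times> (real^'d) \<Rightarrow> real) \<Rightarrow> (real \<times> (real^'d) \<Rightarrow> real) \<Rightarrow> real \<times> (real^'d) \<Rightarrow> bool"
  where "touches_below T \<phi> u z \<longleftrightarrow> u z - \<phi> z = 0 \<and> (\<forall>y\<in>cylinder T. u y - \<phi> y \<ge> u z - \<phi> z)"

text \<open>Sub- and supersolutions on \<open>[0,T) \<times> \<real>\<^sup>d\<close>: no condition at \<open>t = T\<close> other than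
  semicontinuity up to the terminal time.\<close>

definition interior_subsolution :: "real \<Rightarrow> (real \<times> (real^'d) \<Rightarrow> real^'d) \<Rightarrow>
    (real \<times> (real^'d) \<Rightarrow> real^'d^'d) \<Rightarrow> 'd nonlin \<Rightarrow> (real \<times> (real^'d) \<Rightarrow> real) \<Rightarrow>
    (real \<times> (real^'d) \<Rightarrow> real) \<Rightarrow> bool"
  where "interior_subsolution T \<mu> \<sigma> F g u \<longleftrightarrow> usc_on (cylinder T) u \<and>
    (\<forall>z\<in>{0..<T} \<times> UNIV. \<forall>\<phi>. smooth \<phi> \<and> touches_above T \<phi> u z \<longrightarrow> obstacle_op \<mu> \<sigma> F g \<phi> z \<le> 0)"

definition interior_supersolution :: "real \<Rightarrow> (real \<times> (real^'d) \<Rightarrow> real^'d) \<Rightarrow>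
    (real \<times> (real^'d) \<Rightarrow> real^'d^'d) \<Rightarrow> 'd nonlin \<Rightarrow> (real \<times> (real^'d) \<Rightarrow> real) \<Rightarrow>
    (real \<times> (real^'d) \<Rightarrow> real) \<Rightarrow> bool"
  where "interior_supersolution T \<mu> \<sigma> F g u \<longleftrightarrow> lsc_on (cylinder T) u \<and>
    (\<forall>z\<in>{0..<T} \<times> UNIV. \<forall>\<phi>. smooth \<phi> \<and> touches_below T \<phi> u z \<longrightarrow> obstacle_op \<mu> \<sigma> F g \<phi> z \<ge> 0)"

definition viscosity_subsolution :: "real \<Rightarrow> (real \<times> (real^'d) \<Rightarrow> real^'d) \<Rightarrow>
    (real \<times> (real^'d) \<Rightarrow> real^'d^'d) \<Rightarrow> 'd nonlin \<Rightarrow> (real \<times> (real^'d) \<Rightarrow> real) \<Rightarrow>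
    (real \<times> (real^'d) \<Rightarrow> real) \<Rightarrow> bool"
  where "viscosity_subsolution T \<mu> \<sigma> F g u \<longleftrightarrow> interior_subsolution T \<mu> \<sigma> F g u \<and>
    (\<forall>x \<phi>. smooth \<phi> \<and> touches_above T \<phi> u (T, x) \<longrightarrow> u (T, x) - g (T, x) \<le> 0)"

definition viscosity_supersolution :: "real \<Rightarrow> (real \<times> (real^'d) \<Rightarrow> real^'d) \<Rightarrow>
    (real \<times> (real^'d) \<Rightarrow> real^'d^'d) \<Rightarrow> 'd nonlin \<Rightarrow> (real \<times> (real^'d) \<Rightarrow> real) \<Rightarrow>
    (real \<times> (real^'d) \<Rightarrow> real) \<Rightarrow> bool"
  where "viscosity_supersolution T \<mu> \<sigma> F g u \<longleftrightarrow> interior_supersolution T \<mu> \<sigma> F g u \<and>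
    (\<forall>x \<phi>. smooth \<phi> \<and> touches_below T \<phi> u (T, x) \<longrightarrow> u (T, x) - g (T, x) \<ge> 0)"

definition viscosity_solution :: "real \<Rightarrow> (real \<times> (real^'d) \<Rightarrow> real^'d) \<Rightarrow>
    (real \<times> (real^'d) \<Rightarrow> real^'d^'d) \<Rightarrow> 'd nonlin \<Rightarrow> (real \<times> (real^'d) \<Rightarrow> real) \<Rightarrow>
    (real \<times> (real^'d) \<Rightarrow> real) \<Rightarrow> bool"
  where "viscosity_solution T \<mu> \<sigma> F g u \<longleftrightarrow>
    viscosity_subsolution T \<mu> \<sigma> F g u \<and> viscosity_supersolution T \<mu> \<sigma> F g u"

definition comparison_bounded :: "real \<Rightarrow> (real \<times> (real^'d) \<Rightarrow> real^'d) \<Rightarrow>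
    (real \<times> (real^'d) \<Rightarrow> real^'d^'d) \<Rightarrow> 'd nonlin \<Rightarrow> (real \<times> (real^'d) \<Rightarrow> real) \<Rightarrow> bool"
  where "comparison_bounded T \<mu> \<sigma> F g \<longleftrightarrow>
    (\<forall>u w. bounded (u ` cylinder T) \<and> bounded (w ` cylinder T) \<and>
       interior_subsolution T \<mu> \<sigma> F g u \<and> interior_supersolution T \<mu> \<sigma> F g w \<and>
       (\<forall>x. u (T, x) \<le> w (T, x)) \<longrightarrow>
     (\<forall>z\<in>cylinder T. u z \<le> w z))"

section \<open>Brownian motion and the numerical scheme\<close>

definition brownian_motion :: "'w measure \<Rightarrow> (real \<Rightarrow> 'w \<Rightarrow> real^'d) \<Rightarrow> bool" where
  "brownian_motion M W \<longleftrightarrow> prob_space M \<and>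
     (\<forall>t\<ge>0. W t \<in> borel_measurable M) \<and>
     (AE \<omega> in M. W 0 \<omega> = 0) \<and>
     (\<forall>s t. 0 \<le> s \<and> s < t \<longrightarrow> distributed M lborel (\<lambda>\<omega>. W t \<omega> - W s \<omega>)
        (\<lambda>y. ennreal (\<Prod>i\<in>UNIV. normal_density 0 (sqrt (t - s)) (y $ i)))) \<and>
     (\<forall>(\<tau>::nat \<Rightarrow> real) k. 0 \<le> \<tau> 0 \<and> mono \<tau> \<longrightarrow>
        prob_space.indep_vars M (\<lambda>_. borel) (\<lambda>j \<omega>. W (\<tau> (Suc j)) \<omega> - W (\<tau> j) \<omega>) {..<k}) \<and>
     (AE \<omega> in M. continuous_on {0..} (\<lambda>t. W t \<omega>))"

definition euler_step :: "(real \<Rightarrow> 'w \<Rightarrow> real^'d) \<Rightarrow> (real \<times> (real^'d) \<Rightarrow> real^'d) \<Rightarrow>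
    (real \<times> (real^'d) \<Rightarrow> real^'d^'d) \<Rightarrow> real \<Rightarrow> real \<times> (real^'d) \<Rightarrow> 'w \<Rightarrow> real^'d"
  where "euler_step W \<mu> \<sigma> h = (\<lambda>(t, x) \<omega>.
    x + h *\<^sub>R \<mu> (t, x) + \<sigma> (t, x) *v (W (t + h) \<omega> - W t \<omega>))"

definition weight1 :: "real^'d^'d \<Rightarrow> real \<Rightarrow> real^'d \<Rightarrow> real^'d" where
  "weight1 s h \<Delta> = matrix_inv (transpose s) *v ((1 / h) *\<^sub>R \<Delta>)"

definition weight2 :: "real^'d^'d \<Rightarrow> real \<Rightarrow> real^'d \<Rightarrow> real^'d^'d" where
  "weight2 s h \<Delta> = matrix_inv (transpose s) **
     ((1 / h\<^sup>2) *\<^sub>R ((\<chi> i j. \<Delta> $ i * \<Delta> $ j) - h *\<^sub>R mat 1)) ** matrix_inv s"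

definition D0h :: "'w measure \<Rightarrow> (real \<Rightarrow> 'w \<Rightarrow> real^'d) \<Rightarrow> (real \<times> (real^'d) \<Rightarrow> real^'d) \<Rightarrow>
    (real \<times> (real^'d) \<Rightarrow> real^'d^'d) \<Rightarrow> real \<Rightarrow> (real \<times> (real^'d) \<Rightarrow> real) \<Rightarrow> real \<times> (real^'d) \<Rightarrow> real"
  where "D0h M W \<mu> \<sigma> h \<psi> = (\<lambda>(t, x).
    integral\<^sup>L M (\<lambda>\<omega>. \<psi> (t + h, euler_step W \<mu> \<sigma> h (t, x) \<omega>)))"

definition D1h :: "'w measure \<Rightarrow> (real \<Rightarrow> 'w \<Rightarrow> real^'d) \<Rightarrow> (real \<times> (real^'d) \<Rightarrow> real^'d) \<Rightarrow>
    (real \<times> (real^'d) \<Rightarrow> real^'d^'d) \<Rightarrow> real \<Rightarrow> (real \<times> (real^'d) \<Rightarrow> real) \<Rightarrow> real \<times> (real^'d) \<Rightarrow> real^'d"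
  where "D1h M W \<mu> \<sigma> h \<psi> = (\<lambda>(t, x).
    integral\<^sup>L M (\<lambda>\<omega>. \<psi> (t + h, euler_step W \<mu> \<sigma> h (t, x) \<omega>) *\<^sub>R
      weight1 (\<sigma> (t, x)) h (W (t + h) \<omega> - W t \<omega>)))"

definition D2h :: "'w measure \<Rightarrow> (real \<Rightarrow> 'w \<Rightarrow> real^'d) \<Rightarrow> (real \<times> (real^'d) \<Rightarrow> real^'d) \<Rightarrow>
    (real \<times> (real^'d) \<Rightarrow> real^'d^'d) \<Rightarrow> real \<Rightarrow> (real \<times> (real^'d) \<Rightarrow> real) \<Rightarrow> real \<times> (real^'d) \<Rightarrow>
    real^'d^'d"
  where "D2h M W \<mu> \<sigma> h \<psi> = (\<lambda>(t, x).
    integral\<^sup>L M (\<lambda>\<omega>. \<psi> (t + h, euler_step W \<mu> \<sigma> h (t, x) \<omega>) *\<^sub>R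
      weight2 (\<sigma> (t, x)) h (W (t + h) \<omega> - W t \<omega>)))"

definition Th :: "'w measure \<Rightarrow> (real \<Rightarrow> 'w \<Rightarrow> real^'d) \<Rightarrow> (real \<times> (real^'d) \<Rightarrow> real^'d) \<Rightarrow>
    (real \<times> (real^'d) \<Rightarrow> real^'d^'d) \<Rightarrow> 'd nonlin \<Rightarrow> real \<Rightarrow> (real \<times> (real^'d) \<Rightarrow> real) \<Rightarrow>
    real \<times> (real^'d) \<Rightarrow> real"
  where "Th M W \<mu> \<sigma> F h \<psi> z = D0h M W \<mu> \<sigma> h \<psi> z +
    h * F z (D0h M W \<mu> \<sigma> h \<psi> z) (D1h M W \<mu> \<sigma> h \<psi> z) (D2h M W \<mu> \<sigma> h \<psi> z)"

definition grid :: "real \<Rightarrow> nat \<Rightarrow> nat \<Rightarrow> real" where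
  "grid T n i = real i * (T / real n)"

text \<open>The backward recursion determines \<open>vh\<close> exactly at the grid times; its values at other
  times are irrelevant.\<close>

definition backward_scheme :: "'w measure \<Rightarrow> (real \<Rightarrow> 'w \<Rightarrow> real^'d) \<Rightarrow> real \<Rightarrow>
    (real \<times> (real^'d) \<Rightarrow> real^'d) \<Rightarrow> (real \<times> (real^'d) \<Rightarrow> real^'d^'d) \<Rightarrow> 'd nonlin \<Rightarrow>
    (real \<times> (real^'d) \<Rightarrow> real) \<Rightarrow> nat \<Rightarrow> (real \<times> (real^'d) \<Rightarrow> real) \<Rightarrow> bool"
  where "backward_scheme M W T \<mu> \<sigma> F g n vh \<longleftrightarrow>
    (\<forall>x. vh (T, x) = g (T, x)) \<and>
    (\<forall>i<n. \<forall>x. vh (grid T n i, x) =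
       max (Th M W \<mu> \<sigma> F (T / real n) vh (grid T n i, x)) (g (grid T n i, x)))"

definition grid_locally_uniform_limit ::
    "real \<Rightarrow> (nat \<Rightarrow> real \<times> (real^'d) \<Rightarrow> real) \<Rightarrow> (real \<times> (real^'d) \<Rightarrow> real) \<Rightarrow> bool"
  where "grid_locally_uniform_limit T vh v \<longleftrightarrow>
    (\<forall>C. compact C \<and> C \<subseteq> cylinder T \<longrightarrow>
      (\<forall>e>0. eventually (\<lambda>n. \<forall>i\<le>n. \<forall>x. (grid T n i, x) \<in> C \<longrightarrow>
         \<bar>vh n (grid T n i, x) - v (grid T n i, x)\<bar> < e) sequentially))"

end

(*
  The hypotheses (iii)-(v) make the scheme exactly monotone. If R, P, G are gradients of F and X is
  the argument of the weights, the value psi(t+h, .) enters T_h with the factor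
    1 - a^{-1}.G + h R + P.X + X^T G X / h,  X = sigma^{-T} Delta,
  which is nonnegative after completing the square with P = G y and R >= P^T G^- P / 4.
  F is only Lipschitz, so by Rademacher's theorem and Fubini its increments are bounded below by
  the infimum of its a.e. gradients along the increment; this suffices for monotonicity.
  Together with stability and consistency, the relaxed upper and lower limits of v^h are a sub-
  and a supersolution (Barles-Souganidis). The terminal inequality limsup v^h(T, .) <= g(T, .) is
  not read off the scheme: a viscosity subsolution with the obstacle inequality at t = T, tested
  with b|x - x0|^2 + k(T - t) for large k, already satisfies it. Comparison then identifies the two
  limits and gives locally uniform convergence and uniqueness.
*)
theory Submission
  imports Defs
begin

section \<open>Rademacher's theorem\<close>

text \<open>The obstacle is that the structural conditions speak of gradients that exist only almost
  everywhere, while monotonicity compares two given arguments of \<open>F\<close>, and the segment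
  joining them may miss every point of differentiability. The remedy rests on the direction of the
  increment being fixed by the two functions compared, independently of the base point: almost every
  parallel segment is good, and continuity returns to the given one. Since \<open>F\<close> is
  meaningful on a subspace of matrices only, the argument runs on its symmetrised extension. The
  scheme integrates over all of space. Test functions are therefore replaced outside a ball by a
  constant beyond the uniform bound of \<open>v^h\<close>. As \<open>v^h\<close> is only known to be
  Borel and bounded in \<open>x\<close>, suprema over the grid need not be attained, and near-maxima
  are used with an error below the consistency gap of one step. The uniform bound comes from
  constants as upper barriers: a step sends \<open>c\<close> to at most
  \<open>(1 + hL)c + hK\<close>. From below the obstacle is the barrier.\<close>

text \<open>At a bad point, arbitrarily short segments have an increment of the integral that misses
  \<open>g\<close> times the length by a fixed fraction of the length. Vitali's theorem selects
  disjoint such segments covering almost all bad points, and Henstock's lemma makes the sum of their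
  errors, hence their total length, small.\<close>

lemma negligible_not_derivative_indefinite_integral:
  fixes g :: "real \<Rightarrow> real"
  assumes g: "g integrable_on {a..b}"
  shows "negligible {x \<in> {a<..<b}. \<not> ((\<lambda>u. integral {a..u} g) has_real_derivative g x) (at x)}"
proof -
  define I where "I = (\<lambda>u. integral {a..u} g)"
  define E where "E = (\<lambda>n::nat. {x \<in> {a<..<b}. \<forall>d>0. \<exists>y\<in>{a<..<b}. y \<noteq> x \<and> \<bar>y - x\<bar> < d \<and>
      \<bar>I y - I x - g x * (y - x)\<bar> > inverse (real (Suc n)) * \<bar>y - x\<bar>})"
  have I_diff: "I y - I x = integral {x..y} g" if "a \<le> x" "x \<le> y" "y \<le> b" for x y
  proof -
    have "g integrable_on {a..y}" using g that by (meson integrable_on_subinterval atLeastatMost_subset_iff order_refl)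
    then show ?thesis
      using Henstock_Kurzweil_Integration.integral_combine[of a x y g] that unfolding I_def by simp
  qed
  have E_neg: "negligible (E n)" for n
  proof -
    define \<epsilon> where "\<epsilon> = inverse (real (Suc n))"
    have \<epsilon>: "\<epsilon> > 0" by (simp add: \<epsilon>_def)
    show ?thesis unfolding negligible_outer_le
    proof (intro allI impI)
      fix \<eta> :: real assume \<eta>: "\<eta> > 0"
      have gc: "g integrable_on cbox a b" using g by simp
      \<comment> \<open>On each selected segment the error exceeds \<open>\<epsilon>\<close> times
        the length, so this tolerance bounds the total length by \<open>\<eta>/2\<close>; the
        covering balls are twice as long as the segments.\<close>
      obtain \<gamma> where \<gamma>: "gauge \<gamma>" and hens: "\<And>p. \<lbrakk>p tagged_partial_division_of (cbox a b); \<gamma> fine p\<rbrakk> \<Longrightarrow>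
             sum (\<lambda>(x,k). norm(measure lborel k *\<^sub>R g x - integral k g)) p < \<epsilon> * \<eta> / 2"
        using Henstock_lemma[OF gc, of "\<epsilon> * \<eta> / 2"] half_gt_zero[OF mult_pos_pos[OF \<epsilon> \<eta>]] by blast
      \<comment> \<open>Two sets are attached to a pair \<open>(x, y)\<close>: the segment with the
        tag \<open>x\<close> as an endpoint, whose integral is the increment, and the larger ball
        centred at \<open>x\<close>, which is what Vitali's theorem selects. Disjoint balls give
        disjoint segments.\<close>
      define seg where "seg = (\<lambda>(x::real, y::real). {min x y..max x y})"
      define K where "K = {(x, y). x \<in> {a<..<b} \<and> y \<in> {a<..<b} \<and> y \<noteq> x \<and>
        \<bar>I y - I x - g x * (y - x)\<bar> > \<epsilon> * \<bar>y - x\<bar> \<and> seg (x, y) \<subseteq> \<gamma> x}"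
      have cov: "\<exists>i. i \<in> K \<and> x \<in> cball (fst i) \<bar>snd i - fst i\<bar> \<and> \<bar>snd i - fst i\<bar> < d"
        if xE: "x \<in> E n" and d: "0 < d" for x d
      proof -
        obtain e where e: "e > 0" "ball x e \<subseteq> \<gamma> x"
          using \<gamma> by (meson gauge_def open_contains_ball)
        have "min d e > 0" using e d by simp
        then obtain y where y: "y \<in> {a<..<b}" "y \<noteq> x" "\<bar>y - x\<bar> < min d e"
            "\<bar>I y - I x - g x * (y - x)\<bar> > \<epsilon> * \<bar>y - x\<bar>"
          using xE unfolding E_def \<epsilon>_def by blast
        have "seg (x, y) \<subseteq> ball x e" using y(3) unfolding seg_def by (auto simp: dist_real_def)
        then have "(x, y) \<in> K" using xE y e unfolding K_def E_def by auto
        then show ?thesis using y by (intro exI[of _ "(x, y)"]) auto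
      qed
      have pos: "0 < \<bar>snd i - fst i\<bar>" if "i \<in> K" for i using that unfolding K_def by auto
      obtain C where C: "countable C" "C \<subseteq> K"
        and pw: "pairwise (\<lambda>i j. disjnt (cball (fst i) \<bar>snd i - fst i\<bar>) (cball (fst j) \<bar>snd j - fst j\<bar>)) C"
        and neg: "negligible (E n - (\<Union>i \<in> C. cball (fst i) \<bar>snd i - fst i\<bar>))"
        using Vitali_covering_theorem_cballs[of K "\<lambda>i. \<bar>snd i - fst i\<bar>" "E n" fst, OF pos cov] by blast
      define B where "B = (\<lambda>i::real\<times>real. cball (fst i) \<bar>snd i - fst i\<bar>)"
      have seg_B: "seg i \<subseteq> B i" for i unfolding seg_def B_def by (cases i) (auto simp: dist_real_def)
      have fin_bound: "(\<Sum>i\<in>F. measure lebesgue (B i)) \<le> \<eta>" if F: "F \<subseteq> C" "finite F" for F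
      proof -
        define p where "p = (\<lambda>i. (fst i, seg i)) ` F"
        have inj: "inj_on (\<lambda>i. (fst i, seg i)) F"
        proof (rule inj_onI, rule ccontr)
          fix i j assume ij: "i \<in> F" "j \<in> F" "(fst i, seg i) = (fst j, seg j)" "i \<noteq> j"
          then have "disjnt (B i) (B j)" using pairwiseD[OF pw, of i j] F(1) unfolding B_def by blast
          moreover have "fst i \<in> B i" "fst i \<in> B j" using ij unfolding B_def by auto
          ultimately show False by (auto simp: disjnt_def)
        qed
        have "p tagged_partial_division_of (cbox a b)"
          unfolding tagged_partial_division_of_def
        proof (intro conjI allI impI)
          show "finite p" using F by (simp add: p_def)
          fix x k assume "(x, k) \<in> p"
          then obtain i where i: "i \<in> F" "x = fst i" "k = seg i" by (auto simp: p_def)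
          have iK: "i \<in> K" using i F C by blast
          show "x \<in> k" using i unfolding seg_def by (cases i) auto
          show "k \<subseteq> cbox a b" using iK i unfolding seg_def K_def by auto
          show "\<exists>a b. k = cbox a b" using i unfolding seg_def by (cases i) (auto simp: cbox_interval)
        next
          fix x k x' k' assume *: "(x, k) \<in> p \<and> (x', k') \<in> p \<and> (x, k) \<noteq> (x', k')"
          then obtain i j where i: "i \<in> F" "x = fst i" "k = seg i" and j: "j \<in> F" "x' = fst j" "k' = seg j"
            by (auto simp: p_def)
          have "i \<noteq> j" using i j * by auto
          then have "disjnt (B i) (B j)" using pairwiseD[OF pw, of i j] i(1) j(1) F(1) unfolding B_def by blast
          then show "interior k \<inter> interior k' = {}"
            using seg_B[of i] seg_B[of j] i j interior_subset unfolding disjnt_def by blast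
        qed
        moreover have "\<gamma> fine p" unfolding fine_def p_def using F C unfolding K_def by fastforce
        ultimately have "sum (\<lambda>(x,k). norm(measure lborel k *\<^sub>R g x - integral k g)) p < \<epsilon> * \<eta> / 2"
          by (rule hens)
        then have *: "(\<Sum>i\<in>F. norm (measure lborel (seg i) *\<^sub>R g (fst i) - integral (seg i) g)) < \<epsilon> * \<eta> / 2"
          unfolding p_def by (subst (asm) sum.reindex[OF inj]) simp
        have "\<epsilon> * \<bar>snd i - fst i\<bar> \<le> norm (measure lborel (seg i) *\<^sub>R g (fst i) - integral (seg i) g)"
          if "i \<in> F" for i
        proof -
          obtain x y where i: "i = (x, y)" by (cases i)
          have xy: "x \<in> {a<..<b}" "y \<in> {a<..<b}" "\<bar>I y - I x - g x * (y - x)\<bar> > \<epsilon> * \<bar>y - x\<bar>"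
            using that F C unfolding i K_def by auto
          show ?thesis
          proof (cases "x \<le> y")
            case True
            then show ?thesis using xy I_diff[of x y] by (simp add: i seg_def algebra_simps abs_minus_commute)
          next
            case False
            have "I y - I x - g x * (y - x) = measure lborel (seg i) *\<^sub>R g (fst i) - integral (seg i) g"
              using xy I_diff[of y x] False by (simp add: i seg_def algebra_simps)
            then show ?thesis using xy by (simp add: i)
          qed
        qed
        then have "(\<Sum>i\<in>F. \<epsilon> * \<bar>snd i - fst i\<bar>) \<le> (\<Sum>i\<in>F. norm (measure lborel (seg i) *\<^sub>R g (fst i) - integral (seg i) g))"
          by (rule sum_mono)
        then have "\<epsilon> * (\<Sum>i\<in>F. \<bar>snd i - fst i\<bar>) < \<epsilon> * (\<eta> / 2)" using * by (simp add: sum_distrib_left)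
        then have "(\<Sum>i\<in>F. \<bar>snd i - fst i\<bar>) < \<eta> / 2" using \<epsilon> by simp
        moreover have "measure lebesgue (B i) = 2 * \<bar>snd i - fst i\<bar>" for i
          unfolding B_def by (simp add: cball_eq_atLeastAtMost)
        ultimately show ?thesis by (simp add: sum_distrib_left[symmetric])
      qed
      have U: "(\<Union>i\<in>C. B i) \<in> lmeasurable \<and> measure lebesgue (\<Union>i\<in>C. B i) \<le> \<eta>"
      proof -
        have b: "measure lebesgue (\<Union>\<D>') \<le> \<eta>" if \<D>': "\<D>' \<subseteq> B ` C" "finite \<D>'" for \<D>'
        proof -
          obtain F where F: "F \<subseteq> C" "finite F" "\<D>' = B ` F" using \<D>' by (meson finite_subset_image)
          have "measure lebesgue (\<Union>i\<in>F. B i) \<le> (\<Sum>i\<in>F. measure lebesgue (B i))"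
            using F by (intro measure_UNION_le) (auto simp: B_def)
          then show ?thesis using fin_bound[OF F(1,2)] F by simp
        qed
        have B: "D \<in> lmeasurable" if "D \<in> B ` C" for D using that by (auto simp: B_def)
        show ?thesis
          using fmeasurable_Union_bound[OF countable_image[OF C(1)] B b] measure_Union_bound[OF countable_image[OF C(1)] B b] by auto
      qed
      define R where "R = E n - (\<Union>i\<in>C. B i)"
      have R: "R \<in> lmeasurable" "measure lebesgue R = 0"
        using neg unfolding R_def B_def by (auto simp: negligible_iff_measure)
      show "\<exists>T. E n \<subseteq> T \<and> T \<in> lmeasurable \<and> measure lebesgue T \<le> \<eta>"
      proof (intro exI conjI)
        show "E n \<subseteq> R \<union> (\<Union>i\<in>C. B i)" by (auto simp: R_def)
        show "R \<union> (\<Union>i\<in>C. B i) \<in> lmeasurable" using R U by (intro fmeasurable.Un) auto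
        show "measure lebesgue (R \<union> (\<Union>i\<in>C. B i)) \<le> \<eta>"
          using measure_Un_le[of R lebesgue "\<Union>i\<in>C. B i"] R U by (auto simp: fmeasurableD)
      qed
    qed
  qed
  have "{x \<in> {a<..<b}. \<not> (I has_real_derivative g x) (at x)} \<subseteq> (\<Union>n. E n)"
  proof
    fix x assume x: "x \<in> {x \<in> {a<..<b}. \<not> (I has_real_derivative g x) (at x)}"
    show "x \<in> (\<Union>n. E n)"
    proof (rule ccontr)
      assume nE: "x \<notin> (\<Union>n. E n)"
      have "(I has_real_derivative g x) (at x)"
        unfolding has_field_derivative_def has_derivative_at'
      proof (intro conjI allI impI)
        show "bounded_linear ((*) (g x))" by (rule bounded_linear_mult_right)
        fix e :: real assume "e > 0"
        then obtain n where n: "inverse (real (Suc n)) < e" using reals_Archimedean by blast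
        have "x \<notin> E n" using nE by blast
        then have "\<not> (\<forall>d>0. \<exists>y\<in>{a<..<b}. y \<noteq> x \<and> \<bar>y - x\<bar> < d \<and>
            \<bar>I y - I x - g x * (y - x)\<bar> > inverse (real (Suc n)) * \<bar>y - x\<bar>)"
          using x unfolding E_def by blast
        then obtain d where d: "d > 0" "\<And>y. y \<in> {a<..<b} \<Longrightarrow> y \<noteq> x \<Longrightarrow> \<bar>y - x\<bar> < d \<Longrightarrow>
          \<bar>I y - I x - g x * (y - x)\<bar> \<le> inverse (real (Suc n)) * \<bar>y - x\<bar>"
          by (meson not_less)
        define d' where "d' = min d (min (x - a) (b - x))"
        show "\<exists>d>0. \<forall>x'. 0 < norm (x' - x) \<and> norm (x' - x) < d \<longrightarrow>
            norm (I x' - I x - g x * (x' - x)) / norm (x' - x) < e"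
        proof (intro exI[of _ d'] conjI allI impI)
          show "d' > 0" using d x by (auto simp: d'_def)
          fix y assume y: "0 < norm (y - x) \<and> norm (y - x) < d'"
          then have "y \<in> {a<..<b}" unfolding d'_def by auto
          then have "\<bar>I y - I x - g x * (y - x)\<bar> \<le> inverse (real (Suc n)) * \<bar>y - x\<bar>"
            using y d(2)[of y] by (auto simp: d'_def)
          also have "\<dots> < e * \<bar>y - x\<bar>" using n y by (intro mult_strict_right_mono) auto
          finally show "norm (I y - I x - g x * (y - x)) / norm (y - x) < e"
            using y by (simp add: divide_less_eq)
        qed
      qed
      then show False using x by blast
    qed
  qed
  moreover have "negligible (\<Union>n. E n)" using E_neg by (intro negligible_Union_nat) auto
  ultimately show ?thesis unfolding I_def by (rule negligible_subset[rotated])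
qed

text \<open>After adding a linear function the increments define a Stieltjes measure. It is
  absolutely continuous because Lipschitz maps preserve null sets, and its Radon-Nikodym density,
  corrected by the added slope, is the integrand.\<close>

lemma lipschitz_real_indefinite_integral:
  fixes f :: "real \<Rightarrow> real"
  assumes f: "L-lipschitz_on UNIV f"
  obtains g where "\<And>a b. a \<le> b \<Longrightarrow> (g has_integral (f b - f a)) {a..b}"
proof -
  have L: "L \<ge> 0" using f lipschitz_on_nonneg by blast
  \<comment> \<open>This slope makes \<open>m\<close> expand distances, so \<open>m\<close> is a
    strictly increasing bijection of the line and its inverse is monotone, hence Borel.\<close>
  define k where "k = L + 1"
  define m where "m = (\<lambda>x. f x + k * x)"
  have lip: "\<bar>f x - f y\<bar> \<le> L * \<bar>x - y\<bar>" for x y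
    using lipschitz_onD[OF f, of x y] by (simp add: dist_real_def)
  have m_grow: "m y - m x \<ge> y - x" if "x \<le> y" for x y
  proof -
    have "f y - f x \<ge> - (L * (y - x))" using lip[of y x] that by simp
    moreover have "k * y - k * x = L * (y - x) + (y - x)" by (simp add: k_def algebra_simps)
    ultimately show ?thesis unfolding m_def by linarith
  qed
  have m_lip: "\<bar>m x - m y\<bar> \<le> (L + k) * \<bar>x - y\<bar>" for x y
  proof -
    have "\<bar>m x - m y\<bar> \<le> \<bar>f x - f y\<bar> + \<bar>k * (x - y)\<bar>" unfolding m_def by (simp add: algebra_simps)
    also have "\<dots> \<le> L * \<bar>x - y\<bar> + k * \<bar>x - y\<bar>" using lip[of x y] L by (simp add: abs_mult k_def)
    finally show ?thesis by (simp add: algebra_simps)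
  qed
  have m_cont: "continuous_on UNIV m"
    unfolding m_def using lipschitz_on_continuous_on[OF f] by (intro continuous_intros)
  have mono: "m x < m y" if "x < y" for x y using m_grow[of x y] that by simp
  then have inj: "inj m" by (metis injI linorder_neqE_linordered_idom order_less_irrefl)
  have surj: "\<exists>x. m x = y" for y
  proof -
    have 1: "m (- \<bar>y - m 0\<bar>) \<le> y" using m_grow[of "- \<bar>y - m 0\<bar>" 0] by simp
    have 2: "y \<le> m (\<bar>y - m 0\<bar>)" using m_grow[of 0 "\<bar>y - m 0\<bar>"] by simp
    show ?thesis using IVT'[of m, OF 1 2] m_cont continuous_on_subset by fastforce
  qed
  define w where "w = inv m"
  have wm: "w (m x) = x" and mw: "m (w y) = y" for x y
    unfolding w_def using inj surj by (auto simp: f_inv_into_f image_iff) (metis f_inv_into_f rangeI)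
  have w_le: "w y \<le> b \<longleftrightarrow> y \<le> m b" for y b by (metis mono mw linorder_not_less order_le_less)
  have w_ge: "a \<le> w y \<longleftrightarrow> m a \<le> y" for y a by (metis mono mw linorder_not_less order_le_less)
  have "mono w" by (metis monoI w_le mw wm w_ge)
  then have w_meas[measurable]: "w \<in> borel_measurable borel" by (rule borel_measurable_mono)
  \<comment> \<open>Pushing Lebesgue measure forward by the inverse of \<open>m\<close> gives mass
    \<open>m b - m a\<close> to \<open>{a..b}\<close>, without constructing a Stieltjes measure
    separately.\<close>
  define \<nu> where "\<nu> = distr lborel borel w"
  have \<nu>_Icc: "emeasure \<nu> {a..b} = ennreal (m b - m a)" if "a \<le> b" for a b
  proof -
    have "w -` {a..b} = {m a..m b}" using w_le w_ge by auto
    then show ?thesis using m_grow[OF that] that unfolding \<nu>_def by (subst emeasure_distr) auto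
  qed
  have ac: "absolutely_continuous lborel \<nu>"
    unfolding absolutely_continuous_def
  proof
    fix A :: "real set" assume A: "A \<in> null_sets lborel"
    \<comment> \<open>The preimage under the inverse is the image under \<open>m\<close>, so
      absolute continuity reduces to the Lipschitz bound for \<open>m\<close>.\<close>
    have vim: "w -` A = m ` A" using wm mw by (auto simp: image_iff) (metis)
    have "negligible A" using A by (simp add: negligible_iff_null_sets null_sets_completionI)
    have "negligible (m ` A)"
    proof (rule negligible_locally_Lipschitz_image[OF _ \<open>negligible A\<close>])
      fix x assume "x \<in> A"
      show "\<exists>T B. open T \<and> x \<in> T \<and> (\<forall>y\<in>A \<inter> T. norm (m y - m x) \<le> B * norm (y - x))"
        by (intro exI[of _ UNIV] exI[of _ "L + k"]) (use m_lip in auto)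
    qed simp
    then have "w -` A \<in> null_sets lborel"
      using vim A measurable_sets[OF w_meas, of A] by (simp add: negligible_iff_null_sets null_sets_completion_iff null_sets_def)
    then show "A \<in> null_sets \<nu>" using A unfolding \<nu>_def by (auto simp: null_sets_def emeasure_distr)
  qed
  obtain \<rho> where \<rho>[measurable]: "\<rho> \<in> borel_measurable lborel" and dens: "density lborel \<rho> = \<nu>"
    using sigma_finite_measure.Radon_Nikodym[OF sigma_finite_lborel ac] unfolding \<nu>_def by auto
  \<comment> \<open>\<open>enn2real\<close> replaces infinite values of the density by 0; on a
    bounded interval they form a null set because the mass is finite.\<close>
  define g where "g = (\<lambda>x. enn2real (\<rho> x) - k)"
  have "(g has_integral (f b - f a)) {a..b}" if ab: "a \<le> b" for a b
  proof -
    have int: "(\<integral>\<^sup>+x. \<rho> x * indicator {a..b} x \<partial>lborel) = ennreal (m b - m a)"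
      using \<nu>_Icc[OF ab] emeasure_density[of \<rho> lborel "{a..b}"] dens by simp
    then have "AE x in lborel. \<rho> x * indicator {a..b} x \<noteq> \<infinity>"
      by (intro nn_integral_noteq_infinite) auto
    then have "(\<integral>\<^sup>+x. ennreal (enn2real (\<rho> x) * indicator {a..b} x) \<partial>lborel) = (\<integral>\<^sup>+x. \<rho> x * indicator {a..b} x \<partial>lborel)"
      by (intro nn_integral_cong_AE) (auto simp: indicator_def top.not_eq_extremum)
    then have "((\<lambda>x. enn2real (\<rho> x) * indicator {a..b} x) has_integral (m b - m a)) UNIV"
      using m_grow[OF ab] ab int by (intro nn_integral_has_integral[OF _ _ _]) auto
    moreover have "(\<lambda>x. enn2real (\<rho> x) * indicator {a..b} x) = (\<lambda>x. if x \<in> {a..b} then enn2real (\<rho> x) else 0)"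
      by (auto simp: indicator_def)
    ultimately have "((\<lambda>x. enn2real (\<rho> x)) has_integral (m b - m a)) {a..b}"
      by (subst has_integral_restrict_UNIV[symmetric]) simp
    from has_integral_diff[OF this has_integral_const_real[of k a b]] show ?thesis
      using ab unfolding g_def m_def by (simp add: algebra_simps)
  qed
  then show ?thesis by (rule that)
qed

text \<open>On each interval \<open>(-n, n)\<close> the function is a constant plus the integral of
  its density, so the differentiation theorem for integrals applies there; countably many intervals
  cover the line.\<close>

lemma negligible_lipschitz_not_differentiable_real:
  fixes f :: "real \<Rightarrow> real"
  assumes f: "L-lipschitz_on UNIV f"
  shows "negligible {x. \<not> f differentiable (at x)}"
proof -
  obtain g where g: "\<And>a b. a \<le> b \<Longrightarrow> (g has_integral (f b - f a)) {a..b}"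
    using lipschitz_real_indefinite_integral[OF f] by blast
  define N where "N = (\<lambda>n::nat. {x \<in> {-real n<..<real n}. \<not> ((\<lambda>u. integral {-real n..u} g) has_real_derivative g x) (at x)})"
  have "negligible (N n)" for n
    unfolding N_def using g[of "-real n" "real n"] by (intro negligible_not_derivative_indefinite_integral) auto
  then have "negligible (\<Union>n. N n)" by (intro negligible_Union_nat) auto
  moreover have "{x. \<not> f differentiable (at x)} \<subseteq> (\<Union>n. N n)"
  proof
    fix x assume x: "x \<in> {x. \<not> f differentiable (at x)}"
    obtain n :: nat where n: "\<bar>x\<bar> < real n" using reals_Archimedean2 by blast
    have "\<not> ((\<lambda>u. integral {-real n..u} g) has_real_derivative g x) (at x)"
    proof
      assume "((\<lambda>u. integral {-real n..u} g) has_real_derivative g x) (at x)"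
      then have "((\<lambda>u. integral {-real n..u} g + f (- real n)) has_real_derivative g x) (at x)"
        by (auto intro!: derivative_eq_intros)
      then have "(f has_real_derivative g x) (at x)"
      proof (rule has_field_derivative_transform_within_open[where S = "{-real n<..<real n}"])
        fix u assume "u \<in> {-real n<..<real n}"
        then show "integral {-real n..u} g + f (- real n) = f u" using integral_unique[OF g[of "-real n" u]] by simp
      qed (use n in auto)
      then show False using x by (auto simp: real_differentiable_def)
    qed
    then show "x \<in> (\<Union>n. N n)" using n unfolding N_def by (auto intro!: exI[of _ n])
  qed
  ultimately show ?thesis by (rule negligible_subset)
qed

section \<open>From the line to Euclidean space: null sets, directional derivatives,
  differentiability\<close>

lemma nn_integral_translated_indicator:
  fixes A :: "'a::euclidean_space set"
  assumes [measurable]: "A \<in> sets borel"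
  shows "(\<integral>\<^sup>+x. indicator A (x + c) \<partial>lborel) = emeasure lborel A"
proof -
  have "emeasure lborel A = (\<integral>\<^sup>+x. indicator A x \<partial>distr lborel borel ((+) c))"
    by (simp add: lborel_distr_plus)
  also have "\<dots> = (\<integral>\<^sup>+x. indicator A (c + x) \<partial>lborel)" by (subst nn_integral_distr) auto
  finally show ?thesis by (simp add: add.commute)
qed

text \<open>Translation invariance replaces a change of coordinates: averaging the measure of the
  translates of \<open>A\<close> by \<open>s u\<close> over \<open>s\<close> in \<open>[0,1]\<close>
  returns the measure of \<open>A\<close>, and exchanging the integrals leaves the null sections
  inside. The direction \<open>u\<close> needs no normalisation and may be zero.\<close>

lemma null_set_if_null_on_lines:
  fixes A :: "'a::euclidean_space set"
  assumes A[measurable]: "A \<in> sets borel"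
    and lines: "\<And>x. {s. x + s *\<^sub>R u \<in> A} \<in> null_sets lborel"
  shows "A \<in> null_sets lborel"
proof -
  have m[measurable]: "(\<lambda>(x, s). indicator A (x + s *\<^sub>R u) * indicator {0..1} s :: ennreal) \<in> borel_measurable (lborel \<Otimes>\<^sub>M (lborel :: real measure))"
    unfolding case_prod_unfold by measurable
  have "emeasure lborel A = (\<integral>\<^sup>+s. (\<integral>\<^sup>+x. indicator A (x + s *\<^sub>R u) * indicator {0..1::real} s \<partial>lborel) \<partial>lborel)"
    by (simp add: nn_integral_multc nn_integral_translated_indicator nn_integral_cmult)
  also have "\<dots> = (\<integral>\<^sup>+x. (\<integral>\<^sup>+s. indicator A (x + s *\<^sub>R u) * indicator {0..1::real} s \<partial>lborel) \<partial>lborel)"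
    using lborel_pair.Fubini'[OF m] by simp
  also have "\<dots> = (\<integral>\<^sup>+(x::'a). 0 \<partial>lborel)"
  proof (rule nn_integral_cong)
    fix x :: 'a
    have "AE s in lborel. s \<notin> {s. x + s *\<^sub>R u \<in> A}" using lines by (rule AE_not_in)
    then have "AE s in lborel. indicator A (x + s *\<^sub>R u) * indicator {0..1::real} s = (0::ennreal)"
      by eventually_elim simp
    then show "(\<integral>\<^sup>+s. indicator A (x + s *\<^sub>R u) * indicator {0..1::real} s \<partial>lborel) = 0"
      by (subst nn_integral_0_iff_AE) auto
  qed
  finally show ?thesis using A by (simp add: null_sets_def)
qed

text \<open>The same exchange of integrals in the converse direction; since the total is zero, no
  normalisation in \<open>s\<close> is required.\<close>

lemma AE_lines_avoid_null_set:
  fixes A :: "'a::euclidean_space set"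
  assumes A: "A \<in> null_sets lborel"
  shows "AE x in lborel. AE s in lborel. x + (s::real) *\<^sub>R u \<notin> A"
proof -
  have [measurable]: "A \<in> sets borel" using A by (simp add: null_sets_def)
  have m[measurable]: "(\<lambda>(x, s). indicator A (x + s *\<^sub>R u) :: ennreal) \<in> borel_measurable (lborel \<Otimes>\<^sub>M (lborel :: real measure))"
    unfolding case_prod_unfold by measurable
  have "(\<integral>\<^sup>+x. (\<integral>\<^sup>+(s::real). indicator A (x + s *\<^sub>R u) \<partial>lborel) \<partial>lborel) =
      (\<integral>\<^sup>+(s::real). (\<integral>\<^sup>+x. indicator A (x + s *\<^sub>R u) \<partial>lborel) \<partial>lborel)"
    using lborel_pair.Fubini'[OF m] by simp
  also have "\<dots> = 0" using A by (simp add: nn_integral_translated_indicator null_sets_def)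
  finally have "AE x in lborel. (\<integral>\<^sup>+(s::real). indicator A (x + s *\<^sub>R u) \<partial>lborel) = 0"
    by (subst (asm) nn_integral_0_iff_AE) auto
  then show ?thesis
  proof eventually_elim
    case (elim x)
    then have "AE s in lborel. indicator A (x + (s::real) *\<^sub>R u) = (0::ennreal)"
      by (subst (asm) nn_integral_0_iff_AE) auto
    then show ?case by eventually_elim (auto simp: indicator_def split: if_splits)
  qed
qed

definition has_dir_derivative :: "('a::real_normed_vector \<Rightarrow> real) \<Rightarrow> 'a \<Rightarrow> 'a \<Rightarrow> real \<Rightarrow> bool" where
  "has_dir_derivative f x u l \<longleftrightarrow> ((\<lambda>s. (f (x + s *\<^sub>R u) - f x) / s) \<longlongrightarrow> l) (at 0)"

text \<open>The limit is taken along the sequence \<open>1/(n+1)\<close>, so that the function is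
  Borel for every Borel \<open>f\<close>, whether or not the full limit exists. Where
  \<open>has_dir_derivative\<close> holds it is the directional derivative.\<close>

definition dir_derivative :: "('a::real_normed_vector \<Rightarrow> real) \<Rightarrow> 'a \<Rightarrow> 'a \<Rightarrow> real" where
  "dir_derivative f u x = lim (\<lambda>n. (f (x + inverse (real (Suc n)) *\<^sub>R u) - f x) / inverse (real (Suc n)))"

lemma dir_derivative_eq: "has_dir_derivative f x u l \<Longrightarrow> dir_derivative f u x = l"
proof -
  assume *: "has_dir_derivative f x u l"
  have "filterlim (\<lambda>n. inverse (real (Suc n))) (at 0) sequentially"
    using LIMSEQ_inverse_real_of_nat by (auto simp: filterlim_at)
  from filterlim_compose[OF *[unfolded has_dir_derivative_def] this] show ?thesis
    unfolding dir_derivative_def by (rule limI)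
qed

lemma has_dir_derivative_minus:
  "has_dir_derivative f x u l \<Longrightarrow> has_dir_derivative (\<lambda>x. - f x) x u (- l)"
  unfolding has_dir_derivative_def by (drule tendsto_minus) (simp add: minus_divide_left)

lemma has_dir_derivative_scale:
  assumes "has_dir_derivative f x u l"
  shows "has_dir_derivative f x (c *\<^sub>R u) (c * l)"
proof (cases "c = 0")
  case True
  then show ?thesis by (simp add: has_dir_derivative_def)
next
  case False
  have "filterlim (\<lambda>s. s * c) (at 0) (at (0::real))"
    using False by (auto simp: filterlim_at eventually_at_filter intro!: tendsto_eq_intros)
  from tendsto_mult[OF tendsto_const[of c] filterlim_compose[OF assms[unfolded has_dir_derivative_def] this]]
  have "((\<lambda>s. c * ((f (x + (s * c) *\<^sub>R u) - f x) / (s * c))) \<longlongrightarrow> c * l) (at 0)" .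
  moreover have "c * ((f (x + (s * c) *\<^sub>R u) - f x) / (s * c)) = (f (x + (s * c) *\<^sub>R u) - f x) / s" for s
    using False by (cases "s = 0") auto
  ultimately show ?thesis by (simp add: has_dir_derivative_def)
qed

lemma borel_measurable_dir_derivative [measurable]:
  fixes f :: "'a::euclidean_space \<Rightarrow> real"
  assumes [measurable]: "f \<in> borel_measurable borel"
  shows "dir_derivative f u \<in> borel_measurable borel"
  unfolding dir_derivative_def by measurable

text \<open>The Cauchy form eliminates the unknown value of the limit. With non-strict inequalities
  and all real \<open>s\<close>, \<open>t\<close> inside, each inner condition defines a closed set
  when \<open>f\<close> is continuous, so existence of the derivative is a Borel condition.\<close>

lemma has_dir_derivative_iff_Cauchy:
  "(\<exists>l. has_dir_derivative f x u l) \<longleftrightarrow> (\<forall>n::nat. \<exists>m::nat. \<forall>s t. 0 < \<bar>s\<bar> \<and> \<bar>s\<bar> < inverse (real (Suc m)) \<and> 0 < \<bar>t\<bar> \<and> \<bar>t\<bar> < inverse (real (Suc m)) \<longrightarrow>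
     \<bar>(f (x + s *\<^sub>R u) - f x) / s - (f (x + t *\<^sub>R u) - f x) / t\<bar> \<le> inverse (real (Suc n)))"
  (is "?L \<longleftrightarrow> ?R")
proof
  define q where "q = (\<lambda>s. (f (x + s *\<^sub>R u) - f x) / s)"
  assume ?L
  then obtain l where l: "(q \<longlongrightarrow> l) (at 0)" by (auto simp: has_dir_derivative_def q_def)
  have "\<exists>m::nat. \<forall>s t. 0 < \<bar>s\<bar> \<and> \<bar>s\<bar> < inverse (real (Suc m)) \<and> 0 < \<bar>t\<bar> \<and> \<bar>t\<bar> < inverse (real (Suc m)) \<longrightarrow>
     \<bar>q s - q t\<bar> \<le> inverse (real (Suc n))" for n
  proof -
    have "\<forall>\<^sub>F s in at 0. dist (q s) l < inverse (real (Suc n)) / 2" using l by (rule tendstoD) simp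
    then obtain d where d: "d > 0" "\<And>s. s \<noteq> 0 \<Longrightarrow> \<bar>s\<bar> < d \<Longrightarrow> dist (q s) l < inverse (real (Suc n)) / 2"
      by (auto simp: eventually_at dist_real_def)
    obtain m where m: "inverse (real (Suc m)) < d" using reals_Archimedean[OF d(1)] by blast
    show ?thesis
    proof (intro exI[of _ m] allI impI)
      fix s t assume "0 < \<bar>s\<bar> \<and> \<bar>s\<bar> < inverse (real (Suc m)) \<and> 0 < \<bar>t\<bar> \<and> \<bar>t\<bar> < inverse (real (Suc m))"
      then have "dist (q s) l < inverse (real (Suc n)) / 2" "dist (q t) l < inverse (real (Suc n)) / 2"
        using d(2)[of s] d(2)[of t] m by auto
      then show "\<bar>q s - q t\<bar> \<le> inverse (real (Suc n))" unfolding dist_real_def by linarith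
    qed
  qed
  then show ?R unfolding q_def by blast
next
  define q where "q = (\<lambda>s. (f (x + s *\<^sub>R u) - f x) / s)"
  assume ?R
  then obtain m :: "nat \<Rightarrow> nat" where m: "\<And>n s t. 0 < \<bar>s\<bar> \<Longrightarrow> \<bar>s\<bar> < inverse (real (Suc (m n))) \<Longrightarrow> 0 < \<bar>t\<bar> \<Longrightarrow> \<bar>t\<bar> < inverse (real (Suc (m n))) \<Longrightarrow>
     \<bar>q s - q t\<bar> \<le> inverse (real (Suc n))" unfolding q_def by metis
  define S where "S = (\<lambda>k::nat. inverse (real (Suc k)) :: real)"
  have S: "S \<longlonglongrightarrow> 0" unfolding S_def by (rule LIMSEQ_inverse_real_of_nat)
  have S0: "0 < \<bar>S k\<bar>" for k by (simp add: S_def)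
  have Ssm: "\<forall>\<^sub>F k in sequentially. \<bar>S k\<bar> < inverse (real (Suc n))" for n
    using tendstoD[OF S, of "inverse (real (Suc n))"] by (simp add: dist_real_def)
  have "Cauchy (\<lambda>k. q (S k))"
  proof (rule metric_CauchyI)
    fix e :: real assume "e > 0"
    then obtain n where n: "inverse (real (Suc n)) < e" using reals_Archimedean by blast
    obtain K where K: "\<And>k. k \<ge> K \<Longrightarrow> \<bar>S k\<bar> < inverse (real (Suc (m n)))"
      using Ssm[of "m n"] by (auto simp: eventually_sequentially)
    show "\<exists>M. \<forall>k\<ge>M. \<forall>j\<ge>M. dist (q (S k)) (q (S j)) < e"
      using m[OF S0 K S0 K] n by (intro exI[of _ K]) (fastforce simp: dist_real_def)
  qed
  then obtain l where l: "(\<lambda>k. q (S k)) \<longlonglongrightarrow> l" using Cauchy_convergent convergent_def by blast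
  have "(q \<longlongrightarrow> l) (at 0)"
  proof (rule tendstoI)
    fix e :: real assume "e > 0"
    then obtain n where n: "inverse (real (Suc n)) < e" using reals_Archimedean by blast
    have "\<bar>q s - l\<bar> \<le> inverse (real (Suc n))" if s: "0 < \<bar>s\<bar>" "\<bar>s\<bar> < inverse (real (Suc (m n)))" for s
    proof (rule tendsto_upperbound)
      show "(\<lambda>k. \<bar>q s - q (S k)\<bar>) \<longlonglongrightarrow> \<bar>q s - l\<bar>" by (intro tendsto_intros l)
      show "\<forall>\<^sub>F k in sequentially. \<bar>q s - q (S k)\<bar> \<le> inverse (real (Suc n))"
        using Ssm[of "m n"] by eventually_elim (rule m[OF s S0])
    qed simp
    then show "\<forall>\<^sub>F s in at 0. dist (q s) l < e"
      unfolding eventually_at using n by (intro exI[of _ "inverse (real (Suc (m n)))"]) (auto simp: dist_real_def intro: le_less_trans)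
  qed
  then show ?L unfolding has_dir_derivative_def q_def by blast
qed

lemma borel_has_dir_derivative:
  fixes f :: "'a::euclidean_space \<Rightarrow> real"
  assumes f: "continuous_on UNIV f"
  shows "{x. \<exists>l. has_dir_derivative f x u l} \<in> sets borel"
proof -
  define C where "C = (\<lambda>n m::nat. {x. \<forall>s t. 0 < \<bar>s\<bar> \<and> \<bar>s\<bar> < inverse (real (Suc m)) \<and> 0 < \<bar>t\<bar> \<and> \<bar>t\<bar> < inverse (real (Suc m)) \<longrightarrow>
     \<bar>(f (x + s *\<^sub>R u) - f x) / s - (f (x + t *\<^sub>R u) - f x) / t\<bar> \<le> inverse (real (Suc n))})"
  have fc: "continuous_on UNIV (\<lambda>x. f (x + c))" for c
    by (rule continuous_on_compose2[OF f]) (auto intro!: continuous_intros)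
  have [measurable]: "C n m \<in> sets borel" for n m
    unfolding C_def divide_inverse by (intro borel_closed closed_Collect_all closed_Collect_imp open_Collect_const closed_Collect_le) (auto intro!: continuous_intros f fc)
  have "{x. \<exists>l. has_dir_derivative f x u l} = (\<Inter>n. \<Union>m. C n m)"
    unfolding C_def has_dir_derivative_iff_Cauchy by auto
  then show ?thesis by simp
qed

lemma AE_lborel_iff_negligible: "(AE x in lborel. P x) \<longleftrightarrow> negligible {x. \<not> P x}" for P :: "'a::euclidean_space \<Rightarrow> bool"
proof -
  have "(AE x in lborel. P x) \<longleftrightarrow> (AE x in lebesgue. P x)" by (simp add: AE_completion_iff)
  also have "\<dots> \<longleftrightarrow> negligible {x. \<not> P x}"
    unfolding negligible_iff_null_sets by (subst completion.AE_iff_null_sets) (auto simp: Collect_neg_eq)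
  finally show ?thesis .
qed

text \<open>Along every line in the direction \<open>u\<close> the function is Lipschitz in one
  variable, so the exceptional set meets each such line in a null set.\<close>

lemma AE_has_dir_derivative:
  fixes f :: "'a::euclidean_space \<Rightarrow> real"
  assumes f: "L-lipschitz_on UNIV f"
  shows "AE x in lborel. \<exists>l. has_dir_derivative f x u l"
proof -
  define A where "A = - {x. \<exists>l. has_dir_derivative f x u l}"
  have [measurable]: "A \<in> sets borel"
    unfolding A_def using borel_has_dir_derivative[OF lipschitz_on_continuous_on[OF f]] by (intro borel_comp)
  have "A \<in> null_sets lborel"
  proof (rule null_set_if_null_on_lines)
    fix x :: 'a
    define \<phi> where "\<phi> = (\<lambda>s::real. f (x + s *\<^sub>R u))"
    have "(L * norm u)-lipschitz_on UNIV \<phi>"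
    proof (rule lipschitz_onI)
      fix s t :: real
      have "dist (\<phi> s) (\<phi> t) \<le> L * dist (x + s *\<^sub>R u) (x + t *\<^sub>R u)" unfolding \<phi>_def by (rule lipschitz_onD[OF f]) auto
      also have "dist (x + s *\<^sub>R u) (x + t *\<^sub>R u) = \<bar>s - t\<bar> * norm u"
        by (simp add: dist_norm scaleR_left_diff_distrib[symmetric])
      finally show "dist (\<phi> s) (\<phi> t) \<le> L * norm u * dist s t" by (simp add: dist_real_def mult_ac)
    qed (use lipschitz_on_nonneg[OF f] in simp)
    then have "negligible {s. \<not> \<phi> differentiable (at s)}" by (rule negligible_lipschitz_not_differentiable_real)
    moreover have "{s. x + s *\<^sub>R u \<in> A} \<subseteq> {s. \<not> \<phi> differentiable (at s)}"
    proof safe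
      fix s assume s: "x + s *\<^sub>R u \<in> A" "\<phi> differentiable (at s)"
      then obtain l where "(\<phi> has_real_derivative l) (at s)" by (auto simp: real_differentiable_def)
      then have "((\<lambda>h. (\<phi> (s + h) - \<phi> s) / h) \<longlongrightarrow> l) (at 0)" by (simp add: DERIV_def)
      then have "has_dir_derivative f (x + s *\<^sub>R u) u l"
        unfolding has_dir_derivative_def \<phi>_def by (simp add: scaleR_left_distrib add.assoc)
      then show False using s(1) by (auto simp: A_def)
    qed
    ultimately have "negligible {s. x + s *\<^sub>R u \<in> A}" by (rule negligible_subset)
    moreover have "{s::real. x + s *\<^sub>R u \<in> A} \<in> sets borel" by measurable
    ultimately show "{s. x + s *\<^sub>R u \<in> A} \<in> null_sets lborel"
      by (simp add: negligible_iff_null_sets null_sets_completion_iff)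
  qed measurable
  then show ?thesis by (auto dest!: AE_not_in simp: A_def)
qed

text \<open>Points whose isolation radius is \<open>1/(k+1)\<close> have mutual distance at least
  that, so the integer part of \<open>(k+1)s\<close> distinguishes them.\<close>

lemma countable_if_isolated:
  fixes S :: "real set"
  assumes "\<And>s. s \<in> S \<Longrightarrow> \<exists>n::nat. \<forall>t. \<bar>t\<bar> < inverse (real (Suc n)) \<and> t \<noteq> 0 \<longrightarrow> s + t \<notin> S"
  shows "countable S"
proof -
  obtain n :: "real \<Rightarrow> nat" where n: "\<And>s t. s \<in> S \<Longrightarrow> \<bar>t\<bar> < inverse (real (Suc (n s))) \<Longrightarrow> t \<noteq> 0 \<Longrightarrow> s + t \<notin> S"
    using assms by metis
  define R where "R = (\<lambda>k. {s \<in> S. n s = k})"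
  have "countable (R k)" for k
  proof -
    have "inj_on (\<lambda>s. \<lfloor>real (Suc k) * s\<rfloor>) (R k)"
    proof (rule inj_onI, rule ccontr)
      fix s t assume st: "s \<in> R k" "t \<in> R k" "\<lfloor>real (Suc k) * s\<rfloor> = \<lfloor>real (Suc k) * t\<rfloor>" "s \<noteq> t"
      then have "\<bar>real (Suc k) * t - real (Suc k) * s\<bar> < 1" by linarith
      then have "real (Suc k) * \<bar>t - s\<bar> < 1" by (simp add: right_diff_distrib[symmetric] abs_mult)
      then have "\<bar>t - s\<bar> < inverse (real (Suc k))" by (simp add: field_simps)
      then have "s + (t - s) \<notin> S" using st by (intro n) (auto simp: R_def)
      then show False using st by (simp add: R_def)
    qed
    then show ?thesis by (rule countable_image_inj_on[rotated]) simp
  qed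
  then have "countable (\<Union>k. R k)" by simp
  moreover have "S = (\<Union>k. R k)" by (auto simp: R_def)
  ultimately show ?thesis by simp
qed

text \<open>Fix bounds on the difference quotients in direction \<open>v\<close>. On a set where these hold and
  subadditivity fails, a point cannot be an accumulation point of the set along the direction
  \<open>u\<close>: the set meets each line in that direction in a countable set.\<close>

lemma AE_dir_derivative_subadditive:
  fixes f :: "'a::euclidean_space \<Rightarrow> real"
  assumes f: "L-lipschitz_on UNIV f"
  shows "AE x in lborel. \<forall>a b c. has_dir_derivative f x u a \<and> has_dir_derivative f x v b \<and>
     has_dir_derivative f x (u + v) c \<longrightarrow> c \<le> a + b"
proof -
  have fcont: "continuous_on UNIV f" by (rule lipschitz_on_continuous_on[OF f])
  have fc: "continuous_on UNIV (\<lambda>x. f (x + c))" for c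
    by (rule continuous_on_compose2[OF fcont]) (auto intro!: continuous_intros)
  have [measurable]: "f \<in> borel_measurable borel" using fcont by (rule borel_measurable_continuous_onI)
  define D where "D = (\<lambda>w. {x. \<exists>l. has_dir_derivative f x w l})"
  have [measurable]: "D w \<in> sets borel" for w unfolding D_def by (rule borel_has_dir_derivative[OF fcont])
  \<comment> \<open>Quotients in the direction \<open>v\<close> stay within \<open>1/(n+1)\<close>
    of the rational \<open>\<alpha>\<close> for all \<open>t\<close> below \<open>1/(m+1)\<close>.
    Uniformity in \<open>t\<close> over the set lets the bound be used at a moving base point, and
    only countably many triples occur.\<close>
  define Q where "Q = (\<lambda>(\<alpha>::rat, n::nat, m::nat). {x. \<forall>t. 0 < \<bar>t\<bar> \<and> \<bar>t\<bar> < inverse (real (Suc m)) \<longrightarrow>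
      \<bar>f (x + t *\<^sub>R v) - f x - t * of_rat \<alpha>\<bar> \<le> inverse (real (Suc n)) * \<bar>t\<bar>})"
  have [measurable]: "Q i \<in> sets borel" for i
    unfolding Q_def case_prod_unfold
    by (intro borel_closed closed_Collect_all closed_Collect_imp open_Collect_const closed_Collect_le)
       (auto intro!: continuous_intros fc fcont)
  \<comment> \<open>Subadditivity fails here by twice the accuracy of \<open>Q\<close>; along an
    accumulating sequence the failure could be at most once that accuracy.\<close>
  define B where "B = (\<lambda>i. D u \<inter> D v \<inter> D (u + v) \<inter> Q i \<inter>
     {x. dir_derivative f u x + of_rat (fst i) + 2 * inverse (real (Suc (fst (snd i)))) < dir_derivative f (u + v) x})"
  have B_null: "B i \<in> null_sets lborel" for i
  proof (rule null_set_if_null_on_lines[of _ u])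
    show "B i \<in> sets borel" unfolding B_def by measurable
    fix x :: 'a
    obtain \<alpha> n m where i: "i = (\<alpha>, n, m)" by (cases i) auto
    define \<epsilon> where "\<epsilon> = inverse (real (Suc n))"
    have \<epsilon>: "\<epsilon> > 0" by (simp add: \<epsilon>_def)
    have "countable {s. x + s *\<^sub>R u \<in> B i}"
    proof (rule countable_if_isolated, rule ccontr)
      fix s assume s: "s \<in> {s. x + s *\<^sub>R u \<in> B i}"
        and acc: "\<not> (\<exists>k::nat. \<forall>t. \<bar>t\<bar> < inverse (real (Suc k)) \<and> t \<noteq> 0 \<longrightarrow> s + t \<notin> {s. x + s *\<^sub>R u \<in> B i})"
      define y where "y = x + s *\<^sub>R u"
      have yB: "y \<in> B i" using s by (simp add: y_def)
      obtain a c where a: "has_dir_derivative f y u a" and c: "has_dir_derivative f y (u + v) c"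
        using yB by (auto simp: B_def D_def)
      have ac: "a + of_rat \<alpha> + 2 * \<epsilon> < c"
        using yB dir_derivative_eq[OF a] dir_derivative_eq[OF c] by (simp add: B_def i \<epsilon>_def)
      have "\<exists>t. \<bar>t\<bar> < inverse (real (Suc k)) \<and> t \<noteq> 0 \<and> y + t *\<^sub>R u \<in> B i" for k
        using acc by (auto simp: y_def algebra_simps)
      then obtain t where t: "\<And>k. \<bar>t k\<bar> < inverse (real (Suc k))" "\<And>k. t k \<noteq> 0" "\<And>k. y + t k *\<^sub>R u \<in> B i"
        by metis
      have t0: "t \<longlonglongrightarrow> 0"
      proof (rule Lim_null_comparison)
        show "\<forall>\<^sub>F k in sequentially. norm (t k) \<le> inverse (real (Suc k))" using t(1) by (auto intro: always_eventually less_imp_le)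
      qed (rule LIMSEQ_inverse_real_of_nat)
      then have tf: "filterlim t (at 0) sequentially" using t(2) by (simp add: filterlim_at)
      have l1: "(\<lambda>k. (f (y + t k *\<^sub>R u) - f y) / t k) \<longlonglongrightarrow> a"
        using filterlim_compose[OF a[unfolded has_dir_derivative_def] tf] .
      have l2: "(\<lambda>k. (f (y + t k *\<^sub>R (u + v)) - f y) / t k) \<longlonglongrightarrow> c"
        using filterlim_compose[OF c[unfolded has_dir_derivative_def] tf] .
      have "\<forall>\<^sub>F k in sequentially. \<bar>t k\<bar> < inverse (real (Suc m))"
        using tendstoD[OF t0, of "inverse (real (Suc m))"] by (simp add: dist_real_def)
      then have "\<forall>\<^sub>F k in sequentially. (f (y + t k *\<^sub>R (u + v)) - f y) / t k \<le> (f (y + t k *\<^sub>R u) - f y) / t k + of_rat \<alpha> + \<epsilon>"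
      proof eventually_elim
        case (elim k)
        \<comment> \<open>The increment in the direction \<open>v\<close> is taken at the displaced
          point \<open>y + t u\<close>, not at \<open>y\<close>; this is why that point must belong
          to the set too.\<close>
        have "\<bar>f (y + t k *\<^sub>R u + t k *\<^sub>R v) - f (y + t k *\<^sub>R u) - t k * of_rat \<alpha>\<bar> \<le> \<epsilon> * \<bar>t k\<bar>"
          using t(3)[of k] t(2)[of k] elim by (auto simp: B_def Q_def i \<epsilon>_def)
        then have "\<bar>(f (y + t k *\<^sub>R u + t k *\<^sub>R v) - f (y + t k *\<^sub>R u) - t k * of_rat \<alpha>) / t k\<bar> \<le> \<epsilon>"
          using t(2)[of k] by (simp add: abs_divide divide_le_eq)
        moreover have "(f (y + t k *\<^sub>R u + t k *\<^sub>R v) - f (y + t k *\<^sub>R u) - t k * of_rat \<alpha>) / t k =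
            (f (y + t k *\<^sub>R (u + v)) - f y) / t k - (f (y + t k *\<^sub>R u) - f y) / t k - of_rat \<alpha>"
          using t(2)[of k] by (simp add: field_simps scaleR_right_distrib add.assoc)
        ultimately show ?case by linarith
      qed
      moreover have "(\<lambda>k. (f (y + t k *\<^sub>R u) - f y) / t k + of_rat \<alpha> + \<epsilon>) \<longlonglongrightarrow> a + of_rat \<alpha> + \<epsilon>"
        by (intro tendsto_intros l1)
      ultimately have "c \<le> a + of_rat \<alpha> + \<epsilon>" using l2 by (intro tendsto_le[of sequentially]) auto
      then show False using ac \<epsilon> by linarith
    qed
    then show "{s. x + s *\<^sub>R u \<in> B i} \<in> null_sets lborel" by (rule countable_imp_null_set_lborel)
  qed
  have "AE x in lborel. \<forall>i. x \<notin> B i"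
    by (subst AE_all_countable) (use B_null in \<open>auto intro: AE_not_in\<close>)
  then show ?thesis
  proof eventually_elim
    case (elim x)
    show ?case
    proof (intro allI impI, elim conjE, rule ccontr)
    fix a b c
    assume a: "has_dir_derivative f x u a" and b: "has_dir_derivative f x v b"
      and c: "has_dir_derivative f x (u + v) c" and neg: "\<not> c \<le> a + b"
    obtain n where n: "inverse (real (Suc n)) < (c - a - b) / 4"
      using reals_Archimedean[of "(c - a - b) / 4"] neg by auto
    define \<epsilon> where "\<epsilon> = inverse (real (Suc n))"
    have \<epsilon>: "\<epsilon> > 0" by (simp add: \<epsilon>_def)
    obtain r where r: "b - \<epsilon> / 2 < r" "r < b + \<epsilon> / 2" "r \<in> \<rat>" using Rats_dense_in_real[of "b - \<epsilon> / 2" "b + \<epsilon> / 2"] \<epsilon> by auto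
    then obtain \<alpha> where \<alpha>: "r = of_rat \<alpha>" by (auto elim: Rats_cases)
    have "\<forall>\<^sub>F t in at 0. dist ((f (x + t *\<^sub>R v) - f x) / t) b < \<epsilon> / 2"
      using b[unfolded has_dir_derivative_def] \<epsilon> by (intro tendstoD) auto
    then obtain d where d: "d > 0" "\<And>t. t \<noteq> 0 \<Longrightarrow> \<bar>t\<bar> < d \<Longrightarrow> dist ((f (x + t *\<^sub>R v) - f x) / t) b < \<epsilon> / 2"
      by (auto simp: eventually_at dist_real_def)
    obtain m where m: "inverse (real (Suc m)) < d" using reals_Archimedean[OF d(1)] by blast
    have "x \<in> Q (\<alpha>, n, m)"
      unfolding Q_def
    proof (clarsimp simp del: of_nat_Suc)
      fix t :: real assume t: "t \<noteq> 0" "\<bar>t\<bar> < inverse (real (Suc m))"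
      have "\<bar>(f (x + t *\<^sub>R v) - f x) / t - b\<bar> < \<epsilon> / 2" using d(2)[of t] t m by (simp add: dist_real_def)
      then have "\<bar>(f (x + t *\<^sub>R v) - f x) / t - of_rat \<alpha>\<bar> \<le> \<epsilon>" using r \<alpha> by linarith
      moreover have "(f (x + t *\<^sub>R v) - f x) / t - of_rat \<alpha> = (f (x + t *\<^sub>R v) - f x - t * of_rat \<alpha>) / t"
        using t by (simp add: field_simps)
      ultimately show "\<bar>f (x + t *\<^sub>R v) - f x - t * of_rat \<alpha>\<bar> \<le> inverse (real (Suc n)) * \<bar>t\<bar>"
        using t by (simp add: \<epsilon>_def abs_divide divide_le_eq del: of_nat_Suc)
    qed
    moreover have "a + r + 2 * \<epsilon> < c" using n r(2) \<epsilon> unfolding \<epsilon>_def[symmetric] by argo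
    ultimately have "x \<in> B (\<alpha>, n, m)"
      using a b c \<alpha> dir_derivative_eq[OF a] dir_derivative_eq[OF c] by (auto simp: B_def D_def \<epsilon>_def)
    then show False using elim by blast
    qed
  qed
qed

text \<open>Subadditivity for \<open>f\<close> and for \<open>-f\<close> together give
  equality.\<close>

lemma AE_dir_derivative_add:
  fixes f :: "'a::euclidean_space \<Rightarrow> real"
  assumes f: "L-lipschitz_on UNIV f"
  shows "AE x in lborel. has_dir_derivative f x (u + v) (dir_derivative f u x + dir_derivative f v x)"
proof -
  have mf: "L-lipschitz_on UNIV (\<lambda>x. - f x)" using f by (simp add: lipschitz_on_def dist_real_def abs_minus_commute)
  show ?thesis
    using AE_has_dir_derivative[OF f, of u] AE_has_dir_derivative[OF f, of v] AE_has_dir_derivative[OF f, of "u + v"]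
      AE_dir_derivative_subadditive[OF f, of u v] AE_dir_derivative_subadditive[OF mf, of u v]
  proof eventually_elim
    case (elim x)
    then obtain a b c where a: "has_dir_derivative f x u a" and b: "has_dir_derivative f x v b" and c: "has_dir_derivative f x (u + v) c"
      by auto
    have "c \<le> a + b" using elim(4) a b c by blast
    moreover have "- c \<le> - a + - b"
      using elim(5) has_dir_derivative_minus[OF a] has_dir_derivative_minus[OF b] has_dir_derivative_minus[OF c] by blast
    ultimately have "c = a + b" by simp
    then show ?case using c dir_derivative_eq[OF a] dir_derivative_eq[OF b] by simp
  qed
qed

text \<open>The direction is assembled one basis vector at a time. The exceptional null set depends
  on \<open>v\<close>, which is why only countably many directions can be treated at once
  afterwards.\<close>

lemma AE_dir_derivative_linear:
  fixes f :: "'a::euclidean_space \<Rightarrow> real"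
  assumes f: "L-lipschitz_on UNIV f"
  shows "AE x in lborel. has_dir_derivative f x v (\<Sum>b\<in>Basis. (v \<bullet> b) * dir_derivative f b x)"
proof -
  have "AE x in lborel. has_dir_derivative f x (\<Sum>b\<in>F. (v \<bullet> b) *\<^sub>R b) (\<Sum>b\<in>F. (v \<bullet> b) * dir_derivative f b x)"
    if "finite F" for F
    using that
  proof (induction F rule: finite_induct)
    case empty
    then show ?case by (simp add: has_dir_derivative_def)
  next
    case (insert b F)
    show ?case
      using insert.IH AE_has_dir_derivative[OF f, of b]
        AE_dir_derivative_add[OF f, of "(v \<bullet> b) *\<^sub>R b" "\<Sum>b\<in>F. (v \<bullet> b) *\<^sub>R b"]
    proof eventually_elim
      case (elim x)
      then obtain l where l: "has_dir_derivative f x b l" by blast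
      show ?case
        using elim(3) insert.hyps dir_derivative_eq[OF elim(1)] dir_derivative_eq[OF l]
          dir_derivative_eq[OF has_dir_derivative_scale[OF l, of "v \<bullet> b"]] by simp
    qed
  qed
  from this[OF finite_Basis] show ?thesis by (simp add: euclidean_representation)
qed

text \<open>At almost every point the directional derivatives exist and are linear along a countable
  dense set of directions. Compactness of the sphere and the Lipschitz bound upgrade this to a
  Frechet derivative.\<close>

theorem AE_lipschitz_differentiable:
  fixes f :: "'a::euclidean_space \<Rightarrow> real"
  assumes f: "L-lipschitz_on UNIV f"
  shows "AE x in lborel. f differentiable (at x)"
proof -
  obtain D :: "'a set" where D: "countable D" "\<And>X. open X \<Longrightarrow> X \<noteq> {} \<Longrightarrow> \<exists>d\<in>D. d \<in> X"
    using countable_dense_exists by blast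
  define p where "p = (\<lambda>x. \<Sum>b\<in>Basis. dir_derivative f b x *\<^sub>R b)"
  have p: "(\<Sum>b\<in>Basis. (v \<bullet> b) * dir_derivative f b x) = p x \<bullet> v" for v x
    unfolding p_def by (simp add: inner_sum_left inner_sum_right mult.commute inner_commute)
  have "AE x in lborel. \<forall>v\<in>D. has_dir_derivative f x v (p x \<bullet> v)"
    using AE_dir_derivative_linear[OF f] by (subst AE_ball_countable[OF D(1)]) (simp add: p)
  then show ?thesis
  proof eventually_elim
    case (elim x)
    define P where "P = p x"
    have L: "L \<ge> 0" using lipschitz_on_nonneg[OF f] .
    have "(f has_derivative (\<lambda>h. P \<bullet> h)) (at x)"
      unfolding has_derivative_at'
    proof (intro conjI allI impI)
      show "bounded_linear (\<lambda>h. P \<bullet> h)" by (rule bounded_linear_inner_right)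
      fix e :: real assume e: "e > 0"
      \<comment> \<open>Replacing a direction by a neighbour costs \<open>L \<epsilon> t\<close> in
        \<open>f\<close> and \<open>norm P \<epsilon> t\<close> in the linear part, and the
        difference quotient costs \<open>\<epsilon> t\<close>; the choice makes the sum
        \<open>e t / 2\<close>.\<close>
      define \<epsilon> where "\<epsilon> = e / (2 * (L + norm P + 1))"
      have den: "L + norm P + 1 > 0" using L by (smt (verit) norm_ge_zero)
      have \<epsilon>: "\<epsilon> > 0" using e den by (simp add: \<epsilon>_def)
      \<comment> \<open>A finite net of directions makes the limits uniform over the directions
        used.\<close>
      have "sphere 0 1 \<subseteq> (\<Union>v\<in>D. ball v \<epsilon>)"
      proof
        fix h :: 'a
        obtain v where "v \<in> D" "v \<in> ball h \<epsilon>" using D(2)[of "ball h \<epsilon>"] \<epsilon> by auto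
        then show "h \<in> (\<Union>v\<in>D. ball v \<epsilon>)" by (auto simp: dist_commute)
      qed
      then obtain F where F: "F \<subseteq> D" "finite F" "sphere 0 1 \<subseteq> (\<Union>v\<in>F. ball v \<epsilon>)"
        using compactE_image[OF compact_sphere, of D "\<lambda>v. ball v \<epsilon>"] by (metis open_ball)
      have "\<forall>\<^sub>F t in at 0. \<forall>v\<in>F. dist ((f (x + t *\<^sub>R v) - f x) / t) (P \<bullet> v) < \<epsilon>"
        unfolding eventually_ball_finite_distrib[OF F(2)]
        using elim F(1) \<epsilon> by (auto simp: has_dir_derivative_def P_def intro!: tendstoD)
      then obtain d where d: "d > 0" "\<And>t v. t \<noteq> 0 \<Longrightarrow> \<bar>t\<bar> < d \<Longrightarrow> v \<in> F \<Longrightarrow> dist ((f (x + t *\<^sub>R v) - f x) / t) (P \<bullet> v) < \<epsilon>"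
        by (auto simp: eventually_at dist_real_def)
      show "\<exists>d>0. \<forall>x'. 0 < norm (x' - x) \<and> norm (x' - x) < d \<longrightarrow> norm (f x' - f x - P \<bullet> (x' - x)) / norm (x' - x) < e"
      proof (intro exI[of _ d] conjI allI impI d(1))
        fix y assume y: "0 < norm (y - x) \<and> norm (y - x) < d"
        define t where "t = norm (y - x)"
        have t: "0 < t" "t < d" using y by (auto simp: t_def)
        have "(y - x) /\<^sub>R t \<in> sphere 0 1" using t by (simp add: t_def)
        then have "(y - x) /\<^sub>R t \<in> (\<Union>v\<in>F. ball v \<epsilon>)" using F(3) by blast
        then obtain v where v: "v \<in> F" "dist v ((y - x) /\<^sub>R t) < \<epsilon>" by auto
        have "norm ((y - x) - t *\<^sub>R v) = t * dist v ((y - x) /\<^sub>R t)"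
        proof -
          have "(y - x) - t *\<^sub>R v = t *\<^sub>R ((y - x) /\<^sub>R t - v)" using t by (simp add: algebra_simps)
          then show ?thesis using t by (simp add: dist_norm norm_minus_commute)
        qed
        then have nv: "norm ((y - x) - t *\<^sub>R v) \<le> t * \<epsilon>" using v t by simp
        have 1: "\<bar>f y - f (x + t *\<^sub>R v)\<bar> \<le> L * (t * \<epsilon>)"
        proof -
          have "\<bar>f y - f (x + t *\<^sub>R v)\<bar> \<le> L * norm (y - (x + t *\<^sub>R v))"
            using lipschitz_onD[OF f, of y "x + t *\<^sub>R v"] by (simp add: dist_norm)
          also have "\<dots> \<le> L * (t * \<epsilon>)" using nv L by (intro mult_left_mono) (simp_all add: algebra_simps)
          finally show ?thesis .
        qed
        have "\<bar>(f (x + t *\<^sub>R v) - f x) / t - P \<bullet> v\<bar> < \<epsilon>" using d(2)[of t v] t v by (simp add: dist_real_def)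
        then have "\<bar>(f (x + t *\<^sub>R v) - f x) / t - P \<bullet> v\<bar> * t \<le> \<epsilon> * t" using t by (intro mult_right_mono) auto
        also have "\<bar>(f (x + t *\<^sub>R v) - f x) / t - P \<bullet> v\<bar> * t = \<bar>f (x + t *\<^sub>R v) - f x - t * (P \<bullet> v)\<bar>"
          using t by (simp add: field_simps abs_mult_pos[symmetric] flip: abs_mult_pos)
        finally have 2: "\<bar>f (x + t *\<^sub>R v) - f x - t * (P \<bullet> v)\<bar> \<le> \<epsilon> * t" .
        have "\<bar>P \<bullet> ((y - x) - t *\<^sub>R v)\<bar> \<le> norm P * (t * \<epsilon>)"
          using Cauchy_Schwarz_ineq2[of P "(y - x) - t *\<^sub>R v"] mult_left_mono[OF nv norm_ge_zero[of P]] by linarith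
        then have 3: "\<bar>P \<bullet> (y - x) - t * (P \<bullet> v)\<bar> \<le> norm P * (t * \<epsilon>)" by (simp add: inner_diff_right)
        have "\<bar>f y - f x - P \<bullet> (y - x)\<bar> \<le> L * (t * \<epsilon>) + \<epsilon> * t + norm P * (t * \<epsilon>)"
          using 1 2 3 by linarith
        also have "\<dots> = (L + norm P + 1) * \<epsilon> * t" by (simp add: algebra_simps)
        also have "(L + norm P + 1) * \<epsilon> = e / 2"
        proof -
          have "A * (e / (2 * A)) = e / 2" if "A > 0" for A using that by simp
          from this[OF den] show ?thesis by (simp add: \<epsilon>_def)
        qed
        also have "e / 2 * t < e * t" using e t by simp
        finally show "norm (f y - f x - P \<bullet> (y - x)) / norm (y - x) < e"
          using t by (simp add: t_def divide_less_eq)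
      qed
    qed
    then show ?case by (auto simp: differentiable_def)
  qed
qed

section \<open>Increments bounded below through almost everywhere gradients\<close>

text \<open>The increment is the integral over \<open>[0,1]\<close> of a density that coincides with
  the derivative off a null set.\<close>

lemma lipschitz_real_increment_ge:
  fixes \<phi> :: "real \<Rightarrow> real"
  assumes \<phi>: "L-lipschitz_on UNIV \<phi>"
    and ae: "AE s in lborel. \<forall>d. (\<phi> has_real_derivative d) (at s) \<longrightarrow> d \<ge> c"
  shows "\<phi> 1 - \<phi> 0 \<ge> c"
proof -
  obtain g where g: "\<And>a b. a \<le> b \<Longrightarrow> (g has_integral (\<phi> b - \<phi> a)) {a..b}"
    using lipschitz_real_indefinite_integral[OF \<phi>] by blast
  define N where "N = {x \<in> {0<..<1}. \<not> ((\<lambda>u. integral {0..u} g) has_real_derivative g x) (at x)}"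
  define Z where "Z = N \<union> {s. \<not> (\<forall>d. (\<phi> has_real_derivative d) (at s) \<longrightarrow> d \<ge> c)} \<union> {0, 1}"
  have "negligible N"
    unfolding N_def using g[of 0 1] by (intro negligible_not_derivative_indefinite_integral) auto
  then have Z: "negligible Z" using ae unfolding Z_def AE_lborel_iff_negligible by (intro negligible_Un) auto
  have "c \<le> g s" if s: "s \<in> {0..1} - Z" for s
  proof -
    have s01: "s \<in> {0<..<1}" using s by (auto simp: Z_def less_le)
    then have "((\<lambda>u. integral {0..u} g) has_real_derivative g s) (at s)" using s by (auto simp: Z_def N_def)
    then have "((\<lambda>u. integral {0..u} g + \<phi> 0) has_real_derivative g s) (at s)"
      by (auto intro!: derivative_eq_intros)
    then have "(\<phi> has_real_derivative g s) (at s)"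
    proof (rule has_field_derivative_transform_within_open[where S = "{0<..<1}"])
      fix u :: real assume "u \<in> {0<..<1}"
      then show "integral {0..u} g + \<phi> 0 = \<phi> u" using integral_unique[OF g[of 0 u]] by simp
    qed (use s01 in auto)
    then show ?thesis using s by (auto simp: Z_def)
  qed
  \<comment> \<open>The density is above \<open>c\<close> only off a null set; replacing it by its
    maximum with \<open>c\<close> leaves the integral unchanged and makes the bound
    pointwise.\<close>
  then have eq: "max c (g s) = g s" if "s \<in> {0..1} - Z" for s using that by (simp add: max_absorb2)
  have "(g has_integral (\<phi> 1 - \<phi> 0)) {0..1}" using g[of 0 1] by simp
  from has_integral_spike[OF Z eq this] have "((\<lambda>s. max c (g s)) has_integral (\<phi> 1 - \<phi> 0)) {0..1}" .
  from has_integral_le[OF has_integral_const_real[of c 0 1] this] show ?thesis by simp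
qed

text \<open>The hypothesis says nothing at points where \<open>f\<close> is not differentiable, and
  the given segment may consist of such points. Almost every parallel segment meets the
  differentiability set almost everywhere, which yields the bound for almost every
  \<open>x\<close>.\<close>

lemma lipschitz_increment_ge:
  fixes f :: "'a::euclidean_space \<Rightarrow> real"
  assumes f: "L-lipschitz_on UNIV f"
    and d: "\<And>x f'. (f has_derivative f') (at x) \<Longrightarrow> f' u \<ge> c"
  shows "f (x + u) - f x \<ge> c"
proof -
  obtain N where N0: "{x \<in> space lborel. \<not> f differentiable (at x)} \<subseteq> N" "emeasure lborel N = 0" "N \<in> sets lborel"
    by (rule AE_E[OF AE_lipschitz_differentiable[OF f]])
  then have N: "{x. \<not> f differentiable (at x)} \<subseteq> N" "N \<in> null_sets lborel"
    by (simp_all add: null_sets_def)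
  have "AE x in lborel. f (x + u) - f x \<ge> c"
    using AE_lines_avoid_null_set[OF N(2), of u]
  proof eventually_elim
    case (elim x)
    define \<phi> where "\<phi> = (\<lambda>s::real. f (x + s *\<^sub>R u))"
    have "(L * norm u)-lipschitz_on UNIV \<phi>"
    proof (rule lipschitz_onI)
      fix s t :: real
      have "dist (\<phi> s) (\<phi> t) \<le> L * dist (x + s *\<^sub>R u) (x + t *\<^sub>R u)" unfolding \<phi>_def by (rule lipschitz_onD[OF f]) auto
      also have "dist (x + s *\<^sub>R u) (x + t *\<^sub>R u) = \<bar>s - t\<bar> * norm u"
        by (simp add: dist_norm scaleR_left_diff_distrib[symmetric])
      finally show "dist (\<phi> s) (\<phi> t) \<le> L * norm u * dist s t" by (simp add: dist_real_def mult_ac)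
    qed (use lipschitz_on_nonneg[OF f] in simp)
    moreover have "AE s in lborel. \<forall>d. (\<phi> has_real_derivative d) (at s) \<longrightarrow> d \<ge> c"
      using elim
    proof eventually_elim
      case (elim s)
      then obtain f' where f': "(f has_derivative f') (at (x + s *\<^sub>R u))" using N(1) by (auto simp: differentiable_def)
      have "(\<phi> has_derivative (\<lambda>h. f' (h *\<^sub>R u))) (at s)"
        unfolding \<phi>_def
        by (rule has_derivative_compose[of "\<lambda>s. x + s *\<^sub>R u" "\<lambda>h. h *\<^sub>R u" s UNIV f f', OF _ f']) (auto intro!: derivative_eq_intros)
      moreover have "f' (h *\<^sub>R u) = f' u * h" for h
        using linear_cmul[OF has_derivative_linear[OF f']] by simp
      ultimately have "(\<phi> has_real_derivative f' u) (at s)" by (simp add: has_field_derivative_def)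
      then show ?case using d[OF f'] DERIV_unique by blast
    qed
    ultimately have "\<phi> 1 - \<phi> 0 \<ge> c" by (rule lipschitz_real_increment_ge)
    then show ?case by (simp add: \<phi>_def)
  qed
  then have neg: "negligible {x. \<not> f (x + u) - f x \<ge> c}" by (simp add: AE_lborel_iff_negligible)
  have fcont: "continuous_on UNIV f" by (rule lipschitz_on_continuous_on[OF f])
  \<comment> \<open>By continuity the set of violations is open, and an open null set is
    empty.\<close>
  have "open {x. \<not> f (x + u) - f x \<ge> c}"
    unfolding not_le by (intro open_Collect_less continuous_intros continuous_on_compose2[OF fcont]) auto
  then show ?thesis using open_not_negligible neg by blast
qed

section \<open>Pseudo-inverses and positivity of the weights\<close>

lemma matrix_inv_right: "A ** matrix_inv A = mat 1"
  and matrix_inv_left: "matrix_inv A ** A = mat 1" if "invertible A" for A :: "real^'d^'d"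
  using that someI_ex[of "\<lambda>B. A ** B = mat 1 \<and> B ** A = mat 1"]
  unfolding invertible_def matrix_inv_def by auto

lemma matrix_inv_eqI: "A ** B = mat 1 \<Longrightarrow> matrix_inv A = B" for A B :: "real^'d^'d"
proof -
  assume *: "A ** B = mat 1"
  then have "invertible A" using matrix_left_right_inverse invertible_def by blast
  then have "matrix_inv A ** (A ** B) = B" by (simp add: matrix_mul_assoc matrix_inv_left)
  then show ?thesis by (simp add: *)
qed

lemma matrix_inv_transpose: "invertible A \<Longrightarrow> matrix_inv (transpose A) = transpose (matrix_inv A)"
  for A :: "real^'d^'d"
  by (rule matrix_inv_eqI) (simp add: matrix_transpose_mul[symmetric] matrix_inv_left transpose_mat)

lemma matrix_inv_diffusion:
  fixes s :: "real^'d^'d"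
  assumes "invertible s"
  shows "matrix_inv (s ** transpose s) = matrix_inv (transpose s) ** matrix_inv s"
proof (rule matrix_inv_eqI)
  have "s ** transpose s ** (matrix_inv (transpose s) ** matrix_inv s) =
      s ** (transpose s ** matrix_inv (transpose s)) ** matrix_inv s"
    by (simp add: matrix_mul_assoc)
  also have "\<dots> = mat 1" using assms by (simp add: matrix_inv_right transpose_invertible)
  finally show "s ** transpose s ** (matrix_inv (transpose s) ** matrix_inv s) = mat 1" .
qed

lemma continuous_on_det:
  fixes A :: "'a::topological_space \<Rightarrow> real^'d^'d"
  assumes "\<And>i j. continuous_on S (\<lambda>z. A z $ i $ j)"
  shows "continuous_on S (\<lambda>z. det (A z))"
  unfolding det_def by (intro continuous_intros assms)

text \<open>By Cramer's rule the entries of the inverse are quotients of determinants, with a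
  denominator that does not vanish.\<close>

lemma continuous_on_matrix_inv:
  fixes A :: "'a::topological_space \<Rightarrow> real^'d^'d"
  assumes A: "continuous_on S A" and inv: "\<And>z. z \<in> S \<Longrightarrow> invertible (A z)"
  shows "continuous_on S (\<lambda>z. matrix_inv (A z))"
proof -
  have Aij: "continuous_on S (\<lambda>z. A z $ i $ j)" for i j by (intro continuous_intros A)
  have eq: "matrix_inv (A z) $ k $ l = det (\<chi> i j. if j = k then axis l 1 $ i else A z $ i $ j) / det (A z)"
    if "z \<in> S" for z k l
  proof -
    have "A z *v (matrix_inv (A z) *v axis l 1) = axis l 1"
      using inv[OF that] by (simp add: matrix_vector_mul_assoc matrix_inv_right)
    then have "matrix_inv (A z) *v axis l 1 = (\<chi> k. det (\<chi> i j. if j = k then axis l 1 $ i else A z $ i $ j) / det (A z))"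
      using inv[OF that] by (subst cramer[symmetric]) (auto simp: invertible_det_nz)
    moreover have "(matrix_inv (A z) *v axis l 1) $ k = matrix_inv (A z) $ k $ l"
      by (simp add: matrix_vector_mul_component axis_def inner_vec_def if_distrib cong: if_cong)
    ultimately show ?thesis by simp
  qed
  have "continuous_on S (\<lambda>z. det (\<chi> i j. if j = k then axis l 1 $ i else A z $ i $ j) / det (A z))" for k l
  proof (intro continuous_on_divide continuous_on_det Aij)
    fix i j
    show "continuous_on S (\<lambda>z. (\<chi> i j. if j = k then axis l 1 $ i else A z $ i $ j) $ i $ j)"
      by (cases "j = k") (auto intro: Aij)
  qed (use inv in \<open>auto simp: invertible_det_nz\<close>)
  then have *: "continuous_on S (\<lambda>z. matrix_inv (A z) $ k $ l)" for k l
    by (subst continuous_on_cong[OF refl eq]) auto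
  have "continuous_on S (\<lambda>z. \<chi> k l. matrix_inv (A z) $ k $ l)" by (intro continuous_intros *)
  then show ?thesis by simp
qed

section \<open>Rank-one matrices and transposition\<close>

definition outer :: "real^'d \<Rightarrow> real^'d^'d" where
  "outer v = (\<chi> i j. v $ i * v $ j)"

lemma outer_mult_vec: "outer v *v x = (v \<bullet> x) *\<^sub>R v"
  by (simp add: outer_def vec_eq_iff matrix_vector_mult_def inner_vec_def sum_distrib_left sum_distrib_right mult_ac)

lemma transpose_outer: "transpose (outer v) = outer v"
  by (simp add: outer_def vec_eq_iff transpose_def mult.commute)

lemma inner_outer: "G \<bullet> outer v = v \<bullet> (G *v v)"
  by (simp add: outer_def inner_vec_def matrix_vector_mult_def sum_distrib_left mult_ac)

lemma matrix_add_rdistrib: "(B + C) ** A = B ** A + C ** A" for A B C :: "real^'d^'d"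
  by (simp add: vec_eq_iff matrix_matrix_mult_def distrib_right sum.distrib)

lemma matrix_sub_ldistrib: "A ** (B - C) = A ** B - A ** C" for A B C :: "real^'d^'d"
  by (simp add: vec_eq_iff matrix_matrix_mult_def right_diff_distrib sum_subtractf)

lemma matrix_sub_rdistrib: "(B - C) ** A = B ** A - C ** A" for A B C :: "real^'d^'d"
  by (simp add: vec_eq_iff matrix_matrix_mult_def left_diff_distrib sum_subtractf)

lemma matrix_eq_vecI: "(\<And>x. A *v x = B *v x) \<Longrightarrow> A = B" for A B :: "real^'d^'d"
  by (simp add: matrix_eq)

lemma outer_conj: "N ** outer v ** transpose N = outer (N *v v)" for N :: "real^'d^'d"
proof (rule matrix_eq_vecI)
  fix x
  have "v \<bullet> (transpose N *v x) = (N *v v) \<bullet> x"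
    by (metis dot_lmul_matrix inner_commute transpose_matrix_vector)
  then show "(N ** outer v ** transpose N) *v x = outer (N *v v) *v x"
    by (simp add: matrix_vector_mul_assoc[symmetric] outer_mult_vec matrix_vector_mult_scaleR del: transpose_matrix_vector)
qed

lemma norm_outer: "norm (outer v) = norm v ^ 2" for v :: "real^'d"
proof -
  have "outer v \<bullet> outer v = (v \<bullet> v) * (v \<bullet> v)" by (simp add: inner_outer outer_mult_vec)
  then show ?thesis unfolding norm_eq_sqrt_inner by simp
qed

lemma transpose_add: "transpose (A + B) = transpose A + transpose B" for A B :: "real^'d^'d"
  by (simp add: transpose_def vec_eq_iff)

lemma transpose_scaleR: "transpose (c *\<^sub>R A) = c *\<^sub>R transpose A" for A :: "real^'d^'d"
  by (simp add: transpose_def vec_eq_iff)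

lemma transpose_diff: "transpose (A - B) = transpose A - transpose B" for A B :: "real^'d^'d"
  by (simp add: transpose_def vec_eq_iff)

lemma inner_transpose: "transpose A \<bullet> transpose B = A \<bullet> B" for A B :: "real^'d^'d"
  unfolding inner_vec_def transpose_def by simp (rule sum.swap)

lemma norm_transpose: "norm (transpose A) = norm A" for A :: "real^'d^'d"
  unfolding norm_eq_sqrt_inner by (simp add: inner_transpose)

section \<open>The pseudo-inverse of a symmetric matrix\<close>

text \<open>The property selected by \<open>THE\<close> in \<open>pseudo_inv\<close>, named so that
  existence and uniqueness can be established separately.\<close>

definition moore_penrose :: "real^'d^'d \<Rightarrow> real^'d^'d \<Rightarrow> bool" where
  "moore_penrose A B \<longleftrightarrow> A ** B ** A = A \<and> B ** A ** B = B \<and>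
     transpose (A ** B) = A ** B \<and> transpose (B ** A) = B ** A"

text \<open>Symmetry of the four products forces \<open>A B = A C\<close> and
  \<open>B A = C A\<close>; then \<open>B = B A B = B A C = C A C = C\<close>.\<close>

lemma moore_penrose_unique:
  assumes B: "moore_penrose A B" and C: "moore_penrose A C"
  shows "B = C"
proof -
  have "A ** B = (A ** C) ** (A ** B)" using C by (simp add: moore_penrose_def matrix_mul_assoc)
  also have "\<dots> = transpose (A ** C) ** transpose (A ** B)" using B C by (simp add: moore_penrose_def)
  also have "\<dots> = transpose ((A ** B ** A) ** C)" by (simp add: matrix_transpose_mul[symmetric] matrix_mul_assoc)
  also have "\<dots> = A ** C" using B C by (simp add: moore_penrose_def)
  finally have 1: "A ** B = A ** C" .
  have "B ** A = (B ** A) ** (C ** A)" using C by (simp add: moore_penrose_def matrix_mul_assoc[symmetric])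
  also have "\<dots> = transpose (B ** A) ** transpose (C ** A)" using B C by (simp add: moore_penrose_def)
  also have "\<dots> = transpose (C ** (A ** B ** A))" by (simp add: matrix_transpose_mul[symmetric] matrix_mul_assoc)
  also have "\<dots> = C ** A" using B C by (simp add: moore_penrose_def)
  finally have 2: "B ** A = C ** A" .
  have "B = B ** (A ** B)" using B by (simp add: moore_penrose_def matrix_mul_assoc)
  also have "\<dots> = (B ** A) ** C" using 1 by (simp add: matrix_mul_assoc)
  also have "\<dots> = C" using C 2 by (simp add: moore_penrose_def)
  finally show ?thesis .
qed

text \<open>If \<open>Q\<close> is the orthogonal projection onto the kernel of \<open>A\<close>, then \<open>A + Q\<close> is invertible
  and \<open>(A + Q)\<^sup>-\<^sup>1 - Q\<close> is the pseudo-inverse.\<close>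

lemma moore_penrose_exists:
  fixes A :: "real^'d^'d"
  assumes A: "transpose A = A"
  shows "\<exists>B. moore_penrose A B"
proof -
  define S where "S = {x. A *v x = 0}"
  have S: "subspace S"
    unfolding S_def subspace_def by (auto simp: matrix_vector_right_distrib matrix_vector_mult_scaleR)
  obtain B where B: "B \<subseteq> S" "pairwise orthogonal B" "\<And>x. x \<in> B \<Longrightarrow> norm x = 1" "independent B" "card B = dim S" "span B = S"
    by (metis orthonormal_basis_subspace[OF S])
  have fin: "finite B" using B(4) by (rule independent_imp_finite)
  \<comment> \<open>Summing the rank-one matrices of an orthonormal basis of the kernel gives the
    orthogonal projection onto it.\<close>
  define Q where "Q = (\<Sum>b\<in>B. outer b)"
  have Qx: "Q *v x = (\<Sum>b\<in>B. (b \<bullet> x) *\<^sub>R b)" for x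
  proof -
    have "(\<Sum>b\<in>F. outer b) *v x = (\<Sum>b\<in>F. outer b *v x)" if "finite F" for F :: "(real^'d) set"
      using that by induction (simp_all add: matrix_vector_mult_add_rdistrib)
    then show ?thesis using fin by (simp add: Q_def outer_mult_vec)
  qed
  have QS: "Q *v x \<in> S" for x
    unfolding Qx using B(1) S by (intro subspace_sum subspace_mul) auto
  have Qid: "Q *v x = x" if "x \<in> S" for x
  proof -
    have "x \<in> span B" using that B(6) by simp
    then show ?thesis
    proof (induction rule: span_induct_alt)
      case base
      show ?case by simp
    next
      case (step c y z)
      have "Q *v y = (\<Sum>b\<in>B. if b = y then y else 0)"
        unfolding Qx using step(1) B(2,3) by (intro sum.cong) (auto simp: pairwise_def orthogonal_def dot_square_norm)
      then have "Q *v y = y" using step(1) fin by simp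
      then show ?case using step.IH by (simp add: matrix_vector_right_distrib matrix_vector_mult_scaleR)
    qed
  qed
  have Qt: "transpose Q = Q"
  proof -
    have "transpose (\<Sum>b\<in>F. outer b) = (\<Sum>b\<in>F. outer b)" if "finite F" for F :: "(real^'d) set"
      using that by induction (simp_all add: transpose_add transpose_outer, simp add: transpose_def vec_eq_iff)
    then show ?thesis using fin by (simp add: Q_def)
  qed
  have AQ: "A ** Q = 0"
    by (rule matrix_eq_vecI) (use QS in \<open>simp add: matrix_vector_mul_assoc[symmetric] S_def\<close>)
  have QA: "Q ** A = 0"
  proof -
    have "transpose (Q ** A) = 0" by (simp add: matrix_transpose_mul A Qt AQ)
    then have "transpose (transpose (Q ** A)) = transpose 0" by simp
    then show ?thesis by (simp add: transpose_def vec_eq_iff)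
  qed
  have QQ: "Q ** Q = Q"
    by (rule matrix_eq_vecI) (simp add: matrix_vector_mul_assoc[symmetric] Qid QS)
  \<comment> \<open>Applying \<open>Q\<close> to \<open>(A + Q)x = 0\<close> gives
    \<open>Q x = 0\<close>, since \<open>Q A = 0\<close> and \<open>Q\<close> is idempotent. Then
    \<open>A x = 0\<close>, so \<open>x\<close> lies in the kernel, where \<open>Q\<close> is the
    identity.\<close>
  have "invertible (A + Q)"
    unfolding invertible_left_inverse matrix_left_invertible_ker
  proof (intro allI impI)
    fix x assume x: "(A + Q) *v x = 0"
    then have "Q *v ((A + Q) *v x) = 0" by simp
    then have "(Q ** (A + Q)) *v x = 0" by (simp add: matrix_vector_mul_assoc)
    then have "Q *v x = 0" by (simp add: matrix_add_ldistrib QA QQ)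
    moreover from this x have "A *v x = 0" by (simp add: matrix_vector_mult_add_rdistrib)
    ultimately show "x = 0" using Qid[of x] by (simp add: S_def)
  qed
  then obtain C where C: "C ** (A + Q) = mat 1" "(A + Q) ** C = mat 1" unfolding invertible_def by blast
  have CQ: "C ** Q = Q"
  proof -
    have "C ** ((A + Q) ** Q) = Q" using C by (simp add: matrix_mul_assoc)
    then show ?thesis by (simp add: matrix_add_rdistrib AQ QQ)
  qed
  have QC: "Q ** C = Q"
  proof -
    have "(Q ** (A + Q)) ** C = Q" using C by (simp add: matrix_mul_assoc[symmetric])
    then show ?thesis by (simp add: matrix_add_ldistrib QA QQ)
  qed
  have CA: "C ** A = mat 1 - Q" using C(1) CQ by (simp add: matrix_add_ldistrib algebra_simps)
  have AC: "A ** C = mat 1 - Q" using C(2) QC by (simp add: matrix_add_rdistrib algebra_simps)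
  define D where "D = C - Q"
  have DA: "D ** A = mat 1 - Q" by (simp add: D_def matrix_sub_rdistrib CA QA)
  have AD: "A ** D = mat 1 - Q" by (simp add: D_def matrix_sub_ldistrib AC AQ)
  have QD: "Q ** D = 0" by (simp add: D_def matrix_sub_ldistrib QC QQ)
  have sym: "transpose (mat 1 - Q) = mat 1 - Q" by (simp add: transpose_diff transpose_mat Qt)
  have "moore_penrose A D"
    unfolding moore_penrose_def
    by (auto simp: DA AD sym matrix_sub_rdistrib QA QD)
  then show ?thesis ..
qed

lemma moore_penrose_pseudo_inv:
  assumes "transpose A = A"
  shows "moore_penrose A (pseudo_inv A)"
proof -
  obtain B where "moore_penrose A B" using moore_penrose_exists[OF assms] ..
  then have "\<exists>!B. moore_penrose A B" using moore_penrose_unique by blast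
  then show ?thesis unfolding pseudo_inv_def moore_penrose_def by (rule theI')
qed

lemma inner_sym_matrix: "transpose G = G \<Longrightarrow> x \<bullet> (G *v y) = (G *v x) \<bullet> y" for G :: "real^'d^'d"
  by (metis dot_lmul_matrix transpose_matrix_vector)

text \<open>Removes the pseudo-inverse from the sign condition when \<open>P = G q\<close>; the
  identity \<open>G G^- G = G\<close> suffices.\<close>

lemma pseudo_inv_quadratic:
  assumes "transpose G = G"
  shows "(G *v q) \<bullet> (pseudo_inv G *v (G *v q)) = q \<bullet> (G *v q)"
proof -
  have "(G *v q) \<bullet> (pseudo_inv G *v (G *v q)) = q \<bullet> ((G ** pseudo_inv G ** G) *v q)"
    by (simp add: inner_sym_matrix[OF assms, symmetric] matrix_vector_mul_assoc[symmetric])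
  then show ?thesis using moore_penrose_pseudo_inv[OF assms] by (simp add: moore_penrose_def)
qed

section \<open>Positivity of the factor in front of the test function\<close>

lemma psd_quadratic_nonneg:
  fixes G :: "real^'d^'d"
  assumes "transpose G = G" "\<And>y. y \<bullet> (G *v y) \<ge> 0" "h > 0"
  shows "(1 / h) * (\<xi> \<bullet> (G *v \<xi>)) + (G *v q) \<bullet> \<xi> + h / 4 * (q \<bullet> (G *v q)) \<ge> 0"
proof -
  \<comment> \<open>The expression is \<open>h\<close> times the quadratic form of \<open>G\<close>
    at this vector. The coefficient \<open>1/2\<close> of \<open>q\<close> produces the constant
    \<open>1/4\<close> of the sign condition.\<close>
  define y where "y = (1 / h) *\<^sub>R \<xi> + (1 / 2) *\<^sub>R q"
  have *: "q \<bullet> (G *v \<xi>) = \<xi> \<bullet> (G *v q)" using inner_sym_matrix[OF assms(1), of \<xi> q] by (simp add: inner_commute)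
  have "h * (y \<bullet> (G *v y)) = (1 / h) * (\<xi> \<bullet> (G *v \<xi>)) + (G *v q) \<bullet> \<xi> + h / 4 * (q \<bullet> (G *v q))"
    using assms(3) unfolding y_def
    by (simp add: matrix_vector_right_distrib matrix_vector_mult_scaleR inner_add_left inner_add_right * inner_commute[of "G *v q"] field_simps power2_eq_square)
  then show ?thesis using assms(2)[of y] assms(3) by (metis mult_nonneg_nonneg less_imp_le)
qed

text \<open>Separates the rank-one part, which carries the quadratic form, from the deterministic
  part, which meets the trace condition. The coefficient is left as \<open>h/h^2\<close>, so the
  identity also holds at \<open>h = 0\<close> under division by zero.\<close>

lemma weight2_alt:
  fixes s :: "real^'d^'d"
  assumes "invertible s"
  shows "weight2 s h \<Delta> = (1 / h\<^sup>2) *\<^sub>R outer (matrix_inv (transpose s) *v \<Delta>)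
     - (h / h\<^sup>2) *\<^sub>R matrix_inv (s ** transpose s)"
proof -
  define N where "N = matrix_inv (transpose s)"
  have N: "matrix_inv s = transpose N" using matrix_inv_transpose[OF assms] by (simp add: N_def)
  have o: "(\<chi> i j. \<Delta> $ i * \<Delta> $ j) = outer \<Delta>" by (simp add: outer_def)
  have "weight2 s h \<Delta> = (1 / h\<^sup>2) *\<^sub>R (N ** (outer \<Delta> - h *\<^sub>R mat 1) ** transpose N)"
    unfolding weight2_def N_def[symmetric] N o by (simp add: matrix_scalar_ac scalar_matrix_assoc)
  also have "N ** (outer \<Delta> - h *\<^sub>R mat 1) ** transpose N = outer (N *v \<Delta>) - h *\<^sub>R (N ** transpose N)"
    by (simp add: matrix_sub_ldistrib matrix_sub_rdistrib outer_conj matrix_scalar_ac scalar_matrix_assoc[symmetric])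
  finally show ?thesis using matrix_inv_diffusion[OF assms] by (simp add: N N_def[symmetric] scaleR_diff_right)
qed

text \<open>The leading 1 is the weight of the expectation standing outside \<open>F\<close> in the
  scheme; it pays for the trace term, and the sign condition bounds \<open>R\<close> below by
  exactly the missing term of the square.\<close>

lemma weight_positivity:
  fixes s G :: "real^'d^'d"
  assumes s: "invertible s" and h: "h > 0" and G: "transpose G = G" "\<And>y. y \<bullet> (G *v y) \<ge> 0"
    and tr: "matrix_inv (s ** transpose s) \<bullet> G \<le> 1"
    and P: "P = G *v q" and R: "R - 1 / 4 * (P \<bullet> (pseudo_inv G *v P)) \<ge> 0"
  shows "1 + h * (R + P \<bullet> weight1 s h \<Delta> + G \<bullet> weight2 s h \<Delta>) \<ge> 0"
proof -
  define \<xi> where "\<xi> = matrix_inv (transpose s) *v \<Delta>"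
  have R': "R \<ge> 1 / 4 * (q \<bullet> (G *v q))" using R pseudo_inv_quadratic[OF G(1)] by (simp add: P)
  have w1: "P \<bullet> weight1 s h \<Delta> = (1 / h) * (P \<bullet> \<xi>)"
    by (simp add: weight1_def \<xi>_def matrix_vector_mult_scaleR)
  have w2: "G \<bullet> weight2 s h \<Delta> = (1 / h\<^sup>2) * (\<xi> \<bullet> (G *v \<xi>)) - (1 / h) * (matrix_inv (s ** transpose s) \<bullet> G)"
    using h by (simp add: weight2_alt[OF s] inner_diff_right inner_outer \<xi>_def[symmetric] inner_commute[of G "matrix_inv _"] power2_eq_square)
  have "1 + h * (R + P \<bullet> weight1 s h \<Delta> + G \<bullet> weight2 s h \<Delta>) =
     (1 - matrix_inv (s ** transpose s) \<bullet> G) + h * R + P \<bullet> \<xi> + (1 / h) * (\<xi> \<bullet> (G *v \<xi>))"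
    unfolding w1 w2 using h by (simp add: field_simps power2_eq_square)
  also have "\<dots> \<ge> h * (1 / 4 * (q \<bullet> (G *v q))) + P \<bullet> \<xi> + (1 / h) * (\<xi> \<bullet> (G *v \<xi>))"
  proof -
    have "h * (1 / 4 * (q \<bullet> (G *v q))) \<le> h * R" using h by (intro mult_left_mono[OF R']) simp
    then show ?thesis using tr by linarith
  qed
  moreover have "h * (1 / 4 * (q \<bullet> (G *v q))) + P \<bullet> \<xi> + (1 / h) * (\<xi> \<bullet> (G *v \<xi>)) \<ge> 0"
    using psd_quadratic_nonneg[OF G h, of \<xi> q] by (simp add: P)
  ultimately show ?thesis by linarith
qed

section \<open>Gaussian vectors\<close>

definition gauss_density :: "real \<Rightarrow> real^'d \<Rightarrow> real" where
  "gauss_density h y = (\<Prod>i\<in>UNIV. normal_density 0 (sqrt h) (y $ i))"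

text \<open>The centred normal law with covariance \<open>h\<close> times the identity, that is, the
  law of a Brownian increment over a time step \<open>h\<close>.\<close>

definition gauss :: "real \<Rightarrow> (real^'d) measure" where
  "gauss h = density lborel (\<lambda>y. ennreal (gauss_density h y))"

lemma gauss_density_nonneg: "gauss_density h y \<ge> 0"
  by (simp add: gauss_density_def prod_nonneg)

lemma measurable_gauss_density [measurable]: "gauss_density h \<in> borel_measurable borel"
  unfolding gauss_density_def by measurable

lemma sets_gauss [simp, measurable_cong]: "sets (gauss h) = sets borel"
  by (simp add: gauss_def)

lemma space_gauss [simp]: "space (gauss h) = UNIV"
  by (simp add: gauss_def)

text \<open>Fubini's theorem for products of functions of one coordinate. Lebesgue measure is a
  product over basis vectors, so the factors are re-indexed along the map from indices to unit
  vectors.\<close>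

lemma has_bochner_integral_lborel_prod:
  fixes q :: "'d::finite \<Rightarrow> real \<Rightarrow> real"
  assumes q: "\<And>i. integrable lborel (q i)"
  shows "has_bochner_integral lborel (\<lambda>y::real^'d. \<Prod>i\<in>UNIV. q i (y $ i)) (\<Prod>i\<in>UNIV. integral\<^sup>L lborel (q i))"
proof -
  interpret product_sigma_finite "\<lambda>_::real^'d. lborel :: real measure" by standard
  define ax where "ax = (\<lambda>i::'d. axis i (1::real))"
  have ax: "bij_betw ax UNIV (Basis :: (real^'d) set)"
    unfolding bij_betw_def ax_def Basis_vec_def by (auto simp: inj_on_def axis_eq_axis)
  define p where "p = (\<lambda>b. q (the_inv ax b))"
  have p: "p (ax i) = q i" for i
    unfolding p_def using ax by (simp add: the_inv_f_f bij_betw_def)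
  have pint: "integrable lborel (p b)" for b unfolding p_def by (rule q)
  have [measurable]: "p b \<in> borel_measurable borel" for b using borel_measurable_integrable[OF pint] by simp
  define T where "T = (\<lambda>f. \<Sum>b\<in>(Basis :: (real^'d) set). f b *\<^sub>R b)"
  have [measurable]: "T \<in> borel_measurable (\<Pi>\<^sub>M b\<in>Basis. lborel)" unfolding T_def by measurable
  have eq: "(\<Prod>b\<in>Basis. p b (T f \<bullet> b)) = (\<Prod>b\<in>Basis. p b (f b))" for f
    unfolding T_def by (intro prod.cong refl) simp
  have 1: "integrable (\<Pi>\<^sub>M b\<in>Basis. lborel) (\<lambda>f. \<Prod>b\<in>(Basis :: (real^'d) set). p b (f b))"
    by (rule product_integrable_prod) (auto intro: pint)
  have 2: "(\<integral>f. (\<Prod>b\<in>(Basis :: (real^'d) set). p b (f b)) \<partial>(\<Pi>\<^sub>M b\<in>Basis. lborel)) = (\<Prod>b\<in>(Basis :: (real^'d) set). integral\<^sup>L lborel (p b))"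
    by (rule product_integral_prod) (auto intro: pint)
  have L: "(lborel :: (real^'d) measure) = distr (\<Pi>\<^sub>M b\<in>Basis. lborel) borel T" unfolding T_def by (rule lborel_eq)
  have "integrable lborel (\<lambda>y::real^'d. \<Prod>b\<in>Basis. p b (y \<bullet> b))"
    unfolding L using 1 by (subst integrable_distr_eq) (auto simp: eq)
  moreover have "(\<integral>y. (\<Prod>b\<in>Basis. p b (y \<bullet> b)) \<partial>lborel) = (\<Prod>b\<in>(Basis :: (real^'d) set). integral\<^sup>L lborel (p b))"
    unfolding L using 2 by (subst integral_distr) (auto simp: eq)
  moreover have "(\<Prod>b\<in>Basis. p b (y \<bullet> b)) = (\<Prod>i\<in>UNIV. q i (y $ i))" for y :: "real^'d"
    by (rule prod.reindex_bij_betw[OF ax, symmetric, THEN trans]) (simp add: p, simp add: ax_def inner_axis)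
  moreover have "(\<Prod>b\<in>(Basis :: (real^'d) set). integral\<^sup>L lborel (p b)) = (\<Prod>i\<in>UNIV. integral\<^sup>L lborel (q i))"
    by (rule prod.reindex_bij_betw[OF ax, symmetric, THEN trans]) (simp add: p)
  ultimately show ?thesis by (simp add: has_bochner_integral_iff)
qed

section \<open>Moments of Gaussian vectors\<close>

definition normal_mom :: "real \<Rightarrow> nat \<Rightarrow> real" where
  "normal_mom h k = (\<integral>x. normal_density 0 (sqrt h) x * x ^ k \<partial>lborel)"

lemma normal_mom_odd: "h > 0 \<Longrightarrow> odd k \<Longrightarrow> normal_mom h k = 0"
  unfolding normal_mom_def using integral_normal_moment_odd[of "sqrt h" 0] by (auto elim!: oddE)

lemma normal_mom_even: "h > 0 \<Longrightarrow> normal_mom h (2 * k) = fact (2 * k) / (2 ^ k * fact k) * h ^ k"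
  unfolding normal_mom_def using integral_normal_moment_even[of "sqrt h" 0 k] by (simp add: power_divide)

lemma normal_mom_0: "h > 0 \<Longrightarrow> normal_mom h 0 = 1"
  using normal_mom_even[of h 0] by simp

lemma normal_mom_2: "h > 0 \<Longrightarrow> normal_mom h 2 = h"
  using normal_mom_even[of h 1] by (simp add: numeral_2_eq_2)

lemma normal_mom_4: "h > 0 \<Longrightarrow> normal_mom h 4 = 3 * h\<^sup>2"
  using normal_mom_even[of h 2] by (simp add: fact_numeral)

lemma has_bochner_integral_gauss:
  assumes "f \<in> borel_measurable borel"
    "has_bochner_integral lborel (\<lambda>y. gauss_density h y * f y) c"
  shows "has_bochner_integral (gauss h) f c"
  unfolding gauss_def using assms by (intro has_bochner_integral_density) (auto simp: gauss_density_nonneg)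

lemma gauss_monomial:
  fixes c :: "'d::finite \<Rightarrow> nat"
  assumes h: "h > 0"
  shows "has_bochner_integral (gauss h) (\<lambda>y::real^'d. \<Prod>i\<in>UNIV. (y $ i) ^ c i) (\<Prod>i\<in>UNIV. normal_mom h (c i))"
proof (rule has_bochner_integral_gauss)
  have "integrable lborel (\<lambda>x. normal_density 0 (sqrt h) x * x ^ c i)" for i
    using integrable_normal_moment[of "sqrt h" 0 "c i"] h by simp
  from has_bochner_integral_lborel_prod[OF this]
  show "has_bochner_integral lborel (\<lambda>y::real^'d. gauss_density h y * (\<Prod>i\<in>UNIV. (y $ i) ^ c i)) (\<Prod>i\<in>UNIV. normal_mom h (c i))"
    by (simp add: gauss_density_def normal_mom_def prod.distrib)
qed measurable

lemma prob_space_gauss: "h > 0 \<Longrightarrow> prob_space (gauss h :: (real^'d) measure)"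
proof
  assume h: "h > 0"
  have "has_bochner_integral (gauss h :: (real^'d) measure) (\<lambda>y. 1) (1::real)"
    using gauss_monomial[OF h, of "\<lambda>_::'d. 0"] by (simp add: normal_mom_0[OF h])
  then have 1: "integrable (gauss h :: (real^'d) measure) (\<lambda>y. 1::real)" and "integral\<^sup>L (gauss h :: (real^'d) measure) (\<lambda>y. 1::real) = 1"
    by (simp_all only: has_bochner_integral_iff)
  then have "(\<integral>\<^sup>+y. ennreal 1 \<partial>(gauss h :: (real^'d) measure)) = ennreal 1"
    using nn_integral_eq_integral[OF 1] by simp
  then show "emeasure (gauss h :: (real^'d) measure) (space (gauss h)) = 1" by simp
qed

text \<open>A monomial is given by the list of its indices; its expectation vanishes as soon as some
  index occurs an odd number of times.\<close>

definition idx_monomial :: "'d list \<Rightarrow> real^'d \<Rightarrow> real" where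
  "idx_monomial is = (\<lambda>y. \<Prod>i\<leftarrow>is. y $ i)"

lemma gauss_idx_monomial:
  assumes h: "h > 0"
  shows "has_bochner_integral (gauss h) (idx_monomial is :: real^'d \<Rightarrow> real) (\<Prod>i\<in>UNIV. normal_mom h (count_list is i))"
proof -
  have "idx_monomial is y = (\<Prod>i\<in>UNIV. (y $ i) ^ count_list is i)" for y :: "real^'d"
  proof (induction "is")
    case Nil
    then show ?case by (simp add: idx_monomial_def)
  next
    case (Cons j js)
    have "(\<Prod>i\<in>UNIV. (y $ i) ^ count_list (j # js) i) = (\<Prod>i\<in>UNIV. (if i = j then y $ j else 1) * (y $ i) ^ count_list js i)"
      by (intro prod.cong) auto
    also have "\<dots> = y $ j * (\<Prod>i\<in>UNIV. (y $ i) ^ count_list js i)" by (simp add: prod.distrib)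
    finally show ?case using Cons by (simp add: idx_monomial_def)
  qed
  then have "idx_monomial is = (\<lambda>y::real^'d. \<Prod>i\<in>UNIV. (y $ i) ^ count_list is i)" by blast
  then show ?thesis using gauss_monomial[OF h] by simp
qed

lemma gauss_odd:
  assumes h: "h > 0" and odd: "odd (count_list is j)"
  shows "has_bochner_integral (gauss h) (idx_monomial is :: real^'d \<Rightarrow> real) 0"
proof -
  have "(\<Prod>i\<in>UNIV. normal_mom h (count_list is i)) = 0"
    using normal_mom_odd[OF h odd] by (intro prod_zero) auto
  with gauss_idx_monomial[OF h, of "is"] show ?thesis by (simp only:)
qed

text \<open>The multiplicities of the indices sum to the degree, so an odd degree forces an odd
  multiplicity.\<close>

lemma gauss_odd_length:
  fixes "is" :: "'d::finite list"
  assumes h: "h > 0" and odd: "odd (length is)"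
  shows "has_bochner_integral (gauss h) (idx_monomial is :: real^'d \<Rightarrow> real) 0"
proof -
  have "(\<Sum>i\<in>UNIV. count_list is i) = length is"
  proof (induction "is")
    case (Cons j js)
    have "(\<Sum>i\<in>UNIV. count_list (j # js) i) = (\<Sum>i\<in>UNIV. (if i = j then 1 else 0) + count_list js i)"
      by (intro sum.cong) auto
    then show ?case using Cons by (simp add: sum.distrib)
  qed simp
  then have "\<exists>j. odd (count_list is j)" using odd by (metis dvd_sum)
  then show ?thesis using gauss_odd[OF h] by blast
qed

lemma gauss_mom_1: "h > 0 \<Longrightarrow> has_bochner_integral (gauss h) (\<lambda>y::real^'d. y $ i) 0"
  using gauss_odd_length[of h "[i]"] by (simp add: idx_monomial_def)

lemma gauss_mom_3: "h > 0 \<Longrightarrow> has_bochner_integral (gauss h) (\<lambda>y::real^'d. y $ i * y $ j * y $ k) 0"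
  using gauss_odd_length[of h "[i, j, k]"] by (simp add: idx_monomial_def mult.assoc)

lemma prod_single: "(\<And>i. i \<noteq> j \<Longrightarrow> f i = 1) \<Longrightarrow> prod f UNIV = f j" for f :: "'d::finite \<Rightarrow> real"
  by (subst prod.remove[of _ j]) (auto intro: prod.neutral)

lemma gauss_mom_2:
  assumes h: "h > 0"
  shows "has_bochner_integral (gauss h) (\<lambda>y::real^'d. y $ i * y $ j) (if i = j then h else 0)"
proof (cases "i = j")
  case True
  have "(\<Prod>k\<in>UNIV. normal_mom h (count_list [i, i] k)) = normal_mom h (count_list [i, i] i)"
    by (rule prod_single) (simp add: normal_mom_0[OF h])
  then show ?thesis using gauss_idx_monomial[OF h, of "[i, i]"] True normal_mom_2[OF h] by (simp add: idx_monomial_def numeral_2_eq_2)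
next
  case False
  then show ?thesis using gauss_odd[OF h, of "[i, j]" i] by (simp add: idx_monomial_def)
qed

text \<open>Isserlis' formula: \<open>h^2\<close> times the number of ways to pair the four indices
  into equal pairs. If all indices agree the three pairings give \<open>3 h^2\<close>; if no pairing
  exists some index occurs an odd number of times.\<close>

lemma gauss_mom_4:
  assumes h: "h > 0"
  shows "has_bochner_integral (gauss h) (\<lambda>y::real^'d. y $ i * y $ j * y $ k * y $ l)
    (h\<^sup>2 * ((if i = j \<and> k = l then 1 else 0) + (if i = k \<and> j = l then 1 else 0) + (if i = l \<and> j = k then 1 else 0)))"
proof -
  have pair: "has_bochner_integral (gauss h) (\<lambda>y::real^'d. y $ a * y $ a * (y $ b * y $ b)) (if a = b then 3 * h\<^sup>2 else h\<^sup>2)" for a b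
  proof (cases "a = b")
    case True
    have "(\<Prod>k\<in>UNIV. normal_mom h (count_list [a, a, a, a] k)) = normal_mom h (count_list [a, a, a, a] a)"
      by (rule prod_single) (simp add: normal_mom_0[OF h])
    then show ?thesis using gauss_idx_monomial[OF h, of "[a, a, a, a]"] True normal_mom_4[OF h]
      by (simp add: idx_monomial_def eval_nat_numeral mult.assoc)
  next
    case False
    have "(\<Prod>k\<in>UNIV. normal_mom h (count_list [a, a, b, b] k)) = (\<Prod>k\<in>UNIV - {a}. normal_mom h (count_list [a, a, b, b] k)) * h"
      using False normal_mom_2[OF h] by (subst prod.remove[of _ a]) (auto simp: numeral_2_eq_2)
    also have "(\<Prod>k\<in>UNIV - {a}. normal_mom h (count_list [a, a, b, b] k)) = (\<Prod>k\<in>UNIV - {a} - {b}. normal_mom h (count_list [a, a, b, b] k)) * h"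
      using False normal_mom_2[OF h] by (subst prod.remove[of _ b]) (auto simp: numeral_2_eq_2)
    also have "(\<Prod>k\<in>UNIV - {a} - {b}. normal_mom h (count_list [a, a, b, b] k)) = 1"
      by (rule prod.neutral) (auto simp: normal_mom_0[OF h])
    finally show ?thesis using gauss_idx_monomial[OF h, of "[a, a, b, b]"] False
      by (simp add: idx_monomial_def mult.assoc power2_eq_square)
  qed
  have odd: "has_bochner_integral (gauss h) (\<lambda>y::real^'d. y $ i * y $ j * y $ k * y $ l) 0"
    if "odd (count_list [i, j, k, l] m)" for m
    using gauss_odd[OF h that] by (simp add: idx_monomial_def mult.assoc)
  \<comment> \<open>The index \<open>l\<close> need not be listed: multiplicities sum to four, so an
    odd multiplicity of one value comes with an odd multiplicity of another.\<close>
  have "(i = j \<and> k = l) \<or> (i = k \<and> j = l) \<or> (i = l \<and> j = k) \<or>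
      odd (count_list [i, j, k, l] i) \<or> odd (count_list [i, j, k, l] j) \<or> odd (count_list [i, j, k, l] k)"
    by (cases "i = j"; cases "i = k"; cases "i = l"; cases "j = k"; cases "j = l"; cases "k = l"; simp)
  then consider "i = j" "k = l" | "i = k" "j = l" | "i = l" "j = k"
    | "odd (count_list [i, j, k, l] i)" | "odd (count_list [i, j, k, l] j)" | "odd (count_list [i, j, k, l] k)"
    by blast
  then show ?thesis
  proof cases
    case 1
    then show ?thesis using pair[of i k] by (cases "i = k") (simp_all add: mult.assoc, simp add: mult.commute)
  next
    case 2
    then show ?thesis using pair[of i j] by (cases "i = j") (simp_all add: mult.assoc mult.commute mult.left_commute)
  next
    case 3
    then show ?thesis using pair[of i j] by (cases "i = j") (simp_all add: mult.assoc mult.commute mult.left_commute)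
  next
    case 4
    then have "\<not> (i = j \<and> k = l) \<and> \<not> (i = k \<and> j = l) \<and> \<not> (i = l \<and> j = k)"
      by (cases "i = j"; cases "i = k"; cases "i = l"; cases "j = k"; cases "j = l"; cases "k = l"; simp)
    then have "(if i = j \<and> k = l then 1 else 0) + (if i = k \<and> j = l then 1 else 0) + (if i = l \<and> j = k then 1 else 0) = (0::real)"
      by (elim conjE) (simp only: if_False add_0_left)
    with odd[OF 4] show ?thesis by (simp only: mult_zero_right)
  next
    case 5
    then have "\<not> (i = j \<and> k = l) \<and> \<not> (i = k \<and> j = l) \<and> \<not> (i = l \<and> j = k)"
      by (cases "i = j"; cases "i = k"; cases "i = l"; cases "j = k"; cases "j = l"; cases "k = l"; simp)
    then have "(if i = j \<and> k = l then 1 else 0) + (if i = k \<and> j = l then 1 else 0) + (if i = l \<and> j = k then 1 else 0) = (0::real)"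
      by (elim conjE) (simp only: if_False add_0_left)
    with odd[OF 5] show ?thesis by (simp only: mult_zero_right)
  next
    case 6
    then have "\<not> (i = j \<and> k = l) \<and> \<not> (i = k \<and> j = l) \<and> \<not> (i = l \<and> j = k)"
      by (cases "i = j"; cases "i = k"; cases "i = l"; cases "j = k"; cases "j = l"; cases "k = l"; simp)
    then have "(if i = j \<and> k = l then 1 else 0) + (if i = k \<and> j = l then 1 else 0) + (if i = l \<and> j = k then 1 else 0) = (0::real)"
      by (elim conjE) (simp only: if_False add_0_left)
    with odd[OF 6] show ?thesis by (simp only: mult_zero_right)
  qed
qed

text \<open>The squared norm is at most the dimension times the largest squared component, and that
  component is one of the summands on the right.\<close>

lemma norm_power_le_sum_components:
  fixes y :: "real^'d"
  shows "norm y ^ (2 * k) \<le> real CARD('d) ^ k * (\<Sum>i\<in>UNIV. (y $ i) ^ (2 * k))"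
proof -
  define m where "m = Max (range (\<lambda>i. (y $ i)\<^sup>2))"
  have "m \<in> range (\<lambda>i. (y $ i)\<^sup>2)" unfolding m_def by (intro Max_in) auto
  then obtain j where j: "m = (y $ j)\<^sup>2" by auto
  have "(y $ i)\<^sup>2 \<le> m" for i unfolding m_def by (intro Max_ge) auto
  then have "(\<Sum>i\<in>UNIV. (y $ i)\<^sup>2) \<le> (\<Sum>i\<in>(UNIV :: 'd set). m)" by (intro sum_mono)
  then have "(norm y)\<^sup>2 \<le> real CARD('d) * m"
    by (simp add: power2_norm_eq_inner inner_vec_def) (simp add: power2_eq_square)
  then have "((norm y)\<^sup>2) ^ k \<le> (real CARD('d) * m) ^ k" by (intro power_mono) auto
  also have "\<dots> = real CARD('d) ^ k * (y $ j) ^ (2 * k)" by (simp add: power_mult_distrib j power_mult)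
  also have "\<dots> \<le> real CARD('d) ^ k * (\<Sum>i\<in>UNIV. (y $ i) ^ (2 * k))"
    by (intro mult_left_mono member_le_sum) (auto simp: power_mult)
  finally show ?thesis by (simp add: power_mult)
qed

text \<open>The point is the scaling in \<open>h\<close> with one constant for all \<open>h\<close>;
  the estimates for the scheme divide by powers of \<open>h\<close>.\<close>

lemma gauss_norm_moment:
  obtains C where "C \<ge> 0" "\<And>h. h > 0 \<Longrightarrow> integrable (gauss h) (\<lambda>y::real^'d. norm y ^ (2 * k))"
    "\<And>h. h > 0 \<Longrightarrow> (\<integral>y. norm (y::real^'d) ^ (2 * k) \<partial>gauss h) \<le> C * h ^ k"
proof
  define C where "C = real CARD('d) ^ k * (real CARD('d) * (fact (2 * k) / (2 ^ k * fact k)))"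
  show "C \<ge> 0" by (simp add: C_def)
  fix h :: real assume h: "h > 0"
  have comp: "has_bochner_integral (gauss h) (\<lambda>y::real^'d. (y $ i) ^ (2 * k)) (fact (2 * k) / (2 ^ k * fact k) * h ^ k)" for i
  proof -
    define c where "c = (\<lambda>j. if j = i then 2 * k else 0)"
    have "(\<Prod>j\<in>UNIV. (y $ j) ^ c j) = (y $ i) ^ (2 * k)" for y :: "real^'d"
      using prod_single[of i "\<lambda>j. (y $ j) ^ c j"] by (simp add: c_def)
    moreover have "(\<Prod>j\<in>UNIV. normal_mom h (c j)) = normal_mom h (2 * k)"
      using prod_single[of i "\<lambda>j. normal_mom h (c j)"] by (simp add: c_def normal_mom_0[OF h])
    ultimately show ?thesis using gauss_monomial[OF h, of c] normal_mom_even[OF h, of k] by simp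
  qed
  have s: "has_bochner_integral (gauss h) (\<lambda>y::real^'d. real CARD('d) ^ k * (\<Sum>i\<in>UNIV. (y $ i) ^ (2 * k))) (C * h ^ k)"
    using has_bochner_integral_mult_right[OF has_bochner_integral_sum[where I = "UNIV :: 'd set", OF comp], of "real CARD('d) ^ k"]
    by (simp add: C_def mult.assoc)
  show int: "integrable (gauss h) (\<lambda>y::real^'d. norm y ^ (2 * k))"
    by (rule Bochner_Integration.integrable_bound[OF integrable.intros[OF s]])
       (auto intro!: AE_I2 norm_power_le_sum_components[THEN order_trans])
  have "(\<integral>y. norm (y::real^'d) ^ (2 * k) \<partial>gauss h) \<le> (\<integral>y. real CARD('d) ^ k * (\<Sum>i\<in>UNIV. ((y::real^'d) $ i) ^ (2 * k)) \<partial>gauss h)"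
    by (rule integral_mono[OF int integrable.intros[OF s]]) (rule norm_power_le_sum_components)
  also have "\<dots> = C * h ^ k" using s by (simp add: has_bochner_integral_iff)
  finally show "(\<integral>y. norm (y::real^'d) ^ (2 * k) \<partial>gauss h) \<le> C * h ^ k" .
qed

text \<open>A single polynomial majorant covers the integrands below; lower powers are absorbed by
  \<open>norm_power_le_poly\<close>.\<close>

lemma gauss_integrable_bound:
  fixes f :: "real^'d \<Rightarrow> 'b::{banach, second_countable_topology}"
  assumes h: "h > 0" and [measurable]: "f \<in> borel_measurable borel"
    and b: "\<And>y. norm (f y) \<le> C * (1 + norm y ^ 6)"
  shows "integrable (gauss h) f"
proof -
  interpret prob_space "gauss h :: (real^'d) measure" by (rule prob_space_gauss[OF h])
  obtain K where "\<And>h. h > 0 \<Longrightarrow> integrable (gauss h) (\<lambda>y::real^'d. norm y ^ (2 * 3))"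
    using gauss_norm_moment[of 3] by metis
  from this[OF h] have "integrable (gauss h) (\<lambda>y::real^'d. C * (1 + norm y ^ 6))" by simp
  then show ?thesis
    by (rule Bochner_Integration.integrable_bound) (auto intro!: AE_I2 b[THEN order_trans])
qed

section \<open>Expectations over Brownian increments as Gaussian integrals\<close>

lemma brownian_increment_distr:
  fixes W :: "real \<Rightarrow> 'w \<Rightarrow> real^'d"
  assumes W: "brownian_motion M W" and t: "t \<ge> 0" and h: "h > 0"
  shows "(\<lambda>\<omega>. W (t + h) \<omega> - W t \<omega>) \<in> borel_measurable M"
    and "distr M borel (\<lambda>\<omega>. W (t + h) \<omega> - W t \<omega>) = gauss h"
proof -
  have d: "distributed M lborel (\<lambda>\<omega>. W (t + h) \<omega> - W t \<omega>)
      (\<lambda>y. ennreal (\<Prod>i\<in>UNIV. normal_density 0 (sqrt (t + h - t)) (y $ i)))"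
  proof -
    have f: "\<forall>s t. 0 \<le> s \<and> s < t \<longrightarrow> distributed M lborel (\<lambda>\<omega>. W t \<omega> - W s \<omega>)
        (\<lambda>y. ennreal (\<Prod>i\<in>UNIV. normal_density 0 (sqrt (t - s)) (y $ i)))"
      using W unfolding brownian_motion_def by (elim conjE)
    have "0 \<le> t \<and> t < t + h" using t h by simp
    from f[THEN spec, THEN spec, THEN mp, OF this] show ?thesis .
  qed
  show "(\<lambda>\<omega>. W (t + h) \<omega> - W t \<omega>) \<in> borel_measurable M"
    using distributed_measurable[OF d] by simp
  have "distr M borel (\<lambda>\<omega>. W (t + h) \<omega> - W t \<omega>) = distr M lborel (\<lambda>\<omega>. W (t + h) \<omega> - W t \<omega>)"
    by (rule distr_cong) auto
  also have "\<dots> = gauss h"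
    using distributed_distr_eq_density[OF d] by (simp add: gauss_def gauss_density_def)
  finally show "distr M borel (\<lambda>\<omega>. W (t + h) \<omega> - W t \<omega>) = gauss h" .
qed

text \<open>Moves expectations of the scheme from the probability space to \<open>gauss h\<close>,
  where moments are explicit; the starting time drops out.\<close>

lemma brownian_increment_integral:
  fixes W :: "real \<Rightarrow> 'w \<Rightarrow> real^'d" and f :: "real^'d \<Rightarrow> 'b::{banach, second_countable_topology}"
  assumes W: "brownian_motion M W" and t: "t \<ge> 0" and h: "h > 0" and f: "f \<in> borel_measurable borel"
  shows "(\<integral>\<omega>. f (W (t + h) \<omega> - W t \<omega>) \<partial>M) = (\<integral>y. f y \<partial>gauss h)"
  using integral_distr[OF brownian_increment_distr(1)[OF W t h] f] brownian_increment_distr(2)[OF W t h] by simp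

section \<open>Gradients of the nonlinearity\<close>

text \<open>The norm of the matrix type is the Frobenius norm, so Cauchy-Schwarz is applied row by
  row.\<close>

lemma norm_matrix_vector_mult_le: "norm (A *v y) \<le> norm A * norm y" for A :: "real^'d^'d"
proof -
  have "(norm (A *v y))\<^sup>2 = (\<Sum>i\<in>UNIV. (A $ i \<bullet> y)\<^sup>2)"
    by (simp add: power2_norm_eq_inner inner_vec_def[of "A *v y"] matrix_vector_mul_component) (simp add: power2_eq_square)
  also have "\<dots> \<le> (\<Sum>i\<in>UNIV. (A $ i \<bullet> A $ i) * (y \<bullet> y))"
    by (intro sum_mono Cauchy_Schwarz_ineq)
  also have "\<dots> = (norm A * norm y)\<^sup>2"
    by (simp add: power_mult_distrib power2_norm_eq_inner inner_vec_def[of A] sum_distrib_right)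
  finally show ?thesis by (rule power2_le_imp_le) simp
qed

lemma norm_matrix_matrix_mult_le: "norm (A ** B) \<le> norm A * norm B" for A B :: "real^'d^'d"
proof -
  have row: "(A ** B) $ i = transpose B *v (A $ i)" for i
    by (simp add: vec_eq_iff matrix_matrix_mult_def vector_matrix_mult_def mult.commute)
  have "(norm (A ** B))\<^sup>2 = (\<Sum>i\<in>UNIV. (norm (transpose B *v (A $ i)))\<^sup>2)"
    by (simp add: power2_norm_eq_inner inner_vec_def[of "A ** B"] row del: transpose_matrix_vector)
  also have "\<dots> \<le> (\<Sum>i\<in>UNIV. (norm B * norm (A $ i))\<^sup>2)"
    using norm_matrix_vector_mult_le[of "transpose B"] by (intro sum_mono power_mono) (simp_all add: norm_transpose del: transpose_matrix_vector)
  also have "\<dots> = (norm A * norm B)\<^sup>2"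
  proof -
    have "(norm A)\<^sup>2 = (\<Sum>i\<in>UNIV. (norm (A $ i))\<^sup>2)"
      by (simp only: power2_norm_eq_inner inner_vec_def[of A A])
    then show ?thesis by (simp add: power_mult_distrib sum_distrib_left mult.commute)
  qed
  finally show ?thesis by (rule power2_le_imp_le) simp
qed

definition symm :: "real^'d^'d \<Rightarrow> real^'d^'d" where
  "symm A = (1 / 2) *\<^sub>R (A + transpose A)"

lemma symm_in_sym_mats: "symm A \<in> sym_mats"
  by (simp add: symm_def sym_mats_def transpose_scaleR transpose_add add.commute)

lemma symm_id: "A \<in> sym_mats \<Longrightarrow> symm A = A"
  by (simp add: symm_def sym_mats_def scaleR_2[symmetric])

lemma symm_add: "symm (A + B) = symm A + symm B"
  by (simp add: symm_def transpose_add scaleR_add_right add_ac)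

lemma symm_diff: "symm (A - B) = symm A - symm B"
  by (simp add: symm_def transpose_diff scaleR_add_right scaleR_diff_right algebra_simps)

lemma symm_zero: "symm 0 = 0"
  using symm_diff[of 0 0] by simp

lemma symm_scaleR: "symm (c *\<^sub>R A) = c *\<^sub>R symm A"
  by (simp add: symm_def transpose_scaleR scaleR_add_right mult.commute)

lemma norm_symm_le: "norm (symm A) \<le> norm A"
  using norm_triangle_ineq[of A "transpose A"] by (simp add: symm_def norm_transpose)

lemma bounded_linear_symm: "bounded_linear symm"
  by (rule bounded_linear_intro[where K = 1]) (auto simp: symm_add symm_scaleR norm_symm_le)

lemma outer_in_sym_mats: "outer v \<in> sym_mats"
  by (simp add: sym_mats_def transpose_outer)

lemma sym_mats_add: "A \<in> sym_mats \<Longrightarrow> B \<in> sym_mats \<Longrightarrow> A + B \<in> sym_mats"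
  by (simp add: sym_mats_def transpose_add)

lemma sym_mats_diff: "A \<in> sym_mats \<Longrightarrow> B \<in> sym_mats \<Longrightarrow> A - B \<in> sym_mats"
  by (simp add: sym_mats_def transpose_diff)

lemma sym_mats_scaleR: "A \<in> sym_mats \<Longrightarrow> c *\<^sub>R A \<in> sym_mats"
  by (simp add: sym_mats_def transpose_scaleR)

lemma linear_functional_inner:
  fixes g :: "'a::euclidean_space \<Rightarrow> real"
  assumes "linear g"
  obtains p where "\<And>x. g x = p \<bullet> x"
  using adjoint_works[OF assms, of _ 1] by (metis inner_commute inner_real_def mult.right_neutral)

text \<open>Only symmetric matrices are meaningful arguments of \<open>F\<close>; composing with the
  symmetrisation makes \<open>F\<close> a function on a Euclidean space, to which Rademacher's theorem applies.\<close>

definition Fsym :: "'d nonlin \<Rightarrow> real \<times> (real^'d) \<Rightarrow> real \<times> (real^'d) \<times> (real^'d^'d) \<Rightarrow> real" where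
  "Fsym F z = (\<lambda>(r, p, \<gamma>). F z r p (symm \<gamma>))"

text \<open>The extension ignores antisymmetric directions, so the matrix part of its gradient
  annihilates them and is symmetric. The gradients obtained are those of \<open>F\<close> at the
  symmetrised argument, so the structural conditions apply.\<close>

lemma Fsym_gradients:
  fixes F :: "'d::finite nonlin"
  assumes D: "(Fsym F z has_derivative D) (at (r, p, \<gamma>))"
  obtains R P G where "has_F_r F z r p (symm \<gamma>) R" "has_F_p F z r p (symm \<gamma>) P"
    "has_F_gamma F z r p (symm \<gamma>) G" "\<And>a b c. D (a, b, c) = R * a + P \<bullet> b + G \<bullet> c"
proof -
  have lin: "linear D" using D by (rule has_derivative_linear)
  have Dr: "((\<lambda>r. F z r p (symm \<gamma>)) has_derivative (\<lambda>a. D (a, 0, 0))) (at r)"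
    using has_derivative_compose[of "\<lambda>r. (r, p, \<gamma>)" "\<lambda>a. (a, 0, 0)" r UNIV "Fsym F z" D, OF _ D]
    by (simp add: Fsym_def has_derivative_Pair)
  have Dp: "((\<lambda>p. F z r p (symm \<gamma>)) has_derivative (\<lambda>a. D (0, a, 0))) (at p)"
    using has_derivative_compose[of "\<lambda>p. (r, p, \<gamma>)" "\<lambda>a. (0, a, 0)" p UNIV "Fsym F z" D, OF _ D]
    by (simp add: Fsym_def has_derivative_Pair)
  define g where "g = (\<lambda>\<gamma>. F z r p (symm \<gamma>))"
  have Dg: "(g has_derivative (\<lambda>a. D (0, 0, a))) (at \<gamma>)"
    using has_derivative_compose[of "\<lambda>\<gamma>. (r, p, \<gamma>)" "\<lambda>a. (0, 0, a)" \<gamma> UNIV "Fsym F z" D, OF _ D]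
    by (simp add: Fsym_def g_def has_derivative_Pair)
  obtain P where P: "\<And>b. D (0, b, 0) = P \<bullet> b"
    using linear_functional_inner[OF has_derivative_linear[OF Dp]] by blast
  obtain G where G: "\<And>c. D (0, 0, c) = G \<bullet> c"
    using linear_functional_inner[OF has_derivative_linear[OF Dg]] by blast
  have Dg': "(g has_derivative (\<lambda>a. G \<bullet> a)) (at \<gamma>)" using Dg G by simp
  have symm_der: "((\<lambda>\<eta>. \<gamma> + symm (\<eta> - \<gamma>)) has_derivative symm) (at \<gamma>)"
    by (auto intro!: derivative_eq_intros bounded_linear.has_derivative[OF bounded_linear_symm])
  have "((\<lambda>\<eta>. g (\<gamma> + symm (\<eta> - \<gamma>))) has_derivative (\<lambda>a. G \<bullet> symm a)) (at \<gamma>)"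
    using has_derivative_compose[OF symm_der, of g "\<lambda>a. G \<bullet> a"] Dg' by (simp add: symm_zero)
  moreover have "g (\<gamma> + symm (\<eta> - \<gamma>)) = g \<eta>" for \<eta>
    unfolding g_def by (simp add: symm_add symm_id[OF symm_in_sym_mats] symm_diff)
  ultimately have "(\<lambda>a. G \<bullet> symm a) = (\<lambda>a. G \<bullet> a)" using Dg' by (simp add: has_derivative_unique)
  then have Gs: "G \<bullet> symm a = G \<bullet> a" for a by metis
  have "(G - transpose G) \<bullet> a = 0" for a
  proof -
    have "transpose G \<bullet> a = G \<bullet> transpose a" using inner_transpose[of G "transpose a"] by (simp add: transpose_transpose)
    then show ?thesis using Gs[of a] by (simp add: inner_diff_left symm_def inner_add_right)
  qed
  from this[of "G - transpose G"] have GT: "transpose G = G" by simp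
  \<comment> \<open>The base point need not be symmetric. Translation by its antisymmetric part
    carries a derivative at \<open>\<gamma>\<close> to one at \<open>symm \<gamma>\<close> within
    symmetric matrices, where both functions agree.\<close>
  have shift: "((\<lambda>\<eta>. \<gamma> + (\<eta> - symm \<gamma>)) has_derivative (\<lambda>a. a)) (at (symm \<gamma>) within sym_mats)"
    by (auto intro!: derivative_eq_intros)
  have "((\<lambda>\<eta>. g (\<gamma> + (\<eta> - symm \<gamma>))) has_derivative (\<lambda>a. G \<bullet> a)) (at (symm \<gamma>) within sym_mats)"
    using has_derivative_compose[OF shift, of g "\<lambda>a. G \<bullet> a"] Dg' by simp
  then have "(F z r p has_derivative (\<lambda>a. G \<bullet> a)) (at (symm \<gamma>) within sym_mats)"
  proof (rule has_derivative_transform[rotated 2])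
    fix \<eta> :: "real^'d^'d" assume "\<eta> \<in> sym_mats"
    then show "F z r p \<eta> = g (\<gamma> + (\<eta> - symm \<gamma>))"
      by (simp add: g_def symm_add symm_diff symm_id symm_in_sym_mats)
  qed (rule symm_in_sym_mats)
  then have 3: "has_F_gamma F z r p (symm \<gamma>) G" using GT by (simp add: has_F_gamma_def sym_mats_def)
  have 2: "has_F_p F z r p (symm \<gamma>) P" using Dp P by (simp add: has_F_p_def)
  define R where "R = D (1, 0, 0)"
  have Dr1: "D (a, 0, 0) = R * a" for a
    using linear_cmul[OF lin, of a "(1, 0, 0)"] by (simp add: R_def)
  have 1: "has_F_r F z r p (symm \<gamma>) R"
    unfolding has_F_r_def has_field_derivative_def using Dr Dr1 by simp
  have "D (a, b, c) = R * a + P \<bullet> b + G \<bullet> c" for a b c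
  proof -
    have "(a, b, c) = (a, 0, 0) + ((0, b, 0) + (0, 0, c))" by simp
    then have "D (a, b, c) = D (a, 0, 0) + (D (0, b, 0) + D (0, 0, c))" by (simp only: linear_add[OF lin])
    then show ?thesis using P G Dr1[of a] by simp
  qed
  with 1 2 3 show ?thesis by (rule that)
qed

section \<open>Integrals against the weights\<close>

lemma integral_vec_nth: "integrable M f \<Longrightarrow> (\<integral>x. f x \<partial>M) $ i = (\<integral>x. f x $ i \<partial>M)"
  for f :: "'w \<Rightarrow> 'b::euclidean_space^'d"
  by (rule integral_bounded_linear[OF bounded_linear_vec_nth, symmetric])

lemma measurable_matrix_vec [measurable]: "(\<lambda>y. A *v y) \<in> borel_measurable borel" for A :: "real^'d^'d"
  by (intro borel_measurable_continuous_onI linear_continuous_on matrix_vector_mul_bounded_linear)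

lemma continuous_on_outer: "continuous_on UNIV outer"
  unfolding outer_def by (intro continuous_intros)

lemma measurable_weight1 [measurable]: "weight1 s h \<in> borel_measurable borel" for s :: "real^'d^'d"
  unfolding weight1_def by measurable

lemma measurable_weight2 [measurable]:
  fixes s :: "real^'d^'d"
  assumes "invertible s"
  shows "weight2 s h \<in> borel_measurable borel"
proof -
  have [measurable]: "outer \<in> borel_measurable (borel :: (real^'d) measure)"
    by (rule borel_measurable_continuous_onI[OF continuous_on_outer])
  show ?thesis unfolding weight2_alt[OF assms, abs_def] by measurable
qed

lemma norm_power_le_poly: "k \<le> 6 \<Longrightarrow> norm y ^ k \<le> 1 + norm y ^ 6"
proof -
  assume k: "k \<le> 6"
  show ?thesis
  proof (cases "norm y \<le> 1")
    case True
    then have "norm y ^ k \<le> 1" by (simp add: power_le_one)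
    then show ?thesis by (smt (verit) norm_ge_zero zero_le_power)
  next
    case False
    then have "norm y ^ k \<le> norm y ^ 6" using k by (intro power_increasing) auto
    then show ?thesis by simp
  qed
qed

lemma norm_weight1_le: "norm (weight1 s h y) \<le> norm (matrix_inv (transpose s)) * (\<bar>1 / h\<bar> * norm y)" for s :: "real^'d^'d"
  unfolding weight1_def by (rule norm_matrix_vector_mult_le[THEN order_trans]) simp

lemma weight2_outer: "weight2 s h y = matrix_inv (transpose s) ** ((1 / h\<^sup>2) *\<^sub>R (outer y - h *\<^sub>R mat 1)) ** matrix_inv s"
  by (simp add: weight2_def outer_def)

lemma norm_weight2_le:
  fixes s :: "real^'d^'d"
  shows "norm (weight2 s h y) \<le> norm (matrix_inv (transpose s)) * norm (matrix_inv s) * ((1 / h\<^sup>2) * ((norm y)\<^sup>2 + \<bar>h\<bar> * norm (mat 1 :: real^'d^'d)))"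
proof -
  have "norm (weight2 s h y) \<le> norm (matrix_inv (transpose s)) * norm ((1 / h\<^sup>2) *\<^sub>R (outer y - h *\<^sub>R mat 1)) * norm (matrix_inv s)"
    unfolding weight2_outer
    by (rule norm_matrix_matrix_mult_le[THEN order_trans], rule mult_right_mono[OF norm_matrix_matrix_mult_le]) simp
  also have "norm ((1 / h\<^sup>2) *\<^sub>R (outer y - h *\<^sub>R mat 1)) \<le> (1 / h\<^sup>2) * ((norm y)\<^sup>2 + \<bar>h\<bar> * norm (mat 1 :: real^'d^'d))"
    using norm_triangle_ineq4[of "outer y" "h *\<^sub>R mat 1"] by (simp add: norm_outer divide_right_mono)
  finally show ?thesis by (simp add: mult_left_mono mult_right_mono mult_ac)
qed

lemma integrable_weights:
  fixes s :: "real^'d^'d"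
  assumes h: "h > 0" and s: "invertible s" and u[measurable]: "u \<in> borel_measurable borel" and b: "\<And>y. \<bar>u y\<bar> \<le> C"
  shows "integrable (gauss h) u" "integrable (gauss h) (\<lambda>y. u y *\<^sub>R weight1 s h y)"
    "integrable (gauss h) (\<lambda>y. u y *\<^sub>R weight2 s h y)"
proof -
  note [measurable] = measurable_weight2[OF s]
  have C: "C \<ge> 0" using b[of 0] by linarith
  show "integrable (gauss h) u"
  proof (rule gauss_integrable_bound[OF h u])
    fix y :: "real^'d"
    have "C * 1 \<le> C * (1 + norm y ^ 6)" using C by (intro mult_left_mono) auto
    then show "norm (u y) \<le> C * (1 + norm y ^ 6)" using b[of y] by simp
  qed
  show "integrable (gauss h) (\<lambda>y. u y *\<^sub>R weight1 s h y)"
  proof (rule gauss_integrable_bound[OF h])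
    fix y :: "real^'d"
    have "norm (u y *\<^sub>R weight1 s h y) \<le> C * (norm (matrix_inv (transpose s)) * (\<bar>1 / h\<bar> * norm y))"
      unfolding norm_scaleR using b C by (intro mult_mono norm_weight1_le) auto
    also have "\<dots> = (C * norm (matrix_inv (transpose s)) * \<bar>1 / h\<bar>) * norm y ^ 1" by simp
    also have "\<dots> \<le> (C * norm (matrix_inv (transpose s)) * \<bar>1 / h\<bar>) * (1 + norm y ^ 6)"
      using C by (intro mult_left_mono norm_power_le_poly) auto
    finally show "norm (u y *\<^sub>R weight1 s h y) \<le> (C * norm (matrix_inv (transpose s)) * \<bar>1 / h\<bar>) * (1 + norm y ^ 6)" .
  qed measurable
  show "integrable (gauss h) (\<lambda>y. u y *\<^sub>R weight2 s h y)"
  proof (rule gauss_integrable_bound[OF h])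
    fix y :: "real^'d"
    define B where "B = norm (matrix_inv (transpose s)) * norm (matrix_inv s) * (1 / h\<^sup>2)"
    define I where "I = h * norm (mat 1 :: real^'d^'d)"
    have B: "B \<ge> 0" and I: "I \<ge> 0" using h by (auto simp: B_def I_def)
    have "norm (weight2 s h y) \<le> B * ((norm y)\<^sup>2 + I)"
      using norm_weight2_le[of s h y] h by (simp add: B_def I_def mult_ac)
    also have "\<dots> \<le> B * ((1 + norm y ^ 6) + I * (1 + norm y ^ 6))"
      using B I norm_power_le_poly[of 2 y] by (intro mult_left_mono add_mono) (auto simp: distrib_left)
    also have "\<dots> = B * (1 + I) * (1 + norm y ^ 6)" by (simp add: algebra_simps)
    finally have "norm (weight2 s h y) \<le> B * (1 + I) * (1 + norm y ^ 6)" .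
    then have "norm (u y *\<^sub>R weight2 s h y) \<le> C * (B * (1 + I) * (1 + norm y ^ 6))"
      unfolding norm_scaleR using b C by (intro mult_mono) auto
    then show "norm (u y *\<^sub>R weight2 s h y) \<le> C * ((norm (matrix_inv (transpose s)) * norm (matrix_inv s) * (1 / h\<^sup>2)) * (1 + h * norm (mat 1 :: real^'d^'d))) * (1 + norm y ^ 6)"
      by (simp add: B_def I_def mult_ac)
  qed measurable
qed

lemma weight2_sym: "invertible s \<Longrightarrow> weight2 s h y \<in> sym_mats"
proof -
  assume s: "invertible s"
  have "matrix_inv (s ** transpose s) \<in> sym_mats"
    using s matrix_inv_diffusion[OF s] matrix_inv_transpose[OF s] by (simp add: sym_mats_def matrix_transpose_mul)
  then show ?thesis
    unfolding weight2_alt[OF s] by (intro sym_mats_diff sym_mats_scaleR outer_in_sym_mats)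
qed

lemma integral_sym_mats:
  assumes "integrable M f" "\<And>y. f y \<in> sym_mats"
  shows "(\<integral>y. f y \<partial>M) \<in> sym_mats"
proof -
  have "bounded_linear (transpose :: real^'d^'d \<Rightarrow> _)"
    by (rule bounded_linear_intro[where K = 1]) (auto simp: transpose_add transpose_scaleR norm_transpose)
  from integral_bounded_linear[OF this assms(1)]
  have "transpose (\<integral>y. f y \<partial>M) = (\<integral>y. transpose (f y) \<partial>M)" by (rule sym)
  also have "\<dots> = (\<integral>y. f y \<partial>M)" using assms(2) by (simp only: sym_mats_def mem_Collect_eq)
  finally show ?thesis by (simp add: sym_mats_def)
qed

text \<open>The matrix subtracted in the second weight is the covariance of the increment. As a
  consequence, adding a constant to a function changes its expectation but not its discrete
  derivatives.\<close>

lemma weights_mean_zero: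
  fixes s :: "real^'d^'d"
  assumes h: "h > 0" and s: "invertible s"
  shows "(\<integral>y. weight1 s h y \<partial>gauss h) = 0" "(\<integral>y. weight2 s h y \<partial>gauss h) = 0"
proof -
  interpret prob_space "gauss h :: (real^'d) measure" by (rule prob_space_gauss[OF h])
  have i1: "integrable (gauss h) (\<lambda>y. y :: real^'d)"
    using norm_power_le_poly[of 1] by (intro gauss_integrable_bound[OF h, of _ 1]) auto
  have "(\<integral>y. y \<partial>gauss h) = (0 :: real^'d)"
  proof -
    have "(\<integral>y. (y::real^'d) $ i \<partial>gauss h) = 0" for i :: 'd
      using gauss_mom_1[OF h, of i] by (simp add: has_bochner_integral_iff)
    then show ?thesis by (simp add: vec_eq_iff integral_vec_nth[OF i1])
  qed
  moreover have "(\<integral>y. weight1 s h y \<partial>gauss h) = matrix_inv (transpose s) *v ((1 / h) *\<^sub>R (\<integral>y. y \<partial>gauss h))"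
    unfolding weight1_def
    by (subst integral_bounded_linear[OF matrix_vector_mul_bounded_linear]) (auto intro: i1)
  ultimately show "(\<integral>y. weight1 s h y \<partial>gauss h) = 0" by simp
  have [measurable]: "outer \<in> borel_measurable (borel :: (real^'d) measure)"
    by (rule borel_measurable_continuous_onI[OF continuous_on_outer])
  have i2: "integrable (gauss h) (outer :: real^'d \<Rightarrow> _)"
    using norm_power_le_poly[of 2] by (intro gauss_integrable_bound[OF h, of _ 1]) (auto simp: norm_outer)
  have o: "(\<integral>y. outer y \<partial>gauss h) = h *\<^sub>R (mat 1 :: real^'d^'d)"
  proof -
    have "(\<integral>y. outer y \<partial>gauss h) $ i $ j = (h *\<^sub>R (mat 1 :: real^'d^'d)) $ i $ j" for i j
    proof -
      have "integrable (gauss h) (\<lambda>y::real^'d. outer y $ i)"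
        by (rule integrable_bounded_linear[OF bounded_linear_vec_nth i2])
      then have "(\<integral>y. outer y \<partial>gauss h) $ i $ j = (\<integral>y. outer (y::real^'d) $ i $ j \<partial>gauss h)"
        by (simp only: integral_vec_nth[OF i2] integral_vec_nth)
      then show ?thesis using gauss_mom_2[OF h, of i j]
        by (simp add: outer_def mat_def has_bochner_integral_iff)
    qed
    then show ?thesis by (simp add: vec_eq_iff)
  qed
  have bl: "bounded_linear (\<lambda>X :: real^'d^'d. matrix_inv (transpose s) ** ((1 / h\<^sup>2) *\<^sub>R X) ** matrix_inv s)"
  proof (rule bounded_linear_intro[where K = "norm (matrix_inv (transpose s)) * (1 / h\<^sup>2) * norm (matrix_inv s)"])
    fix X Y :: "real^'d^'d" and c :: real
    show "matrix_inv (transpose s) ** ((1 / h\<^sup>2) *\<^sub>R (X + Y)) ** matrix_inv s =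
      matrix_inv (transpose s) ** ((1 / h\<^sup>2) *\<^sub>R X) ** matrix_inv s + matrix_inv (transpose s) ** ((1 / h\<^sup>2) *\<^sub>R Y) ** matrix_inv s"
      by (simp add: scaleR_add_right matrix_add_ldistrib matrix_add_rdistrib)
    show "matrix_inv (transpose s) ** ((1 / h\<^sup>2) *\<^sub>R c *\<^sub>R X) ** matrix_inv s = c *\<^sub>R (matrix_inv (transpose s) ** ((1 / h\<^sup>2) *\<^sub>R X) ** matrix_inv s)"
      by (simp add: matrix_scalar_ac scalar_matrix_assoc[symmetric] mult.commute)
    have "norm (matrix_inv (transpose s) ** ((1 / h\<^sup>2) *\<^sub>R X) ** matrix_inv s) \<le> norm (matrix_inv (transpose s)) * norm ((1 / h\<^sup>2) *\<^sub>R X) * norm (matrix_inv s)"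
      by (rule norm_matrix_matrix_mult_le[THEN order_trans], rule mult_right_mono[OF norm_matrix_matrix_mult_le]) simp
    then show "norm (matrix_inv (transpose s) ** ((1 / h\<^sup>2) *\<^sub>R X) ** matrix_inv s) \<le> norm X * (norm (matrix_inv (transpose s)) * (1 / h\<^sup>2) * norm (matrix_inv s))"
      by (simp add: mult_ac)
  qed
  have "integrable (gauss h) (\<lambda>y::real^'d. outer y - h *\<^sub>R mat 1)" using i2 by (intro Bochner_Integration.integrable_diff) auto
  moreover have "(\<integral>y. (outer y - h *\<^sub>R mat 1) \<partial>gauss h) = (0 :: real^'d^'d)"
    using i2 o prob_space by simp
  ultimately show "(\<integral>y. weight2 s h y \<partial>gauss h) = 0"
    unfolding weight2_outer by (subst integral_bounded_linear[OF bl]) auto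
qed

section \<open>Monotonicity and stability of the scheme\<close>

text \<open>Bounded Borel functions of the space variable at one time: expectations against the
  polynomially growing weights exist, and the recursion stays in this class.\<close>

definition good_slice :: "(real \<times> (real^'d) \<Rightarrow> real) \<Rightarrow> real \<Rightarrow> bool" where
  "good_slice \<psi> t \<longleftrightarrow> (\<lambda>x. \<psi> (t, x)) \<in> borel_measurable borel \<and> (\<exists>C. \<forall>x. \<bar>\<psi> (t, x)\<bar> \<le> C)"

text \<open>Working form of the hypotheses: \<open>K\<close> bounds \<open>F\<close> at zero
  arguments, \<open>L\<close> is its Lipschitz constant, and the regularity of the coefficients
  appears as continuity on the cylinder.\<close>

locale obstacle_scheme =
  fixes T :: real
    and \<mu> :: "real \<times> (real^'d) \<Rightarrow> real^'d"
    and \<sigma> :: "real \<times> (real^'d) \<Rightarrow> real^'d^'d"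
    and F :: "'d nonlin"
    and g :: "real \<times> (real^'d) \<Rightarrow> real"
    and M :: "'w measure"
    and W :: "real \<Rightarrow> 'w \<Rightarrow> real^'d"
    and K L :: real
  assumes T: "T > 0"
    and W: "brownian_motion M W"
    and F_lipschitz: "\<And>t. t \<in> {0..T} \<Longrightarrow> L-lipschitz_on (UNIV \<times> UNIV \<times> UNIV \<times> sym_mats) (\<lambda>(x, r, p, \<gamma>). F (t, x) r p \<gamma>)"
    and F_zero: "\<And>z. z \<in> cylinder T \<Longrightarrow> \<bar>F z 0 0 0\<bar> \<le> K"
    and \<sigma>_invertible: "\<And>z. z \<in> cylinder T \<Longrightarrow> invertible (\<sigma> z)"
    and \<mu>_cont: "continuous_on (cylinder T) \<mu>"
    and \<sigma>_cont: "continuous_on (cylinder T) \<sigma>"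
    and F_elliptic: "\<And>z r p \<gamma> \<gamma>'. z \<in> cylinder T \<Longrightarrow> \<gamma> \<in> sym_mats \<Longrightarrow> \<gamma>' \<in> sym_mats \<Longrightarrow>
        (\<And>y. y \<bullet> (\<gamma> *v y) \<le> y \<bullet> (\<gamma>' *v y)) \<Longrightarrow> F z r p \<gamma> \<le> F z r p \<gamma>'"
    and F_trace: "\<And>z r p \<gamma> G. z \<in> cylinder T \<Longrightarrow> \<gamma> \<in> sym_mats \<Longrightarrow> has_F_gamma F z r p \<gamma> G \<Longrightarrow>
        matrix_inv (diffusion \<sigma> z) \<bullet> G \<le> 1"
    and F_image: "\<And>z r p \<gamma> P G. z \<in> cylinder T \<Longrightarrow> \<gamma> \<in> sym_mats \<Longrightarrow> has_F_p F z r p \<gamma> P \<Longrightarrow>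
        has_F_gamma F z r p \<gamma> G \<Longrightarrow> P \<in> range (\<lambda>y. G *v y)"
    and F_sign: "\<And>z r p \<gamma> R P G. z \<in> cylinder T \<Longrightarrow> \<gamma> \<in> sym_mats \<Longrightarrow> has_F_r F z r p \<gamma> R \<Longrightarrow>
        has_F_p F z r p \<gamma> P \<Longrightarrow> has_F_gamma F z r p \<gamma> G \<Longrightarrow>
        R - 1 / 4 * (P \<bullet> (pseudo_inv G *v P)) \<ge> 0"
    and F_cont: "\<And>x r p \<gamma>. \<gamma> \<in> sym_mats \<Longrightarrow> continuous_on {0..T} (\<lambda>t. F (t, x) r p \<gamma>)"
    and g_cont: "continuous_on (cylinder T) g"
    and g_bounded: "bounded (g ` cylinder T)"
begin

lemma L_nonneg: "L \<ge> 0"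
  using lipschitz_on_nonneg[OF F_lipschitz[of 0]] T by simp

lemma F_lipschitz_dist:
  assumes "t \<in> {0..T}" "\<gamma> \<in> sym_mats" "\<gamma>' \<in> sym_mats"
  shows "\<bar>F (t, x) r p \<gamma> - F (t, x') r' p' \<gamma>'\<bar> \<le> L * (norm (x - x') + \<bar>r - r'\<bar> + norm (p - p') + norm (\<gamma> - \<gamma>'))"
proof -
  have "\<bar>F (t, x) r p \<gamma> - F (t, x') r' p' \<gamma>'\<bar> \<le> L * dist (x, r, p, \<gamma>) (x', r', p', \<gamma>')"
    using lipschitz_onD[OF F_lipschitz[OF assms(1)], of "(x, r, p, \<gamma>)" "(x', r', p', \<gamma>')"] assms
    by (simp add: dist_real_def)
  also have "dist (x, r, p, \<gamma>) (x', r', p', \<gamma>') \<le> norm (x - x') + \<bar>r - r'\<bar> + norm (p - p') + norm (\<gamma> - \<gamma>')"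
  proof -
    have *: "dist (a, b) (c, d) \<le> dist a c + dist b d" for a c :: "'x::metric_space" and b d :: "'y::metric_space"
      unfolding dist_Pair_Pair by (rule sqrt_sum_squares_le_sum) auto
    show ?thesis
      using *[of x "(r, p, \<gamma>)" x' "(r', p', \<gamma>')"] *[of r "(p, \<gamma>)" r' "(p', \<gamma>')"] *[of p \<gamma> p' \<gamma>']
      by (simp add: dist_norm dist_real_def)
  qed
  finally show ?thesis using L_nonneg by (simp add: mult_left_mono)
qed

text \<open>Symmetrisation does not increase the Frobenius norm, so the Lipschitz constant is
  kept.\<close>

lemma Fsym_lipschitz:
  assumes z: "z \<in> cylinder T"
  shows "L-lipschitz_on UNIV (Fsym F z)"
proof (rule lipschitz_onI)
  obtain t x where tx: "z = (t, x)" "t \<in> {0..T}" using z by auto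
  fix u v :: "real \<times> (real^'d) \<times> (real^'d^'d)"
  obtain r p \<gamma> where u: "u = (r, p, \<gamma>)" by (cases u) auto
  obtain r' p' \<gamma>' where v: "v = (r', p', \<gamma>')" by (cases v) auto
  have "dist (Fsym F z u) (Fsym F z v) \<le> L * dist (x, r, p, symm \<gamma>) (x, r', p', symm \<gamma>')"
    using lipschitz_onD[OF F_lipschitz[OF tx(2)], of "(x, r, p, symm \<gamma>)" "(x, r', p', symm \<gamma>')"] symm_in_sym_mats[of \<gamma>] symm_in_sym_mats[of \<gamma>']
    by (simp add: Fsym_def u v tx)
  also have "\<dots> \<le> L * dist u v"
  proof (rule mult_left_mono[OF _ L_nonneg])
    have "dist (symm \<gamma>) (symm \<gamma>') \<le> dist \<gamma> \<gamma>'" by (simp add: dist_norm symm_diff[symmetric] norm_symm_le)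
    then show "dist (x, r, p, symm \<gamma>) (x, r', p', symm \<gamma>') \<le> dist u v"
      by (simp add: u v dist_Pair_Pair power_mono)
  qed
  finally show "dist (Fsym F z u) (Fsym F z v) \<le> L * dist u v" .
qed (rule L_nonneg)

text \<open>Along \<open>\<gamma> + s y y^T\<close> ellipticity makes \<open>F\<close> nondecreasing
  in \<open>s\<close>, and the derivative at \<open>s = 0\<close> is the quadratic form of
  \<open>G\<close> at \<open>y\<close>.\<close>

lemma F_gamma_psd:
  assumes z: "z \<in> cylinder T" and \<gamma>: "\<gamma> \<in> sym_mats" and G: "has_F_gamma F z r p \<gamma> G"
  shows "y \<bullet> (G *v y) \<ge> 0"
proof -
  define \<phi> where "\<phi> = (\<lambda>s::real. F z r p (\<gamma> + s *\<^sub>R outer y))"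
  have l: "\<gamma> + s *\<^sub>R outer y \<in> sym_mats" for s
    by (intro sym_mats_add \<gamma> sym_mats_scaleR outer_in_sym_mats)
  have "mono \<phi>"
  proof (rule monoI)
    fix s s' :: real assume s: "s \<le> s'"
    show "\<phi> s \<le> \<phi> s'"
      unfolding \<phi>_def
    proof (rule F_elliptic[OF z l l])
      fix w
      show "w \<bullet> ((\<gamma> + s *\<^sub>R outer y) *v w) \<le> w \<bullet> ((\<gamma> + s' *\<^sub>R outer y) *v w)"
        using mult_right_mono[OF s, of "(y \<bullet> w) * (y \<bullet> w)"]
        by (simp add: matrix_vector_mult_add_rdistrib inner_add_right scaleR_matrix_vector_assoc[symmetric] outer_mult_vec inner_commute mult.assoc)
    qed
  qed
  have line: "((\<lambda>s::real. \<gamma> + s *\<^sub>R outer y) has_derivative (\<lambda>s. s *\<^sub>R outer y)) (at 0 within UNIV)"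
    by (auto intro!: derivative_eq_intros)
  have "(F z r p has_derivative (\<lambda>\<eta>. G \<bullet> \<eta>)) (at \<gamma> within range (\<lambda>s::real. \<gamma> + s *\<^sub>R outer y))"
    using G l unfolding has_F_gamma_def by (blast intro: has_derivative_subset)
  then have "(\<phi> has_derivative (\<lambda>s. G \<bullet> (s *\<^sub>R outer y))) (at 0)"
    unfolding \<phi>_def using has_derivative_in_compose[OF line, of "F z r p" "\<lambda>\<eta>. G \<bullet> \<eta>"] by simp
  then have "(\<phi> has_real_derivative (G \<bullet> outer y)) (at 0)"
    by (simp add: has_field_derivative_def mult_commute_abs)
  then have "G \<bullet> outer y \<ge> 0"
    using mono_on_imp_deriv_nonneg[of UNIV \<phi>] \<open>mono \<phi>\<close> by simp
  then show ?thesis by (simp add: inner_outer)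
qed

text \<open>Monotonicity in raw form: \<open>u\<close> is the gap between two functions fed to the
  scheme, and its weighted integrals are the gaps between their discrete derivatives. These
  integrals give a direction that is fixed while the base point varies.\<close>

lemma F_increment_ge:
  assumes z: "z \<in> cylinder T" and h: "h > 0"
    and u[measurable]: "u \<in> borel_measurable borel" and b: "\<And>y. \<bar>u y\<bar> \<le> C" and pos: "\<And>y. u y \<ge> 0"
    and \<gamma>: "\<gamma> \<in> sym_mats"
  shows "F z (r + (\<integral>y. u y \<partial>gauss h)) (p + (\<integral>y. u y *\<^sub>R weight1 (\<sigma> z) h y \<partial>gauss h))
      (\<gamma> + (\<integral>y. u y *\<^sub>R weight2 (\<sigma> z) h y \<partial>gauss h)) - F z r p \<gamma> \<ge> - (\<integral>y. u y \<partial>gauss h) / h"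
proof -
  define s where "s = \<sigma> z"
  have s: "invertible s" using \<sigma>_invertible[OF z] by (simp add: s_def)
  note int = integrable_weights[OF h s u b]
  define a0 a1 a2 where "a0 = (\<integral>y. u y \<partial>gauss h)" and "a1 = (\<integral>y. u y *\<^sub>R weight1 s h y \<partial>gauss h)"
    and "a2 = (\<integral>y. u y *\<^sub>R weight2 s h y \<partial>gauss h)"
  have a2: "a2 \<in> sym_mats"
    unfolding a2_def using int(3) s by (intro integral_sym_mats sym_mats_scaleR weight2_sym) auto
  have "Fsym F z ((r, p, \<gamma>) + (a0, a1, a2)) - Fsym F z (r, p, \<gamma>) \<ge> - a0 / h"
  proof (rule lipschitz_increment_ge[OF Fsym_lipschitz[OF z]])
    fix v D
    assume D: "(Fsym F z has_derivative D) (at v)"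
    obtain r p \<gamma> where v: "v = (r, p, \<gamma>)" by (cases v) auto
    obtain R P G where gr: "has_F_r F z r p (symm \<gamma>) R" "has_F_p F z r p (symm \<gamma>) P"
      "has_F_gamma F z r p (symm \<gamma>) G" and Dabc: "\<And>a b c. D (a, b, c) = R * a + P \<bullet> b + G \<bullet> c"
      using Fsym_gradients[OF D[unfolded v]] by metis
    note \<gamma>s = symm_in_sym_mats[of \<gamma>]
    have GT: "transpose G = G" using gr(3) by (simp add: has_F_gamma_def sym_mats_def)
    obtain q where q: "P = G *v q" using F_image[OF z \<gamma>s gr(2,3)] by auto
    have wp: "1 + h * (R + P \<bullet> weight1 s h y + G \<bullet> weight2 s h y) \<ge> 0" for y
      using F_trace[OF z \<gamma>s gr(3)] F_sign[OF z \<gamma>s gr] F_gamma_psd[OF z \<gamma>s gr(3)]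
      by (intro weight_positivity[OF s h GT _ _ q]) (auto simp: diffusion_def s_def)
    have i1: "P \<bullet> a1 = (\<integral>y. P \<bullet> (u y *\<^sub>R weight1 s h y) \<partial>gauss h)"
      unfolding a1_def by (rule integral_inner_right[OF int(2), symmetric])
    have i2: "G \<bullet> a2 = (\<integral>y. G \<bullet> (u y *\<^sub>R weight2 s h y) \<partial>gauss h)"
      unfolding a2_def by (rule integral_inner_right[OF int(3), symmetric])
    have I: "integrable (gauss h) (\<lambda>y. R * u y)" "integrable (gauss h) (\<lambda>y. P \<bullet> (u y *\<^sub>R weight1 s h y))"
        "integrable (gauss h) (\<lambda>y. G \<bullet> (u y *\<^sub>R weight2 s h y))" "integrable (gauss h) (\<lambda>y. u y / h)"
      using int by (auto simp: integrable_inner_right simp del: inner_scaleR_right)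
    have "D (a0, a1, a2) + a0 / h = (\<integral>y. R * u y + P \<bullet> (u y *\<^sub>R weight1 s h y) + G \<bullet> (u y *\<^sub>R weight2 s h y) + u y / h \<partial>gauss h)"
      unfolding Dabc i1 i2 using I int(1) by (simp add: a0_def del: inner_scaleR_right)
    \<comment> \<open>The term \<open>u y / h\<close>, coming from the lower bound to be proved,
      supplies the leading 1 of the positive factor.\<close>
    also have "\<dots> = (\<integral>y. u y * (1 + h * (R + P \<bullet> weight1 s h y + G \<bullet> weight2 s h y)) / h \<partial>gauss h)"
      using h by (intro Bochner_Integration.integral_cong refl) (simp add: field_simps)
    also have "\<dots> \<ge> 0"
      using wp pos h by (intro Bochner_Integration.integral_nonneg) auto
    finally show "- a0 / h \<le> D (a0, a1, a2)" by simp
  qed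
  then show ?thesis
    using \<gamma> a2 by (simp add: Fsym_def symm_id sym_mats_add a0_def a1_def a2_def s_def)
qed

text \<open>Here \<open>u\<close> is the function seen from the Gaussian variable. Symmetry of the
  second discrete derivative is recorded because \<open>F\<close> is controlled at symmetric
  matrices.\<close>

lemma Dh_gauss:
  fixes \<psi> :: "real \<times> (real^'d) \<Rightarrow> real" and x :: "real^'d" and t h :: real
  assumes t: "0 \<le> t" "t \<le> T" and h: "h > 0" and \<psi>: "good_slice \<psi> (t + h)"
    and u_def: "\<And>y. u y = \<psi> (t + h, x + h *\<^sub>R \<mu> (t, x) + \<sigma> (t, x) *v y)"
  shows "u \<in> borel_measurable borel" "\<exists>C. \<forall>y. \<bar>u y\<bar> \<le> C"
    "D0h M W \<mu> \<sigma> h \<psi> (t, x) = (\<integral>y. u y \<partial>gauss h)"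
    "D1h M W \<mu> \<sigma> h \<psi> (t, x) = (\<integral>y. u y *\<^sub>R weight1 (\<sigma> (t, x)) h y \<partial>gauss h)"
    "D2h M W \<mu> \<sigma> h \<psi> (t, x) = (\<integral>y. u y *\<^sub>R weight2 (\<sigma> (t, x)) h y \<partial>gauss h)"
    "D2h M W \<mu> \<sigma> h \<psi> (t, x) \<in> sym_mats"
proof -
  have s: "invertible (\<sigma> (t, x))" using t by (intro \<sigma>_invertible) auto
  note [measurable] = measurable_weight2[OF s]
  have [measurable]: "(\<lambda>x. \<psi> (t + h, x)) \<in> borel_measurable borel" using \<psi> by (simp add: good_slice_def)
  show u[measurable]: "u \<in> borel_measurable borel" unfolding u_def[abs_def] by measurable
  show b: "\<exists>C. \<forall>y. \<bar>u y\<bar> \<le> C" using \<psi> by (auto simp: good_slice_def u_def)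
  note bi = brownian_increment_integral[OF W t(1) h]
  show "D0h M W \<mu> \<sigma> h \<psi> (t, x) = (\<integral>y. u y \<partial>gauss h)"
    unfolding D0h_def euler_step_def using bi[of u] by (simp add: u_def)
  show "D1h M W \<mu> \<sigma> h \<psi> (t, x) = (\<integral>y. u y *\<^sub>R weight1 (\<sigma> (t, x)) h y \<partial>gauss h)"
    unfolding D1h_def euler_step_def using bi[of "\<lambda>y. u y *\<^sub>R weight1 (\<sigma> (t, x)) h y"] by (simp add: u_def)
  show 2: "D2h M W \<mu> \<sigma> h \<psi> (t, x) = (\<integral>y. u y *\<^sub>R weight2 (\<sigma> (t, x)) h y \<partial>gauss h)"
    unfolding D2h_def euler_step_def using bi[of "\<lambda>y. u y *\<^sub>R weight2 (\<sigma> (t, x)) h y"] by (simp add: u_def)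
  obtain C where "\<And>y. \<bar>u y\<bar> \<le> C" using b by blast
  then show "D2h M W \<mu> \<sigma> h \<psi> (t, x) \<in> sym_mats"
    unfolding 2 using s h by (intro integral_sym_mats integrable_weights[OF h s u] sym_mats_scaleR weight2_sym) auto
qed

lemma add_diff_cancel': "a + (b - a) = b" for a b :: "'z::ab_group_add"
  by simp

text \<open>The possible loss in \<open>h F\<close> is at most the gain in the expectation, so the
  two balance without an error term.\<close>

lemma Th_mono:
  assumes t: "0 \<le> t" "t \<le> T" and h: "h > 0" and \<psi>1: "good_slice \<psi>1 (t + h)" and \<psi>2: "good_slice \<psi>2 (t + h)"
    and le: "\<And>y. \<psi>1 (t + h, y) \<le> \<psi>2 (t + h, y)"
  shows "Th M W \<mu> \<sigma> F h \<psi>1 (t, x) \<le> Th M W \<mu> \<sigma> F h \<psi>2 (t, x)"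
proof -
  have z: "(t, x) \<in> cylinder T" using t by auto
  have s: "invertible (\<sigma> (t, x))" using \<sigma>_invertible[OF z] .
  define u1 u2 where "u1 = (\<lambda>y. \<psi>1 (t + h, x + h *\<^sub>R \<mu> (t, x) + \<sigma> (t, x) *v y))"
    and "u2 = (\<lambda>y. \<psi>2 (t + h, x + h *\<^sub>R \<mu> (t, x) + \<sigma> (t, x) *v y))"
  have u1: "u1 y = \<psi>1 (t + h, x + h *\<^sub>R \<mu> (t, x) + \<sigma> (t, x) *v y)"
    and u2: "u2 y = \<psi>2 (t + h, x + h *\<^sub>R \<mu> (t, x) + \<sigma> (t, x) *v y)" for y
    by (simp_all add: u1_def u2_def)
  note D1 = Dh_gauss[OF t h \<psi>1 u1] and D2 = Dh_gauss[OF t h \<psi>2 u2]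
  obtain C1 C2 where C: "\<And>y. \<bar>u1 y\<bar> \<le> C1" "\<And>y. \<bar>u2 y\<bar> \<le> C2" using D1(2) D2(2) by blast
  note i1 = integrable_weights[OF h s D1(1) C(1)] and i2 = integrable_weights[OF h s D2(1) C(2)]
  define u where "u = (\<lambda>y. u2 y - u1 y)"
  have u: "u \<in> borel_measurable borel" unfolding u_def using D1(1) D2(1) by measurable
  have bu: "\<bar>u y\<bar> \<le> C1 + C2" for y using C(1)[of y] C(2)[of y] unfolding u_def by linarith
  have pu: "u y \<ge> 0" for y using le by (simp add: u_def u1_def u2_def)
  have e0: "(\<integral>y. u y \<partial>gauss h) = D0h M W \<mu> \<sigma> h \<psi>2 (t, x) - D0h M W \<mu> \<sigma> h \<psi>1 (t, x)"
    unfolding D1 D2 u_def using i1 i2 by simp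
  have e1: "(\<integral>y. u y *\<^sub>R weight1 (\<sigma> (t, x)) h y \<partial>gauss h) = D1h M W \<mu> \<sigma> h \<psi>2 (t, x) - D1h M W \<mu> \<sigma> h \<psi>1 (t, x)"
    unfolding D1 D2 u_def using i1 i2 by (simp add: scaleR_diff_left)
  have e2: "(\<integral>y. u y *\<^sub>R weight2 (\<sigma> (t, x)) h y \<partial>gauss h) = D2h M W \<mu> \<sigma> h \<psi>2 (t, x) - D2h M W \<mu> \<sigma> h \<psi>1 (t, x)"
    unfolding D1(5) D2(5) u_def using i1 i2 by (simp add: scaleR_diff_left)
  have "- (\<integral>y. u y \<partial>gauss h) / h \<le>
      F (t, x) (D0h M W \<mu> \<sigma> h \<psi>2 (t, x)) (D1h M W \<mu> \<sigma> h \<psi>2 (t, x)) (D2h M W \<mu> \<sigma> h \<psi>2 (t, x)) -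
      F (t, x) (D0h M W \<mu> \<sigma> h \<psi>1 (t, x)) (D1h M W \<mu> \<sigma> h \<psi>1 (t, x)) (D2h M W \<mu> \<sigma> h \<psi>1 (t, x))"
    using F_increment_ge[OF z h u bu pu D1(6), of "D0h M W \<mu> \<sigma> h \<psi>1 (t, x)" "D1h M W \<mu> \<sigma> h \<psi>1 (t, x)"]
    unfolding e0 e1 e2 add_diff_cancel' .
  moreover have "- a / h \<le> b \<Longrightarrow> - a \<le> h * b" for a b using h by (simp add: field_simps)
  ultimately have "- (\<integral>y. u y \<partial>gauss h) \<le> h * (F (t, x) (D0h M W \<mu> \<sigma> h \<psi>2 (t, x)) (D1h M W \<mu> \<sigma> h \<psi>2 (t, x)) (D2h M W \<mu> \<sigma> h \<psi>2 (t, x)) -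
      F (t, x) (D0h M W \<mu> \<sigma> h \<psi>1 (t, x)) (D1h M W \<mu> \<sigma> h \<psi>1 (t, x)) (D2h M W \<mu> \<sigma> h \<psi>1 (t, x)))"
    by blast
  then show ?thesis unfolding Th_def e0 right_diff_distrib by linarith
qed

lemma Th_const:
  assumes t: "0 \<le> t" "t \<le> T" and h: "h > 0"
  shows "Th M W \<mu> \<sigma> F h (\<lambda>_. c) (t, x) = c + h * F (t, x) c 0 0"
proof -
  have s: "invertible (\<sigma> (t, x))" using t by (intro \<sigma>_invertible) auto
  interpret G: prob_space "gauss h :: (real^'d) measure" by (rule prob_space_gauss[OF h])
  have gs: "good_slice (\<lambda>_::real\<times>(real^'d). c) (t + h)" by (auto simp: good_slice_def)
  note D = Dh_gauss[where x = x, OF t h gs refl]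
  have 0: "D0h M W \<mu> \<sigma> h (\<lambda>_. c) (t, x) = c" unfolding D using G.prob_space by simp
  have 1: "D1h M W \<mu> \<sigma> h (\<lambda>_. c) (t, x) = 0" unfolding D using weights_mean_zero[OF h s] by simp
  have 2: "D2h M W \<mu> \<sigma> h (\<lambda>_. c) (t, x) = 0" unfolding D(5) using weights_mean_zero[OF h s] by simp
  show ?thesis by (simp add: Th_def 0 1 2)
qed

end

section \<open>Measurability of the scheme and its uniform bound\<close>

lemma bounded_bilinear_matrix_vector: "bounded_bilinear ((*v) :: real^'d^'d \<Rightarrow> _)"
  by (rule bounded_bilinear.intro)
     (auto intro!: exI[of _ 1] norm_matrix_vector_mult_le
       simp: matrix_vector_mult_add_rdistrib matrix_vector_right_distrib matrix_vector_mult_scaleR scaleR_matrix_vector_assoc)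

lemma bounded_bilinear_matrix_matrix: "bounded_bilinear ((**) :: real^'d^'d \<Rightarrow> real^'d^'d \<Rightarrow> _)"
  by (rule bounded_bilinear.intro)
     (auto intro!: exI[of _ 1] norm_matrix_matrix_mult_le
       simp: matrix_add_ldistrib matrix_add_rdistrib matrix_scalar_ac scalar_matrix_assoc)

lemmas continuous_on_matrix_vector [continuous_intros] = bounded_bilinear.continuous_on[OF bounded_bilinear_matrix_vector]
lemmas continuous_on_matrix_matrix [continuous_intros] = bounded_bilinear.continuous_on[OF bounded_bilinear_matrix_matrix]

lemma zero_sym_mats: "(0 :: real^'d^'d) \<in> sym_mats"
  by (simp add: sym_mats_def transpose_def vec_eq_iff)

lemma bounded_linear_transpose: "bounded_linear (transpose :: real^'d^'d \<Rightarrow> _)"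
  by (rule bounded_linear_intro[where K = 1]) (auto simp: transpose_add transpose_scaleR norm_transpose)

lemmas continuous_on_transpose [continuous_intros] = bounded_linear.continuous_on[OF bounded_linear_transpose]

lemma continuous_on_outer' [continuous_intros]: "continuous_on S f \<Longrightarrow> continuous_on S (\<lambda>x. outer (f x))"
  by (rule continuous_on_compose2[OF continuous_on_outer]) auto

lemma borel_measurable_gauss_integral:
  fixes f :: "'a::euclidean_space \<Rightarrow> real^'d \<Rightarrow> 'b::euclidean_space"
  assumes h: "h > 0" and f: "(\<lambda>p. f (fst p) (snd p)) \<in> borel_measurable borel"
  shows "(\<lambda>x. \<integral>y. f x y \<partial>gauss h) \<in> borel_measurable borel"
proof -
  interpret prob_space "gauss h :: (real^'d) measure" by (rule prob_space_gauss[OF h])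
  have eq: "sets (borel \<Otimes>\<^sub>M (gauss h :: (real^'d) measure)) = sets (borel :: ('a \<times> (real^'d)) measure)"
    by (subst borel_prod[symmetric]) (rule sets_pair_measure_cong, auto)
  have "case_prod f \<in> borel_measurable (borel \<Otimes>\<^sub>M gauss h)"
    using f unfolding measurable_cong_sets[OF eq refl] by (simp add: case_prod_unfold)
  then show ?thesis by (rule borel_measurable_lebesgue_integral)
qed

context obstacle_scheme
begin

definition gB :: real where "gB = (SUP z\<in>cylinder T. \<bar>g z\<bar>)"

lemma g_le_gB: "z \<in> cylinder T \<Longrightarrow> \<bar>g z\<bar> \<le> gB"
  unfolding gB_def
proof (rule cSUP_upper)
  show "bdd_above ((\<lambda>z. \<bar>g z\<bar>) ` cylinder T)"
  proof -
    obtain B where "\<forall>z\<in>cylinder T. \<bar>g z\<bar> \<le> B" using g_bounded by (auto simp: bounded_iff)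
    then show ?thesis by (intro bdd_aboveI2[where M = B]) auto
  qed
qed

lemma gB_nonneg: "gB \<ge> 0"
  using g_le_gB[of "(0, 0)"] T by auto

lemma K_nonneg: "K \<ge> 0"
  using F_zero[of "(0, 0)"] T by auto

text \<open>Discrete Gronwall constant: an upper bound \<open>c\<close> becomes at most
  \<open>(1 + hL)c + hK\<close> in one step, and \<open>(1 + hL)^n\<close> is at most
  \<open>exp (L * T)\<close>.\<close>

definition vB :: real where "vB = exp (L * T) * (gB + K * T)"

lemma gB_le_vB: "gB \<le> vB"
proof -
  have "1 * gB \<le> exp (L * T) * (gB + K * T)"
    using L_nonneg T K_nonneg gB_nonneg by (intro mult_mono) auto
  then show ?thesis by (simp add: vB_def)
qed

lemma F_const_le: "t \<in> {0..T} \<Longrightarrow> c \<ge> 0 \<Longrightarrow> F (t, x) c 0 0 \<le> K + L * c"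
  using F_lipschitz_dist[OF _ zero_sym_mats zero_sym_mats, of t x c 0 x 0 0] F_zero[of "(t, x)"] by (auto simp: abs_le_iff)

lemma Fsym_continuous:
  assumes t: "t \<in> {0..T}"
  shows "continuous_on UNIV (\<lambda>(x, r, p, \<gamma>). F (t, x) r p (symm \<gamma>))"
proof -
  have "continuous_on (UNIV \<times> UNIV \<times> UNIV \<times> sym_mats) (\<lambda>(x, r, p, \<gamma>). F (t, x) r p \<gamma>)"
    by (rule lipschitz_on_continuous_on[OF F_lipschitz[OF t]])
  moreover have "continuous_on UNIV (\<lambda>(x::real^'d, r::real, p::real^'d, \<gamma>::real^'d^'d). (x, r, p, symm \<gamma>))"
    unfolding case_prod_unfold by (intro continuous_intros bounded_linear.continuous_on[OF bounded_linear_symm])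
  ultimately have "continuous_on UNIV ((\<lambda>(x, r, p, \<gamma>). F (t, x) r p \<gamma>) \<circ> (\<lambda>(x, r, p, \<gamma>). (x, r, p, symm \<gamma>)))"
    by (intro continuous_on_compose) (auto elim!: continuous_on_subset simp: symm_in_sym_mats)
  then show ?thesis by (simp add: o_def case_prod_unfold)
qed

text \<open>The next expectation of the recursion is meaningful only if the current values are Borel
  in \<open>x\<close>. The coefficients and inverses are continuous in \<open>x\<close>, so the
  integrands are jointly Borel.\<close>

lemma Th_measurable:
  assumes t: "0 \<le> t" "t \<le> T" and h: "h > 0" and \<psi>: "good_slice \<psi> (t + h)"
  shows "(\<lambda>x. Th M W \<mu> \<sigma> F h \<psi> (t, x)) \<in> borel_measurable borel"
proof -
  have \<mu>c: "continuous_on UNIV (\<lambda>x. \<mu> (t, x))" and \<sigma>c: "continuous_on UNIV (\<lambda>x. \<sigma> (t, x))"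
    using t by (auto intro!: continuous_on_compose2[OF \<mu>_cont] continuous_on_compose2[OF \<sigma>_cont] continuous_intros)
  have \<mu>c': "continuous_on UNIV (\<lambda>p. \<mu> (t, fst p))" and \<sigma>c': "continuous_on UNIV (\<lambda>p. \<sigma> (t, fst p))"
    for p :: "(real^'d) \<times> (real^'d)"
    by (auto intro!: continuous_on_compose2[OF \<mu>c] continuous_on_compose2[OF \<sigma>c] continuous_intros)
  have inv: "invertible (\<sigma> (t, x))" for x using t by (intro \<sigma>_invertible) auto
  have \<sigma>i: "continuous_on UNIV (\<lambda>x. matrix_inv (\<sigma> (t, x)))"
    by (intro continuous_on_matrix_inv \<sigma>c inv)
  have \<sigma>it: "continuous_on UNIV (\<lambda>x. matrix_inv (transpose (\<sigma> (t, x))))"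
    by (intro continuous_on_matrix_inv continuous_intros \<sigma>c transpose_invertible inv)
  have \<sigma>i': "continuous_on UNIV (\<lambda>p. matrix_inv (\<sigma> (t, fst p)))" and \<sigma>it': "continuous_on UNIV (\<lambda>p. matrix_inv (transpose (\<sigma> (t, fst p))))"
    for p :: "(real^'d) \<times> (real^'d)"
    by (auto intro!: continuous_on_compose2[OF \<sigma>i] continuous_on_compose2[OF \<sigma>it] continuous_intros)
  have [measurable]: "(\<lambda>x. \<psi> (t + h, x)) \<in> borel_measurable borel" using \<psi> by (simp add: good_slice_def)
  have [measurable]: "(\<lambda>p :: (real^'d) \<times> (real^'d). fst p + h *\<^sub>R \<mu> (t, fst p) + \<sigma> (t, fst p) *v snd p) \<in> borel_measurable borel"
    by (intro borel_measurable_continuous_onI continuous_intros \<mu>c' \<sigma>c')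
  have [measurable]: "(\<lambda>p :: (real^'d) \<times> (real^'d). weight1 (\<sigma> (t, fst p)) h (snd p)) \<in> borel_measurable borel"
    unfolding weight1_def by (intro borel_measurable_continuous_onI continuous_intros \<sigma>it')
  have [measurable]: "(\<lambda>p :: (real^'d) \<times> (real^'d). weight2 (\<sigma> (t, fst p)) h (snd p)) \<in> borel_measurable borel"
    unfolding weight2_outer by (intro borel_measurable_continuous_onI continuous_intros \<sigma>it' \<sigma>i')
  note D = Dh_gauss[OF t h \<psi> refl]
  have u: "(\<lambda>p :: (real^'d) \<times> (real^'d). \<psi> (t + h, fst p + h *\<^sub>R \<mu> (t, fst p) + \<sigma> (t, fst p) *v snd p)) \<in> borel_measurable borel"
    by measurable
  note [measurable] = u
  have [measurable]: "(\<lambda>x. D0h M W \<mu> \<sigma> h \<psi> (t, x)) \<in> borel_measurable borel"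
    unfolding D(3) by (intro borel_measurable_gauss_integral[OF h] u)
  have [measurable]: "(\<lambda>x. D1h M W \<mu> \<sigma> h \<psi> (t, x)) \<in> borel_measurable borel"
    unfolding D(4) by (intro borel_measurable_gauss_integral[OF h]) measurable
  have [measurable]: "(\<lambda>x. D2h M W \<mu> \<sigma> h \<psi> (t, x)) \<in> borel_measurable borel"
    unfolding D(5) by (intro borel_measurable_gauss_integral[OF h]) measurable
  \<comment> \<open>Symmetrisation extends \<open>F\<close> continuously to all matrices; it changes
    nothing at the second discrete derivative, which is symmetric.\<close>
  have [measurable]: "(\<lambda>(x, r, p, \<gamma>). F (t, x) r p (symm \<gamma>)) \<in> borel_measurable borel"
    using t by (intro borel_measurable_continuous_onI Fsym_continuous) auto
  have "(\<lambda>x. (x, D0h M W \<mu> \<sigma> h \<psi> (t, x), D1h M W \<mu> \<sigma> h \<psi> (t, x), D2h M W \<mu> \<sigma> h \<psi> (t, x))) \<in> borel_measurable borel"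
    by (intro borel_measurable_Pair) measurable
  then have "(\<lambda>x. (\<lambda>(x, r, p, \<gamma>). F (t, x) r p (symm \<gamma>)) (x, D0h M W \<mu> \<sigma> h \<psi> (t, x), D1h M W \<mu> \<sigma> h \<psi> (t, x), D2h M W \<mu> \<sigma> h \<psi> (t, x))) \<in> borel_measurable borel"
    by measurable
  then have [measurable]: "(\<lambda>x. F (t, x) (D0h M W \<mu> \<sigma> h \<psi> (t, x)) (D1h M W \<mu> \<sigma> h \<psi> (t, x)) (D2h M W \<mu> \<sigma> h \<psi> (t, x))) \<in> borel_measurable borel"
    by (simp add: symm_id[OF D(6)])
  show ?thesis unfolding Th_def by measurable
qed

lemma grid_bounds:
  assumes n: "n \<ge> 1" and i: "i \<le> n"
  shows "0 \<le> grid T n i" "grid T n i \<le> T"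
proof -
  show "0 \<le> grid T n i" using T by (simp add: grid_def)
  have "real i * (T / real n) \<le> real n * (T / real n)" using i T by (intro mult_right_mono) auto
  then show "grid T n i \<le> T" using n by (simp add: grid_def)
qed

lemma grid_Suc: "grid T n i + T / real n = grid T n (Suc i)"
  by (simp add: grid_def algebra_simps add_divide_distrib)

lemma grid_n: "n \<ge> 1 \<Longrightarrow> grid T n n = T"
  by (simp add: grid_def)

lemma scheme_ge_g:
  assumes n: "n \<ge> 1" and bs: "backward_scheme M W T \<mu> \<sigma> F g n v" and i: "i \<le> n"
  shows "g (grid T n i, x) \<le> v (grid T n i, x)"
proof (cases "i = n")
  case True
  then show ?thesis using bs grid_n[OF n] by (simp add: backward_scheme_def)
next
  case False
  then show ?thesis using bs i by (simp add: backward_scheme_def)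
qed

text \<open>Induction on the number of steps back from the terminal time. Monotonicity compares
  \<open>v\<close> with a constant barrier, and since the value is at least \<open>g\<close> the
  lower bound needs no recursion.\<close>

lemma scheme_good:
  assumes n: "n \<ge> 1" and bs: "backward_scheme M W T \<mu> \<sigma> F g n v" and k: "k \<le> n"
  shows "(\<lambda>x. v (grid T n (n - k), x)) \<in> borel_measurable borel \<and>
    (\<forall>x. v (grid T n (n - k), x) \<le> (1 + T / real n * L) ^ k * (gB + real k * (T / real n) * K))"
  using k
proof (induction k)
  case 0
  have "continuous_on UNIV (\<lambda>x. g (T, x))"
    using T by (auto intro!: continuous_on_compose2[OF g_cont] continuous_intros)
  moreover have "g (T, x) \<le> gB" for x using g_le_gB[of "(T, x)"] T by (auto simp: abs_le_iff)
  ultimately show ?case using bs grid_n[OF n] by (auto simp: backward_scheme_def borel_measurable_continuous_onI)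
next
  case (Suc k)
  define h where "h = T / real n"
  have h: "h > 0" using T n by (simp add: h_def)
  define i where "i = n - Suc k"
  have i: "i < n" "n - k = Suc i" using Suc.prems by (auto simp: i_def)
  define t where "t = grid T n i"
  have t: "0 \<le> t" "t \<le> T" "t + h = grid T n (n - k)"
    using grid_bounds[OF n, of i] i grid_Suc[of n i] by (auto simp: t_def h_def)
  define c where "c = (1 + h * L) ^ k * (gB + real k * h * K)"
  have c: "c \<ge> 0" using h L_nonneg gB_nonneg K_nonneg by (simp add: c_def)
  note IH = Suc.IH[OF Suc_leD[OF Suc.prems], folded h_def, folded t(3) c_def]
  have m: "(\<lambda>x. v (t + h, x)) \<in> borel_measurable borel" and le: "v (t + h, x) \<le> c" for x
    using IH by auto
  have ge: "- gB \<le> v (t + h, x)" for x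
    using scheme_ge_g[OF n bs, of "n - k" x] g_le_gB[of "(t + h, x)"] grid_bounds[OF n, of "n - k"] unfolding t(3) by auto
  have "\<bar>v (t + h, x)\<bar> \<le> gB + c" for x using le[of x] ge[of x] c gB_nonneg by linarith
  then have gs: "good_slice v (t + h)" using m by (auto simp: good_slice_def)
  have gc: "good_slice (\<lambda>_::real\<times>(real^'d). c) (t + h)" by (auto simp: good_slice_def)
  have veq: "v (t, x) = max (Th M W \<mu> \<sigma> F h v (t, x)) (g (t, x))" for x
    using bs i(1) by (simp add: backward_scheme_def t_def h_def)
  have "continuous_on UNIV (\<lambda>x. g (t, x))"
    using t by (auto intro!: continuous_on_compose2[OF g_cont] continuous_intros)
  then have [measurable]: "(\<lambda>x. g (t, x)) \<in> borel_measurable borel" by (rule borel_measurable_continuous_onI)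
  note [measurable] = Th_measurable[OF t(1,2) h gs]
  have "(\<lambda>x. v (t, x)) \<in> borel_measurable borel" unfolding veq by measurable
  moreover have "v (t, x) \<le> (1 + h * L) ^ Suc k * (gB + real (Suc k) * h * K)" for x
  proof -
    have 1: "(1 + h * L) ^ j \<ge> 1" for j using h L_nonneg by (intro one_le_power) simp
    have "Th M W \<mu> \<sigma> F h v (t, x) \<le> c + h * F (t, x) c 0 0"
      using Th_mono[OF t(1,2) h gs gc le] Th_const[OF t(1,2) h] by simp
    also have "\<dots> \<le> c + h * (K + L * c)" using F_const_le[of t c x] t c h by (intro add_left_mono mult_left_mono) auto
    also have "\<dots> = (1 + h * L) * c + h * K" by (simp add: algebra_simps)
    also have "h * K \<le> (1 + h * L) ^ Suc k * (h * K)"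
      using mult_right_mono[OF 1[of "Suc k"], of "h * K"] h K_nonneg by simp
    also have "(1 + h * L) * c + (1 + h * L) ^ Suc k * (h * K) = (1 + h * L) ^ Suc k * (gB + real (Suc k) * h * K)"
      by (simp add: c_def algebra_simps)
    finally have A: "Th M W \<mu> \<sigma> F h v (t, x) \<le> (1 + h * L) ^ Suc k * (gB + real (Suc k) * h * K)" by simp
    \<comment> \<open>The obstacle branch of the maximum: the barrier never falls below
      \<open>gB\<close>.\<close>
    have "g (t, x) \<le> 1 * (gB + 0)" using g_le_gB[of "(t, x)"] t by auto
    also have "\<dots> \<le> (1 + h * L) ^ Suc k * (gB + real (Suc k) * h * K)"
      using 1[of "Suc k"] gB_nonneg K_nonneg h by (intro mult_mono) auto
    finally show ?thesis using A veq by simp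
  qed
  ultimately show ?case by (simp add: t_def h_def i_def)
qed

lemma scheme_bounds:
  assumes n: "n \<ge> 1" and bs: "backward_scheme M W T \<mu> \<sigma> F g n v" and i: "i \<le> n"
  shows "\<bar>v (grid T n i, x)\<bar> \<le> vB" "good_slice v (grid T n i)"
proof -
  define h where "h = T / real n"
  have h: "h > 0" using T n by (simp add: h_def)
  have b: "\<bar>v (grid T n i, x)\<bar> \<le> vB" for x
  proof -
    have "v (grid T n i, x) \<le> (1 + h * L) ^ (n - i) * (gB + real (n - i) * h * K)"
      using scheme_good[OF n bs, of "n - i"] i by (simp add: h_def)
    also have "\<dots> \<le> exp (L * T) * (gB + K * T)"
    proof (rule mult_mono)
      have "(1 + h * L) ^ (n - i) \<le> (1 + h * L) ^ n" using h L_nonneg by (intro power_increasing) auto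
      also have "\<dots> \<le> exp (h * L) ^ n" using h L_nonneg by (intro power_mono) (auto simp: exp_ge_add_one_self)
      also have "\<dots> = exp (L * T)" using n by (simp add: exp_of_nat_mult[symmetric] h_def mult_ac)
      finally show "(1 + h * L) ^ (n - i) \<le> exp (L * T)" .
      have "real (n - i) * h \<le> real n * h" using h by (intro mult_right_mono) auto
      also have "\<dots> = T" using n by (simp add: h_def)
      finally show "gB + real (n - i) * h * K \<le> gB + K * T" using K_nonneg mult_right_mono[of "real (n - i) * h" T K] by (simp add: mult.commute)
    qed (use gB_nonneg K_nonneg h in auto)
    finally have 1: "v (grid T n i, x) \<le> vB" by (simp add: vB_def)
    have "- gB \<le> v (grid T n i, x)"
      using scheme_ge_g[OF n bs i, of x] g_le_gB[of "(grid T n i, x)"] grid_bounds[OF n i] by auto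
    then show ?thesis using 1 gB_le_vB by linarith
  qed
  then show "\<bar>v (grid T n i, x)\<bar> \<le> vB" .
  show "good_slice v (grid T n i)"
    using scheme_good[OF n bs, of "n - i"] i b by (auto simp: good_slice_def)
qed

end

section \<open>Consistency of the scheme\<close>

text \<open>The derivatives are carried as explicit data, so that sums and sign changes of test
  functions need no recomputation of \<open>dt\<close>, \<open>Dx\<close>,
  \<open>Dxx\<close>.\<close>

definition C12 :: "(real \<times> (real^'d) \<Rightarrow> real) \<Rightarrow> (real \<times> (real^'d) \<Rightarrow> real) \<Rightarrow> (real \<times> (real^'d) \<Rightarrow> real^'d) \<Rightarrow>
    (real \<times> (real^'d) \<Rightarrow> real^'d^'d) \<Rightarrow> bool" where
  "C12 \<phi> A p B \<longleftrightarrow> continuous_on UNIV \<phi> \<and> continuous_on UNIV A \<and> continuous_on UNIV p \<and> continuous_on UNIV B \<and>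
    (\<forall>z. transpose (B z) = B z) \<and>
    (\<forall>t x. ((\<lambda>s. \<phi> (s, x)) has_real_derivative A (t, x)) (at t)) \<and>
    (\<forall>t x. ((\<lambda>y. \<phi> (t, y)) has_derivative (\<lambda>\<eta>. p (t, x) \<bullet> \<eta>)) (at x)) \<and>
    (\<forall>t x. ((\<lambda>y. p (t, y)) has_derivative (\<lambda>\<eta>. B (t, x) *v \<eta>)) (at x))"

text \<open>The remainder is uniform over base points near \<open>z0\<close>, as needed for the
  near-touching points, which only approach \<open>z0\<close>.\<close>

lemma C12_taylor:
  fixes \<phi> :: "real \<times> (real^'d) \<Rightarrow> real" and z0 :: "real \<times> (real^'d)"
  assumes C: "C12 \<phi> A p B" and \<epsilon>: "\<epsilon> > 0"
  obtains \<rho> where "\<rho> > 0" "\<And>t x h \<eta>. dist (t, x) z0 < \<rho> \<Longrightarrow> 0 < h \<Longrightarrow> h < \<rho> \<Longrightarrow> norm \<eta> < \<rho> \<Longrightarrow>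
    \<bar>\<phi> (t + h, x + \<eta>) - \<phi> (t, x) - h * A (t, x) - p (t, x) \<bullet> \<eta> - 1 / 2 * (\<eta> \<bullet> (B (t, x) *v \<eta>))\<bar> \<le> \<epsilon> * (h + (norm \<eta>)\<^sup>2)"
proof -
  have cA: "isCont A z0" and cB: "isCont B z0"
    using C by (cases z0, auto simp: C12_def continuous_on_eq_continuous_at)+
  obtain r1 where r1: "r1 > 0" "\<And>z. dist z z0 < r1 \<Longrightarrow> dist (A z) (A z0) < \<epsilon> / 2"
    using cA \<epsilon> unfolding continuous_at_eps_delta by (metis half_gt_zero)
  obtain r2 where r2: "r2 > 0" "\<And>z. dist z z0 < r2 \<Longrightarrow> dist (B z) (B z0) < \<epsilon> / 2"
    using cB \<epsilon> unfolding continuous_at_eps_delta by (metis half_gt_zero)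
  \<comment> \<open>The distance of the base point to \<open>z0\<close>, the time step and the space
    displacement each take one third of the radius.\<close>
  define \<rho> where "\<rho> = min r1 r2 / 3"
  show ?thesis
  proof (rule that[of \<rho>])
    show "\<rho> > 0" using r1 r2 by (simp add: \<rho>_def)
    fix t h :: real and x \<eta> :: "real^'d" assume z: "dist (t, x) z0 < \<rho>" and h: "0 < h" "h < \<rho>" and \<eta>: "norm \<eta> < \<rho>"
    have near: "dist (t + a, x + v) z0 < 3 * \<rho>" if "0 \<le> a" "a \<le> h" "norm v \<le> norm \<eta>" for a v
    proof -
      have "dist (t + a, x + v) (t, x) \<le> \<bar>a\<bar> + norm v"
        unfolding dist_Pair_Pair by (rule sqrt_sum_squares_le_sum[THEN order_trans]) (auto simp: dist_norm)
      then show ?thesis using dist_triangle[of "(t + a, x + v)" z0 "(t, x)"] z that h \<eta> by linarith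
    qed
    have nearA: "\<bar>A (t + a, x + v) - A (t, x)\<bar> \<le> \<epsilon>" if "0 \<le> a" "a \<le> h" "norm v \<le> norm \<eta>" for a v
    proof -
      have "dist (A (t + a, x + v)) (A z0) < \<epsilon> / 2" "dist (A (t, x)) (A z0) < \<epsilon> / 2"
        using r1(2)[of "(t + a, x + v)"] r1(2)[of "(t, x)"] near[OF that] near[of 0 0] h unfolding \<rho>_def by auto
      then show ?thesis using dist_triangle2[of "A (t + a, x + v)" "A (t, x)" "A z0"] by (simp add: dist_real_def)
    qed
    have nearB: "norm (B (t, x + v) - B (t, x)) \<le> \<epsilon>" if "norm v \<le> norm \<eta>" for v
    proof -
      have "dist (B (t, x + v)) (B z0) < \<epsilon> / 2" "dist (B (t, x)) (B z0) < \<epsilon> / 2"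
        using r2(2)[of "(t, x + v)"] r2(2)[of "(t, x)"] near[of 0 v] near[of 0 0] that h unfolding \<rho>_def by auto
      then show ?thesis using dist_triangle2[of "B (t, x + v)" "B (t, x)" "B z0"] by (simp add: dist_norm)
    qed
    \<comment> \<open>The time increment is taken at the displaced point \<open>x + \<eta>\<close>,
      leaving a purely spatial expansion at time \<open>t\<close>.\<close>
    have "\<exists>\<theta>>t. \<theta> < t + h \<and> \<phi> (t + h, x + \<eta>) - \<phi> (t, x + \<eta>) = (t + h - t) * A (\<theta>, x + \<eta>)"
      using C h by (intro MVT2) (auto simp: C12_def)
    then obtain \<theta> where \<theta>: "\<theta> > t" "\<theta> < t + h" "\<phi> (t + h, x + \<eta>) - \<phi> (t, x + \<eta>) = h * A (\<theta>, x + \<eta>)" by auto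
    have "\<bar>A (\<theta>, x + \<eta>) - A (t, x)\<bar> \<le> \<epsilon>" using nearA[of "\<theta> - t" \<eta>] \<theta> by simp
    from mult_left_mono[OF this, of h]
    have 1: "\<bar>\<phi> (t + h, x + \<eta>) - \<phi> (t, x + \<eta>) - h * A (t, x)\<bar> \<le> h * \<epsilon>"
      unfolding \<theta>(3) using h by (simp add: abs_mult right_diff_distrib[symmetric])
    define f where "f = (\<lambda>s::real. \<phi> (t, x + s *\<^sub>R \<eta>))"
    define f1 where "f1 = (\<lambda>s::real. p (t, x + s *\<^sub>R \<eta>) \<bullet> \<eta>)"
    define f2 where "f2 = (\<lambda>s::real. \<eta> \<bullet> (B (t, x + s *\<^sub>R \<eta>) *v \<eta>))"
    have line: "((\<lambda>s. x + s *\<^sub>R \<eta>) has_derivative (\<lambda>a. a *\<^sub>R \<eta>)) (at s)" for s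
      by (auto intro!: derivative_eq_intros)
    have df: "(f has_real_derivative f1 s) (at s)" for s
    proof -
      have "(f has_derivative (\<lambda>a. p (t, x + s *\<^sub>R \<eta>) \<bullet> (a *\<^sub>R \<eta>))) (at s)"
        unfolding f_def by (rule has_derivative_compose[OF line]) (use C in \<open>simp add: C12_def\<close>)
      then show ?thesis by (simp add: has_field_derivative_def f1_def mult_commute_abs)
    qed
    have df1: "(f1 has_real_derivative f2 s) (at s)" for s
    proof -
      have "((\<lambda>s. p (t, x + s *\<^sub>R \<eta>)) has_derivative (\<lambda>a. B (t, x + s *\<^sub>R \<eta>) *v (a *\<^sub>R \<eta>))) (at s)"
        by (rule has_derivative_compose[OF line]) (use C in \<open>simp add: C12_def\<close>)
      from has_derivative_inner_left[OF this, of \<eta>]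
      show ?thesis by (simp add: has_field_derivative_def f1_def f2_def mult_commute_abs matrix_vector_mult_scaleR inner_commute)
    qed
    define diff where "diff = (\<lambda>m::nat. if m = 0 then f else if m = 1 then f1 else f2)"
    \<comment> \<open>Second-order expansion along the segment: the intermediate Hessian is then
      compared with the one at the base point.\<close>
    have "\<exists>s. 0 < s \<and> s < 1 \<and> f 1 = (\<Sum>m<2. diff m 0 / fact m * 1 ^ m) + diff 2 s / fact 2 * 1 ^ 2"
      by (rule Maclaurin) (auto simp: diff_def df df1 less_Suc_eq numeral_2_eq_2)
    then obtain s where s: "0 < s" "s < 1" "f 1 = f 0 + f1 0 + f2 s / 2"
      by (auto simp: diff_def numeral_2_eq_2)
    have "norm (s *\<^sub>R \<eta>) \<le> norm \<eta>" using s mult_right_mono[of s 1 "norm \<eta>"] by simp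
    then have nB: "norm (B (t, x + s *\<^sub>R \<eta>) - B (t, x)) \<le> \<epsilon>" by (rule nearB)
    have "\<bar>f2 s - f2 0\<bar> = \<bar>\<eta> \<bullet> ((B (t, x + s *\<^sub>R \<eta>) - B (t, x)) *v \<eta>)\<bar>"
      by (simp add: f2_def matrix_vector_mult_diff_rdistrib inner_diff_right)
    also have "\<dots> \<le> norm \<eta> * norm ((B (t, x + s *\<^sub>R \<eta>) - B (t, x)) *v \<eta>)" by (rule Cauchy_Schwarz_ineq2)
    also have "\<dots> \<le> norm \<eta> * (\<epsilon> * norm \<eta>)"
      using norm_matrix_vector_mult_le[of "B (t, x + s *\<^sub>R \<eta>) - B (t, x)" \<eta>] mult_right_mono[OF nB, of "norm \<eta>"]
      by (intro mult_left_mono) auto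
    finally have "\<bar>f2 s - f2 0\<bar> \<le> \<epsilon> * (norm \<eta>)\<^sup>2" by (simp add: power2_eq_square mult_ac)
    then have 2: "\<bar>\<phi> (t, x + \<eta>) - \<phi> (t, x) - p (t, x) \<bullet> \<eta> - 1 / 2 * (\<eta> \<bullet> (B (t, x) *v \<eta>))\<bar> \<le> \<epsilon> * (norm \<eta>)\<^sup>2"
      using s(3) \<epsilon> unfolding f_def f1_def f2_def by simp
    show "\<bar>\<phi> (t + h, x + \<eta>) - \<phi> (t, x) - h * A (t, x) - p (t, x) \<bullet> \<eta> - 1 / 2 * (\<eta> \<bullet> (B (t, x) *v \<eta>))\<bar> \<le> \<epsilon> * (h + (norm \<eta>)\<^sup>2)"
      using 1 2 by (simp add: distrib_left mult.commute)
  qed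
qed

section \<open>Gaussian expansions: recovering value, gradient and Hessian\<close>

text \<open>On quadratic polynomials the weights give the gradient and Hessian exactly; only the
  expectation carries the trace correction, which becomes the second-order part of the
  generator.\<close>

lemma gauss_quadratic_moments:
  fixes b :: "real^'d" and S :: "real^'d^'d" and \<alpha> :: real
  assumes h: "h > 0" and S: "transpose S = S"
  defines "P \<equiv> \<lambda>y::real^'d. \<alpha> + b \<bullet> y + 1 / 2 * (y \<bullet> (S *v y))"
  shows "has_bochner_integral (gauss h) P (\<alpha> + h / 2 * trace S)"
    "has_bochner_integral (gauss h) (\<lambda>y. P y * y $ i) (h * b $ i)"
    "has_bochner_integral (gauss h) (\<lambda>y. P y * (y $ i * y $ j - (if i = j then h else 0))) (h\<^sup>2 * S $ i $ j)"
proof -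
  interpret prob_space "gauss h :: (real^'d) measure" by (rule prob_space_gauss[OF h])
  note intros = has_bochner_integral_add has_bochner_integral_diff has_bochner_integral_sum has_bochner_integral_mult_right
    gauss_mom_1[OF h] gauss_mom_2[OF h] gauss_mom_3[OF h] gauss_mom_4[OF h]
  have c: "has_bochner_integral (gauss h) (\<lambda>y::real^'d. \<alpha>) \<alpha>"
    using prob_space by (simp add: has_bochner_integral_iff)
  have Pe: "P y = \<alpha> + (\<Sum>k\<in>UNIV. b $ k * y $ k) + 1 / 2 * (\<Sum>k\<in>UNIV. \<Sum>l\<in>UNIV. S $ k $ l * (y $ k * y $ l))" for y
    unfolding P_def by (simp add: inner_vec_def matrix_vector_mult_def sum_distrib_left mult_ac)
  have "has_bochner_integral (gauss h) P
     (\<alpha> + (\<Sum>k\<in>UNIV. b $ k * 0) + 1 / 2 * (\<Sum>k\<in>UNIV. \<Sum>l\<in>UNIV. S $ k $ l * (if k = l then h else 0)))"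
    unfolding Pe[abs_def] by (intro c intros)
  moreover have "(\<Sum>k\<in>UNIV. \<Sum>l\<in>UNIV. S $ k $ l * (if k = l then h else 0)) = h * trace S"
    by (simp add: trace_def sum_distrib_left if_distrib mult.commute cong: if_cong)
  ultimately show "has_bochner_integral (gauss h) P (\<alpha> + h / 2 * trace S)" by simp
  have "has_bochner_integral (gauss h) (\<lambda>y::real^'d. \<alpha> * y $ i + (\<Sum>k\<in>UNIV. b $ k * (y $ k * y $ i)) +
      1 / 2 * (\<Sum>k\<in>UNIV. \<Sum>l\<in>UNIV. S $ k $ l * (y $ k * y $ l * y $ i)))
     (\<alpha> * 0 + (\<Sum>k\<in>UNIV. b $ k * (if k = i then h else 0)) + 1 / 2 * (\<Sum>k\<in>(UNIV::'d set). \<Sum>l\<in>(UNIV::'d set). S $ k $ l * 0))"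
    by (intro intros)
  moreover have "\<alpha> * y $ i + (\<Sum>k\<in>UNIV. b $ k * (y $ k * y $ i)) + 1 / 2 * (\<Sum>k\<in>UNIV. \<Sum>l\<in>UNIV. S $ k $ l * (y $ k * y $ l * y $ i)) = P y * y $ i" for y :: "real^'d"
    unfolding Pe by (simp add: distrib_right sum_distrib_right mult.assoc)
  moreover have "(\<Sum>k\<in>UNIV. b $ k * (if k = i then h else 0)) = h * b $ i"
    by (simp add: if_distrib mult.commute cong: if_cong)
  ultimately show "has_bochner_integral (gauss h) (\<lambda>y. P y * y $ i) (h * b $ i)" by simp
  define \<delta> where "\<delta> = (if i = j then h else 0)"
  have "has_bochner_integral (gauss h) (\<lambda>y::real^'d. \<alpha> * (y $ i * y $ j) - \<delta> * \<alpha> +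
      (\<Sum>k\<in>UNIV. b $ k * (y $ k * y $ i * y $ j) - (\<delta> * b $ k) * y $ k) +
      1 / 2 * (\<Sum>k\<in>UNIV. \<Sum>l\<in>UNIV. S $ k $ l * (y $ k * y $ l * y $ i * y $ j) - (\<delta> * S $ k $ l) * (y $ k * y $ l)))
     (\<alpha> * (if i = j then h else 0) - \<delta> * \<alpha> + (\<Sum>k\<in>(UNIV::'d set). b $ k * 0 - (\<delta> * b $ k) * 0) +
      1 / 2 * (\<Sum>k\<in>UNIV. \<Sum>l\<in>UNIV. S $ k $ l * (h\<^sup>2 * ((if k = l \<and> i = j then 1 else 0) + (if k = i \<and> l = j then 1 else 0) + (if k = j \<and> l = i then 1 else 0)))
          - (\<delta> * S $ k $ l) * (if k = l then h else 0)))"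
    by (intro intros c)
  moreover have "\<alpha> * (y $ i * y $ j) - \<delta> * \<alpha> +
      (\<Sum>k\<in>UNIV. b $ k * (y $ k * y $ i * y $ j) - (\<delta> * b $ k) * y $ k) +
      1 / 2 * (\<Sum>k\<in>UNIV. \<Sum>l\<in>UNIV. S $ k $ l * (y $ k * y $ l * y $ i * y $ j) - (\<delta> * S $ k $ l) * (y $ k * y $ l)) = P y * (y $ i * y $ j - \<delta>)" for y :: "real^'d"
    unfolding Pe by (simp add: distrib_right sum_distrib_right sum_distrib_left sum_subtractf right_diff_distrib mult.assoc mult.commute[of _ \<delta>] mult.left_commute[of _ \<delta>])
      (simp add: algebra_simps sum_distrib_left)
  \<comment> \<open>Of the three pairings the one matching \<open>i\<close> with \<open>j\<close>
    cancels against the subtracted covariance; the other two give the symmetric entries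
    \<open>S $ i $ j\<close> and \<open>S $ j $ i\<close>.\<close>
  moreover have "(\<Sum>k\<in>UNIV. \<Sum>l\<in>UNIV. S $ k $ l * (h\<^sup>2 * ((if k = l \<and> i = j then 1 else 0) + (if k = i \<and> l = j then 1 else 0) + (if k = j \<and> l = i then 1 else 0)))
          - (\<delta> * S $ k $ l) * (if k = l then h else 0)) = 2 * h\<^sup>2 * S $ i $ j"
  proof -
    have "S $ k $ l * (h\<^sup>2 * ((if k = l \<and> i = j then 1 else 0) + (if k = i \<and> l = j then 1 else 0) + (if k = j \<and> l = i then 1 else 0)))
          - (\<delta> * S $ k $ l) * (if k = l then h else 0) =
        (if k = i then (if l = j then h\<^sup>2 * S $ k $ l else 0) else 0) + (if k = j then (if l = i then h\<^sup>2 * S $ k $ l else 0) else 0)" for k l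
      by (simp add: \<delta>_def power2_eq_square algebra_simps)
    then have "?thesis \<longleftrightarrow> h\<^sup>2 * S $ i $ j + h\<^sup>2 * S $ j $ i = 2 * h\<^sup>2 * S $ i $ j"
      by (simp add: sum.distrib if_distrib[of "\<lambda>x. sum x _"] sum.If_cases if_distribR cong: if_cong)
    moreover have "S $ j $ i = S $ i $ j" using S by (metis (no_types) transpose_def vec_lambda_beta)
    ultimately show ?thesis by simp
  qed
  ultimately show "has_bochner_integral (gauss h) (\<lambda>y. P y * (y $ i * y $ j - (if i = j then h else 0))) (h\<^sup>2 * S $ i $ j)"
    by (simp add: \<delta>_def)
qed

text \<open>The remainder may have a small multiple of \<open>|y|^2 + h\<close> and a possibly large
  multiple of \<open>|y|^4\<close>. Multiplied by a quadratic and integrated at variance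
  \<open>h\<close>, these are of order \<open>\<epsilon> h^2\<close> and \<open>C h^3\<close>, so
  division by \<open>h^2\<close> leaves \<open>\<epsilon> + C h\<close>.\<close>

lemma gauss_expansion:
  obtains N where "N \<ge> 0" "\<And>h \<epsilon> C \<alpha> (b::real^'d) S u Cu. \<lbrakk>0 < h; h \<le> 1; \<epsilon> \<ge> 0; C \<ge> 0; transpose S = S; u \<in> borel_measurable borel; \<And>y. \<bar>u y\<bar> \<le> Cu;
      \<And>y. \<bar>u y - (\<alpha> + b \<bullet> y + 1 / 2 * (y \<bullet> (S *v y)))\<bar> \<le> \<epsilon> * ((norm y)\<^sup>2 + h) + C * norm y ^ 4\<rbrakk> \<Longrightarrow>
      \<bar>(\<integral>y. u y \<partial>gauss h) - \<alpha> - h / 2 * trace S\<bar> \<le> h * (N * (\<epsilon> + C * h)) \<and>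
      norm ((1 / h) *\<^sub>R (\<integral>y. u y *\<^sub>R y \<partial>gauss h) - b) \<le> N * (\<epsilon> + C * h) \<and>
      norm ((1 / h\<^sup>2) *\<^sub>R (\<integral>y. u y *\<^sub>R (outer y - h *\<^sub>R mat 1) \<partial>gauss h) - S) \<le> N * (\<epsilon> + C * h)"
proof -
  obtain N1 where N1: "N1 \<ge> 0" "\<And>h. h > 0 \<Longrightarrow> integrable (gauss h) (\<lambda>y::real^'d. norm y ^ (2 * 1))"
    "\<And>h. h > 0 \<Longrightarrow> (\<integral>y. norm (y::real^'d) ^ (2 * 1) \<partial>gauss h) \<le> N1 * h ^ 1" using gauss_norm_moment[of 1] by metis
  obtain N2 where N2: "N2 \<ge> 0" "\<And>h. h > 0 \<Longrightarrow> integrable (gauss h) (\<lambda>y::real^'d. norm y ^ (2 * 2))"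
    "\<And>h. h > 0 \<Longrightarrow> (\<integral>y. norm (y::real^'d) ^ (2 * 2) \<partial>gauss h) \<le> N2 * h ^ 2" using gauss_norm_moment[of 2] by metis
  obtain N3 where N3: "N3 \<ge> 0" "\<And>h. h > 0 \<Longrightarrow> integrable (gauss h) (\<lambda>y::real^'d. norm y ^ (2 * 3))"
    "\<And>h. h > 0 \<Longrightarrow> (\<integral>y. norm (y::real^'d) ^ (2 * 3) \<partial>gauss h) \<le> N3 * h ^ 3" using gauss_norm_moment[of 3] by metis
  \<comment> \<open>Sum of the moment constants in the integral of \<open>E\<close>:
    \<open>N2 + 2 N1 + 1\<close> goes with \<open>\<epsilon>\<close> and \<open>N3 + N2\<close> with
    \<open>C\<close>.\<close>
  define N0 where "N0 = N2 + 2 * N1 + 1 + N3 + N2"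
  define I where "I = norm (mat 1 :: real^'d^'d)"
  define N where "N = (1 + I) * N0"
  have N0: "N0 \<ge> 0" using N1 N2 N3 by (simp add: N0_def)
  have I: "I \<ge> 0" by (simp add: I_def)
  have N0N: "N0 \<le> N" using N0 I by (simp add: N_def distrib_right)
  show ?thesis
  proof (rule that[of N])
    show "N \<ge> 0" using N0 I by (simp add: N_def)
    fix h \<epsilon> C \<alpha> Cu :: real and b :: "real^'d" and S :: "real^'d^'d" and u :: "real^'d \<Rightarrow> real"
    assume h: "0 < h" "h \<le> 1" and \<epsilon>: "\<epsilon> \<ge> 0" and C: "C \<ge> 0" and S: "transpose S = S"
      and u[measurable]: "u \<in> borel_measurable borel" and ub: "\<And>y. \<bar>u y\<bar> \<le> Cu"
      and rem: "\<And>y. \<bar>u y - (\<alpha> + b \<bullet> y + 1 / 2 * (y \<bullet> (S *v y)))\<bar> \<le> \<epsilon> * ((norm y)\<^sup>2 + h) + C * norm y ^ 4"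
    interpret prob_space "gauss h :: (real^'d) measure" by (rule prob_space_gauss[OF h(1)])
    have [measurable]: "outer \<in> borel_measurable (borel :: (real^'d) measure)"
      by (rule borel_measurable_continuous_onI[OF continuous_on_outer])
    define P where "P = (\<lambda>y. \<alpha> + b \<bullet> y + 1 / 2 * (y \<bullet> (S *v y)))"
    have Pm: "has_bochner_integral (gauss h) P (\<alpha> + h / 2 * trace S)"
      "has_bochner_integral (gauss h) (\<lambda>y. P y * y $ i) (h * b $ i)"
      "has_bochner_integral (gauss h) (\<lambda>y. P y * (y $ i * y $ j - (if i = j then h else 0))) (h\<^sup>2 * S $ i $ j)" for i j
      unfolding P_def by (rule gauss_quadratic_moments[OF h(1) S])+
    have [measurable]: "P \<in> borel_measurable borel" unfolding P_def by measurable
    define R where "R = (\<lambda>y. u y - P y)"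
    have [measurable]: "R \<in> borel_measurable borel" unfolding R_def by measurable
    have Cu: "Cu \<ge> 0" using ub[of 0] by linarith
    \<comment> \<open>One majorant serves all three estimates: the remainder alone and the remainder
      times \<open>y\<close> are bounded by \<open>E / h\<close>, the remainder times the second
      weight by a multiple of \<open>E\<close>.\<close>
    define E where "E = (\<lambda>y::real^'d. (\<epsilon> * ((norm y)\<^sup>2 + h) + C * norm y ^ 4) * ((norm y)\<^sup>2 + h))"
    have E_eq: "E y = \<epsilon> * norm y ^ (2 * 2) + 2 * \<epsilon> * h * norm y ^ (2 * 1) + \<epsilon> * h\<^sup>2 + C * norm y ^ (2 * 3) + C * h * norm y ^ (2 * 2)" for y
      unfolding E_def by (simp add: algebra_simps power2_eq_square eval_nat_numeral)
    have E_int: "integrable (gauss h) E"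
      unfolding E_eq[abs_def] using N1(2)[OF h(1)] N2(2)[OF h(1)] N3(2)[OF h(1)] by auto
    have E_le: "(\<integral>y. E y \<partial>gauss h) \<le> h\<^sup>2 * (N0 * (\<epsilon> + C * h))"
    proof -
      have "(\<integral>y. E y \<partial>gauss h) = \<epsilon> * (\<integral>y. norm (y::real^'d) ^ (2 * 2) \<partial>gauss h) + 2 * \<epsilon> * h * (\<integral>y. norm (y::real^'d) ^ (2 * 1) \<partial>gauss h) + \<epsilon> * h\<^sup>2
          + C * (\<integral>y. norm (y::real^'d) ^ (2 * 3) \<partial>gauss h) + C * h * (\<integral>y. norm (y::real^'d) ^ (2 * 2) \<partial>gauss h)"
        unfolding E_eq using N1(2)[OF h(1)] N2(2)[OF h(1)] N3(2)[OF h(1)] prob_space by simp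
      also have "\<dots> \<le> \<epsilon> * (N2 * h ^ 2) + 2 * \<epsilon> * h * (N1 * h ^ 1) + \<epsilon> * h\<^sup>2 + C * (N3 * h ^ 3) + C * h * (N2 * h ^ 2)"
        using \<epsilon> C h by (intro add_mono mult_left_mono N1(3) N2(3) N3(3)) auto
      also have "\<dots> = h\<^sup>2 * (\<epsilon> * (N2 + 2 * N1 + 1) + C * h * (N3 + N2))" by (simp add: algebra_simps power2_eq_square power3_eq_cube)
      also have "\<dots> \<le> h\<^sup>2 * (\<epsilon> * N0 + C * h * N0)"
        using \<epsilon> C h N1(1) N2(1) N3(1) by (intro mult_left_mono add_mono) (auto simp: N0_def)
      also have "\<dots> = h\<^sup>2 * (N0 * (\<epsilon> + C * h))" by (simp add: algebra_simps)
      finally show ?thesis .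
    qed
    have RE: "\<bar>R y\<bar> * ((norm y)\<^sup>2 + h) \<le> E y" for y
      unfolding E_def R_def P_def using rem[of y] h by (intro mult_right_mono) auto
    have R1: "\<bar>R y\<bar> \<le> (1 / h) * E y" for y
    proof -
      have "\<bar>R y\<bar> * h \<le> \<bar>R y\<bar> * ((norm y)\<^sup>2 + h)" by (intro mult_left_mono) auto
      then have "\<bar>R y\<bar> * h \<le> E y" using RE[of y] by linarith
      then show ?thesis using h by (simp add: field_simps)
    qed
    have R2: "\<bar>R y\<bar> * norm y \<le> (1 / h) * E y" for y
    proof -
      \<comment> \<open>This is where \<open>h \<le> 1\<close> is used: compare with
        \<open>h\<close> when \<open>norm y\<close> is at most one, otherwise with the square of
        \<open>norm y\<close>.\<close>
      have "norm y * h \<le> (norm y)\<^sup>2 + h"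
      proof (cases "norm y \<le> 1")
        case True
        then have "norm y * h \<le> 1 * h" using h by (intro mult_right_mono) auto
        then show ?thesis using zero_le_power2[of "norm y"] by linarith
      next
        case False
        then have "norm y * h \<le> norm y * norm y" using h by (intro mult_left_mono) auto
        then show ?thesis using h by (simp add: power2_eq_square)
      qed
      then have "\<bar>R y\<bar> * (norm y * h) \<le> \<bar>R y\<bar> * ((norm y)\<^sup>2 + h)" by (rule mult_left_mono) simp
      then have "\<bar>R y\<bar> * norm y * h \<le> E y" using RE[of y] by (simp add: mult.assoc)
      then show ?thesis using h by (simp add: field_simps)
    qed
    have R3: "\<bar>R y\<bar> * norm (outer y - h *\<^sub>R mat 1) \<le> (1 + I) * E y" for y
    proof -
      have "norm (outer y - h *\<^sub>R mat 1) \<le> (norm y)\<^sup>2 + h * I"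
        using norm_triangle_ineq4[of "outer y" "h *\<^sub>R mat 1"] h by (simp add: norm_outer I_def)
      also have "\<dots> \<le> (1 + I) * ((norm y)\<^sup>2 + h)" using I h by (simp add: algebra_simps)
      finally have "\<bar>R y\<bar> * norm (outer y - h *\<^sub>R mat 1) \<le> \<bar>R y\<bar> * ((1 + I) * ((norm y)\<^sup>2 + h))" by (rule mult_left_mono) simp
      also have "\<dots> = (1 + I) * (\<bar>R y\<bar> * ((norm y)\<^sup>2 + h))" by simp
      also have "\<dots> \<le> (1 + I) * E y" using I by (intro mult_left_mono RE) auto
      finally show ?thesis .
    qed
    have iu: "integrable (gauss h) u"
    proof (rule gauss_integrable_bound[OF h(1) u])
      fix y :: "real^'d"
      have "Cu * 1 \<le> Cu * (1 + norm y ^ 6)" using Cu by (intro mult_left_mono) auto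
      then show "norm (u y) \<le> Cu * (1 + norm y ^ 6)" using ub[of y] by simp
    qed
    have iuy: "integrable (gauss h) (\<lambda>y. u y *\<^sub>R y)"
    proof (rule gauss_integrable_bound[OF h(1)])
      fix y :: "real^'d"
      show "norm (u y *\<^sub>R y) \<le> Cu * (1 + norm y ^ 6)"
        unfolding norm_scaleR real_norm_def using ub[of y] norm_power_le_poly[of 1 y] Cu by (intro mult_mono) auto
    qed measurable
    have iuo: "integrable (gauss h) (\<lambda>y. u y *\<^sub>R (outer y - h *\<^sub>R mat 1))"
    proof (rule gauss_integrable_bound[OF h(1)])
      fix y :: "real^'d"
      have "norm (outer y - h *\<^sub>R mat 1) \<le> (norm y)\<^sup>2 + h * I"
        using norm_triangle_ineq4[of "outer y" "h *\<^sub>R mat 1"] h by (simp add: norm_outer I_def)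
      also have "\<dots> \<le> (1 + norm y ^ 6) + 1 * I" using norm_power_le_poly[of 2 y] h I by (intro add_mono mult_right_mono) auto
      also have "\<dots> \<le> (1 + I) * (1 + norm y ^ 6)" using I by (simp add: algebra_simps)
      finally have "norm (u y *\<^sub>R (outer y - h *\<^sub>R mat 1)) \<le> Cu * ((1 + I) * (1 + norm y ^ 6))"
        unfolding norm_scaleR real_norm_def using ub[of y] Cu by (intro mult_mono) auto
      then show "norm (u y *\<^sub>R (outer y - h *\<^sub>R mat 1)) \<le> (Cu * (1 + I)) * (1 + norm y ^ 6)" by (simp add: mult.assoc)
    qed measurable
    have dominated: "integrable (gauss h) f" if [measurable]: "f \<in> borel_measurable borel" and "\<And>y. norm (f y) \<le> c * E y"
      for f :: "real^'d \<Rightarrow> 'z::{banach, second_countable_topology}" and c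
    proof (rule Bochner_Integration.integrable_bound)
      show "integrable (gauss h) (\<lambda>y. c * E y)" using E_int by simp
      show "AE y in gauss h. norm (f y) \<le> norm (c * E y)"
        using that(2) by (intro AE_I2) (metis abs_ge_self order_trans real_norm_def)
    qed measurable
    have bnd: "norm (\<integral>y. f y \<partial>gauss h) \<le> c * (h\<^sup>2 * (N0 * (\<epsilon> + C * h)))"
      if "\<And>y. norm (f y) \<le> c * E y" "c \<ge> 0" for f :: "real^'d \<Rightarrow> 'z::{banach, second_countable_topology}" and c
    proof -
      have "norm (\<integral>y. f y \<partial>gauss h) \<le> (\<integral>y. norm (f y) \<partial>gauss h)" by (rule integral_norm_bound)
      also have "\<dots> \<le> (\<integral>y. c * E y \<partial>gauss h)"
        using E_int order_trans[OF norm_ge_zero that(1)] by (intro integral_mono' that(1)) auto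
      also have "\<dots> \<le> c * (h\<^sup>2 * (N0 * (\<epsilon> + C * h)))" using E_le that by (simp add: mult_left_mono)
      finally show ?thesis .
    qed
    have iP: "integrable (gauss h) P" and eP: "(\<integral>y. P y \<partial>gauss h) = \<alpha> + h / 2 * trace S"
      using Pm(1) by (auto simp: has_bochner_integral_iff)
    have "\<bar>\<integral>y. R y \<partial>gauss h\<bar> \<le> (1 / h) * (h\<^sup>2 * (N0 * (\<epsilon> + C * h)))"
      using bnd[of R "1 / h"] R1 h by simp
    also have "\<dots> = h * (N0 * (\<epsilon> + C * h))" using h by (simp add: power2_eq_square)
    also have "\<dots> \<le> h * (N * (\<epsilon> + C * h))" using h \<epsilon> C N0N by (intro mult_left_mono mult_right_mono) auto
    finally have 1: "\<bar>(\<integral>y. u y \<partial>gauss h) - \<alpha> - h / 2 * trace S\<bar> \<le> h * (N * (\<epsilon> + C * h))"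
      using iu iP eP by (simp add: R_def)
    have iPy: "integrable (gauss h) (\<lambda>y. P y *\<^sub>R y)" and ePy: "(\<integral>y. P y *\<^sub>R y \<partial>gauss h) = h *\<^sub>R b"
    proof -
      have "integrable (gauss h) (\<lambda>y. u y *\<^sub>R y - R y *\<^sub>R y)"
        using R2 h by (intro Bochner_Integration.integrable_diff iuy dominated[of _ "1 / h"]) auto
      then show i: "integrable (gauss h) (\<lambda>y. P y *\<^sub>R y)" by (simp add: R_def scaleR_diff_left)
      show "(\<integral>y. P y *\<^sub>R y \<partial>gauss h) = h *\<^sub>R b"
        using Pm(2) by (simp add: vec_eq_iff integral_vec_nth[OF i] has_bochner_integral_iff)
    qed
    have "norm (\<integral>y. R y *\<^sub>R y \<partial>gauss h) \<le> (1 / h) * (h\<^sup>2 * (N0 * (\<epsilon> + C * h)))"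
      using bnd[of "\<lambda>y. R y *\<^sub>R y" "1 / h"] R2 h by simp
    also have "\<dots> = h * (N0 * (\<epsilon> + C * h))" using h by (simp add: power2_eq_square)
    also have "\<dots> \<le> h * (N * (\<epsilon> + C * h))" using h \<epsilon> C N0N by (intro mult_left_mono mult_right_mono) auto
    finally have "norm ((\<integral>y. u y *\<^sub>R y \<partial>gauss h) - h *\<^sub>R b) \<le> h * (N * (\<epsilon> + C * h))"
      using iuy iPy ePy by (simp add: R_def scaleR_diff_left)
    moreover have "(1 / h) *\<^sub>R (\<integral>y. u y *\<^sub>R y \<partial>gauss h) - b = (1 / h) *\<^sub>R ((\<integral>y. u y *\<^sub>R y \<partial>gauss h) - h *\<^sub>R b)"
      using h by (simp add: scaleR_diff_right)
    ultimately have 2: "norm ((1 / h) *\<^sub>R (\<integral>y. u y *\<^sub>R y \<partial>gauss h) - b) \<le> N * (\<epsilon> + C * h)"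
      using h by (simp add: divide_le_eq mult.commute)
    define Q where "Q = (\<lambda>y::real^'d. outer y - h *\<^sub>R mat 1)"
    have Qij: "Q y $ i $ j = y $ i * y $ j - (if i = j then h else 0)" for y i j
      by (simp add: Q_def outer_def mat_def)
    have [measurable]: "Q \<in> borel_measurable borel" unfolding Q_def by measurable
    have iuQ: "integrable (gauss h) (\<lambda>y. u y *\<^sub>R Q y)" using iuo by (simp add: Q_def)
    have iPo: "integrable (gauss h) (\<lambda>y. P y *\<^sub>R Q y)" and ePo: "(\<integral>y. P y *\<^sub>R Q y \<partial>gauss h) = h\<^sup>2 *\<^sub>R S"
    proof -
      have "integrable (gauss h) (\<lambda>y. u y *\<^sub>R Q y - R y *\<^sub>R Q y)"
        using R3 I by (intro Bochner_Integration.integrable_diff iuQ dominated[of _ "1 + I"]) (auto simp: Q_def)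
      then show i: "integrable (gauss h) (\<lambda>y. P y *\<^sub>R Q y)" by (simp add: R_def scaleR_diff_left)
      have "(\<integral>y. P y *\<^sub>R Q y \<partial>gauss h) $ i $ j = h\<^sup>2 * S $ i $ j" for i j
      proof -
        have "integrable (gauss h) (\<lambda>y. (P y *\<^sub>R Q y) $ i)"
          by (rule integrable_bounded_linear[OF bounded_linear_vec_nth i])
        then have "(\<integral>y. P y *\<^sub>R Q y \<partial>gauss h) $ i $ j = (\<integral>y. (P y *\<^sub>R Q y) $ i $ j \<partial>gauss h)"
          by (simp only: integral_vec_nth[OF i] integral_vec_nth)
        also have "\<dots> = h\<^sup>2 * S $ i $ j" using Pm(3)[of i j] by (simp add: has_bochner_integral_iff Qij)
        finally show ?thesis .
      qed
      then show "(\<integral>y. P y *\<^sub>R Q y \<partial>gauss h) = h\<^sup>2 *\<^sub>R S" by (simp add: vec_eq_iff)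
    qed
    have "norm (\<integral>y. R y *\<^sub>R Q y \<partial>gauss h) \<le> (1 + I) * (h\<^sup>2 * (N0 * (\<epsilon> + C * h)))"
      using bnd[of "\<lambda>y. R y *\<^sub>R Q y" "1 + I"] R3 I by (simp add: Q_def)
    also have "\<dots> = h\<^sup>2 * (N * (\<epsilon> + C * h))" by (simp add: N_def)
    finally have "norm ((\<integral>y. u y *\<^sub>R Q y \<partial>gauss h) - h\<^sup>2 *\<^sub>R S) \<le> h\<^sup>2 * (N * (\<epsilon> + C * h))"
      using iuo iPo ePo by (simp add: R_def scaleR_diff_left Q_def)
    moreover have "(1 / h\<^sup>2) *\<^sub>R (\<integral>y. u y *\<^sub>R Q y \<partial>gauss h) - S = (1 / h\<^sup>2) *\<^sub>R ((\<integral>y. u y *\<^sub>R Q y \<partial>gauss h) - h\<^sup>2 *\<^sub>R S)"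
      using h by (simp add: scaleR_diff_right)
    ultimately have 3: "norm ((1 / h\<^sup>2) *\<^sub>R (\<integral>y. u y *\<^sub>R Q y \<partial>gauss h) - S) \<le> N * (\<epsilon> + C * h)"
      using h by (simp add: divide_le_eq mult.commute)
    show "\<bar>(\<integral>y. u y \<partial>gauss h) - \<alpha> - h / 2 * trace S\<bar> \<le> h * (N * (\<epsilon> + C * h)) \<and>
      norm ((1 / h) *\<^sub>R (\<integral>y. u y *\<^sub>R y \<partial>gauss h) - b) \<le> N * (\<epsilon> + C * h) \<and>
      norm ((1 / h\<^sup>2) *\<^sub>R (\<integral>y. u y *\<^sub>R (outer y - h *\<^sub>R mat 1) \<partial>gauss h) - S) \<le> N * (\<epsilon> + C * h)"
      using 1 2 3 by (simp add: Q_def)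
  qed
qed

lemma continuous_on_local_bound:
  assumes "continuous_on S f" "z0 \<in> S"
  shows "\<exists>r>0. \<forall>z\<in>S. dist z z0 < r \<longrightarrow> norm (f z) \<le> norm (f z0) + 1"
proof -
  obtain r where r: "r > 0" "\<And>z. z \<in> S \<Longrightarrow> dist z z0 < r \<Longrightarrow> dist (f z) (f z0) < 1"
    using assms unfolding continuous_on_iff by (meson zero_less_one)
  show ?thesis
  proof (intro exI[of _ r] conjI ballI impI r(1))
    fix z assume "z \<in> S" "dist z z0 < r"
    then have "norm (f z - f z0) < 1" using r(2) by (simp add: dist_norm)
    then show "norm (f z) \<le> norm (f z0) + 1" using norm_triangle_sub[of "f z" "f z0"] by linarith
  qed
qed

lemma transpose_vec_inner: "(transpose s *v p) \<bullet> y = p \<bullet> (s *v y)" for s :: "real^'d^'d"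
  by (metis dot_lmul_matrix transpose_matrix_vector)

lemma conj_quadratic: "y \<bullet> ((transpose s ** B ** s) *v y) = (s *v y) \<bullet> (B *v (s *v y))" for s :: "real^'d^'d"
  by (metis inner_commute matrix_vector_mul_assoc transpose_vec_inner)

lemma trace_conj: "trace (transpose s ** B ** s) = (s ** transpose s) \<bullet> B" for s B :: "real^'d^'d"
proof -
  have "trace (transpose s ** B ** s) = trace (s ** (transpose s ** B))" by (rule trace_mul_sym)
  also have "\<dots> = (s ** transpose s) \<bullet> B"
    by (simp add: inner_matrix_eq_trace matrix_transpose_mul matrix_mul_assoc transpose_transpose)
  finally show ?thesis .
qed

lemma transpose_conj: "transpose B = B \<Longrightarrow> transpose (transpose s ** B ** s) = transpose s ** B ** s" for s B :: "real^'d^'d"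
  by (simp add: matrix_transpose_mul transpose_transpose matrix_mul_assoc)

text \<open>The constant \<open>C\<close> may depend on \<open>\<epsilon>\<close>, because it
  multiplies a null sequence.\<close>

lemma tendsto_zero_if_bounds:
  fixes e :: "nat \<Rightarrow> 'a::real_normed_vector" and h :: "nat \<Rightarrow> real"
  assumes N: "N \<ge> 0" and h: "h \<longlonglongrightarrow> 0"
    and b: "\<And>\<epsilon>. \<epsilon> > 0 \<Longrightarrow> \<exists>C. \<forall>\<^sub>F k in sequentially. norm (e k) \<le> N * (\<epsilon> + C * h k)"
  shows "e \<longlonglongrightarrow> 0"
proof (rule tendstoI)
  fix \<eta> :: real assume \<eta>: "\<eta> > 0"
  define \<epsilon> where "\<epsilon> = \<eta> / (2 * (N + 1))"
  have \<epsilon>: "\<epsilon> > 0" using \<eta> N by (simp add: \<epsilon>_def)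
  have N\<epsilon>: "N * \<epsilon> \<le> \<eta> / 2" using \<eta> N by (simp add: \<epsilon>_def field_simps)
  obtain C where C: "\<forall>\<^sub>F k in sequentially. norm (e k) \<le> N * (\<epsilon> + C * h k)" using b[OF \<epsilon>] by blast
  have "(\<lambda>k. N * C * h k) \<longlonglongrightarrow> N * C * 0" by (intro tendsto_intros h)
  then have "\<forall>\<^sub>F k in sequentially. dist (N * C * h k) 0 < \<eta> / 2" using \<eta> by (intro tendstoD) auto
  then show "\<forall>\<^sub>F k in sequentially. dist (e k) 0 < \<eta>" using C
  proof eventually_elim
    case (elim k)
    then show ?case using N\<epsilon> by (simp add: distrib_left mult.assoc abs_less_iff)
  qed
qed

context obstacle_scheme
begin

text \<open>\<open>\<psi>\<close> equals the smooth function only near \<open>z0\<close> and is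
  merely bounded elsewhere. For small Gaussian variable Taylor's formula applies; for large ones
  everything is dominated by a multiple of the fourth power.\<close>

lemma scheme_expansion:
  fixes \<phi> \<psi> :: "real \<times> (real^'d) \<Rightarrow> real"
  assumes C: "C12 \<phi> A p B" and z0: "z0 \<in> cylinder T" and r0: "r0 > 0"
    and \<psi>: "\<And>z. z \<in> cylinder T \<Longrightarrow> dist z z0 < r0 \<Longrightarrow> \<psi> z = \<phi> z"
    and \<psi>b: "\<And>z. z \<in> cylinder T \<Longrightarrow> \<bar>\<psi> z\<bar> \<le> M\<psi>" and \<epsilon>: "\<epsilon> > 0"
  obtains r C where "r > 0" "C \<ge> 0"
    "\<And>t x h y. dist (t, x) z0 < r \<Longrightarrow> 0 \<le> t \<Longrightarrow> 0 < h \<Longrightarrow> h < r \<Longrightarrow> t + h \<le> T \<Longrightarrow>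
      \<bar>\<psi> (t + h, x + h *\<^sub>R \<mu> (t, x) + \<sigma> (t, x) *v y) - ((\<phi> (t, x) + h * (A (t, x) + p (t, x) \<bullet> \<mu> (t, x))) +
        (transpose (\<sigma> (t, x)) *v p (t, x)) \<bullet> y + 1 / 2 * (y \<bullet> ((transpose (\<sigma> (t, x)) ** B (t, x) ** \<sigma> (t, x)) *v y)))\<bar>
      \<le> \<epsilon> * ((norm y)\<^sup>2 + h) + C * norm y ^ 4"
proof -
  have cont: "continuous_on (cylinder T) \<phi>" "continuous_on (cylinder T) A" "continuous_on (cylinder T) p" "continuous_on (cylinder T) B"
    using C by (auto simp: C12_def intro: continuous_on_subset)
  note lb = continuous_on_local_bound[OF _ z0]
  obtain r1 where r1: "r1 > 0" "\<And>z. z \<in> cylinder T \<Longrightarrow> dist z z0 < r1 \<Longrightarrow> norm (\<phi> z) \<le> norm (\<phi> z0) + 1" using lb[OF cont(1)] by blast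
  obtain r2 where r2: "r2 > 0" "\<And>z. z \<in> cylinder T \<Longrightarrow> dist z z0 < r2 \<Longrightarrow> norm (A z) \<le> norm (A z0) + 1" using lb[OF cont(2)] by blast
  obtain r3 where r3: "r3 > 0" "\<And>z. z \<in> cylinder T \<Longrightarrow> dist z z0 < r3 \<Longrightarrow> norm (p z) \<le> norm (p z0) + 1" using lb[OF cont(3)] by blast
  obtain r4 where r4: "r4 > 0" "\<And>z. z \<in> cylinder T \<Longrightarrow> dist z z0 < r4 \<Longrightarrow> norm (B z) \<le> norm (B z0) + 1" using lb[OF cont(4)] by blast
  obtain r5 where r5: "r5 > 0" "\<And>z. z \<in> cylinder T \<Longrightarrow> dist z z0 < r5 \<Longrightarrow> norm (\<mu> z) \<le> norm (\<mu> z0) + 1" using lb[OF \<mu>_cont] by blast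
  obtain r6 where r6: "r6 > 0" "\<And>z. z \<in> cylinder T \<Longrightarrow> dist z z0 < r6 \<Longrightarrow> norm (\<sigma> z) \<le> norm (\<sigma> z0) + 1" using lb[OF \<sigma>_cont] by blast
  define Q where "Q = norm (\<phi> z0) + norm (A z0) + norm (p z0) + norm (B z0) + norm (\<mu> z0) + norm (\<sigma> z0) + 1"
  have Q1: "Q \<ge> 1" by (simp add: Q_def)
  \<comment> \<open>The displacement satisfies
    \<open>h + |\<eta>|^2 \<le> (1 + 2 Q^2)(|y|^2 + h)\<close>, so the Taylor error takes half of
    \<open>\<epsilon>\<close>.\<close>
  define \<epsilon>t where "\<epsilon>t = \<epsilon> / (2 * (1 + 2 * Q\<^sup>2))"
  have den: "1 + 2 * Q\<^sup>2 > 0" by (simp add: add_pos_nonneg)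
  have "\<epsilon> / (2 * a) * a = \<epsilon> / 2" if "a > 0" for a using that by simp
  from this[OF den] have \<epsilon>t: "\<epsilon>t > 0" "\<epsilon>t * (1 + 2 * Q\<^sup>2) = \<epsilon> / 2" using \<epsilon> den by (auto simp: \<epsilon>t_def)
  obtain \<rho>1 where \<rho>1: "\<rho>1 > 0" "\<And>t x h \<eta>. dist (t, x) z0 < \<rho>1 \<Longrightarrow> 0 < h \<Longrightarrow> h < \<rho>1 \<Longrightarrow> norm \<eta> < \<rho>1 \<Longrightarrow>
    \<bar>\<phi> (t + h, x + \<eta>) - \<phi> (t, x) - h * A (t, x) - p (t, x) \<bullet> \<eta> - 1 / 2 * (\<eta> \<bullet> (B (t, x) *v \<eta>))\<bar> \<le> \<epsilon>t * (h + (norm \<eta>)\<^sup>2)"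
    using C12_taylor[OF C \<epsilon>t(1), of z0] by metis
  define \<rho> where "\<rho> = min \<rho>1 (r0 / 2)"
  have \<rho>: "\<rho> > 0" "\<rho> \<le> \<rho>1" "\<rho> \<le> r0 / 2" using \<rho>1(1) r0 by (auto simp: \<rho>_def)
  \<comment> \<open>Coefficient of \<open>h^2\<close> in the error caused by the drift inside the
    quadratic form; the last entry of \<open>r\<close> below makes
    \<open>H h \<le> \<epsilon>/2\<close>.\<close>
  define H where "H = Q ^ 3 / 2 + Q ^ 6 / \<epsilon>"
  have H: "H > 0" unfolding H_def using Q1 \<epsilon> by (intro add_pos_pos divide_pos_pos zero_less_power) auto
  define r where "r = Min {r1, r2, r3, r4, r5, r6, \<rho>1, 1, \<rho> / (2 * Q), r0 / 4, \<epsilon> / (2 * H)}"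
  have r: "r > 0" using r1(1) r2(1) r3(1) r4(1) r5(1) r6(1) \<rho>1(1) \<rho>(1) Q1 r0 \<epsilon> H
    unfolding r_def by (subst Min_gr_iff) auto
  have rle: "r \<le> r1" "r \<le> r2" "r \<le> r3" "r \<le> r4" "r \<le> r5" "r \<le> r6" "r \<le> \<rho>1" "r \<le> 1" "r \<le> \<rho> / (2 * Q)" "r \<le> r0 / 4" "r \<le> \<epsilon> / (2 * H)"
    unfolding r_def by (rule Min_le; simp)+
  \<comment> \<open>Below this threshold the displacement, at most \<open>Q (h + |y|)\<close>, stays
    under \<open>\<rho>\<close>; the bound by 1 makes powers of \<open>\<delta>\<close>
    comparable.\<close>
  define \<delta> where "\<delta> = min 1 (\<rho> / (2 * Q))"
  have \<delta>: "\<delta> > 0" "\<delta> \<le> 1" "\<delta> \<le> \<rho> / (2 * Q)" using \<rho> Q1 by (auto simp: \<delta>_def)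
  have M\<psi>: "M\<psi> \<ge> 0" using \<psi>b[OF z0] by linarith
  \<comment> \<open>Beyond the threshold every power of \<open>norm y\<close> up to the fourth is at
    most \<open>norm y ^ 4 / \<delta> ^ 4\<close>. The constant 5 collects \<open>3 Q^3\<close> from
    the constant part and one \<open>Q^3\<close> each from the linear and quadratic parts.\<close>
  define D where "D = (M\<psi> + 5 * Q ^ 3) / \<delta> ^ 4"
  have D: "D \<ge> 0" using M\<psi> Q1 \<delta> by (simp add: D_def)
  show ?thesis
  proof (rule that[OF r D])
    fix t h :: real and x y :: "real^'d"
    assume z: "dist (t, x) z0 < r" and t: "0 \<le> t" and h: "0 < h" "h < r" and th: "t + h \<le> T"
    have zc: "(t, x) \<in> cylinder T" using t h th by auto
    define m where "m = \<mu> (t, x)"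
    define s where "s = \<sigma> (t, x)"
    define P0 where "P0 = p (t, x)"
    define B0 where "B0 = B (t, x)"
    have b: "\<bar>\<phi> (t, x)\<bar> \<le> Q" "\<bar>A (t, x)\<bar> \<le> Q" "norm P0 \<le> Q" "norm B0 \<le> Q" "norm m \<le> Q" "norm s \<le> Q"
      using r1(2)[OF zc] r2(2)[OF zc] r3(2)[OF zc] r4(2)[OF zc] r5(2)[OF zc] r6(2)[OF zc] z rle
      unfolding P0_def B0_def m_def s_def Q_def
      by (auto intro!: order_trans[OF r1(2)[OF zc, unfolded real_norm_def]] order_trans[OF r2(2)[OF zc, unfolded real_norm_def]]
        order_trans[OF r3(2)[OF zc]] order_trans[OF r4(2)[OF zc]] order_trans[OF r5(2)[OF zc]] order_trans[OF r6(2)[OF zc]])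
    have h1: "h \<le> 1" using h rle by simp
    define w where "w = s *v y"
    have w: "norm w \<le> Q * norm y"
      unfolding w_def using norm_matrix_vector_mult_le[of s y] mult_right_mono[OF b(6), of "norm y"] by simp
    define \<eta> where "\<eta> = h *\<^sub>R m + w"
    have \<eta>: "norm \<eta> \<le> Q * (h + norm y)"
    proof -
      have "norm \<eta> \<le> h * norm m + norm w" unfolding \<eta>_def using norm_triangle_ineq[of "h *\<^sub>R m" w] h by simp
      also have "\<dots> \<le> h * Q + Q * norm y" using b(5) w h by (intro add_mono mult_left_mono) auto
      finally show ?thesis by (simp add: algebra_simps)
    qed
    have Bsym: "u \<bullet> (B0 *v v) = v \<bullet> (B0 *v u)" for u v
      using inner_sym_matrix[of B0 u v] C by (simp add: C12_def B0_def inner_commute)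
    have Bn: "\<bar>u \<bullet> (B0 *v v)\<bar> \<le> Q * norm u * norm v" for u v
    proof -
      have "\<bar>u \<bullet> (B0 *v v)\<bar> \<le> norm u * norm (B0 *v v)" by (rule Cauchy_Schwarz_ineq2)
      also have "\<dots> \<le> norm u * (norm B0 * norm v)" by (intro mult_left_mono norm_matrix_vector_mult_le) auto
      also have "\<dots> \<le> norm u * (Q * norm v)" using b(4) by (intro mult_left_mono mult_right_mono) auto
      finally show ?thesis by (simp add: mult_ac)
    qed
    have P: "(\<phi> (t, x) + h * (A (t, x) + p (t, x) \<bullet> \<mu> (t, x))) + (transpose (\<sigma> (t, x)) *v p (t, x)) \<bullet> y +
        1 / 2 * (y \<bullet> ((transpose (\<sigma> (t, x)) ** B (t, x) ** \<sigma> (t, x)) *v y)) =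
        \<phi> (t, x) + h * A (t, x) + P0 \<bullet> \<eta> + 1 / 2 * (w \<bullet> (B0 *v w))" (is "?P = _")
      unfolding transpose_vec_inner conj_quadratic by (simp add: \<eta>_def w_def m_def s_def P0_def B0_def inner_add_right algebra_simps)
    have pt: "x + h *\<^sub>R \<mu> (t, x) + \<sigma> (t, x) *v y = x + \<eta>" by (simp add: \<eta>_def w_def m_def s_def)
    show "\<bar>\<psi> (t + h, x + h *\<^sub>R \<mu> (t, x) + \<sigma> (t, x) *v y) - ?P\<bar> \<le> \<epsilon> * ((norm y)\<^sup>2 + h) + D * norm y ^ 4"
      unfolding pt
    proof (cases "norm y < \<delta>")
      case True
      have "norm \<eta> < \<rho>"
      proof -
        have "h + norm y < \<rho> / (2 * Q) + \<rho> / (2 * Q)" using h rle(9) True \<delta>(3) by linarith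
        then have "Q * (h + norm y) < Q * (\<rho> / (2 * Q) + \<rho> / (2 * Q))" using Q1 by (intro mult_strict_left_mono) auto
        also have "\<dots> = \<rho>" using Q1 by (simp add: field_simps)
        finally show ?thesis using \<eta> by linarith
      qed
      have "dist (t + h, x + \<eta>) (t, x) \<le> h + norm \<eta>"
        unfolding dist_Pair_Pair using h by (intro sqrt_sum_squares_le_sum[THEN order_trans]) (auto simp: dist_norm)
      then have "dist (t + h, x + \<eta>) z0 < r0"
        using dist_triangle[of "(t + h, x + \<eta>)" z0 "(t, x)"] z h rle(10) \<open>norm \<eta> < \<rho>\<close> \<rho>(3) by linarith
      then have "\<psi> (t + h, x + \<eta>) = \<phi> (t + h, x + \<eta>)" using t h th by (intro \<psi>) auto
      moreover have "\<bar>\<phi> (t + h, x + \<eta>) - \<phi> (t, x) - h * A (t, x) - P0 \<bullet> \<eta> - 1 / 2 * (\<eta> \<bullet> (B0 *v \<eta>))\<bar> \<le> \<epsilon>t * (h + (norm \<eta>)\<^sup>2)"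
        unfolding P0_def B0_def using z h rle(7) \<open>norm \<eta> < \<rho>\<close> \<rho>(2) by (intro \<rho>1(2)) auto
      moreover have "\<epsilon>t * (h + (norm \<eta>)\<^sup>2) \<le> \<epsilon> / 2 * ((norm y)\<^sup>2 + h)"
      proof -
        have "(norm \<eta>)\<^sup>2 \<le> (Q * (h + norm y))\<^sup>2" using \<eta> by (intro power_mono) auto
        also have "\<dots> \<le> Q\<^sup>2 * (2 * h\<^sup>2 + 2 * (norm y)\<^sup>2)"
          unfolding power_mult_distrib using sum_squares_bound[of h "norm y"] by (intro mult_left_mono) (auto simp: power2_sum)
        also have "\<dots> \<le> Q\<^sup>2 * (2 * h + 2 * (norm y)\<^sup>2)"
          using h h1 by (intro mult_left_mono) (auto simp: power2_eq_square mult_left_le)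
        finally have "(norm \<eta>)\<^sup>2 \<le> 2 * Q\<^sup>2 * ((norm y)\<^sup>2 + h)" by (simp add: algebra_simps)
        then have "h + (norm \<eta>)\<^sup>2 \<le> (1 + 2 * Q\<^sup>2) * ((norm y)\<^sup>2 + h)" by (simp add: algebra_simps add_increasing)
        then have "\<epsilon>t * (h + (norm \<eta>)\<^sup>2) \<le> \<epsilon>t * ((1 + 2 * Q\<^sup>2) * ((norm y)\<^sup>2 + h))" using \<epsilon>t by (intro mult_left_mono) auto
        also have "\<dots> = \<epsilon> / 2 * ((norm y)\<^sup>2 + h)" by (simp only: mult.assoc[symmetric] \<epsilon>t(2))
        finally show ?thesis .
      qed
      moreover have "\<bar>1 / 2 * (\<eta> \<bullet> (B0 *v \<eta>)) - 1 / 2 * (w \<bullet> (B0 *v w))\<bar> \<le> \<epsilon> / 2 * ((norm y)\<^sup>2 + h)"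
      proof -
        \<comment> \<open>Taylor's formula has the quadratic form at the full displacement, the
          polynomial only at its Gaussian part \<open>w\<close>; the cross terms with the drift are
          of lower order.\<close>
        have "1 / 2 * (\<eta> \<bullet> (B0 *v \<eta>)) - 1 / 2 * (w \<bullet> (B0 *v w)) = h\<^sup>2 / 2 * (m \<bullet> (B0 *v m)) + h * (m \<bullet> (B0 *v w))"
          unfolding \<eta>_def by (simp add: matrix_vector_right_distrib matrix_vector_mult_scaleR inner_add_left inner_add_right Bsym[of w m] power2_eq_square algebra_simps)
        also have "\<bar>\<dots>\<bar> \<le> h\<^sup>2 / 2 * \<bar>m \<bullet> (B0 *v m)\<bar> + h * \<bar>m \<bullet> (B0 *v w)\<bar>"
          using h by (simp add: abs_mult order_trans[OF abs_triangle_ineq])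
        also have "\<dots> \<le> h\<^sup>2 / 2 * (Q * Q * Q) + h * (Q * Q * (Q * norm y))"
          using h Q1 b w by (intro add_mono mult_left_mono order_trans[OF Bn] mult_mono) auto
        also have "\<dots> = Q ^ 3 / 2 * h\<^sup>2 + Q ^ 3 * h * norm y" by (simp add: power3_eq_cube algebra_simps)
        \<comment> \<open>Young's inequality, obtained from the square of
          \<open>\<epsilon>/2 |y| - Q^3 h\<close>.\<close>
        also have "Q ^ 3 * h * norm y \<le> \<epsilon> / 4 * (norm y)\<^sup>2 + Q ^ 6 / \<epsilon> * h\<^sup>2"
        proof -
          have "0 \<le> (\<epsilon> / 2 * norm y - Q ^ 3 * h)\<^sup>2" by simp
          then have "\<epsilon> * (Q ^ 3 * h * norm y) \<le> \<epsilon> * (\<epsilon> / 4 * (norm y)\<^sup>2 + Q ^ 6 / \<epsilon> * h\<^sup>2)"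
            using \<epsilon> by (simp add: power2_eq_square algebra_simps eval_nat_numeral)
          then show ?thesis using \<epsilon> by simp
        qed
        also have "Q ^ 3 / 2 * h\<^sup>2 + (\<epsilon> / 4 * (norm y)\<^sup>2 + Q ^ 6 / \<epsilon> * h\<^sup>2) = H * h * h + \<epsilon> / 4 * (norm y)\<^sup>2"
          by (simp add: H_def power2_eq_square algebra_simps)
        also have "H * h * h \<le> \<epsilon> / 2 * h"
        proof -
          have "H * h \<le> H * (\<epsilon> / (2 * H))" using h rle(11) H by (intro mult_left_mono) auto
          also have "\<dots> = \<epsilon> / 2" using H by simp
          finally show ?thesis using h by (intro mult_right_mono) auto
        qed
        also have "\<epsilon> / 2 * h + \<epsilon> / 4 * (norm y)\<^sup>2 \<le> \<epsilon> / 2 * ((norm y)\<^sup>2 + h)" using \<epsilon> by (simp add: algebra_simps)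
        finally show ?thesis by simp
      qed
      moreover have "0 \<le> D * norm y ^ 4" using D by simp
      moreover have "\<epsilon> * ((norm y)\<^sup>2 + h) = \<epsilon> / 2 * ((norm y)\<^sup>2 + h) + \<epsilon> / 2 * ((norm y)\<^sup>2 + h)" by simp
      ultimately show "\<bar>\<psi> (t + h, x + \<eta>) - ?P\<bar> \<le> \<epsilon> * ((norm y)\<^sup>2 + h) + D * norm y ^ 4"
        unfolding P by linarith
    next
      case False
      have "\<bar>\<psi> (t + h, x + \<eta>)\<bar> \<le> M\<psi>" using t h th by (intro \<psi>b) auto
      moreover have "\<bar>\<phi> (t, x) + h * A (t, x) + P0 \<bullet> \<eta> + 1 / 2 * (w \<bullet> (B0 *v w))\<bar> \<le> Q + 1 * Q + Q * (Q * (1 + norm y)) + 1 / 2 * (Q * (Q * norm y) * (Q * norm y))"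
      proof -
        have "\<bar>h * A (t, x)\<bar> \<le> 1 * Q" unfolding abs_mult using h h1 b by (intro mult_mono) auto
        moreover have "\<bar>P0 \<bullet> \<eta>\<bar> \<le> Q * (Q * (1 + norm y))"
        proof -
          have "Q * (h + norm y) \<le> Q * (1 + norm y)" using h1 Q1 by (intro mult_left_mono) auto
          then have "norm \<eta> \<le> Q * (1 + norm y)" using \<eta> by linarith
          then show ?thesis using b(3) Q1 by (intro order_trans[OF Cauchy_Schwarz_ineq2] mult_mono) auto
        qed
        moreover have "\<bar>1 / 2 * (w \<bullet> (B0 *v w))\<bar> \<le> 1 / 2 * (Q * (Q * norm y) * (Q * norm y))"
          unfolding abs_mult using w Q1 by (intro mult_mono order_trans[OF Bn]) auto
        ultimately show ?thesis using b(1) by linarith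
      qed
      moreover have "M\<psi> + (Q + 1 * Q + Q * (Q * (1 + norm y)) + 1 / 2 * (Q * (Q * norm y) * (Q * norm y))) \<le> D * norm y ^ 4"
      proof -
        have pw: "\<delta> ^ 4 * norm y ^ k \<le> norm y ^ 4" if "k \<le> 4" for k
        proof -
          have "\<delta> ^ 4 \<le> \<delta> ^ (4 - k)" using \<delta> by (intro power_decreasing) auto
          also have "\<dots> \<le> norm y ^ (4 - k)" using \<delta> False by (intro power_mono) auto
          finally have "\<delta> ^ 4 * norm y ^ k \<le> norm y ^ (4 - k) * norm y ^ k" by (rule mult_right_mono) simp
          then show ?thesis using that by (simp add: power_add[symmetric])
        qed
        have q: "Q \<le> Q ^ 3" "Q\<^sup>2 \<le> Q ^ 3" using Q1 power_increasing[of 1 3 Q] power_increasing[of 2 3 Q] by auto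
        have "M\<psi> + (Q + 1 * Q + Q * (Q * (1 + norm y)) + 1 / 2 * (Q * (Q * norm y) * (Q * norm y))) =
          (M\<psi> + 2 * Q + Q\<^sup>2) + Q\<^sup>2 * norm y + 1 / 2 * Q ^ 3 * (norm y)\<^sup>2" by (simp add: power2_eq_square power3_eq_cube algebra_simps)
        also have "\<dots> \<le> (M\<psi> + 3 * Q ^ 3) + Q ^ 3 * norm y + Q ^ 3 * (norm y)\<^sup>2"
        proof -
          have "Q\<^sup>2 * norm y \<le> Q ^ 3 * norm y" using q(2) by (rule mult_right_mono) simp
          moreover have "1 / 2 * Q ^ 3 * (norm y)\<^sup>2 \<le> Q ^ 3 * (norm y)\<^sup>2" using Q1 by (intro mult_right_mono) auto
          ultimately show ?thesis using q by linarith
        qed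
        finally have "\<delta> ^ 4 * (M\<psi> + (Q + 1 * Q + Q * (Q * (1 + norm y)) + 1 / 2 * (Q * (Q * norm y) * (Q * norm y)))) \<le>
            \<delta> ^ 4 * ((M\<psi> + 3 * Q ^ 3) + Q ^ 3 * norm y + Q ^ 3 * (norm y)\<^sup>2)" using \<delta> by (intro mult_left_mono) auto
        also have "\<dots> = (M\<psi> + 3 * Q ^ 3) * (\<delta> ^ 4 * norm y ^ 0) + Q ^ 3 * (\<delta> ^ 4 * norm y ^ 1) + Q ^ 3 * (\<delta> ^ 4 * norm y ^ 2)" by (simp add: algebra_simps)
        also have "\<dots> \<le> (M\<psi> + 3 * Q ^ 3) * norm y ^ 4 + Q ^ 3 * norm y ^ 4 + Q ^ 3 * norm y ^ 4"
          using M\<psi> Q1 by (intro add_mono mult_left_mono pw) auto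
        also have "\<dots> = (M\<psi> + 5 * Q ^ 3) * norm y ^ 4" by (simp add: algebra_simps)
        finally show ?thesis using \<delta>(1) by (simp add: D_def field_simps)
      qed
      moreover have "0 \<le> \<epsilon> * ((norm y)\<^sup>2 + h)" using \<epsilon> h by simp
      ultimately show "\<bar>\<psi> (t + h, x + \<eta>) - ?P\<bar> \<le> \<epsilon> * ((norm y)\<^sup>2 + h) + D * norm y ^ 4"
        unfolding P by linarith
    qed
  qed
qed

end

context obstacle_scheme
begin

section \<open>Passage to the limit in the discrete operator\<close>

text \<open>The Lipschitz bound uniform in \<open>t\<close> controls all arguments except time;
  continuity in \<open>t\<close> is used with the other arguments frozen at their limits.\<close>

lemma F_tendsto:
  assumes z: "z \<longlonglongrightarrow> z0" and z0: "z0 \<in> cylinder T" and zc: "\<And>k. z k \<in> cylinder T"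
    and r: "r \<longlonglongrightarrow> r0" and p: "p \<longlonglongrightarrow> p0" and \<gamma>: "\<gamma> \<longlonglongrightarrow> \<gamma>0"
    and \<gamma>s: "\<And>k. \<gamma> k \<in> sym_mats" "\<gamma>0 \<in> sym_mats"
  shows "(\<lambda>k. F (z k) (r k) (p k) (\<gamma> k)) \<longlonglongrightarrow> F z0 r0 p0 \<gamma>0"
proof -
  obtain t0 x0 where tx0: "z0 = (t0, x0)" by (cases z0)
  define t x where "t = (\<lambda>k. fst (z k))" and "x = (\<lambda>k. snd (z k))"
  have zk: "z k = (t k, x k)" for k by (simp add: t_def x_def)
  have t: "t \<longlonglongrightarrow> t0" and x: "x \<longlonglongrightarrow> x0"
    using tendsto_fst[OF z] tendsto_snd[OF z] by (simp_all add: t_def x_def tx0)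
  have tc: "t k \<in> {0..T}" for k using zc[of k] by (auto simp: zk)
  have "(\<lambda>k. F (t k, x0) r0 p0 \<gamma>0) \<longlonglongrightarrow> F (t0, x0) r0 p0 \<gamma>0"
    using z0 tc by (intro continuous_on_tendsto_compose[OF F_cont[OF \<gamma>s(2)] t]) (auto simp: tx0)
  moreover have "(\<lambda>k. F (t k, x k) (r k) (p k) (\<gamma> k) - F (t k, x0) r0 p0 \<gamma>0) \<longlonglongrightarrow> 0"
  proof (rule Lim_null_comparison)
    show "\<forall>\<^sub>F k in sequentially. norm (F (t k, x k) (r k) (p k) (\<gamma> k) - F (t k, x0) r0 p0 \<gamma>0) \<le>
        L * (norm (x k - x0) + \<bar>r k - r0\<bar> + norm (p k - p0) + norm (\<gamma> k - \<gamma>0))"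
      using F_lipschitz_dist[OF tc \<gamma>s] by (intro always_eventually) (simp add: real_norm_def)
    have "(\<lambda>k. L * (norm (x k - x0) + \<bar>r k - r0\<bar> + norm (p k - p0) + norm (\<gamma> k - \<gamma>0))) \<longlonglongrightarrow>
        L * (norm (x0 - x0) + \<bar>r0 - r0\<bar> + norm (p0 - p0) + norm (\<gamma>0 - \<gamma>0))"
      by (intro tendsto_intros x r p \<gamma>)
    then show "(\<lambda>k. L * (norm (x k - x0) + \<bar>r k - r0\<bar> + norm (p k - p0) + norm (\<gamma> k - \<gamma>0))) \<longlonglongrightarrow> 0" by simp
  qed
  ultimately have "(\<lambda>k. (F (t k, x k) (r k) (p k) (\<gamma> k) - F (t k, x0) r0 p0 \<gamma>0) + F (t k, x0) r0 p0 \<gamma>0) \<longlonglongrightarrow> 0 + F (t0, x0) r0 p0 \<gamma>0"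
    by (intro tendsto_add)
  then show ?thesis by (simp add: zk tx0)
qed

text \<open>The constants \<open>c k\<close> are the vertical shifts that bring the test function
  into contact with the grid function. They enter the expectation and the \<open>r\<close> argument
  of \<open>F\<close>, but not the discrete derivatives.\<close>

lemma scheme_consistent_seq:
  fixes \<phi> \<psi> :: "real \<times> (real^'d) \<Rightarrow> real" and t h c :: "nat \<Rightarrow> real" and x :: "nat \<Rightarrow> real^'d"
  assumes C: "C12 \<phi> A p B" and z0: "z0 \<in> cylinder T" and r0: "r0 > 0"
    and \<psi>: "\<And>z. z \<in> cylinder T \<Longrightarrow> dist z z0 < r0 \<Longrightarrow> \<psi> z = \<phi> z"
    and \<psi>b: "\<And>z. z \<in> cylinder T \<Longrightarrow> \<bar>\<psi> z\<bar> \<le> M\<psi>"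
    and \<psi>m: "\<And>t. t \<in> {0..T} \<Longrightarrow> (\<lambda>x. \<psi> (t, x)) \<in> borel_measurable borel"
    and z: "(\<lambda>k. (t k, x k)) \<longlonglongrightarrow> z0" and t: "\<And>k. 0 \<le> t k" and h: "\<And>k. 0 < h k" and th: "\<And>k. t k + h k \<le> T"
    and h0: "h \<longlonglongrightarrow> 0" and c0: "c \<longlonglongrightarrow> 0"
  shows "(\<lambda>k. (Th M W \<mu> \<sigma> F (h k) (\<lambda>z. \<psi> z + c k) (t k, x k) - (\<phi> (t k, x k) + c k)) / h k)
    \<longlonglongrightarrow> A z0 + \<mu> z0 \<bullet> p z0 + 1 / 2 * (diffusion \<sigma> z0 \<bullet> B z0) + F z0 (\<phi> z0) (p z0) (B z0)"
proof -
  define zk where "zk = (\<lambda>k. (t k, x k))"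
  have zkc: "zk k \<in> cylinder T" for k using t[of k] h[of k] th[of k] by (auto simp: zk_def)
  have tT: "t k \<le> T" for k using h[of k] th[of k] by linarith
  have zl: "zk \<longlonglongrightarrow> z0" using z by (simp add: zk_def)
  have inv: "invertible (\<sigma> (zk k))" "invertible (\<sigma> z0)" for k using \<sigma>_invertible zkc z0 by auto
  have tl: "(\<lambda>k. f (zk k)) \<longlonglongrightarrow> f z0" if "continuous_on (cylinder T) f" for f :: "real \<times> (real^'d) \<Rightarrow> 'z::topological_space"
    using zkc by (intro continuous_on_tendsto_compose[OF that zl z0]) auto
  have cont: "continuous_on (cylinder T) \<phi>" "continuous_on (cylinder T) A" "continuous_on (cylinder T) p" "continuous_on (cylinder T) B"
    using C by (auto simp: C12_def intro: continuous_on_subset)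
  have Bt: "transpose (B z) = B z" for z using C unfolding C12_def by blast
  define S where "S = (\<lambda>k. transpose (\<sigma> (zk k)) ** B (zk k) ** \<sigma> (zk k))"
  have St: "transpose (S k) = S k" for k unfolding S_def by (intro transpose_conj Bt)
  have gs: "good_slice (\<lambda>z. \<psi> z + c k) (t k + h k)" for k
  proof -
    have "t k + h k \<in> {0..T}" using t[of k] h[of k] th[of k] by simp
    then have 1: "(\<lambda>x. \<psi> (t k + h k, x)) \<in> borel_measurable borel" and 2: "\<bar>\<psi> (t k + h k, x)\<bar> \<le> M\<psi>" for x
      using \<psi>m \<psi>b by auto
    note [measurable] = 1
    have "\<bar>\<psi> (t k + h k, x) + c k\<bar> \<le> M\<psi> + \<bar>c k\<bar>" for x using 2[of x] by linarith
    then show ?thesis unfolding good_slice_def by auto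
  qed
  define u where "u = (\<lambda>k y. \<psi> (t k + h k, x k + h k *\<^sub>R \<mu> (t k, x k) + \<sigma> (t k, x k) *v y))"
  define uc where "uc = (\<lambda>k y. u k y + c k)"
  have uc: "uc k y = (\<lambda>z. \<psi> z + c k) (t k + h k, x k + h k *\<^sub>R \<mu> (t k, x k) + \<sigma> (t k, x k) *v y)" for k y
    by (simp add: uc_def u_def)
  note D = Dh_gauss[OF t tT h gs uc]
  have um[measurable]: "u k \<in> borel_measurable borel" for k
  proof -
    have "(\<lambda>y. uc k y - c k) \<in> borel_measurable borel" using D(1)[of k] by measurable
    then show ?thesis by (simp add: uc_def)
  qed
  have ub: "\<bar>u k y\<bar> \<le> M\<psi>" for k y unfolding u_def using t[of k] h[of k] th[of k] by (intro \<psi>b) auto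
  note iu = integrable_weights[OF h inv(1) um ub]
  have prob: "prob_space (gauss (h k) :: (real^'d) measure)" for k by (rule prob_space_gauss[OF h])
  have ic: "integrable (gauss (h k)) (\<lambda>y::real^'d. a)" for k and a :: real
    using prob[of k] by (simp add: prob_space.finite_measure finite_measure.integrable_const)
  define a0 where "a0 = (\<lambda>k. \<integral>y. u k y \<partial>gauss (h k))"
  \<comment> \<open>Gradient and Hessian in the Gaussian variable tend to
    \<open>\<sigma>^T p\<close> and \<open>\<sigma>^T B \<sigma>\<close>; the inverse factors in the
    scheme's weights undo the multiplication by \<open>\<sigma>\<close>.\<close>
  define a1 where "a1 = (\<lambda>k. (1 / h k) *\<^sub>R (\<integral>y. u k y *\<^sub>R y \<partial>gauss (h k)))"
  define a2 where "a2 = (\<lambda>k. (1 / (h k)\<^sup>2) *\<^sub>R (\<integral>y. u k y *\<^sub>R (outer y - h k *\<^sub>R mat 1) \<partial>gauss (h k)))"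
  have [measurable]: "outer \<in> borel_measurable (borel :: (real^'d) measure)"
    by (rule borel_measurable_continuous_onI[OF continuous_on_outer])
  have inv1: "invertible (mat 1 :: real^'d^'d)" by (auto simp: invertible_def intro!: exI[of _ "mat 1"])
  have mi1: "matrix_inv (mat 1 :: real^'d^'d) = mat 1" by (rule matrix_inv_eqI) simp
  have w1: "weight1 (mat 1) h y = (1 / h) *\<^sub>R y" for h and y :: "real^'d"
    by (simp add: weight1_def transpose_mat mi1)
  have w2: "weight2 (mat 1) h y = (1 / h\<^sup>2) *\<^sub>R (outer y - h *\<^sub>R mat 1)" for h and y :: "real^'d"
    by (simp add: weight2_outer transpose_mat mi1)
  note iu1 = integrable_weights[OF h inv1 um ub, unfolded w1 w2]
  have a1_eq: "a1 k = (\<integral>y. u k y *\<^sub>R ((1 / h k) *\<^sub>R y) \<partial>gauss (h k))" for k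
    unfolding a1_def by (simp only: integral_scaleR_right[symmetric] scaleR_left_commute)
  have a2_eq: "a2 k = (\<integral>y. u k y *\<^sub>R ((1 / (h k)\<^sup>2) *\<^sub>R (outer y - h k *\<^sub>R mat 1)) \<partial>gauss (h k))" for k
    unfolding a2_def by (simp only: integral_scaleR_right[symmetric] scaleR_left_commute)
  have D0: "D0h M W \<mu> \<sigma> (h k) (\<lambda>z. \<psi> z + c k) (t k, x k) = a0 k + c k" for k
    unfolding D(3) uc_def a0_def using iu(1)[of k] ic[of k] prob_space.prob_space[OF prob[of k]] by simp
  have D1: "D1h M W \<mu> \<sigma> (h k) (\<lambda>z. \<psi> z + c k) (t k, x k) = matrix_inv (transpose (\<sigma> (zk k))) *v a1 k" for k
  proof -
    have w: "integrable (gauss (h k)) (\<lambda>y. weight1 (\<sigma> (zk k)) (h k) y)"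
      using integrable_weights(2)[OF h[of k] inv(1)[of k], of "\<lambda>_. 1" 1] by simp
    have "D1h M W \<mu> \<sigma> (h k) (\<lambda>z. \<psi> z + c k) (t k, x k) = (\<integral>y. u k y *\<^sub>R weight1 (\<sigma> (zk k)) (h k) y + c k *\<^sub>R weight1 (\<sigma> (zk k)) (h k) y \<partial>gauss (h k))"
      unfolding D(4) uc_def by (simp add: scaleR_add_left zk_def)
    also have "\<dots> = (\<integral>y. u k y *\<^sub>R weight1 (\<sigma> (zk k)) (h k) y \<partial>gauss (h k))"
      using iu(2)[of k] w weights_mean_zero(1)[OF h inv(1), of k k] by simp
    also have "\<dots> = (\<integral>y. matrix_inv (transpose (\<sigma> (zk k))) *v (u k y *\<^sub>R ((1 / h k) *\<^sub>R y)) \<partial>gauss (h k))"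
      by (simp only: weight1_def matrix_vector_mult_scaleR)
    also have "\<dots> = matrix_inv (transpose (\<sigma> (zk k))) *v a1 k"
      unfolding a1_eq by (rule integral_bounded_linear[OF matrix_vector_mul_bounded_linear iu1(2)])
    finally show ?thesis .
  qed
  have D2: "D2h M W \<mu> \<sigma> (h k) (\<lambda>z. \<psi> z + c k) (t k, x k) = matrix_inv (transpose (\<sigma> (zk k))) ** a2 k ** matrix_inv (\<sigma> (zk k))" for k
  proof -
    have w: "integrable (gauss (h k)) (\<lambda>y. weight2 (\<sigma> (zk k)) (h k) y)"
      using integrable_weights(3)[OF h[of k] inv(1)[of k], of "\<lambda>_. 1" 1] by simp
    have bl: "bounded_linear (\<lambda>X. matrix_inv (transpose (\<sigma> (zk k))) ** X ** matrix_inv (\<sigma> (zk k)))"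
      using bounded_linear_compose[OF bounded_bilinear.bounded_linear_left[OF bounded_bilinear_matrix_matrix]
        bounded_bilinear.bounded_linear_right[OF bounded_bilinear_matrix_matrix]] .
    have "D2h M W \<mu> \<sigma> (h k) (\<lambda>z. \<psi> z + c k) (t k, x k) = (\<integral>y. u k y *\<^sub>R weight2 (\<sigma> (zk k)) (h k) y + c k *\<^sub>R weight2 (\<sigma> (zk k)) (h k) y \<partial>gauss (h k))"
      unfolding D(5) uc_def by (simp add: scaleR_add_left zk_def)
    also have "\<dots> = (\<integral>y. u k y *\<^sub>R weight2 (\<sigma> (zk k)) (h k) y \<partial>gauss (h k))"
      using iu(3)[of k] w weights_mean_zero(2)[OF h inv(1), of k k] by simp
    also have "\<dots> = (\<integral>y. matrix_inv (transpose (\<sigma> (zk k))) ** (u k y *\<^sub>R ((1 / (h k)\<^sup>2) *\<^sub>R (outer y - h k *\<^sub>R mat 1))) ** matrix_inv (\<sigma> (zk k)) \<partial>gauss (h k))"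
      by (simp only: weight2_outer matrix_scalar_ac scalar_matrix_assoc[symmetric] scaleR_scaleR mult.commute)
    also have "\<dots> = matrix_inv (transpose (\<sigma> (zk k))) ** a2 k ** matrix_inv (\<sigma> (zk k))"
      unfolding a2_eq by (rule integral_bounded_linear[OF bl iu1(3)])
    finally show ?thesis .
  qed
  obtain N where N: "N \<ge> 0" and exp: "\<And>h \<epsilon> C \<alpha> (b::real^'d) S u Cu. \<lbrakk>0 < h; h \<le> 1; \<epsilon> \<ge> 0; C \<ge> 0; transpose S = S; u \<in> borel_measurable borel; \<And>y. \<bar>u y\<bar> \<le> Cu;
      \<And>y. \<bar>u y - (\<alpha> + b \<bullet> y + 1 / 2 * (y \<bullet> (S *v y)))\<bar> \<le> \<epsilon> * ((norm y)\<^sup>2 + h) + C * norm y ^ 4\<rbrakk> \<Longrightarrow>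
      \<bar>(\<integral>y. u y \<partial>gauss h) - \<alpha> - h / 2 * trace S\<bar> \<le> h * (N * (\<epsilon> + C * h)) \<and>
      norm ((1 / h) *\<^sub>R (\<integral>y. u y *\<^sub>R y \<partial>gauss h) - b) \<le> N * (\<epsilon> + C * h) \<and>
      norm ((1 / h\<^sup>2) *\<^sub>R (\<integral>y. u y *\<^sub>R (outer y - h *\<^sub>R mat 1) \<partial>gauss h) - S) \<le> N * (\<epsilon> + C * h)"
    using gauss_expansion by blast
  define \<alpha> where "\<alpha> = (\<lambda>k. \<phi> (zk k) + h k * (A (zk k) + p (zk k) \<bullet> \<mu> (zk k)))"
  define b where "b = (\<lambda>k. transpose (\<sigma> (zk k)) *v p (zk k))"
  have est: "\<exists>C. \<forall>\<^sub>F k in sequentially. \<bar>a0 k - \<alpha> k - h k / 2 * trace (S k)\<bar> \<le> h k * (N * (\<epsilon> + C * h k)) \<and>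
      norm (a1 k - b k) \<le> N * (\<epsilon> + C * h k) \<and> norm (a2 k - S k) \<le> N * (\<epsilon> + C * h k)" if \<epsilon>: "\<epsilon> > 0" for \<epsilon>
  proof -
    obtain r C where r: "r > 0" and C: "C \<ge> 0"
      and rem: "\<And>t x h y. dist (t, x) z0 < r \<Longrightarrow> 0 \<le> t \<Longrightarrow> 0 < h \<Longrightarrow> h < r \<Longrightarrow> t + h \<le> T \<Longrightarrow>
      \<bar>\<psi> (t + h, x + h *\<^sub>R \<mu> (t, x) + \<sigma> (t, x) *v y) - ((\<phi> (t, x) + h * (A (t, x) + p (t, x) \<bullet> \<mu> (t, x))) +
        (transpose (\<sigma> (t, x)) *v p (t, x)) \<bullet> y + 1 / 2 * (y \<bullet> ((transpose (\<sigma> (t, x)) ** B (t, x) ** \<sigma> (t, x)) *v y)))\<bar>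
      \<le> \<epsilon> * ((norm y)\<^sup>2 + h) + C * norm y ^ 4"
      using scheme_expansion[OF assms(1) z0 r0 \<psi> \<psi>b \<epsilon>] by metis
    have "\<forall>\<^sub>F k in sequentially. dist (zk k) z0 < r" using zl r by (rule tendstoD)
    moreover have "\<forall>\<^sub>F k in sequentially. dist (h k) 0 < min r 1" using h0 r by (intro tendstoD) auto
    ultimately have "\<forall>\<^sub>F k in sequentially. \<bar>a0 k - \<alpha> k - h k / 2 * trace (S k)\<bar> \<le> h k * (N * (\<epsilon> + C * h k)) \<and>
      norm (a1 k - b k) \<le> N * (\<epsilon> + C * h k) \<and> norm (a2 k - S k) \<le> N * (\<epsilon> + C * h k)"
    proof eventually_elim
      case (elim k)
      then have hk: "h k < r" "h k \<le> 1" using h[of k] by auto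
      show ?case
        unfolding a0_def a1_def a2_def
      proof (rule exp[OF h hk(2) less_imp_le[OF \<epsilon>] C St um ub])
        fix y
        show "\<bar>u k y - (\<alpha> k + b k \<bullet> y + 1 / 2 * (y \<bullet> (S k *v y)))\<bar> \<le> \<epsilon> * ((norm y)\<^sup>2 + h k) + C * norm y ^ 4"
          using rem[of "t k" "x k" "h k" y] elim(1) hk(1) t[of k] th[of k] h[of k]
          unfolding zk_def u_def \<alpha>_def b_def S_def by blast
      qed
    qed
    then show ?thesis by blast
  qed
  \<comment> \<open>The error of the expectation is of smaller order than \<open>h\<close>, so it
    survives the division by \<open>h\<close> in the consistency quotient.\<close>
  define e0 where "e0 = (\<lambda>k. (a0 k - \<alpha> k - h k / 2 * trace (S k)) / h k)"
  have e0: "e0 \<longlonglongrightarrow> 0"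
  proof (rule tendsto_zero_if_bounds[OF N h0])
    fix \<epsilon> :: real assume "\<epsilon> > 0"
    then obtain C where C: "\<forall>\<^sub>F k in sequentially. \<bar>a0 k - \<alpha> k - h k / 2 * trace (S k)\<bar> \<le> h k * (N * (\<epsilon> + C * h k)) \<and>
      norm (a1 k - b k) \<le> N * (\<epsilon> + C * h k) \<and> norm (a2 k - S k) \<le> N * (\<epsilon> + C * h k)" using est by blast
    have "\<forall>\<^sub>F k in sequentially. norm (e0 k) \<le> N * (\<epsilon> + C * h k)"
      using C
    proof eventually_elim
      case (elim k)
      then have "\<bar>a0 k - \<alpha> k - h k / 2 * trace (S k)\<bar> / h k \<le> N * (\<epsilon> + C * h k)"
        using h[of k] by (subst pos_divide_le_eq) (auto simp: mult.commute)
      then show ?case using h[of k] by (simp add: e0_def abs_divide)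
    qed
    then show "\<exists>C. \<forall>\<^sub>F k in sequentially. norm (e0 k) \<le> N * (\<epsilon> + C * h k)" by blast
  qed
  have "(\<lambda>k. a1 k - b k) \<longlonglongrightarrow> 0"
  proof (rule tendsto_zero_if_bounds[OF N h0])
    fix \<epsilon> :: real assume "\<epsilon> > 0"
    then obtain C where "\<forall>\<^sub>F k in sequentially. \<bar>a0 k - \<alpha> k - h k / 2 * trace (S k)\<bar> \<le> h k * (N * (\<epsilon> + C * h k)) \<and>
      norm (a1 k - b k) \<le> N * (\<epsilon> + C * h k) \<and> norm (a2 k - S k) \<le> N * (\<epsilon> + C * h k)" using est by blast
    then have "\<forall>\<^sub>F k in sequentially. norm (a1 k - b k) \<le> N * (\<epsilon> + C * h k)" by eventually_elim simp
    then show "\<exists>C. \<forall>\<^sub>F k in sequentially. norm (a1 k - b k) \<le> N * (\<epsilon> + C * h k)" by blast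
  qed
  moreover have bl: "b \<longlonglongrightarrow> transpose (\<sigma> z0) *v p z0"
    unfolding b_def by (rule tl[of "\<lambda>z. transpose (\<sigma> z) *v p z"]) (intro continuous_intros \<sigma>_cont cont)
  ultimately have a1l: "a1 \<longlonglongrightarrow> transpose (\<sigma> z0) *v p z0"
    using tendsto_add[of "\<lambda>k. a1 k - b k" 0 sequentially b] by simp
  have "(\<lambda>k. a2 k - S k) \<longlonglongrightarrow> 0"
  proof (rule tendsto_zero_if_bounds[OF N h0])
    fix \<epsilon> :: real assume "\<epsilon> > 0"
    then obtain C where "\<forall>\<^sub>F k in sequentially. \<bar>a0 k - \<alpha> k - h k / 2 * trace (S k)\<bar> \<le> h k * (N * (\<epsilon> + C * h k)) \<and>
      norm (a1 k - b k) \<le> N * (\<epsilon> + C * h k) \<and> norm (a2 k - S k) \<le> N * (\<epsilon> + C * h k)" using est by blast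
    then have "\<forall>\<^sub>F k in sequentially. norm (a2 k - S k) \<le> N * (\<epsilon> + C * h k)" by eventually_elim simp
    then show "\<exists>C. \<forall>\<^sub>F k in sequentially. norm (a2 k - S k) \<le> N * (\<epsilon> + C * h k)" by blast
  qed
  moreover have Sl: "S \<longlonglongrightarrow> transpose (\<sigma> z0) ** B z0 ** \<sigma> z0"
    unfolding S_def by (rule tl[of "\<lambda>z. transpose (\<sigma> z) ** B z ** \<sigma> z"]) (intro continuous_intros \<sigma>_cont cont)
  ultimately have a2l: "a2 \<longlonglongrightarrow> transpose (\<sigma> z0) ** B z0 ** \<sigma> z0"
    using tendsto_add[of "\<lambda>k. a2 k - S k" 0 sequentially S] by simp
  have ci: "continuous_on (cylinder T) (\<lambda>z. matrix_inv (\<sigma> z))"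
    by (intro continuous_on_matrix_inv \<sigma>_cont \<sigma>_invertible)
  have cit: "continuous_on (cylinder T) (\<lambda>z. matrix_inv (transpose (\<sigma> z)))"
    by (intro continuous_on_matrix_inv continuous_intros \<sigma>_cont transpose_invertible \<sigma>_invertible)
  have L1: "(\<lambda>k. matrix_inv (transpose (\<sigma> (zk k))) *v a1 k) \<longlonglongrightarrow> p z0"
  proof -
    have "(\<lambda>k. matrix_inv (transpose (\<sigma> (zk k))) *v a1 k) \<longlonglongrightarrow> matrix_inv (transpose (\<sigma> z0)) *v (transpose (\<sigma> z0) *v p z0)"
      by (rule bounded_bilinear.tendsto[OF bounded_bilinear_matrix_vector tl[OF cit] a1l])
    also have "matrix_inv (transpose (\<sigma> z0)) *v (transpose (\<sigma> z0) *v p z0) = p z0"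
      by (simp only: matrix_vector_mul_assoc matrix_inv_left[OF transpose_invertible[OF inv(2)]] matrix_vector_mul_lid)
    finally show ?thesis .
  qed
  have L2: "(\<lambda>k. matrix_inv (transpose (\<sigma> (zk k))) ** a2 k ** matrix_inv (\<sigma> (zk k))) \<longlonglongrightarrow> B z0"
  proof -
    have "(\<lambda>k. matrix_inv (transpose (\<sigma> (zk k))) ** a2 k ** matrix_inv (\<sigma> (zk k))) \<longlonglongrightarrow>
        matrix_inv (transpose (\<sigma> z0)) ** (transpose (\<sigma> z0) ** B z0 ** \<sigma> z0) ** matrix_inv (\<sigma> z0)"
      by (intro bounded_bilinear.tendsto[OF bounded_bilinear_matrix_matrix] tl[OF cit] tl[OF ci] a2l)
    also have "matrix_inv (transpose (\<sigma> z0)) ** (transpose (\<sigma> z0) ** B z0 ** \<sigma> z0) ** matrix_inv (\<sigma> z0) =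
        (matrix_inv (transpose (\<sigma> z0)) ** transpose (\<sigma> z0)) ** B z0 ** (\<sigma> z0 ** matrix_inv (\<sigma> z0))"
      by (simp only: matrix_mul_assoc)
    also have "\<dots> = B z0"
      by (simp only: matrix_inv_left[OF transpose_invertible[OF inv(2)]] matrix_inv_right[OF inv(2)] matrix_mul_lid matrix_mul_rid)
    finally show ?thesis .
  qed
  define q where "q = (\<lambda>k. A (zk k) + p (zk k) \<bullet> \<mu> (zk k) + 1 / 2 * trace (S k) + e0 k)"
  have a0_eq: "a0 k = \<phi> (zk k) + h k * q k" for k
    unfolding q_def e0_def \<alpha>_def using h[of k] by (simp add: field_simps)
  have tr: "(\<lambda>k. trace (S k)) \<longlonglongrightarrow> diffusion \<sigma> z0 \<bullet> B z0"
  proof -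
    have "(\<lambda>k. (\<lambda>z. (\<sigma> z ** transpose (\<sigma> z)) \<bullet> B z) (zk k)) \<longlonglongrightarrow> (\<lambda>z. (\<sigma> z ** transpose (\<sigma> z)) \<bullet> B z) z0"
      by (rule tl) (intro continuous_intros \<sigma>_cont cont)
    then show ?thesis by (simp add: S_def trace_conj diffusion_def)
  qed
  have ql: "q \<longlonglongrightarrow> A z0 + p z0 \<bullet> \<mu> z0 + 1 / 2 * (diffusion \<sigma> z0 \<bullet> B z0) + 0"
    unfolding q_def by (intro tendsto_intros tl[OF cont(2)] tl[OF cont(3)] tl[OF \<mu>_cont] tr e0)
  have "(\<lambda>k. \<phi> (zk k) + h k * q k + c k) \<longlonglongrightarrow> \<phi> z0 + 0 * (A z0 + p z0 \<bullet> \<mu> z0 + 1 / 2 * (diffusion \<sigma> z0 \<bullet> B z0) + 0) + 0"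
    by (intro tendsto_intros tl[OF cont(1)] h0 ql c0)
  then have L0: "(\<lambda>k. a0 k + c k) \<longlonglongrightarrow> \<phi> z0" by (simp add: a0_eq)
  have "B z0 \<in> sym_mats" using Bt by (simp add: sym_mats_def)
  then have Fl: "(\<lambda>k. F (zk k) (a0 k + c k) (matrix_inv (transpose (\<sigma> (zk k))) *v a1 k)
      (matrix_inv (transpose (\<sigma> (zk k))) ** a2 k ** matrix_inv (\<sigma> (zk k)))) \<longlonglongrightarrow> F z0 (\<phi> z0) (p z0) (B z0)"
    using D(6) unfolding D2 by (intro F_tendsto[OF zl z0 zkc L0 L1 L2])
  have "(Th M W \<mu> \<sigma> F (h k) (\<lambda>z. \<psi> z + c k) (t k, x k) - (\<phi> (t k, x k) + c k)) / h k =
     q k + F (zk k) (a0 k + c k) (matrix_inv (transpose (\<sigma> (zk k))) *v a1 k)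
      (matrix_inv (transpose (\<sigma> (zk k))) ** a2 k ** matrix_inv (\<sigma> (zk k)))" for k
    unfolding Th_def D0 D1 D2 a0_eq using h[of k] by (simp add: zk_def field_simps)
  then show ?thesis using tendsto_add[OF ql Fl] by (simp add: inner_commute)
qed

text \<open>A neighbourhood form of the sequential limit: a failure at every radius
  \<open>1/(k+1)\<close> would produce a sequence contradicting it.\<close>

lemma scheme_consistent:
  fixes \<phi> \<psi> :: "real \<times> (real^'d) \<Rightarrow> real"
  assumes C: "C12 \<phi> A p B" and z0: "z0 \<in> cylinder T" and r0: "r0 > 0"
    and \<psi>: "\<And>z. z \<in> cylinder T \<Longrightarrow> dist z z0 < r0 \<Longrightarrow> \<psi> z = \<phi> z"
    and \<psi>b: "\<And>z. z \<in> cylinder T \<Longrightarrow> \<bar>\<psi> z\<bar> \<le> M\<psi>"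
    and \<psi>m: "\<And>t. t \<in> {0..T} \<Longrightarrow> (\<lambda>x. \<psi> (t, x)) \<in> borel_measurable borel" and e: "e > 0"
  obtains r where "r > 0" "\<And>t x h c. dist (t, x) z0 < r \<Longrightarrow> 0 \<le> t \<Longrightarrow> 0 < h \<Longrightarrow> h < r \<Longrightarrow> t + h \<le> T \<Longrightarrow> \<bar>c\<bar> < r \<Longrightarrow>
    \<bar>(Th M W \<mu> \<sigma> F h (\<lambda>z. \<psi> z + c) (t, x) - (\<phi> (t, x) + c)) / h -
      (A z0 + \<mu> z0 \<bullet> p z0 + 1 / 2 * (diffusion \<sigma> z0 \<bullet> B z0) + F z0 (\<phi> z0) (p z0) (B z0))\<bar> < e"
proof -
  define G where "G = A z0 + \<mu> z0 \<bullet> p z0 + 1 / 2 * (diffusion \<sigma> z0 \<bullet> B z0) + F z0 (\<phi> z0) (p z0) (B z0)"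
  have "\<exists>r>0. \<forall>t x h c. dist (t, x) z0 < r \<and> 0 \<le> t \<and> 0 < h \<and> h < r \<and> t + h \<le> T \<and> \<bar>c\<bar> < r \<longrightarrow>
    \<bar>(Th M W \<mu> \<sigma> F h (\<lambda>z. \<psi> z + c) (t, x) - (\<phi> (t, x) + c)) / h - G\<bar> < e"
  proof (rule ccontr)
    assume neg: "\<not> ?thesis"
    have "\<exists>t x h c. dist (t, x) z0 < inverse (real (Suc k)) \<and> 0 \<le> t \<and> 0 < h \<and> h < inverse (real (Suc k)) \<and> t + h \<le> T \<and> \<bar>c\<bar> < inverse (real (Suc k)) \<and>
      \<not> \<bar>(Th M W \<mu> \<sigma> F h (\<lambda>z. \<psi> z + c) (t, x) - (\<phi> (t, x) + c)) / h - G\<bar> < e" for k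
    proof -
      have "inverse (real (Suc k)) > 0" by simp
      then show ?thesis using neg by blast
    qed
    then obtain t x h c where s: "\<And>k. dist (t k, x k) z0 < inverse (real (Suc k))" "\<And>k. 0 \<le> t k" "\<And>k. 0 < h k"
        "\<And>k. h k < inverse (real (Suc k))" "\<And>k. t k + h k \<le> T" "\<And>k. \<bar>c k\<bar> < inverse (real (Suc k))"
        "\<And>k. \<not> \<bar>(Th M W \<mu> \<sigma> F (h k) (\<lambda>z. \<psi> z + c k) (t k, x k) - (\<phi> (t k, x k) + c k)) / h k - G\<bar> < e"
      by metis
    have z: "(\<lambda>k. (t k, x k)) \<longlonglongrightarrow> z0"
      using Lim_null_comparison[OF always_eventually LIMSEQ_inverse_real_of_nat, of "\<lambda>k. dist (t k, x k) z0"] s(1)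
      by (subst tendsto_dist_iff) (simp add: less_imp_le)
    have h0: "h \<longlonglongrightarrow> 0"
      using Lim_null_comparison[OF always_eventually LIMSEQ_inverse_real_of_nat, of h] s(3,4) by (simp add: less_imp_le)
    have c0: "c \<longlonglongrightarrow> 0"
      using Lim_null_comparison[OF always_eventually LIMSEQ_inverse_real_of_nat, of c] s(6) by (simp add: less_imp_le)
    have "(\<lambda>k. (Th M W \<mu> \<sigma> F (h k) (\<lambda>z. \<psi> z + c k) (t k, x k) - (\<phi> (t k, x k) + c k)) / h k) \<longlonglongrightarrow> G"
      unfolding G_def by (rule scheme_consistent_seq[OF C z0 r0 \<psi> \<psi>b \<psi>m z s(2,3,5) h0 c0])
    from tendstoD[OF this e] obtain k where "\<bar>(Th M W \<mu> \<sigma> F (h k) (\<lambda>z. \<psi> z + c k) (t k, x k) - (\<phi> (t k, x k) + c k)) / h k - G\<bar> < e"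
      unfolding dist_real_def eventually_sequentially by blast
    then show False using s(7) by blast
  qed
  then show ?thesis using that unfolding G_def by blast
qed

end

section \<open>Relaxed limits\<close>

definition grid_pts :: "real \<Rightarrow> nat \<Rightarrow> (real \<times> (real^'d)) set" where
  "grid_pts T n = {z. \<exists>i\<le>n. fst z = grid T n i}"

text \<open>The constants that eventually bound \<open>w\<close> near \<open>z\<close>, so their
  infimum is the upper limit over \<open>n\<close> tending to infinity and grid points tending to
  \<open>z\<close>. Off-grid values are excluded because the scheme does not determine them.\<close>

definition uplim_bounds :: "real \<Rightarrow> (nat \<Rightarrow> real \<times> (real^'d) \<Rightarrow> real) \<Rightarrow> real \<times> (real^'d) \<Rightarrow> real set" where
  "uplim_bounds T w z = {c. \<exists>e>0. \<exists>N. \<forall>n\<ge>N. \<forall>y\<in>grid_pts T n. dist y z < e \<longrightarrow> w n y \<le> c}"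

definition uplim :: "real \<Rightarrow> (nat \<Rightarrow> real \<times> (real^'d) \<Rightarrow> real) \<Rightarrow> real \<times> (real^'d) \<Rightarrow> real" where
  "uplim T w z = Inf (uplim_bounds T w z)"

lemma grid_pts_cylinder:
  assumes "T > 0" "n \<ge> 1"
  shows "grid_pts T n \<subseteq> cylinder T"
proof
  fix z assume "z \<in> grid_pts T n"
  then obtain i where i: "i \<le> n" "fst z = grid T n i" by (auto simp: grid_pts_def)
  have "0 \<le> grid T n i" using assms by (simp add: grid_def)
  moreover have "real i * (T / real n) \<le> real n * (T / real n)" using i assms by (intro mult_right_mono) auto
  ultimately show "z \<in> cylinder T" using i assms by (cases z) (auto simp: grid_def)
qed

text \<open>Without grid points near \<open>z\<close> every real number would be an eventual bound,
  and the infimum would lose its meaning.\<close>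

lemma grid_pts_dense:
  assumes T: "T > 0" and z: "z \<in> cylinder T" and e: "e > 0"
  shows "\<exists>N. \<forall>n\<ge>N. \<exists>y\<in>grid_pts T n. dist y z < e"
proof -
  obtain t x where tx: "z = (t, x)" "0 \<le> t" "t \<le> T" using z by auto
  obtain N where N: "T / e < real N" using reals_Archimedean2 by blast
  show ?thesis
  proof (intro exI[of _ "max N 1"] allI impI)
    fix n assume n: "n \<ge> max N 1"
    define i where "i = nat \<lfloor>t * real n / T\<rfloor>"
    have q: "0 \<le> t * real n / T" using tx T by simp
    have i1: "real i \<le> t * real n / T" "t * real n / T < real i + 1"
      unfolding i_def using q by linarith+
    have "t * real n / T \<le> real n" using tx T by (simp add: field_simps mult_right_mono)
    then have "i \<le> n" using i1 by linarith
    moreover have "dist (grid T n i) t < e"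
    proof -
      have n0: "real n > 0" using n by simp
      have "real i * (T / real n) \<le> t" using i1(1) T n0 by (simp add: field_simps)
      moreover have "t < real i * (T / real n) + T / real n" using i1(2) T n0 by (simp add: field_simps)
      moreover have "T / real n < e"
      proof -
        have "T / e < real n" using N n by simp
        then show ?thesis using e n0 by (simp add: field_simps)
      qed
      ultimately show ?thesis by (simp add: grid_def dist_real_def)
    qed
    ultimately show "\<exists>y\<in>grid_pts T n. dist y z < e"
      by (intro bexI[of _ "(grid T n i, x)"]) (auto simp: tx grid_pts_def dist_Pair_Pair)
  qed
qed

text \<open>Kept abstract because it is applied both to \<open>v^h\<close> and to
  \<open>-v^h\<close>; the lower relaxed limit is minus the upper one of the second family.\<close>

locale bounded_family =
  fixes T :: real and w :: "nat \<Rightarrow> real \<times> (real^'d) \<Rightarrow> real" and C :: real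
  assumes T: "T > 0" and w_bound: "\<And>n y. n \<ge> 1 \<Longrightarrow> y \<in> grid_pts T n \<Longrightarrow> \<bar>w n y\<bar> \<le> C"
begin

lemma C_in_bounds: "C \<in> uplim_bounds T w z"
  unfolding uplim_bounds_def using w_bound by (auto simp: abs_le_iff intro!: exI[of _ 1])

lemma bounds_ge:
  assumes z: "z \<in> cylinder T" and c: "c \<in> uplim_bounds T w z"
  shows "- C \<le> c"
proof -
  obtain e N where e: "e > 0" and N: "\<And>n y. n \<ge> N \<Longrightarrow> y \<in> grid_pts T n \<Longrightarrow> dist y z < e \<Longrightarrow> w n y \<le> c"
    using c by (auto simp: uplim_bounds_def)
  obtain N' where N': "\<And>n. n \<ge> N' \<Longrightarrow> \<exists>y\<in>grid_pts T n. dist y z < e" using grid_pts_dense[OF T z e] by blast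
  define n where "n = max 1 (max N N')"
  have "n \<ge> N'" by (simp add: n_def)
  then obtain y where "y \<in> grid_pts T n" "dist y z < e" using N' by blast
  then have "w n y \<le> c" "\<bar>w n y\<bar> \<le> C" using N[of n y] w_bound[of n y] by (auto simp: n_def)
  then show ?thesis by linarith
qed

lemma bdd_below_bounds: "z \<in> cylinder T \<Longrightarrow> bdd_below (uplim_bounds T w z)"
  using bounds_ge by (intro bdd_belowI[of _ "- C"]) auto

lemma uplim_bound: "z \<in> cylinder T \<Longrightarrow> \<bar>uplim T w z\<bar> \<le> C"
proof -
  assume z: "z \<in> cylinder T"
  have "uplim T w z \<le> C" unfolding uplim_def by (rule cInf_lower[OF C_in_bounds bdd_below_bounds[OF z]])
  moreover have "- C \<le> uplim T w z" unfolding uplim_def using C_in_bounds[of z] bounds_ge[OF z] by (intro cInf_greatest) auto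
  ultimately show ?thesis by simp
qed

lemma uplim_less:
  assumes "uplim T w z < c"
  obtains c' e N where "c' < c" "e > 0" "\<And>n y. n \<ge> N \<Longrightarrow> y \<in> grid_pts T n \<Longrightarrow> dist y z < e \<Longrightarrow> w n y \<le> c'"
proof -
  obtain c' where "c' \<in> uplim_bounds T w z" "c' < c"
    using assms C_in_bounds[of z] cInf_lessD[of "uplim_bounds T w z" c] unfolding uplim_def by auto
  then show ?thesis using that unfolding uplim_bounds_def by blast
qed

lemma uplim_greater:
  assumes z: "z \<in> cylinder T" and c: "c < uplim T w z" and e: "e > 0"
  obtains n y where "n \<ge> N" "y \<in> grid_pts T n" "dist y z < e" "c < w n y"
proof -
  have "c \<notin> uplim_bounds T w z"
    using c cInf_lower[OF _ bdd_below_bounds[OF z], of c] unfolding uplim_def by auto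
  then have "\<exists>n\<ge>N. \<exists>y\<in>grid_pts T n. dist y z < e \<and> \<not> w n y \<le> c" using e unfolding uplim_bounds_def by blast
  then show ?thesis using that by auto
qed

text \<open>An eventual bound on a ball around \<open>z\<close> is one on half-size balls around the
  nearby points.\<close>

lemma usc_uplim: "usc_on (cylinder T) (uplim T w)"
  unfolding usc_on_def
proof (intro ballI allI impI)
  fix z c assume z: "z \<in> cylinder T" and c: "uplim T w z < c"
  obtain c' e N where c': "c' < c" "e > 0" and N: "\<And>n y. n \<ge> N \<Longrightarrow> y \<in> grid_pts T n \<Longrightarrow> dist y z < e \<Longrightarrow> w n y \<le> c'"
    using uplim_less[OF c] by metis
  have "uplim T w z' < c" if z': "z' \<in> cylinder T" "dist z' z < e / 2" for z'
  proof -
    have "c' \<in> uplim_bounds T w z'"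
      unfolding uplim_bounds_def
    proof (intro CollectI exI[of _ "e / 2"] conjI exI[of _ N] allI impI ballI)
      fix n y assume "n \<ge> N" "y \<in> grid_pts T n" "dist y z' < e / 2"
      then show "w n y \<le> c'" using dist_triangle[of y z z'] z' by (intro N) auto
    qed (use c' in simp)
    then have "uplim T w z' \<le> c'" unfolding uplim_def by (rule cInf_lower[OF _ bdd_below_bounds[OF z'(1)]])
    then show ?thesis using c' by simp
  qed
  then show "\<forall>\<^sub>F y in at z within cylinder T. uplim T w y < c"
    unfolding eventually_at using c' by (intro exI[of _ "e / 2"]) auto
qed

text \<open>The source of local uniformity: near each point an eventual bound lies strictly below
  the continuous function, and finitely many such neighbourhoods cover the compact set.\<close>

lemma uplim_compact:
  assumes K: "compact K" "K \<subseteq> cylinder T" and \<Phi>: "continuous_on K \<Phi>" and lt: "\<And>z. z \<in> K \<Longrightarrow> uplim T w z < \<Phi> z"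
  obtains N where "\<And>n y. n \<ge> N \<Longrightarrow> y \<in> grid_pts T n \<Longrightarrow> y \<in> K \<Longrightarrow> w n y < \<Phi> y"
proof -
  have "\<exists>e>0. \<exists>N. \<forall>n\<ge>N. \<forall>y\<in>grid_pts T n. y \<in> K \<and> dist y z < e \<longrightarrow> w n y < \<Phi> y" if z: "z \<in> K" for z
  proof -
    obtain c' e N where c': "c' < \<Phi> z" "e > 0" and N: "\<And>n y. n \<ge> N \<Longrightarrow> y \<in> grid_pts T n \<Longrightarrow> dist y z < e \<Longrightarrow> w n y \<le> c'"
      using uplim_less[OF lt[OF z]] by metis
    obtain d where d: "d > 0" "\<And>y. y \<in> K \<Longrightarrow> dist y z < d \<Longrightarrow> dist (\<Phi> y) (\<Phi> z) < \<Phi> z - c'"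
      using \<Phi> z c' unfolding continuous_on_iff by (metis diff_gt_0_iff_gt)
    show ?thesis
    proof (intro exI[of _ "min e d"] conjI exI[of _ N] allI impI ballI)
      fix n y assume "n \<ge> N" "y \<in> grid_pts T n" "y \<in> K \<and> dist y z < min e d"
      then have "w n y \<le> c'" "\<bar>\<Phi> y - \<Phi> z\<bar> < \<Phi> z - c'" using N[of n y] d(2)[of y] by (auto simp: dist_real_def)
      then show "w n y < \<Phi> y" by linarith
    qed (use c' d in simp)
  qed
  then obtain e N where e: "\<And>z. z \<in> K \<Longrightarrow> e z > 0" and N: "\<And>z n y. z \<in> K \<Longrightarrow> n \<ge> N z \<Longrightarrow> y \<in> grid_pts T n \<Longrightarrow> y \<in> K \<Longrightarrow> dist y z < e z \<Longrightarrow> w n y < \<Phi> y"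
    by metis
  have "K \<subseteq> (\<Union>z\<in>K. ball z (e z))" using e by force
  then obtain J where J: "J \<subseteq> K" "finite J" "K \<subseteq> (\<Union>z\<in>J. ball z (e z))"
    using compactE_image[OF K(1), of K "\<lambda>z. ball z (e z)"] by (metis open_ball)
  show ?thesis
  proof (rule that[of "Max (insert 0 (N ` J))"])
    fix n y assume n: "n \<ge> Max (insert 0 (N ` J))" and y: "y \<in> grid_pts T n" "y \<in> K"
    obtain z where z: "z \<in> J" "y \<in> ball z (e z)" using J(3) y(2) by blast
    have "N z \<le> Max (insert 0 (N ` J))" using J(2) z by (intro Max_ge) auto
    then show "w n y < \<Phi> y" using N[of z n y] z J(1) n y by (auto simp: dist_commute)
  qed
qed

text \<open>The quartic term makes the contact strict and the constant \<open>C + 2\<close> keeps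
  distant grid points away, so the smallest admissible shift \<open>c\<close> is nearly attained
  close to \<open>z0\<close>. The slack \<open>\<eta>\<close> is left to the application, which
  needs it smaller than the gain of one time step.\<close>

lemma near_touching:
  fixes \<phi> \<psi> :: "real \<times> (real^'d) \<Rightarrow> real" and \<eta> :: "nat \<Rightarrow> real"
  assumes \<phi>: "continuous_on (cylinder T) \<phi>" and z0: "z0 \<in> cylinder T"
    and le: "\<And>z. z \<in> cylinder T \<Longrightarrow> uplim T w z \<le> \<phi> z" and eq: "uplim T w z0 = \<phi> z0"
    and \<psi>: "\<And>z. \<psi> z = (if dist z z0 \<le> 1 then \<phi> z + dist z z0 ^ 4 else C + 2)"
    and r: "r > 0" and \<eta>: "\<And>n. n \<ge> 1 \<Longrightarrow> \<eta> n > 0"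
  obtains n y c where "n \<ge> N" "n \<ge> 1" "y \<in> grid_pts T n" "\<bar>c\<bar> < r" "dist y z0 < r"
    "\<And>y'. y' \<in> grid_pts T n \<Longrightarrow> w n y' \<le> \<psi> y' + c" "w n y > \<psi> y + c - \<eta> n"
proof -
  define r' where "r' = min r 1"
  have r': "r' > 0" "r' \<le> 1" "r' \<le> r" using r by (auto simp: r'_def)
  \<comment> \<open>At distance \<open>r'\<close> or more the quartic term exceeds
    \<open>2 \<kappa>\<close> and pushes \<open>w n - \<psi>\<close> below
    \<open>-2 \<kappa>\<close>, whereas a grid point near \<open>z0\<close> reaches more than
    \<open>-\<kappa>\<close>.\<close>
  define \<kappa> where "\<kappa> = min (r' / 2) (r' ^ 4 / 4)"
  have \<kappa>: "\<kappa> > 0" "\<kappa> \<le> r' / 2" "2 * \<kappa> < r' ^ 4" using r' by (auto simp: \<kappa>_def min_def)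
  define \<psi>' where "\<psi>' = (\<lambda>z. \<phi> z + dist z z0 ^ 4)"
  have \<psi>'c: "continuous_on (cylinder T) \<psi>'" unfolding \<psi>'_def by (intro continuous_intros \<phi>)
  define K where "K = cylinder T \<inter> cball z0 1"
  have "closed (cylinder T :: (real \<times> (real^'d)) set)" by (intro closed_Times) auto
  then have K: "compact K" "K \<subseteq> cylinder T" unfolding K_def by (auto intro: closed_Int_compact)
  have K2: "compact (K - ball z0 r')" using K by (intro compact_diff) auto
  have cK: "continuous_on K (\<lambda>z. \<psi>' z + \<kappa>)" "continuous_on (K - ball z0 r') (\<lambda>z. \<psi>' z - 2 * \<kappa>)"
    using K by (auto intro!: continuous_intros continuous_on_subset[OF \<psi>'c])
  have "uplim T w z < \<psi>' z + \<kappa>" if "z \<in> K" for z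
  proof -
    have "uplim T w z \<le> \<phi> z" using le K that by blast
    moreover have "0 \<le> dist z z0 ^ 4" by simp
    ultimately show ?thesis using \<kappa>(1,3) unfolding \<psi>'_def by linarith
  qed
  from uplim_compact[OF K cK(1) this] obtain N1 where N1: "\<And>n y. n \<ge> N1 \<Longrightarrow> y \<in> grid_pts T n \<Longrightarrow> y \<in> K \<Longrightarrow> w n y < \<psi>' y + \<kappa>" by metis
  have "uplim T w z < \<psi>' z - 2 * \<kappa>" if "z \<in> K - ball z0 r'" for z
  proof -
    have "uplim T w z \<le> \<phi> z" using le K that by blast
    moreover have "r' ^ 4 \<le> dist z z0 ^ 4" using that r' by (intro power_mono) (auto simp: dist_commute)
    ultimately show ?thesis using \<kappa>(1,3) unfolding \<psi>'_def by linarith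
  qed
  from uplim_compact[OF K2 _ cK(2) this] K obtain N2 where N2: "\<And>n y. n \<ge> N2 \<Longrightarrow> y \<in> grid_pts T n \<Longrightarrow> y \<in> K - ball z0 r' \<Longrightarrow> w n y < \<psi>' y - 2 * \<kappa>" by blast
  obtain d where d: "d > 0" "\<And>y. y \<in> cylinder T \<Longrightarrow> dist y z0 < d \<Longrightarrow> dist (\<psi>' y) (\<psi>' z0) < \<kappa> / 2"
    using \<psi>'c z0 \<kappa> unfolding continuous_on_iff by (metis half_gt_zero)
  have lt: "\<phi> z0 - \<kappa> / 2 < uplim T w z0" using eq \<kappa> by simp
  obtain n y1 where n: "n \<ge> max (max N 1) (max N1 N2)" and y1: "y1 \<in> grid_pts T n" "dist y1 z0 < min d 1" "\<phi> z0 - \<kappa> / 2 < w n y1"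
    using uplim_greater[OF z0 lt, of "min d 1" "max (max N 1) (max N1 N2)"] d(1) by auto
  have n1: "n \<ge> 1" using n by simp
  have gc: "y \<in> cylinder T" if "y \<in> grid_pts T n" for y using grid_pts_cylinder[OF T n1] that by blast
  have \<psi>K: "\<psi> y = \<psi>' y" if "y \<in> K" for y using that by (simp add: \<psi> \<psi>'_def K_def dist_commute)
  \<comment> \<open>The excess 2 in the cut-off value gives a gap larger than
    \<open>2 \<kappa>\<close>, as \<open>\<kappa>\<close> is at most one half.\<close>
  have out: "w n y \<le> \<psi> y - 2" if "y \<in> grid_pts T n" "y \<notin> K" for y
    using w_bound[OF n1 that(1)] gc[OF that(1)] that(2) by (simp add: \<psi> K_def dist_commute)
  define S where "S = (\<lambda>y. w n y - \<psi> y) ` grid_pts T n"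
  have S_le: "s \<le> \<kappa>" if sS: "s \<in> S" for s
  proof -
    obtain y where y: "y \<in> grid_pts T n" "s = w n y - \<psi> y" using sS unfolding S_def by blast
    show ?thesis
    proof (cases "y \<in> K")
      case True
      then show ?thesis using N1[of n y] y n \<psi>K by auto
    next
      case False
      then show ?thesis using out[of y] y \<kappa> by auto
    qed
  qed
  have bdd: "bdd_above S" using S_le by (rule bdd_aboveI)
  define c where "c = Sup S"
  have y1c: "y1 \<in> cylinder T" by (rule gc[OF y1(1)])
  then have y1K: "y1 \<in> K" using y1(2) by (simp add: K_def dist_commute)
  have "\<bar>\<psi>' y1 - \<psi>' z0\<bar> < \<kappa> / 2" using d(2)[OF y1c] y1(2) by (simp add: dist_real_def)
  moreover have "\<psi>' z0 = \<phi> z0" by (simp add: \<psi>'_def)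
  ultimately have s1: "w n y1 - \<psi> y1 > - \<kappa>" using y1(3) \<psi>K[OF y1K] by linarith
  have c1: "c \<ge> w n y1 - \<psi> y1" unfolding c_def S_def using y1 bdd by (intro cSup_upper) (auto simp: S_def)
  have c2: "c \<le> \<kappa>" unfolding c_def using S_le y1 by (intro cSup_least) (auto simp: S_def)
  \<comment> \<open>Capping the slack at \<open>\<kappa>\<close> keeps the near-maximiser above
    \<open>-2 \<kappa>\<close>, hence inside the small ball.\<close>
  have "c - min (\<eta> n) \<kappa> < Sup S" using \<eta>[OF n1] \<kappa> by (simp add: c_def)
  then obtain s where "s \<in> S" "c - min (\<eta> n) \<kappa> < s"
    using less_cSupD[of S] y1 by (auto simp: S_def)
  then obtain y where y: "y \<in> grid_pts T n" "c - min (\<eta> n) \<kappa> < w n y - \<psi> y" by (auto simp: S_def)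
  have yg: "w n y - \<psi> y > - 2 * \<kappa>" using y c1 s1 by linarith
  have "y \<in> K" using out[OF y(1)] yg \<kappa> r' by (cases "y \<in> K") auto
  moreover have "y \<notin> K - ball z0 r'" using N2[of n y] y(1) n yg \<psi>K by fastforce
  ultimately have "dist y z0 < r'" by (simp add: dist_commute)
  show ?thesis
  proof (rule that[of n y c])
    show "n \<ge> N" "n \<ge> 1" using n by auto
    show "\<bar>c\<bar> < r" using c1 c2 s1 \<kappa> r' by auto
    show "dist y z0 < r" using \<open>dist y z0 < r'\<close> r' by simp
    show "w n y > \<psi> y + c - \<eta> n" using y(2) by linarith
    fix y' :: "real \<times> (real^'d)" assume "y' \<in> grid_pts T n"
    then have "w n y' - \<psi> y' \<le> c" unfolding c_def using bdd by (intro cSup_upper) (auto simp: S_def)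
    then show "w n y' \<le> \<psi> y' + c" by simp
  qed (rule y(1))
qed

end

text \<open>If there were no maximum, every \<open>z\<close> would have a fixed competitor beating a
  whole neighbourhood of \<open>z\<close>. Finitely many neighbourhoods cover the compact set, and
  the best of the finitely many competitors would itself be beaten by one of them.\<close>

lemma usc_attains_max:
  fixes u :: "'a::metric_space \<Rightarrow> real"
  assumes K: "compact K" "K \<noteq> {}" and KS: "K \<subseteq> S" and u: "usc_on S u" and \<Phi>: "continuous_on S \<Phi>"
  shows "\<exists>z\<in>K. \<forall>y\<in>K. u y + \<Phi> y \<le> u z + \<Phi> z"
proof (rule ccontr)
  assume neg: "\<not> ?thesis"
  define f where "f = (\<lambda>z. u z + \<Phi> z)"
  have "\<exists>z'\<in>K. f z < f z'" if "z \<in> K" for z using neg that unfolding f_def by (meson not_le)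
  then obtain m where m: "\<And>z. z \<in> K \<Longrightarrow> m z \<in> K" "\<And>z. z \<in> K \<Longrightarrow> f z < f (m z)" by metis
  have "\<exists>e>0. \<forall>y\<in>K. dist y z < e \<longrightarrow> f y < f (m z)" if z: "z \<in> K" for z
  proof -
    define a where "a = (f (m z) - f z) / 2"
    have a: "a > 0" using m(2)[OF z] by (simp add: a_def)
    have "\<forall>\<^sub>F y in at z within S. u y < u z + a" using u z KS a by (auto simp: usc_on_def)
    then obtain d1 where d1: "d1 > 0" "\<And>y. y \<in> S \<Longrightarrow> y \<noteq> z \<Longrightarrow> dist y z < d1 \<Longrightarrow> u y < u z + a"
      by (auto simp: eventually_at)
    obtain d2 where d2: "d2 > 0" "\<And>y. y \<in> S \<Longrightarrow> dist y z < d2 \<Longrightarrow> dist (\<Phi> y) (\<Phi> z) < a"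
      using \<Phi> z KS a unfolding continuous_on_iff by (meson subsetD)
    show ?thesis
    proof (intro exI[of _ "min d1 d2"] conjI ballI impI)
      fix y assume y: "y \<in> K" "dist y z < min d1 d2"
      then have 1: "\<bar>\<Phi> y - \<Phi> z\<bar> < a" using d2(2)[of y] KS by (auto simp: dist_real_def)
      have 2: "u y < u z + a" using d1(2)[of y] y KS a by (cases "y = z") auto
      have "f y < f z + 2 * a" using 1 2 unfolding f_def by linarith
      moreover have "2 * a = f (m z) - f z" by (simp add: a_def)
      ultimately show "f y < f (m z)" by linarith
    qed (use d1 d2 in simp)
  qed
  then obtain e where e: "\<And>z. z \<in> K \<Longrightarrow> e z > 0" "\<And>z y. z \<in> K \<Longrightarrow> y \<in> K \<Longrightarrow> dist y z < e z \<Longrightarrow> f y < f (m z)" by metis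
  have "K \<subseteq> (\<Union>z\<in>K. ball z (e z))" using e(1) by force
  then obtain J where J: "J \<subseteq> K" "finite J" "K \<subseteq> (\<Union>z\<in>J. ball z (e z))"
    using compactE_image[OF K(1), of K "\<lambda>z. ball z (e z)"] by (metis open_ball)
  have J0: "J \<noteq> {}" using J(3) K(2) by auto
  define b where "b = Max ((\<lambda>z. f (m z)) ` J)"
  have "b \<in> (\<lambda>z. f (m z)) ` J" unfolding b_def using J J0 by (intro Max_in) auto
  then obtain z where z: "z \<in> J" "b = f (m z)" by auto
  have "m z \<in> K" using m J z by blast
  then obtain z' where z': "z' \<in> J" "m z \<in> ball z' (e z')" using J(3) by blast
  then have "f (m z) < f (m z')" using e(2)[of z' "m z"] J \<open>m z \<in> K\<close> by (auto simp: dist_commute)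
  also have "f (m z') \<le> b" unfolding b_def using J z' by (intro Max_ge) auto
  finally show False using z by simp
qed

section \<open>Test functions\<close>

lemma C_diff_SucD: "C_diff (Suc k) f \<Longrightarrow> C_diff k f"
proof (induction k arbitrary: f)
  case 0
  then show ?case by (auto intro!: continuous_at_imp_continuous_on differentiable_imp_continuous_within)
next
  case (Suc k)
  then show ?case by (metis C_diff.simps(2))
qed

lemma C_diff_const: "C_diff k (\<lambda>x. c)"
  by (induction k arbitrary: c) auto

lemma C_diff_bounded_linear: "bounded_linear f \<Longrightarrow> C_diff k f"
proof (cases k)
  case 0
  assume "bounded_linear f"
  then show ?thesis using 0 by (simp add: linear_continuous_on)
next
  case (Suc j)
  assume f: "bounded_linear f"
  have d: "(f has_derivative f) (at x)" for x by (rule bounded_linear_imp_has_derivative[OF f])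
  then have "f differentiable (at x)" for x by (auto simp: differentiable_def)
  moreover have "frechet_derivative f (at x) v = f v" for x v using frechet_derivative_at[OF d[of x]] by simp
  ultimately show ?thesis using Suc by (simp add: C_diff_const)
qed

lemma C_diff_add: "C_diff k f \<Longrightarrow> C_diff k g \<Longrightarrow> C_diff k (\<lambda>x. f x + g x)"
proof (induction k arbitrary: f g)
  case 0
  then show ?case by (auto intro: continuous_intros)
next
  case (Suc k)
  have d: "((\<lambda>x. f x + g x) has_derivative (\<lambda>v. frechet_derivative f (at x) v + frechet_derivative g (at x) v)) (at x)" for x
    using Suc.prems by (intro has_derivative_add) (auto simp: frechet_derivative_works[symmetric])
  have "frechet_derivative (\<lambda>x. f x + g x) (at x) v = frechet_derivative f (at x) v + frechet_derivative g (at x) v" for x v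
    using frechet_derivative_at[OF d[of x]] by metis
  moreover have "(\<lambda>x. f x + g x) differentiable (at x)" for x using d[of x] by (auto simp: differentiable_def)
  ultimately show ?case using Suc.prems by (simp add: Suc.IH)
qed

lemma C_diff_mult: "C_diff k f \<Longrightarrow> C_diff k g \<Longrightarrow> C_diff k (\<lambda>x. f x * g x)"
proof (induction k arbitrary: f g)
  case 0
  then show ?case by (auto intro: continuous_intros)
next
  case (Suc k)
  have d: "((\<lambda>x. f x * g x) has_derivative (\<lambda>v. f x * frechet_derivative g (at x) v + frechet_derivative f (at x) v * g x)) (at x)" for x
    using Suc.prems by (intro has_derivative_mult) (auto simp: frechet_derivative_works[symmetric])
  have "frechet_derivative (\<lambda>x. f x * g x) (at x) v = f x * frechet_derivative g (at x) v + frechet_derivative f (at x) v * g x" for x v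
    using frechet_derivative_at[OF d[of x]] by metis
  moreover have "(\<lambda>x. f x * g x) differentiable (at x)" for x using d[of x] by (auto simp: differentiable_def)
  moreover have "C_diff k f" "C_diff k g" using Suc.prems by (auto intro: C_diff_SucD)
  ultimately show ?case using Suc.prems by (simp add: Suc.IH C_diff_add)
qed

lemma smooth_const: "smooth (\<lambda>x. c)"
  by (simp add: smooth_def C_diff_const)

lemma smooth_bounded_linear: "bounded_linear f \<Longrightarrow> smooth f"
  by (simp add: smooth_def C_diff_bounded_linear)

lemma smooth_add: "smooth f \<Longrightarrow> smooth g \<Longrightarrow> smooth (\<lambda>x. f x + g x)"
  by (simp add: smooth_def C_diff_add)

lemma smooth_mult: "smooth f \<Longrightarrow> smooth g \<Longrightarrow> smooth (\<lambda>x. f x * g x)"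
  by (simp add: smooth_def C_diff_mult)

lemma smooth_sum: "finite I \<Longrightarrow> (\<And>i. i \<in> I \<Longrightarrow> smooth (f i)) \<Longrightarrow> smooth (\<lambda>x. \<Sum>i\<in>I. f i x)"
  by (induction I rule: finite_induct) (auto intro: smooth_const smooth_add)

section \<open>Symmetry of second derivatives and the derivatives in time and space\<close>

text \<open>Schwarz's theorem: the second difference is symmetric in the two directions, and two
  applications of the mean value theorem identify its scaled limit with an iterated
  derivative.\<close>

lemma C_diff_symmetric_second_derivative_limit:
  fixes f :: "'a::real_normed_vector \<Rightarrow> real"
  assumes f: "C_diff 2 f"
  shows "(\<lambda>n. (f (z + inverse (real (Suc n)) *\<^sub>R v + inverse (real (Suc n)) *\<^sub>R w) - f (z + inverse (real (Suc n)) *\<^sub>R v)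
      - f (z + inverse (real (Suc n)) *\<^sub>R w) + f z) / (inverse (real (Suc n)))\<^sup>2)
    \<longlonglongrightarrow> frechet_derivative (\<lambda>x. frechet_derivative f (at x) v) (at z) w"
proof -
  define D where "D = (\<lambda>x. frechet_derivative f (at x) v)"
  define D2 where "D2 = (\<lambda>x. frechet_derivative D (at x) w)"
  define h where "h = (\<lambda>n. inverse (real (Suc n)))"
  have h: "h n > 0" for n by (simp add: h_def)
  have h0: "h \<longlonglongrightarrow> 0" unfolding h_def by (rule LIMSEQ_inverse_real_of_nat)
  have fd: "(f has_derivative frechet_derivative f (at x)) (at x)" for x
    using f by (simp add: numeral_2_eq_2 frechet_derivative_works)
  have Dd: "(D has_derivative frechet_derivative D (at x)) (at x)" for x
    using f unfolding D_def by (simp add: numeral_2_eq_2 frechet_derivative_works)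
  have D2c: "continuous_on UNIV D2"
    using f unfolding D2_def D_def by (simp add: numeral_2_eq_2)
  have ray: "((\<lambda>s. a + s *\<^sub>R b) has_derivative (\<lambda>s. s *\<^sub>R b)) (at s)" for a b :: 'a and s :: real
    by (auto intro!: derivative_eq_intros)
  have fr: "((\<lambda>s. f (a + s *\<^sub>R v)) has_real_derivative D (a + s *\<^sub>R v)) (at s)" for a s
    using has_derivative_compose[OF ray fd] linear_cmul[OF has_derivative_linear[OF fd]]
    by (simp add: has_field_derivative_def D_def mult_commute_abs)
  have Dr: "((\<lambda>s. D (a + s *\<^sub>R w)) has_real_derivative D2 (a + s *\<^sub>R w)) (at s)" for a s
    using has_derivative_compose[OF ray Dd] linear_cmul[OF has_derivative_linear[OF Dd]]
    by (simp add: has_field_derivative_def D2_def mult_commute_abs)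
  have "\<exists>a b. 0 < a \<and> a < h n \<and> 0 < b \<and> b < h n \<and>
      f (z + h n *\<^sub>R v + h n *\<^sub>R w) - f (z + h n *\<^sub>R v) - f (z + h n *\<^sub>R w) + f z = (h n)\<^sup>2 * D2 (z + a *\<^sub>R v + b *\<^sub>R w)" for n
  proof -
    have "\<exists>a>0. a < h n \<and> (f ((z + h n *\<^sub>R w) + h n *\<^sub>R v) - f (z + h n *\<^sub>R v)) - (f ((z + h n *\<^sub>R w) + 0 *\<^sub>R v) - f (z + 0 *\<^sub>R v)) =
        (h n - 0) * (D ((z + h n *\<^sub>R w) + a *\<^sub>R v) - D (z + a *\<^sub>R v))"
      using h[of n] by (intro MVT2[where f = "\<lambda>s. f ((z + h n *\<^sub>R w) + s *\<^sub>R v) - f (z + s *\<^sub>R v)"] DERIV_diff fr)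
    then obtain a where a: "0 < a" "a < h n" "(f ((z + h n *\<^sub>R w) + h n *\<^sub>R v) - f (z + h n *\<^sub>R v)) - (f (z + h n *\<^sub>R w) - f z) =
        h n * (D ((z + h n *\<^sub>R w) + a *\<^sub>R v) - D (z + a *\<^sub>R v))" by auto
    have "\<exists>b>0. b < h n \<and> D ((z + a *\<^sub>R v) + h n *\<^sub>R w) - D ((z + a *\<^sub>R v) + 0 *\<^sub>R w) = (h n - 0) * D2 ((z + a *\<^sub>R v) + b *\<^sub>R w)"
      using h[of n] by (intro MVT2 Dr)
    then obtain b where b: "0 < b" "b < h n" "D ((z + a *\<^sub>R v) + h n *\<^sub>R w) - D (z + a *\<^sub>R v) = h n * D2 ((z + a *\<^sub>R v) + b *\<^sub>R w)" by auto
    have e: "z + h n *\<^sub>R w + a *\<^sub>R v = z + a *\<^sub>R v + h n *\<^sub>R w" "z + h n *\<^sub>R w + h n *\<^sub>R v = z + h n *\<^sub>R v + h n *\<^sub>R w"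
      by (simp_all add: add_ac)
    have "f (z + h n *\<^sub>R v + h n *\<^sub>R w) - f (z + h n *\<^sub>R v) - f (z + h n *\<^sub>R w) + f z = (h n)\<^sup>2 * D2 (z + a *\<^sub>R v + b *\<^sub>R w)"
      using a(3) b(3) unfolding e by (simp add: power2_eq_square)
    then show ?thesis using a b by blast
  qed
  then obtain a b where ab: "\<And>n. 0 < a n" "\<And>n. a n < h n" "\<And>n. 0 < b n" "\<And>n. b n < h n"
    "\<And>n. f (z + h n *\<^sub>R v + h n *\<^sub>R w) - f (z + h n *\<^sub>R v) - f (z + h n *\<^sub>R w) + f z = (h n)\<^sup>2 * D2 (z + a n *\<^sub>R v + b n *\<^sub>R w)"
    by metis
  have a0: "a \<longlonglongrightarrow> 0" and b0: "b \<longlonglongrightarrow> 0"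
    using Lim_null_comparison[OF always_eventually h0, of a] Lim_null_comparison[OF always_eventually h0, of b] ab(1-4)
    by (simp_all add: less_imp_le)
  have "(\<lambda>n. z + a n *\<^sub>R v + b n *\<^sub>R w) \<longlonglongrightarrow> z + 0 *\<^sub>R v + 0 *\<^sub>R w" by (intro tendsto_intros a0 b0)
  then have "(\<lambda>n. D2 (z + a n *\<^sub>R v + b n *\<^sub>R w)) \<longlonglongrightarrow> D2 z"
    by (intro continuous_on_tendsto_compose[OF D2c]) auto
  moreover have "(f (z + h n *\<^sub>R v + h n *\<^sub>R w) - f (z + h n *\<^sub>R v) - f (z + h n *\<^sub>R w) + f z) / (h n)\<^sup>2 = D2 (z + a n *\<^sub>R v + b n *\<^sub>R w)" for n
    using ab(5)[of n] h[of n] by simp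
  ultimately show ?thesis by (simp add: D2_def D_def h_def)
qed

lemma C_diff_symmetric_second_derivative:
  fixes f :: "'a::real_normed_vector \<Rightarrow> real"
  assumes f: "C_diff 2 f"
  shows "frechet_derivative (\<lambda>x. frechet_derivative f (at x) v) (at z) w = frechet_derivative (\<lambda>x. frechet_derivative f (at x) w) (at z) v"
proof -
  have "(\<lambda>n. (f (z + inverse (real (Suc n)) *\<^sub>R v + inverse (real (Suc n)) *\<^sub>R w) - f (z + inverse (real (Suc n)) *\<^sub>R v)
      - f (z + inverse (real (Suc n)) *\<^sub>R w) + f z) / (inverse (real (Suc n)))\<^sup>2)
    \<longlonglongrightarrow> frechet_derivative (\<lambda>x. frechet_derivative f (at x) w) (at z) v"
    using C_diff_symmetric_second_derivative_limit[OF f, of z w v] by (simp add: add_ac diff_diff_eq2 algebra_simps del: of_nat_Suc)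
  from LIMSEQ_unique[OF C_diff_symmetric_second_derivative_limit[OF f] this] show ?thesis .
qed

text \<open>Time and space derivatives are values of the joint derivative on \<open>(1, 0)\<close>
  and on the vectors \<open>(0, axis i 1)\<close>. Symmetry reconciles the index order of
  \<open>Dxx\<close>, whose first index is the direction of differentiation, with multiplication by
  a vector.\<close>

lemma smooth_C12:
  fixes \<phi> :: "real \<times> (real^'d) \<Rightarrow> real"
  assumes \<phi>: "smooth \<phi>"
  shows "C12 \<phi> (dt \<phi>) (Dx \<phi>) (Dxx \<phi>)"
proof -
  define D where "D = (\<lambda>v z. frechet_derivative \<phi> (at z) v)"
  have C: "C_diff k \<phi>" for k using \<phi> by (simp add: smooth_def)
  have CD: "C_diff k (D v)" for k v using C[of "Suc k"] unfolding D_def C_diff.simps by blast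
  have CDD: "C_diff k (\<lambda>z. frechet_derivative (D v) (at z) w)" for k v w using CD[of "Suc k" v] unfolding C_diff.simps by blast
  have d: "(\<phi> has_derivative (\<lambda>v. D v z)) (at z)" for z
  proof -
    have "\<phi> differentiable (at z)" using C[of "Suc 0"] unfolding C_diff.simps by blast
    then show ?thesis by (simp add: D_def frechet_derivative_works)
  qed
  have dD: "(D v has_derivative frechet_derivative (D v) (at z)) (at z)" for v z
  proof -
    have "D v differentiable (at z)" using CD[of "Suc 0" v] unfolding C_diff.simps by blast
    then show ?thesis by (simp add: frechet_derivative_works)
  qed
  have sub_t: "((\<lambda>s. (s, x)) has_derivative (\<lambda>s. (s, 0))) (at t)" for t :: real and x :: "real^'d"
    by (intro has_derivative_Pair has_derivative_ident has_derivative_const)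
  have sub_x: "((\<lambda>y. (t, y)) has_derivative (\<lambda>y. (0, y))) (at x)" for t :: real and x :: "real^'d"
    by (intro has_derivative_Pair has_derivative_ident has_derivative_const)
  have lin: "D (c *\<^sub>R v) z = c * D v z" for c v z
    using linear_cmul[OF has_derivative_linear[OF d[of z]], of c v] by simp
  have lsum: "g (0, \<eta>) = (\<Sum>i\<in>UNIV. g (0, axis i 1) * \<eta> $ i)" if g: "linear g" for g :: "real \<times> (real^'d) \<Rightarrow> real" and \<eta>
  proof -
    have lin0: "linear (\<lambda>\<eta>. g (0, \<eta>))"
    proof (rule linearI)
      fix a b :: "real^'d" and c :: real
      show "g (0, a + b) = g (0, a) + g (0, b)" using linear_add[OF g, of "(0, a)" "(0, b)"] by simp
      show "g (0, c *\<^sub>R a) = c *\<^sub>R g (0, a)" using linear_cmul[OF g, of c "(0, a)"] by simp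
    qed
    have "g (0, \<Sum>i\<in>UNIV. \<eta> $ i *\<^sub>R axis i 1) = (\<Sum>i\<in>UNIV. \<eta> $ i *\<^sub>R g (0, axis i 1))"
      using linear_sum[OF lin0, of "\<lambda>i. \<eta> $ i *\<^sub>R axis i 1" UNIV] linear_cmul[OF lin0] by simp
    moreover have "(\<Sum>i\<in>UNIV. \<eta> $ i *\<^sub>R axis i 1) = \<eta>" using basis_expansion[of \<eta>] by (simp add: scalar_mult_eq_scaleR)
    ultimately show ?thesis by (simp add: mult.commute)
  qed
  have t_der: "((\<lambda>s. \<phi> (s, x)) has_real_derivative D (1, 0) (t, x)) (at t)" for t x
  proof -
    have "((\<lambda>s. \<phi> (s, x)) has_derivative (\<lambda>s. D (s, 0) (t, x))) (at t)"
      using has_derivative_compose[OF sub_t d] .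
    moreover have "(\<lambda>s. D (s, 0) (t, x)) = (*) (D (1, 0) (t, x))"
    proof
      fix s
      show "D (s, 0) (t, x) = D (1, 0) (t, x) * s" using lin[of s "(1, 0)"] by simp
    qed
    ultimately show ?thesis by (simp only: has_field_derivative_def)
  qed
  have dt_eq: "dt \<phi> = D (1, 0)" using DERIV_imp_deriv[OF t_der] by (auto simp: dt_def)
  have x_der: "((\<lambda>y. \<phi> (t, y)) has_derivative (\<lambda>\<eta>. D (0, \<eta>) (t, x))) (at x)" for t x
    using has_derivative_compose[OF sub_x d] .
  have Dx_i: "Dx \<phi> z $ i = D (0, axis i 1) z" for z i
    using frechet_derivative_at[OF x_der[of "fst z" "snd z"], symmetric] by (cases z) (simp add: Dx_def)
  have Dx_inner: "Dx \<phi> z \<bullet> \<eta> = D (0, \<eta>) z" for z \<eta>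
    using lsum[OF has_derivative_linear[OF d[of z]], of \<eta>] by (simp add: inner_vec_def Dx_i)
  have Dx_der_j: "((\<lambda>y. Dx \<phi> (t, y) $ j) has_derivative (\<lambda>\<eta>. frechet_derivative (D (0, axis j 1)) (at (t, x)) (0, \<eta>))) (at x)" for t x j
    unfolding Dx_i using has_derivative_compose[OF sub_x dD] .
  have Dxx_ij: "Dxx \<phi> z $ i $ j = frechet_derivative (D (0, axis j 1)) (at z) (0, axis i 1)" for z i j
    using frechet_derivative_at[OF Dx_der_j[of "fst z" j "snd z"], symmetric] by (cases z) (simp add: Dxx_def)
  have sym: "Dxx \<phi> z $ i $ j = Dxx \<phi> z $ j $ i" for z i j
    unfolding Dxx_ij D_def by (rule C_diff_symmetric_second_derivative[OF C])
  have Dxx_mult: "(Dxx \<phi> z *v \<eta>) $ j = frechet_derivative (D (0, axis j 1)) (at z) (0, \<eta>)" for z \<eta> j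
  proof -
    have "(Dxx \<phi> z *v \<eta>) $ j = (\<Sum>i\<in>UNIV. Dxx \<phi> z $ i $ j * \<eta> $ i)"
      unfolding matrix_vector_mult_def by (simp add: sym[of z j])
    then show ?thesis using lsum[OF has_derivative_linear[OF dD[of "(0, axis j 1)" z]], of \<eta>] by (simp add: Dxx_ij)
  qed
  have Dx_der: "((\<lambda>y. Dx \<phi> (t, y)) has_derivative (\<lambda>\<eta>. Dxx \<phi> (t, x) *v \<eta>)) (at x)" for t x
  proof -
    have "((\<lambda>y. Dx \<phi> (t, y) \<bullet> b) has_derivative (\<lambda>\<eta>. (Dxx \<phi> (t, x) *v \<eta>) \<bullet> b)) (at x)" if bB: "b \<in> Basis" for b
    proof -
      obtain j where "b = axis j 1" using bB by (auto simp: Basis_vec_def)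
      then show ?thesis using Dx_der_j[of t j x] by (simp add: inner_axis Dxx_mult)
    qed
    then show ?thesis by (subst has_derivative_componentwise_within) auto
  qed
  have "continuous_on UNIV \<phi>" "continuous_on UNIV (dt \<phi>)" using C[of 0] CD[of 0] by (simp_all add: dt_eq)
  moreover have "continuous_on UNIV (Dx \<phi>)"
  proof -
    have "continuous_on UNIV (\<lambda>z. \<chi> i. Dx \<phi> z $ i)"
      unfolding Dx_i using CD[of 0] by (intro continuous_intros) simp
    then show ?thesis by simp
  qed
  moreover have "continuous_on UNIV (Dxx \<phi>)"
  proof -
    have "continuous_on UNIV (\<lambda>z. \<chi> i j. Dxx \<phi> z $ i $ j)"
      unfolding Dxx_ij using CDD[of 0] by (intro continuous_intros) simp
    then show ?thesis by simp
  qed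
  moreover have "transpose (Dxx \<phi> z) = Dxx \<phi> z" for z
    using sym by (simp add: transpose_def vec_eq_iff)
  moreover have "((\<lambda>y. \<phi> (t, y)) has_derivative (\<lambda>\<eta>. Dx \<phi> (t, x) \<bullet> \<eta>)) (at x)" for t x
    using x_der by (simp add: Dx_inner)
  ultimately show ?thesis unfolding C12_def using t_der Dx_der by (simp add: dt_eq)
qed

lemma C12_derivatives:
  assumes "C12 \<phi> A p B"
  shows "dt \<phi> = A" "Dx \<phi> = p" "Dxx \<phi> = B"
proof -
  have t: "((\<lambda>s. \<phi> (s, x)) has_real_derivative A (t, x)) (at t)" and x: "((\<lambda>y. \<phi> (t, y)) has_derivative (\<lambda>\<eta>. p (t, x) \<bullet> \<eta>)) (at x)"
    and xx: "((\<lambda>y. p (t, y)) has_derivative (\<lambda>\<eta>. B (t, x) *v \<eta>)) (at x)" and sym: "transpose (B z) = B z" for t x z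
    using assms unfolding C12_def by blast+
  show "dt \<phi> = A" using DERIV_imp_deriv[OF t] by (auto simp: dt_def)
  show p: "Dx \<phi> = p"
    using frechet_derivative_at[OF x, symmetric] by (auto simp: Dx_def vec_eq_iff inner_axis)
  have "((\<lambda>y. p (t, y) $ j) has_derivative (\<lambda>\<eta>. (B (t, x) *v \<eta>) $ j)) (at x)" for t x j
    by (rule bounded_linear.has_derivative[OF bounded_linear_vec_nth xx])
  from frechet_derivative_at[OF this, symmetric]
  have "Dxx \<phi> (t, x) $ i $ j = B (t, x) $ j $ i" for t x i j
    unfolding Dxx_def p by (simp add: matrix_vector_mul_component inner_axis)
  moreover have "B (t, x) $ j $ i = B (t, x) $ i $ j" for t x i j
    using sym[of "(t, x)"] by (metis (no_types) transpose_def vec_lambda_beta)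
  ultimately show "Dxx \<phi> = B" by (auto simp: vec_eq_iff)
qed

lemma inner_fun_add: "(\<bullet>) (a + b) = (\<lambda>x. a \<bullet> x + b \<bullet> x)" and inner_fun_minus: "(\<bullet>) (- a) = (\<lambda>x. - (a \<bullet> x))"
  by (auto simp: inner_add_left)

lemma matrix_fun_add: "(*v) (A + B) = (\<lambda>x. A *v x + B *v x)" and matrix_fun_minus: "(*v) (- A) = (\<lambda>x. - (A *v x))"
  for A B :: "real^'d^'d"
  by (simp_all add: fun_eq_iff vec_eq_iff matrix_vector_mult_def sum_negf distrib_right sum.distrib)

lemma C12_add:
  assumes "C12 \<phi>1 A1 p1 B1" "C12 \<phi>2 A2 p2 B2"
  shows "C12 (\<lambda>z. \<phi>1 z + \<phi>2 z) (\<lambda>z. A1 z + A2 z) (\<lambda>z. p1 z + p2 z) (\<lambda>z. B1 z + B2 z)"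
  using assms unfolding C12_def
  by (auto simp: transpose_add inner_fun_add matrix_fun_add
      intro!: continuous_on_add DERIV_add has_derivative_add)

lemma C12_minus:
  assumes "C12 \<phi> A p B"
  shows "C12 (\<lambda>z. - \<phi> z) (\<lambda>z. - A z) (\<lambda>z. - p z) (\<lambda>z. - B z)"
proof -
  have "transpose (- M) = - transpose M" for M :: "real^'a^'a"
    by (simp add: transpose_def vec_eq_iff)
  then show ?thesis
    using assms unfolding C12_def
    by (auto simp: inner_fun_minus matrix_fun_minus intro!: continuous_on_minus DERIV_minus has_derivative_minus)
qed

text \<open>A perturbation which makes a touching point strict without changing the derivatives there.\<close>

lemma C12_quartic:
  fixes z0 :: "real \<times> (real^'d)"
  obtains A p B where "C12 (\<lambda>z. dist z z0 ^ 4) A p B" "A z0 = 0" "p z0 = 0" "B z0 = 0"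
proof -
  obtain t0 x0 where z0: "z0 = (t0, x0)" by (cases z0)
  define N where "N = (\<lambda>z::real \<times> (real^'d). (fst z - t0)\<^sup>2 + (snd z - x0) \<bullet> (snd z - x0))"
  have d4: "dist z z0 ^ 4 = (N z)\<^sup>2" for z
  proof -
    have "dist z z0 ^ 4 = ((dist z z0)\<^sup>2)\<^sup>2" by (simp add: power_mult[symmetric])
    also have "(dist z z0)\<^sup>2 = N z"
      by (cases z) (simp add: z0 N_def dist_Pair_Pair, simp add: dist_norm power2_norm_eq_inner)
    finally show ?thesis .
  qed
  define A where "A = (\<lambda>z. 4 * N z * (fst z - t0))"
  define p where "p = (\<lambda>z. (4 * N z) *\<^sub>R (snd z - x0))"
  define B where "B = (\<lambda>z. (4 * N z) *\<^sub>R mat 1 + 8 *\<^sub>R outer (snd z - x0))"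
  have N0: "N z0 = 0" by (simp add: N_def z0)
  have Nc: "continuous_on UNIV N" unfolding N_def by (intro continuous_intros)
  have "C12 (\<lambda>z. (N z)\<^sup>2) A p B"
    unfolding C12_def
  proof (intro conjI allI)
    show "continuous_on UNIV (\<lambda>z. (N z)\<^sup>2)" "continuous_on UNIV A" "continuous_on UNIV p" "continuous_on UNIV B"
      unfolding A_def p_def B_def by (intro continuous_intros Nc)+
    show "transpose (B z) = B z" for z
      by (simp add: B_def transpose_add transpose_scaleR transpose_outer transpose_mat)
    fix t :: real and x :: "real^'d"
    show "((\<lambda>s. (N (s, x))\<^sup>2) has_real_derivative A (t, x)) (at t)"
      unfolding N_def A_def by (auto intro!: derivative_eq_intros simp: algebra_simps)
    have Nx: "((\<lambda>y. N (t, y)) has_derivative (\<lambda>\<eta>. 2 * ((x - x0) \<bullet> \<eta>))) (at x)"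
      unfolding N_def by (auto intro!: derivative_eq_intros simp: inner_commute)
    show "((\<lambda>y. (N (t, y))\<^sup>2) has_derivative (\<lambda>\<eta>. p (t, x) \<bullet> \<eta>)) (at x)"
      using has_derivative_power[OF Nx, of 2] by (simp add: p_def mult_ac)
    have "((\<lambda>y. (4 * N (t, y)) *\<^sub>R (y - x0)) has_derivative (\<lambda>\<eta>. (4 * N (t, x)) *\<^sub>R \<eta> + (4 * (2 * ((x - x0) \<bullet> \<eta>))) *\<^sub>R (x - x0))) (at x)"
      by (intro has_derivative_scaleR has_derivative_mult_right Nx) (auto intro!: derivative_eq_intros)
    then show "((\<lambda>y. p (t, y)) has_derivative (\<lambda>\<eta>. B (t, x) *v \<eta>)) (at x)"
      by (simp add: p_def B_def matrix_vector_mult_add_rdistrib scaleR_matrix_vector_assoc[symmetric] outer_mult_vec mult.commute)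
  qed
  moreover have "A z0 = 0" "p z0 = 0" "B z0 = 0" using N0 by (auto simp: A_def p_def B_def z0 outer_def vec_eq_iff)
  ultimately show ?thesis using that by (simp add: d4)
qed

section \<open>The penalty at the terminal time\<close>

text \<open>\<open>b\<close> localises in space; \<open>k\<close> forces touching points towards
  \<open>T\<close> and supplies the time derivative \<open>-k\<close>; \<open>a\<close> is the level
  of contact.\<close>

definition pen :: "real \<Rightarrow> real \<Rightarrow> real \<Rightarrow> real \<Rightarrow> real^'d \<Rightarrow> real \<times> (real^'d) \<Rightarrow> real" where
  "pen T a b k x0 z = a + b * ((snd z - x0) \<bullet> (snd z - x0)) + k * (T - fst z)"

lemma C12_pen:
  fixes x0 :: "real^'d"
  shows "C12 (pen T a b k x0) (\<lambda>z. - k) (\<lambda>z. (2 * b) *\<^sub>R (snd z - x0)) (\<lambda>z. (2 * b) *\<^sub>R mat 1)"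
  unfolding C12_def
proof (intro conjI allI)
  show "continuous_on UNIV (pen T a b k x0)" unfolding pen_def by (intro continuous_intros)
  show "continuous_on UNIV (\<lambda>z::real \<times> (real^'d). - k)" "continuous_on UNIV (\<lambda>z::real \<times> (real^'d). (2 * b) *\<^sub>R (snd z - x0))"
    "continuous_on UNIV (\<lambda>z::real \<times> (real^'d). (2 * b) *\<^sub>R (mat 1 :: real^'d^'d))" by (intro continuous_intros)+
  show "transpose ((2 * b) *\<^sub>R mat 1) = (2 * b) *\<^sub>R (mat 1 :: real^'d^'d)" by (simp add: transpose_scaleR transpose_mat)
  fix t :: real and x :: "real^'d"
  show "((\<lambda>s. pen T a b k x0 (s, x)) has_real_derivative - k) (at t)"
    unfolding pen_def by (auto intro!: derivative_eq_intros)
  show "((\<lambda>y. pen T a b k x0 (t, y)) has_derivative (\<lambda>\<eta>. ((2 * b) *\<^sub>R (snd (t, x) - x0)) \<bullet> \<eta>)) (at x)"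
    unfolding pen_def by (auto intro!: derivative_eq_intros simp: inner_commute algebra_simps)
  show "((\<lambda>y. (2 * b) *\<^sub>R (snd (t, y) - x0)) has_derivative (\<lambda>\<eta>. ((2 * b) *\<^sub>R mat 1) *v \<eta>)) (at x)"
    by (auto intro!: derivative_eq_intros simp: scaleR_matrix_vector_assoc[symmetric])
qed

lemma smooth_pen: "smooth (pen T a b k x0)"
proof -
  have i: "smooth (\<lambda>z::real \<times> (real^'d). snd z $ i)" for i
    by (rule smooth_bounded_linear) (intro bounded_linear_compose[OF bounded_linear_vec_nth] bounded_linear_snd)
  have f: "smooth (\<lambda>z::real \<times> (real^'d). fst z)" by (rule smooth_bounded_linear[OF bounded_linear_fst])
  have eq: "pen T a b k x0 = (\<lambda>z. (a + k * T) + (b * (\<Sum>i\<in>UNIV. (snd z $ i + - x0 $ i) * (snd z $ i + - x0 $ i)) + (- k) * fst z))"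
    by (auto simp: pen_def inner_vec_def algebra_simps)
  show ?thesis unfolding eq by (intro smooth_add smooth_mult smooth_sum smooth_const i f) auto
qed

lemma smooth_minus: "smooth f \<Longrightarrow> smooth (\<lambda>x. - f x)"
  using smooth_mult[OF smooth_const[of "-1"], of f] by simp

section \<open>The terminal condition and convergence\<close>

text \<open>Maximum points of \<open>u - b |x - x0|\<^sup>2 - k (T - t)\<close> tend to \<open>(T, x0)\<close> as \<open>b\<close> and \<open>k\<close> grow, with \<open>b\<close>
  depending only on the modulus of continuity of \<open>f\<close>.\<close>

lemma terminal_penalisation:
  fixes u f :: "real \<times> (real^'d) \<Rightarrow> real"
  assumes T: "T > 0" and u: "usc_on (cylinder T) u" and ub: "\<And>z. z \<in> cylinder T \<Longrightarrow> \<bar>u z\<bar> \<le> C"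
    and f: "continuous_on (cylinder T) f" and gt: "u (T, x0) > f (T, x0)"
  obtains b k0 where "\<And>k. k \<ge> k0 \<Longrightarrow> \<exists>a z. z \<in> cylinder T \<and> touches_above T (pen T a b k x0) u z \<and> u z > f z \<and> norm (snd z - x0) \<le> 1"
proof -
  define m where "m = u (T, x0) - f (T, x0)"
  have m: "m > 0" using gt by (simp add: m_def)
  have zT: "(T, x0) \<in> cylinder T" using T by simp
  obtain \<delta>' where \<delta>': "\<delta>' > 0" "\<And>z. z \<in> cylinder T \<Longrightarrow> dist z (T, x0) < \<delta>' \<Longrightarrow> dist (f z) (f (T, x0)) < m"
    using f zT m unfolding continuous_on_iff by meson
  define \<delta> where "\<delta> = min \<delta>' 1 / 2"
  have \<delta>: "\<delta> > 0" "\<delta> \<le> 1" "2 * \<delta> \<le> \<delta>'" using \<delta>'(1) by (auto simp: \<delta>_def)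
  have C: "C \<ge> 0" using ub[OF zT] by linarith
  \<comment> \<open>Since \<open>u\<close> lies between \<open>-C\<close> and \<open>C\<close>, a
    point penalised by more than \<open>2 C\<close> cannot beat \<open>(T, x0)\<close>. The
    constants \<open>b\<close> and \<open>k0\<close> impose such a penalty at distance
    \<open>\<delta>\<close> in space and in time.\<close>
  define b where "b = (2 * C + 1) / \<delta>\<^sup>2"
  define k0 where "k0 = (2 * C + 1) / \<delta>"
  have b: "b > 0" "b * \<delta>\<^sup>2 = 2 * C + 1" and k0: "k0 > 0" "k0 * \<delta> = 2 * C + 1" using C \<delta> by (auto simp: b_def k0_def)
  show ?thesis
  proof (rule that[of k0 b])
    fix k assume k: "k \<ge> k0"
    have k1: "k > 0" using k k0 by simp
    define \<Phi> where "\<Phi> = (\<lambda>z::real \<times> (real^'d). - pen T 0 b k x0 z)"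
    have \<Phi>c: "continuous_on (cylinder T) \<Phi>" unfolding \<Phi>_def pen_def by (intro continuous_intros)
    \<comment> \<open>The compact set on which the maximum exists; by the choice of \<open>b\<close>
      it is a maximum over the whole cylinder.\<close>
    define K where "K = {0..T} \<times> cball x0 \<delta>"
    have K: "compact K" unfolding K_def by (intro compact_Times) auto
    have KS: "K \<subseteq> cylinder T" by (auto simp: K_def)
    have zK: "(T, x0) \<in> K" using T \<delta> by (simp add: K_def)
    obtain z where z: "z \<in> K" "\<And>y. y \<in> K \<Longrightarrow> u y + \<Phi> y \<le> u z + \<Phi> z"
      using usc_attains_max[OF K _ KS u \<Phi>c] zK by blast
    have \<Phi>0: "\<Phi> (T, x0) = 0" by (simp add: \<Phi>_def pen_def)
    have zmax: "u y + \<Phi> y \<le> u z + \<Phi> z" if y: "y \<in> cylinder T" for y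
    proof (cases "y \<in> K")
      case False
      obtain t x where tx: "y = (t, x)" "0 \<le> t" "t \<le> T" using y by auto
      have "norm (x - x0) > \<delta>" using False tx by (simp add: K_def dist_norm norm_minus_commute)
      then have "\<delta>\<^sup>2 < (norm (x - x0))\<^sup>2" using \<delta> by (intro power_strict_mono) auto
      from mult_strict_left_mono[OF this b(1)]
      have "b * \<delta>\<^sup>2 < b * ((x - x0) \<bullet> (x - x0))" by (simp only: power2_norm_eq_inner)
      moreover have "0 \<le> k * (T - t)" using k1 tx by simp
      ultimately have "\<Phi> y \<le> - (2 * C + 1)" using b(2) unfolding \<Phi>_def pen_def tx by simp
      moreover have "u (T, x0) + \<Phi> (T, x0) \<le> u z + \<Phi> z" by (rule z(2)[OF zK])
      ultimately show ?thesis using ub[OF y] ub[OF zT] \<Phi>0 by linarith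
    qed (rule z(2))
    obtain t x where tx: "z = (t, x)" "0 \<le> t" "t \<le> T" "norm (x - x0) \<le> \<delta>" using z(1) by (auto simp: K_def dist_norm norm_minus_commute)
    have zc: "z \<in> cylinder T" using z KS by blast
    have uz: "u (T, x0) \<le> u z + \<Phi> z" using z(2)[OF zK] \<Phi>0 by simp
    have \<Phi>z: "\<Phi> z = - (b * ((x - x0) \<bullet> (x - x0))) - k * (T - t)" by (simp add: \<Phi>_def pen_def tx)
    have nn: "0 \<le> b * ((x - x0) \<bullet> (x - x0))" "0 \<le> k * (T - t)" using b k1 tx by auto
    have "k * (T - t) \<le> 2 * C" using uz \<Phi>z nn ub[OF zc] ub[OF zT] by linarith
    then have "k0 * (T - t) < k0 * \<delta>" using k0 k tx mult_right_mono[of k0 k "T - t"] by linarith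
    then have Tt: "T - t < \<delta>" using k0(1) by (simp only: mult_less_cancel_left_pos)
    have "dist z (T, x0) \<le> \<bar>t - T\<bar> + norm (x - x0)"
      unfolding tx dist_Pair_Pair by (rule sqrt_sum_squares_le_sum[THEN order_trans]) (auto simp: dist_norm)
    then have "dist z (T, x0) < \<delta>'" using Tt tx \<delta>(3) by linarith
    then have "\<bar>f z - f (T, x0)\<bar> < m" using \<delta>'(2)[OF zc] by (simp add: dist_real_def)
    moreover have "u z \<ge> u (T, x0)" using uz \<Phi>z nn by linarith
    ultimately have "u z > f z" unfolding m_def by linarith
    moreover have "touches_above T (pen T (u z + \<Phi> z) b k x0) u z"
    proof -
      have e: "pen T (u z + \<Phi> z) b k x0 y = u z + \<Phi> z - \<Phi> y" for y by (simp add: \<Phi>_def pen_def)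
      show ?thesis
        unfolding touches_above_def e
      proof (intro conjI ballI)
        fix y :: "real \<times> (real^'d)" assume "y \<in> cylinder T"
        then show "u y - (u z + \<Phi> z - \<Phi> y) \<le> u z - (u z + \<Phi> z - \<Phi> z)" using zmax[of y] by linarith
      qed simp
    qed
    ultimately show "\<exists>a z. z \<in> cylinder T \<and> touches_above T (pen T a b k x0) u z \<and> u z > f z \<and> norm (snd z - x0) \<le> 1"
      using zc tx \<delta> by (intro exI[of _ "u z + \<Phi> z"] exI[of _ z]) auto
  qed
qed

context obstacle_scheme
begin

text \<open>The disjunction in the hypothesis covers two cases: the relaxed limit, which satisfies
  the obstacle inequality even at \<open>T\<close>, and a viscosity subsolution, for which touching
  at \<open>T\<close> gives \<open>u \<le> g\<close> directly.\<close>

lemma terminal_upper: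
  assumes u: "usc_on (cylinder T) u" and ub: "\<And>z. z \<in> cylinder T \<Longrightarrow> \<bar>u z\<bar> \<le> C"
    and touch: "\<And>z a b k x0. z \<in> cylinder T \<Longrightarrow> touches_above T (pen T a b k x0) u z \<Longrightarrow>
      obstacle_op \<mu> \<sigma> F g (pen T a b k x0) z \<le> 0 \<or> u z \<le> g z"
  shows "u (T, x0) \<le> g (T, x0)"
proof (rule ccontr)
  assume "\<not> u (T, x0) \<le> g (T, x0)"
  then obtain b k0 where pk: "\<And>k. k \<ge> k0 \<Longrightarrow> \<exists>a z. z \<in> cylinder T \<and> touches_above T (pen T a b k x0) u z \<and> u z > g z \<and> norm (snd z - x0) \<le> 1"
    using terminal_penalisation[OF T u ub g_cont, of x0] by (metis not_le)
  define K' where "K' = {0..T} \<times> cball x0 1"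
  have K': "compact K'" "K' \<subseteq> cylinder T" unfolding K'_def by (auto intro: compact_Times)
  define P where "P = (\<lambda>z::real \<times> (real^'d). (2 * b) *\<^sub>R (snd z - x0))"
  define B where "B = (2 * b) *\<^sub>R (mat 1 :: real^'d^'d)"
  have Bs: "B \<in> sym_mats" by (simp add: B_def sym_mats_def transpose_scaleR transpose_mat)
  \<comment> \<open>Majorant of every term of the operator other than \<open>k\<close> on a compact
    set that does not depend on \<open>k\<close>; choosing \<open>k\<close> above its maximum is
    then contradictory.\<close>
  define q where "q = (\<lambda>z. \<mu> z \<bullet> P z + 1 / 2 * ((\<sigma> z ** transpose (\<sigma> z)) \<bullet> B) + (K + L * (C + norm (P z) + norm B)))"
  have "continuous_on K' q"
    unfolding q_def P_def by (intro continuous_intros continuous_on_subset[OF \<mu>_cont] continuous_on_subset[OF \<sigma>_cont] K')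
  then have "bounded (q ` K')" using K' by (intro compact_imp_bounded compact_continuous_image)
  then obtain Q where "\<forall>y\<in>q ` K'. norm y \<le> Q" unfolding bounded_iff by blast
  then have Q: "\<bar>q z\<bar> \<le> Q" if "z \<in> K'" for z using that by force
  define k where "k = max k0 (Q + 1)"
  obtain a z where z: "z \<in> cylinder T" "touches_above T (pen T a b k x0) u z" "u z > g z" "norm (snd z - x0) \<le> 1"
    using pk[of k] by (auto simp: k_def)
  have zK: "z \<in> K'" using z by (cases z) (auto simp: K'_def dist_norm norm_minus_commute)
  have pz: "pen T a b k x0 z = u z" using z(2) by (simp add: touches_above_def)
  have "obstacle_op \<mu> \<sigma> F g (pen T a b k x0) z \<le> 0" using touch[OF z(1,2)] z(3) by auto
  then have "- LX \<mu> \<sigma> (pen T a b k x0) z - F z (u z) (P z) B \<le> 0"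
    using z(3) unfolding obstacle_op_def pz C12_derivatives[OF C12_pen] P_def B_def by (auto simp: min_le_iff_disj)
  then have "k \<le> \<mu> z \<bullet> P z + 1 / 2 * ((\<sigma> z ** transpose (\<sigma> z)) \<bullet> B) + F z (u z) (P z) B"
    unfolding LX_def C12_derivatives[OF C12_pen] P_def B_def diffusion_def by simp
  also have "F z (u z) (P z) B \<le> K + L * (C + norm (P z) + norm B)"
  proof -
    have "\<bar>F z (u z) (P z) B - F z 0 0 0\<bar> \<le> L * (\<bar>u z\<bar> + norm (P z) + norm B)"
      using F_lipschitz_dist[OF _ Bs zero_sym_mats, of "fst z" "snd z" "u z" "P z" "snd z" 0 0] z(1) by auto
    also have "\<dots> \<le> L * (C + norm (P z) + norm B)" using ub[OF z(1)] L_nonneg by (intro mult_left_mono add_mono) auto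
    finally show ?thesis using F_zero[OF z(1)] by linarith
  qed
  finally have "k \<le> q z" by (simp add: q_def)
  moreover have "Q + 1 \<le> k" by (simp add: k_def)
  ultimately show False using Q[OF zK] by linarith
qed

text \<open>Here \<open>-u\<close> is penalised. Wherever contact takes place the value is at least
  \<open>g\<close>, by the obstacle part of the minimum before \<open>T\<close> and by the terminal
  condition at \<open>T\<close>, so no comparison of \<open>k\<close> with the operator is
  involved.\<close>

lemma terminal_lower:
  assumes u: "viscosity_supersolution T \<mu> \<sigma> F g u" and ub: "\<And>z. z \<in> cylinder T \<Longrightarrow> \<bar>u z\<bar> \<le> C"
  shows "g (T, x0) \<le> u (T, x0)"
proof (rule ccontr)
  assume neg: "\<not> g (T, x0) \<le> u (T, x0)"
  have usc: "usc_on (cylinder T) (\<lambda>z. - u z)"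
    unfolding usc_on_def
  proof (intro ballI allI impI)
    fix z c assume z: "z \<in> cylinder T" "- u z < c"
    have "lsc_on (cylinder T) u" using u by (simp add: viscosity_supersolution_def interior_supersolution_def)
    then have "\<forall>\<^sub>F y in at z within cylinder T. - c < u y" using z by (auto simp: lsc_on_def)
    then show "\<forall>\<^sub>F y in at z within cylinder T. - u y < c" by eventually_elim simp
  qed
  have gc: "continuous_on (cylinder T) (\<lambda>z. - g z)" by (intro continuous_intros g_cont)
  obtain b k0 where "\<And>k. k \<ge> k0 \<Longrightarrow> \<exists>a z. z \<in> cylinder T \<and> touches_above T (pen T a b k x0) (\<lambda>z. - u z) z \<and> - u z > - g z \<and> norm (snd z - x0) \<le> 1"
    using terminal_penalisation[OF T usc _ gc, of C x0] ub neg by (metis abs_minus_cancel neg_less_iff_less not_le)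
  then obtain a k z where z: "z \<in> cylinder T" "touches_above T (pen T a b k x0) (\<lambda>z. - u z) z" "u z < g z" by fastforce
  define \<phi> where "\<phi> = (\<lambda>z. - pen T a b k x0 z)"
  have sm: "smooth \<phi>" unfolding \<phi>_def by (intro smooth_minus smooth_pen)
  have tb: "touches_below T \<phi> u z"
    unfolding touches_below_def
  proof (intro conjI ballI)
    show 1: "u z - \<phi> z = 0" using z(2) unfolding touches_above_def \<phi>_def by linarith
    fix y :: "real \<times> (real^'d)" assume "y \<in> cylinder T"
    then have "- u y - pen T a b k x0 y \<le> - u z - pen T a b k x0 z" using z(2) unfolding touches_above_def by blast
    then show "u z - \<phi> z \<le> u y - \<phi> y" unfolding \<phi>_def by linarith
  qed
  obtain t x where tx: "z = (t, x)" "0 \<le> t" "t \<le> T" using z(1) by auto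
  show False
  proof (cases "t < T")
    case True
    then have "obstacle_op \<mu> \<sigma> F g \<phi> z \<ge> 0"
      using u sm tb tx unfolding viscosity_supersolution_def interior_supersolution_def by auto
    then have "\<phi> z \<ge> g z" by (simp add: obstacle_op_def)
    moreover have "\<phi> z = u z" using tb by (simp add: touches_below_def)
    ultimately show False using z(3) by simp
  next
    case False
    then have "z = (T, x)" using tx by simp
    then have "u z - g z \<ge> 0" using u sm tb unfolding viscosity_supersolution_def by blast
    then show False using z(3) by simp
  qed
qed

text \<open>The definition tests the terminal condition only at points where a smooth function
  touches; penalisation recovers it at every \<open>x\<close>, as comparison of two solutions
  requires.\<close>

lemma viscosity_terminal:
  assumes u: "viscosity_solution T \<mu> \<sigma> F g u" and ub: "bounded (u ` cylinder T)"
  shows "u (T, x) = g (T, x)"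
proof -
  obtain C where C: "\<And>z. z \<in> cylinder T \<Longrightarrow> \<bar>u z\<bar> \<le> C" using ub by (auto simp: bounded_iff)
  have sub: "viscosity_subsolution T \<mu> \<sigma> F g u" using u by (simp add: viscosity_solution_def)
  have "u (T, x) \<le> g (T, x)"
  proof (rule terminal_upper[OF _ C])
    show "usc_on (cylinder T) u" using sub by (simp add: viscosity_subsolution_def interior_subsolution_def)
    fix z a b k x0 assume z: "z \<in> cylinder T" "touches_above T (pen T a b k x0) u z"
    show "obstacle_op \<mu> \<sigma> F g (pen T a b k x0) z \<le> 0 \<or> u z \<le> g z"
    proof (cases "fst z < T")
      case True
      then have "z \<in> {0..<T} \<times> UNIV" using z(1) by auto
      then show ?thesis using sub z(2) smooth_pen unfolding viscosity_subsolution_def interior_subsolution_def by blast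
    next
      case False
      then have "z = (T, snd z)" using z(1) by (cases z) auto
      then have "u z - g z \<le> 0" using sub z(2) smooth_pen unfolding viscosity_subsolution_def by metis
      then show ?thesis by simp
    qed
  qed
  moreover have "g (T, x) \<le> u (T, x)"
  proof -
    have sup: "viscosity_supersolution T \<mu> \<sigma> F g u" using u by (simp add: viscosity_solution_def)
    show ?thesis by (rule terminal_lower[OF sup C])
  qed
  ultimately show ?thesis by simp
qed

end

section \<open>Relaxed limits of the scheme as sub- and supersolutions\<close>

locale obstacle_scheme_values = obstacle_scheme T \<mu> \<sigma> F g M W K L
  for T and \<mu> :: "real \<times> (real^'d) \<Rightarrow> real^'d" and \<sigma> F g and M :: "'w measure" and W K L +
  fixes vh :: "nat \<Rightarrow> real \<times> (real^'d) \<Rightarrow> real"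
  assumes scheme: "\<And>n. n \<ge> 1 \<Longrightarrow> backward_scheme M W T \<mu> \<sigma> F g n (vh n)"
begin

lemma vh_bound: "n \<ge> 1 \<Longrightarrow> y \<in> grid_pts T n \<Longrightarrow> \<bar>vh n y\<bar> \<le> vB"
  using scheme_bounds(1)[OF _ scheme] by (cases y) (auto simp: grid_pts_def)

lemma vh_ge_g: "n \<ge> 1 \<Longrightarrow> y \<in> grid_pts T n \<Longrightarrow> g y \<le> vh n y"
  using scheme_ge_g[OF _ scheme] by (cases y) (auto simp: grid_pts_def)

sublocale up: bounded_family T vh vB
  by unfold_locales (use T vh_bound in auto)

sublocale lo: bounded_family T "\<lambda>n z. - vh n z" vB
  by unfold_locales (use T vh_bound in auto)

text \<open>The cut-off makes the test function bounded at the price of continuity; boundedness and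
  measurability are what the scheme operator and its monotonicity require.\<close>

lemma perturbed_test_function:
  fixes \<phi> :: "real \<times> (real^'d) \<Rightarrow> real"
  assumes \<phi>: "continuous_on UNIV \<phi>" and z0: "z0 \<in> cylinder T"
    and \<psi>: "\<And>z. \<psi> z = (if dist z z0 \<le> 1 then \<phi> z else c)"
  obtains Q where "\<And>z. z \<in> cylinder T \<Longrightarrow> \<bar>\<psi> z\<bar> \<le> Q" "\<And>t. (\<lambda>x. \<psi> (t, x)) \<in> borel_measurable borel"
    "\<And>t c'. good_slice (\<lambda>z. \<psi> z + c') t"
proof -
  have "bounded (\<phi> ` cball z0 1)" using \<phi> by (intro compact_imp_bounded compact_continuous_image continuous_on_subset[OF \<phi>]) auto
  then obtain Q0 where "\<forall>y\<in>\<phi> ` cball z0 1. norm y \<le> Q0" unfolding bounded_iff by blast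
  then have Q0: "\<bar>\<phi> z\<bar> \<le> Q0" if "z \<in> cball z0 1" for z using that by force
  define Q where "Q = max Q0 \<bar>c\<bar>"
  have Q: "\<bar>\<psi> z\<bar> \<le> Q" for z using Q0[of z] by (auto simp: \<psi> Q_def dist_commute)
  have m: "(\<lambda>x. \<psi> (t, x)) \<in> borel_measurable borel" for t
  proof -
    have [measurable]: "(\<lambda>x. \<phi> (t, x)) \<in> borel_measurable borel"
      by (intro borel_measurable_continuous_onI continuous_on_compose2[OF \<phi>] continuous_intros) auto
    have [measurable]: "(\<lambda>x. dist (t, x) z0) \<in> borel_measurable borel"
      by (intro borel_measurable_continuous_onI continuous_intros)
    show ?thesis unfolding \<psi> by measurable
  qed
  have "good_slice (\<lambda>z. \<psi> z + c') t" for t c'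
  proof -
    note [measurable] = m
    have "\<bar>\<psi> z + c'\<bar> \<le> Q + \<bar>c'\<bar>" for z using Q[of z] by linarith
    then show ?thesis unfolding good_slice_def by auto
  qed
  then show ?thesis using that Q m by blast
qed

text \<open>The point \<open>z0\<close> may lie at time \<open>T\<close>. At a near-maximiser the
  value of the scheme exceeds \<open>g\<close> strictly, which excludes the terminal time, where the
  two agree; thus the obstacle inequality is available at \<open>T\<close> for the penalisation
  argument.\<close>

lemma uplim_subsolution:
  assumes C: "C12 \<phi> A p B" and z0: "z0 \<in> cylinder T" and touch: "touches_above T \<phi> (uplim T vh) z0"
  shows "min (- (A z0 + \<mu> z0 \<bullet> p z0 + 1 / 2 * (diffusion \<sigma> z0 \<bullet> B z0)) - F z0 (\<phi> z0) (p z0) (B z0)) (\<phi> z0 - g z0) \<le> 0"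
proof (rule ccontr)
  define G where "G = A z0 + \<mu> z0 \<bullet> p z0 + 1 / 2 * (diffusion \<sigma> z0 \<bullet> B z0) + F z0 (\<phi> z0) (p z0) (B z0)"
  assume "\<not> ?thesis"
  then have G: "G < 0" and gap: "g z0 < \<phi> z0" by (auto simp: G_def not_le)
  obtain A' p' B' where q: "C12 (\<lambda>z. dist z z0 ^ 4) A' p' B'" "A' z0 = 0" "p' z0 = 0" "B' z0 = 0" by (rule C12_quartic)
  define \<phi>1 where "\<phi>1 = (\<lambda>z. \<phi> z + dist z z0 ^ 4)"
  note C1 = C12_add[OF C q(1), folded \<phi>1_def]
  define \<psi> where "\<psi> = (\<lambda>z. if dist z z0 \<le> 1 then \<phi>1 z else vB + 2)"
  have \<phi>c: "continuous_on UNIV \<phi>" and \<phi>1c: "continuous_on UNIV \<phi>1" using C C1 unfolding C12_def by blast+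
  obtain Q where Q: "\<And>z. z \<in> cylinder T \<Longrightarrow> \<bar>\<psi> z\<bar> \<le> Q" and \<psi>m: "\<And>t. (\<lambda>x. \<psi> (t, x)) \<in> borel_measurable borel"
    and gs: "\<And>t c'. good_slice (\<lambda>z. \<psi> z + c') t"
    using perturbed_test_function[OF \<phi>1c z0, of \<psi> "vB + 2"] unfolding \<psi>_def by blast
  have \<psi>1: "\<psi> z = \<phi>1 z" if "dist z z0 < 1" for z using that by (simp add: \<psi>_def)
  have e: "- G / 2 > 0" using G by simp
  obtain r where r: "r > 0" and cons: "\<And>t x h c. dist (t, x) z0 < r \<Longrightarrow> 0 \<le> t \<Longrightarrow> 0 < h \<Longrightarrow> h < r \<Longrightarrow> t + h \<le> T \<Longrightarrow> \<bar>c\<bar> < r \<Longrightarrow>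
    \<bar>(Th M W \<mu> \<sigma> F h (\<lambda>z. \<psi> z + c) (t, x) - (\<phi>1 (t, x) + c)) / h - G\<bar> < - G / 2"
    using scheme_consistent[OF C1 z0 zero_less_one \<psi>1 Q \<psi>m e] unfolding q(2-4) \<phi>1_def G_def by auto
  define m where "m = (\<phi> z0 - g z0) / 2"
  have m: "m > 0" using gap by (simp add: m_def)
  have "continuous_on (cylinder T) (\<lambda>z. \<phi>1 z - g z)" by (intro continuous_intros g_cont continuous_on_subset[OF \<phi>1c]) auto
  then obtain r2 where r2: "r2 > 0" "\<And>z. z \<in> cylinder T \<Longrightarrow> dist z z0 < r2 \<Longrightarrow> dist (\<phi>1 z - g z) (\<phi>1 z0 - g z0) < m"
    using z0 m unfolding continuous_on_iff by meson
  have near_g: "g z + m < \<phi>1 z" if "z \<in> cylinder T" "dist z z0 < r2" for z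
  proof -
    have "\<phi>1 z0 - g z0 = 2 * m" by (simp add: \<phi>1_def m_def)
    then show ?thesis using r2(2)[OF that] by (simp add: dist_real_def abs_less_iff)
  qed
  \<comment> \<open>The bound \<open>m/2\<close> on the shift and the bound \<open>m/2\<close> in
    \<open>\<eta>\<close> together use up the margin \<open>m\<close> by which the test function
    exceeds \<open>g\<close> near \<open>z0\<close>.\<close>
  define r' where "r' = min (min r r2) (min 1 (m / 2))"
  have r': "r' > 0" "r' \<le> r" "r' \<le> r2" "r' \<le> 1" "r' \<le> m / 2" using r r2 m by (auto simp: r'_def)
  \<comment> \<open>The first entry is the decrease that consistency forces in one time step, so a
    near-maximum with this slack is already contradictory.\<close>
  define \<eta> where "\<eta> = (\<lambda>n::nat. min (T / real n * (- G / 2)) (m / 2))"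
  have \<eta>: "\<eta> n > 0" if "n \<ge> 1" for n unfolding \<eta>_def min_less_iff_conj
    using m by (intro conjI mult_pos_pos e) (use T that in auto)
  obtain N where N: "T / r < real N" using reals_Archimedean2 by blast
  have le: "uplim T vh z \<le> \<phi> z" if "z \<in> cylinder T" for z using touch that by (auto simp: touches_above_def)
  have eq: "uplim T vh z0 = \<phi> z0" using touch by (simp add: touches_above_def)
  have \<psi>e: "\<psi> z = (if dist z z0 \<le> 1 then \<phi> z + dist z z0 ^ 4 else vB + 2)" for z by (simp add: \<psi>_def \<phi>1_def)
  obtain n y c where n: "n \<ge> N" "n \<ge> 1" and y1: "y \<in> grid_pts T n" and c: "\<bar>c\<bar> < r'" and y2: "dist y z0 < r'"
    and below: "\<And>y'. y' \<in> grid_pts T n \<Longrightarrow> vh n y' \<le> \<psi> y' + c" and close: "vh n y > \<psi> y + c - \<eta> n"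
    by (rule up.near_touching[where \<eta> = \<eta> and N = N, OF continuous_on_subset[OF \<phi>c subset_UNIV] z0 le eq \<psi>e r'(1) \<eta>]) (assumption, assumption, (rule that; assumption))
  note y = y1 y2
  obtain i x where i: "i \<le> n" "y = (grid T n i, x)" using y(1) by (cases y) (auto simp: grid_pts_def)
  define h where "h = T / real n"
  have h: "h > 0" using T n by (simp add: h_def)
  have hr: "h < r"
  proof -
    have "T / r < real n" using N n by simp
    then show ?thesis using r n by (simp add: h_def field_simps)
  qed
  have yc: "y \<in> cylinder T" using grid_pts_cylinder[OF T n(2)] y by blast
  have \<psi>y: "\<psi> y = \<phi>1 y" using y(2) r'(4) by (intro \<psi>1) simp
  have "\<eta> n \<le> m / 2" by (simp add: \<eta>_def)
  then have vg: "vh n y > g y" using close c r'(5) near_g[OF yc] y(2) r'(3) \<psi>y by linarith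
  have bs: "backward_scheme M W T \<mu> \<sigma> F g n (vh n)" by (rule scheme[OF n(2)])
  have "i \<noteq> n"
  proof
    assume "i = n"
    then have "y = (T, x)" using i grid_n[OF n(2)] by simp
    then show False using vg bs by (simp add: backward_scheme_def)
  qed
  then have i_n: "i < n" using i by simp
  have t: "0 \<le> grid T n i" "grid T n i \<le> T" using grid_bounds[OF n(2), of i] i by auto
  have th: "grid T n i + h = grid T n (Suc i)" unfolding h_def by (rule grid_Suc)
  have th2: "grid T n i + h \<le> T" using grid_bounds[OF n(2), of "Suc i"] i_n th by simp
  have "vh n y = max (Th M W \<mu> \<sigma> F h (vh n) y) (g y)" using bs i_n unfolding backward_scheme_def i h_def by blast
  \<comment> \<open>Strictly above the obstacle, the maximum in the recursion is the scheme
    operator.\<close>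
  then have "vh n y = Th M W \<mu> \<sigma> F h (vh n) y" using vg by auto
  also have "\<dots> \<le> Th M W \<mu> \<sigma> F h (\<lambda>z. \<psi> z + c) y"
    unfolding i
  proof (rule Th_mono[OF t h _ gs])
    show "good_slice (vh n) (grid T n i + h)" unfolding th using scheme_bounds(2)[OF n(2) bs, of "Suc i"] i_n by simp
    fix y'
    show "vh n (grid T n i + h, y') \<le> \<psi> (grid T n i + h, y') + c"
      unfolding th using i_n by (intro below) (auto simp: grid_pts_def intro!: exI[of _ "Suc i"])
  qed
  also have "\<dots> < \<phi>1 y + c + h * (G / 2)"
  proof -
    have "\<bar>(Th M W \<mu> \<sigma> F h (\<lambda>z. \<psi> z + c) y - (\<phi>1 y + c)) / h - G\<bar> < - G / 2"
      unfolding i using y(2) c r' t h hr th2 i by (intro cons) auto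
    then have "(Th M W \<mu> \<sigma> F h (\<lambda>z. \<psi> z + c) y - (\<phi>1 y + c)) / h < G / 2" by linarith
    then have "Th M W \<mu> \<sigma> F h (\<lambda>z. \<psi> z + c) y - (\<phi>1 y + c) < G / 2 * h" using h by (simp add: pos_divide_less_eq)
    then show ?thesis by (simp add: mult.commute)
  qed
  finally have "vh n y < \<phi>1 y + c + h * (G / 2)" .
  moreover have "\<eta> n \<le> h * (- G / 2)" by (simp add: \<eta>_def h_def)
  ultimately show False using close \<psi>y by simp
qed

definition lowlim :: "real \<times> (real^'d) \<Rightarrow> real" where
  "lowlim z = - uplim T (\<lambda>n z. - vh n z) z"

text \<open>Only the differential part of the minimum is treated here; the obstacle part follows
  from \<open>v^h \<ge> g\<close>. Since \<open>v^h\<close> dominates the scheme operator before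
  \<open>T\<close>, no case distinction on the maximum arises.\<close>

lemma lowlim_supersolution:
  assumes C: "C12 \<phi> A p B" and z0: "z0 \<in> cylinder T" and z0T: "fst z0 < T" and touch: "touches_below T \<phi> lowlim z0"
  shows "- (A z0 + \<mu> z0 \<bullet> p z0 + 1 / 2 * (diffusion \<sigma> z0 \<bullet> B z0)) - F z0 (\<phi> z0) (p z0) (B z0) \<ge> 0"
proof (rule ccontr)
  define G where "G = A z0 + \<mu> z0 \<bullet> p z0 + 1 / 2 * (diffusion \<sigma> z0 \<bullet> B z0) + F z0 (\<phi> z0) (p z0) (B z0)"
  assume "\<not> ?thesis"
  then have G: "G > 0" by (simp add: G_def)
  obtain A' p' B' where q: "C12 (\<lambda>z. dist z z0 ^ 4) A' p' B'" "A' z0 = 0" "p' z0 = 0" "B' z0 = 0" by (rule C12_quartic)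
  define \<phi>1 where "\<phi>1 = (\<lambda>z. \<phi> z + - (dist z z0 ^ 4))"
  note C1 = C12_add[OF C C12_minus[OF q(1)], folded \<phi>1_def]
  define \<psi> where "\<psi> = (\<lambda>z. if dist z z0 \<le> 1 then \<phi>1 z else - (vB + 2))"
  have \<phi>c: "continuous_on UNIV (\<lambda>z. - \<phi> z)" and \<phi>1c: "continuous_on UNIV \<phi>1"
    using C C1 unfolding C12_def by (blast intro: continuous_on_minus)+
  obtain Q where Q: "\<And>z. z \<in> cylinder T \<Longrightarrow> \<bar>\<psi> z\<bar> \<le> Q" and \<psi>m: "\<And>t. (\<lambda>x. \<psi> (t, x)) \<in> borel_measurable borel"
    and gs: "\<And>t c'. good_slice (\<lambda>z. \<psi> z + c') t"
    using perturbed_test_function[OF \<phi>1c z0, of \<psi> "- (vB + 2)"] unfolding \<psi>_def by blast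
  have \<psi>1: "\<psi> z = \<phi>1 z" if "dist z z0 < 1" for z using that by (simp add: \<psi>_def)
  have e: "G / 2 > 0" using G by simp
  obtain r where r: "r > 0" and cons: "\<And>t x h c. dist (t, x) z0 < r \<Longrightarrow> 0 \<le> t \<Longrightarrow> 0 < h \<Longrightarrow> h < r \<Longrightarrow> t + h \<le> T \<Longrightarrow> \<bar>c\<bar> < r \<Longrightarrow>
    \<bar>(Th M W \<mu> \<sigma> F h (\<lambda>z. \<psi> z + c) (t, x) - (\<phi>1 (t, x) + c)) / h - G\<bar> < G / 2"
    using scheme_consistent[OF C1 z0 zero_less_one \<psi>1 Q \<psi>m e] unfolding q(2-4) \<phi>1_def G_def by auto
  \<comment> \<open>The entry \<open>T - fst z0\<close> keeps near-touching points before the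
    terminal time, where the recursion is available.\<close>
  define r' where "r' = min r (min 1 (T - fst z0))"
  have r': "r' > 0" "r' \<le> r" "r' \<le> 1" "r' \<le> T - fst z0" using r z0T by (auto simp: r'_def)
  define \<eta> where "\<eta> = (\<lambda>n::nat. T / real n * (G / 2))"
  have \<eta>: "\<eta> n > 0" if "n \<ge> 1" for n using that T e by (simp add: \<eta>_def)
  obtain N where N: "T / r < real N" using reals_Archimedean2 by blast
  have le: "uplim T (\<lambda>n z. - vh n z) z \<le> - \<phi> z" if "z \<in> cylinder T" for z
  proof -
    have "lowlim z - \<phi> z \<ge> lowlim z0 - \<phi> z0" "lowlim z0 - \<phi> z0 = 0" using touch that unfolding touches_below_def by blast+
    then show ?thesis unfolding lowlim_def by linarith
  qed
  have eq: "uplim T (\<lambda>n z. - vh n z) z0 = - \<phi> z0" using touch by (simp add: touches_below_def lowlim_def)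
  have \<psi>e: "- \<psi> z = (if dist z z0 \<le> 1 then - \<phi> z + dist z z0 ^ 4 else vB + 2)" for z by (simp add: \<psi>_def \<phi>1_def)
  obtain n y c' where n: "n \<ge> N" "n \<ge> 1" and y1: "y \<in> grid_pts T n" and c': "\<bar>c'\<bar> < r'" and y2: "dist y z0 < r'"
    and above': "\<And>y'. y' \<in> grid_pts T n \<Longrightarrow> - vh n y' \<le> - \<psi> y' + c'" and close': "- vh n y > - \<psi> y + c' - \<eta> n"
    by (rule lo.near_touching[where \<eta> = \<eta> and N = N, OF continuous_on_subset[OF \<phi>c subset_UNIV] z0 le eq \<psi>e r'(1) \<eta>]) (assumption, assumption, (rule that; assumption))
  note y = y1 y2
  define c where "c = - c'"
  have c: "\<bar>c\<bar> < r'" and above: "\<And>y'. y' \<in> grid_pts T n \<Longrightarrow> \<psi> y' + c \<le> vh n y'" and close: "vh n y < \<psi> y + c + \<eta> n"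
    using c' above' close' by (fastforce simp: c_def)+
  obtain i x where i: "i \<le> n" "y = (grid T n i, x)" using y(1) by (cases y) (auto simp: grid_pts_def)
  define h where "h = T / real n"
  have h: "h > 0" using T n by (simp add: h_def)
  have hr: "h < r"
  proof -
    have "T / r < real n" using N n by simp
    then show ?thesis using r n by (simp add: h_def field_simps)
  qed
  have \<psi>y: "\<psi> y = \<phi>1 y" using y(2) r'(3) by (intro \<psi>1) simp
  have bs: "backward_scheme M W T \<mu> \<sigma> F g n (vh n)" by (rule scheme[OF n(2)])
  have "dist (fst y) (fst z0) < T - fst z0" using dist_fst_le[of y z0] y(2) r'(4) by linarith
  then have "i \<noteq> n" using i grid_n[OF n(2)] by (auto simp: dist_real_def)
  then have i_n: "i < n" using i by simp
  have t: "0 \<le> grid T n i" "grid T n i \<le> T" using grid_bounds[OF n(2), of i] i by auto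
  have th: "grid T n i + h = grid T n (Suc i)" unfolding h_def by (rule grid_Suc)
  have th2: "grid T n i + h \<le> T" using grid_bounds[OF n(2), of "Suc i"] i_n th by simp
  have "\<phi>1 y + c + h * (G / 2) < Th M W \<mu> \<sigma> F h (\<lambda>z. \<psi> z + c) y"
  proof -
    have "\<bar>(Th M W \<mu> \<sigma> F h (\<lambda>z. \<psi> z + c) y - (\<phi>1 y + c)) / h - G\<bar> < G / 2"
      unfolding i using y(2) c r' t h hr th2 i by (intro cons) auto
    then have "G / 2 < (Th M W \<mu> \<sigma> F h (\<lambda>z. \<psi> z + c) y - (\<phi>1 y + c)) / h" by linarith
    then have "G / 2 * h < Th M W \<mu> \<sigma> F h (\<lambda>z. \<psi> z + c) y - (\<phi>1 y + c)" using h by (simp add: pos_less_divide_eq)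
    then show ?thesis by (simp add: mult.commute)
  qed
  also have "\<dots> \<le> Th M W \<mu> \<sigma> F h (vh n) y"
    unfolding i
  proof (rule Th_mono[OF t h gs])
    show "good_slice (vh n) (grid T n i + h)" unfolding th using scheme_bounds(2)[OF n(2) bs, of "Suc i"] i_n by simp
    fix y'
    show "\<psi> (grid T n i + h, y') + c \<le> vh n (grid T n i + h, y')"
      unfolding th using i_n by (intro above) (auto simp: grid_pts_def intro!: exI[of _ "Suc i"])
  qed
  also have "\<dots> \<le> vh n y" using bs i_n unfolding backward_scheme_def i h_def by auto
  finally have "\<phi>1 y + c + h * (G / 2) < vh n y" .
  moreover have "\<eta> n = h * (G / 2)" by (simp add: \<eta>_def h_def)
  ultimately show False using close \<psi>y by simp
qed

end

lemma par_seminorm_continuous: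
  fixes \<phi> :: "real \<times> (real^'d) \<Rightarrow> 'b::real_normed_vector"
  assumes fin: "par_seminorm T \<phi> < \<infinity>"
  shows "continuous_on (cylinder T) \<phi>"
proof -
  obtain B :: nat where B: "par_seminorm T \<phi> < ereal (real B)" using fin less_PInf_Ex_of_nat[of "par_seminorm T \<phi>"] by auto
  have bound: "norm (\<phi> (t, x) - \<phi> (t', x')) \<le> real B * (norm (x - x') + sqrt \<bar>t - t'\<bar>)"
    if z: "(t, x) \<in> cylinder T" "(t', x') \<in> cylinder T" for t x t' x'
  proof (cases "(t, x) = (t', x')")
    case False
    have "ereal (norm (\<phi> (t, x) - \<phi> (t', x')) / (norm (x - x') + sqrt \<bar>t - t'\<bar>)) \<le> par_seminorm T \<phi>"
      unfolding par_seminorm_def using z False by (intro SUP_upper2[of "((t, x), (t', x'))"]) auto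
    then have "norm (\<phi> (t, x) - \<phi> (t', x')) / (norm (x - x') + sqrt \<bar>t - t'\<bar>) \<le> real B"
      using B by (metis ereal_less_eq(3) less_imp_le order_trans)
    moreover have "norm (x - x') + sqrt \<bar>t - t'\<bar> > 0" using False by (auto simp: add_pos_nonneg add_nonneg_pos)
    ultimately show ?thesis by (simp add: pos_divide_le_eq)
  qed simp
  show ?thesis
    unfolding continuous_on_def
  proof
    fix z0 :: "real \<times> (real^'d)" assume z0: "z0 \<in> cylinder T"
    obtain t0 x0 where e: "z0 = (t0, x0)" by (cases z0)
    have "((\<lambda>z. \<phi> z - \<phi> z0) \<longlongrightarrow> 0) (at z0 within cylinder T)"
    proof (rule Lim_null_comparison)
      show "\<forall>\<^sub>F z in at z0 within cylinder T. norm (\<phi> z - \<phi> z0) \<le> real B * (norm (snd z - x0) + sqrt \<bar>fst z - t0\<bar>)"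
        unfolding eventually_at using bound z0 by (intro exI[of _ 1]) (auto simp: e)
      have "((\<lambda>z. real B * (norm (snd z - x0) + sqrt \<bar>fst z - t0\<bar>)) \<longlongrightarrow> real B * (norm (snd z0 - x0) + sqrt \<bar>fst z0 - t0\<bar>)) (at z0 within cylinder T)"
        by (intro tendsto_intros)
      then show "((\<lambda>z. real B * (norm (snd z - x0) + sqrt \<bar>fst z - t0\<bar>)) \<longlongrightarrow> 0) (at z0 within cylinder T)" by (simp add: e)
    qed
    then show "(\<phi> \<longlongrightarrow> \<phi> z0) (at z0 within cylinder T)" by (rule LIM_zero_cancel)
  qed
qed

lemma continuous_on_if_usc_lsc:
  assumes "usc_on S u" "lsc_on S u"
  shows "continuous_on S u"
  unfolding continuous_on_def
proof (intro ballI tendstoI)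
  fix z e assume z: "z \<in> S" "(e::real) > 0"
  have "\<forall>\<^sub>F y in at z within S. u y < u z + e" "\<forall>\<^sub>F y in at z within S. u z - e < u y"
    using assms z by (auto simp: usc_on_def lsc_on_def)
  then show "\<forall>\<^sub>F y in at z within S. dist (u y) (u z) < e"
    by eventually_elim (auto simp: dist_real_def)
qed

lemma lsc_on_cong:
  assumes "lsc_on S u" "\<And>z. z \<in> S \<Longrightarrow> u z = v z"
  shows "lsc_on S v"
  unfolding lsc_on_def
proof (intro ballI allI impI)
  fix z c assume z: "z \<in> S" "c < v z"
  then have "\<forall>\<^sub>F y in at z within S. c < u y" using assms by (auto simp: lsc_on_def)
  then show "\<forall>\<^sub>F y in at z within S. c < v y"
    using assms(2) unfolding eventually_at_topological by metis
qed

text \<open>Continuity of \<open>f\<close> turns a bound at each grid point into an eventual bound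
  near \<open>z\<close>; applied to \<open>-v^h\<close> it shows that the lower limit stays above
  the obstacle.\<close>

lemma (in bounded_family) uplim_le:
  assumes z: "z \<in> cylinder T" and le: "\<And>n y. n \<ge> 1 \<Longrightarrow> y \<in> grid_pts T n \<Longrightarrow> w n y \<le> f y" and f: "continuous_on (cylinder T) f"
  shows "uplim T w z \<le> f z"
proof (rule field_le_epsilon)
  fix e :: real assume e: "e > 0"
  then obtain d where d: "d > 0" "\<And>y. y \<in> cylinder T \<Longrightarrow> dist y z < d \<Longrightarrow> dist (f y) (f z) < e"
    using f z unfolding continuous_on_iff by meson
  have "f z + e \<in> uplim_bounds T w z"
    unfolding uplim_bounds_def
  proof (intro CollectI exI[of _ d] conjI d(1) exI[of _ 1] allI impI ballI)
    fix n :: nat and y :: "real \<times> (real^'d)" assume n: "n \<ge> 1" and y: "y \<in> grid_pts T n" "dist y z < d"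
    then have "\<bar>f y - f z\<bar> < e" using d(2)[of y] grid_pts_cylinder[OF T n] by (auto simp: dist_real_def)
    then show "w n y \<le> f z + e" using le[OF n y(1)] by linarith
  qed
  then show "uplim T w z \<le> f z + e" unfolding uplim_def by (rule cInf_lower[OF _ bdd_below_bounds[OF z]])
qed

section \<open>Identification of the two limits, convergence and uniqueness\<close>

context obstacle_scheme_values
begin

lemma obstacle_op_C12:
  "C12 \<phi> A p B \<Longrightarrow> obstacle_op \<mu> \<sigma> F g \<phi> z =
    min (- (A z + \<mu> z \<bullet> p z + 1 / 2 * (diffusion \<sigma> z \<bullet> B z)) - F z (\<phi> z) (p z) (B z)) (\<phi> z - g z)"
  by (simp add: obstacle_op_def LX_def C12_derivatives)

lemma uplim_op: "smooth \<phi> \<Longrightarrow> z \<in> cylinder T \<Longrightarrow> touches_above T \<phi> (uplim T vh) z \<Longrightarrow> obstacle_op \<mu> \<sigma> F g \<phi> z \<le> 0"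
  using uplim_subsolution[OF smooth_C12] obstacle_op_C12[OF smooth_C12] by metis

lemma lowlim_ge_g: "z \<in> cylinder T \<Longrightarrow> g z \<le> lowlim z"
  using lo.uplim_le[of z "\<lambda>z. - g z"] vh_ge_g continuous_on_minus[OF g_cont] by (simp add: lowlim_def)

text \<open>If the limits were in reverse order, a common grid point near \<open>z\<close> would
  have a value both below and above an intermediate number.\<close>

lemma lowlim_le_uplim:
  assumes z: "z \<in> cylinder T"
  shows "lowlim z \<le> uplim T vh z"
proof (rule ccontr)
  assume "\<not> ?thesis"
  then have lt: "uplim T vh z < lowlim z" by simp
  define c where "c = (uplim T vh z + lowlim z) / 2"
  have 1: "uplim T vh z < c" using lt by (simp add: c_def)
  have "c < lowlim z" using lt by (simp add: c_def)
  then have 2: "uplim T (\<lambda>n z. - vh n z) z < - c" unfolding lowlim_def by linarith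
  obtain c1 e1 N1 where c1: "c1 < c" "e1 > 0" "\<And>n y. n \<ge> N1 \<Longrightarrow> y \<in> grid_pts T n \<Longrightarrow> dist y z < e1 \<Longrightarrow> vh n y \<le> c1"
    using up.uplim_less[OF 1] by metis
  obtain c2 e2 N2 where c2: "c2 < - c" "e2 > 0" "\<And>n y. n \<ge> N2 \<Longrightarrow> y \<in> grid_pts T n \<Longrightarrow> dist y z < e2 \<Longrightarrow> - vh n y \<le> c2"
    using lo.uplim_less[OF 2] by metis
  have "min e1 e2 > 0" using c1 c2 by simp
  from grid_pts_dense[OF T z this] obtain N3 where N3: "\<And>n. n \<ge> N3 \<Longrightarrow> \<exists>y\<in>grid_pts T n. dist y z < min e1 e2" by blast
  define n where "n = max N1 (max N2 N3)"
  have "n \<ge> N3" by (simp add: n_def)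
  then obtain y where y: "y \<in> grid_pts T n" "dist y z < min e1 e2" using N3 by blast
  have "vh n y \<le> c1" using y by (intro c1(3)) (auto simp: n_def)
  moreover have "- vh n y \<le> c2" using y by (intro c2(3)) (auto simp: n_def)
  ultimately show False using c1(1) c2(1) by linarith
qed

lemma uplim_interior_subsolution: "interior_subsolution T \<mu> \<sigma> F g (uplim T vh)"
  unfolding interior_subsolution_def using up.usc_uplim uplim_op by auto

lemma lowlim_interior_supersolution: "interior_supersolution T \<mu> \<sigma> F g lowlim"
  unfolding interior_supersolution_def
proof (intro conjI ballI allI impI)
  show "lsc_on (cylinder T) lowlim"
    unfolding lsc_on_def
  proof (intro ballI allI impI)
    fix z c assume z: "z \<in> cylinder T" "c < lowlim z"
    then have "\<forall>\<^sub>F y in at z within cylinder T. uplim T (\<lambda>n z. - vh n z) y < - c"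
      using lo.usc_uplim by (auto simp: usc_on_def lowlim_def)
    then show "\<forall>\<^sub>F y in at z within cylinder T. c < lowlim y" by eventually_elim (simp add: lowlim_def)
  qed
  fix z \<phi> assume z: "z \<in> {0..<T} \<times> UNIV" and \<phi>: "smooth \<phi> \<and> touches_below T \<phi> lowlim z"
  have zc: "z \<in> cylinder T" "fst z < T" using z by auto
  have "\<phi> z = lowlim z" using \<phi> by (simp add: touches_below_def)
  then have "\<phi> z - g z \<ge> 0" using lowlim_ge_g[OF zc(1)] by simp
  then show "obstacle_op \<mu> \<sigma> F g \<phi> z \<ge> 0"
    using lowlim_supersolution[OF smooth_C12 zc] \<phi> unfolding obstacle_op_C12[OF smooth_C12[OF conjunct1[OF \<phi>]]] by simp
qed

lemma uplim_terminal: "uplim T vh (T, x) \<le> g (T, x)"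
  by (rule terminal_upper[OF up.usc_uplim up.uplim_bound]) (auto intro: uplim_op smooth_pen)

lemma scheme_converges:
  assumes cmp: "comparison_bounded T \<mu> \<sigma> F g"
  shows "\<exists>v. bounded (v ` cylinder T) \<and> grid_locally_uniform_limit T vh v \<and> viscosity_solution T \<mu> \<sigma> F g v \<and>
    (\<forall>w. bounded (w ` cylinder T) \<and> viscosity_solution T \<mu> \<sigma> F g w \<longrightarrow> (\<forall>z\<in>cylinder T. w z = v z))"
proof (intro exI conjI allI impI)
  define v where "v = uplim T vh"
  have vb: "bounded (v ` cylinder T)" unfolding bounded_iff v_def using up.uplim_bound by auto
  have lb: "bounded (lowlim ` cylinder T)" unfolding bounded_iff lowlim_def using lo.uplim_bound by auto
  have cT: "(T, x) \<in> cylinder T" for x :: "real^'d" using T by simp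
  have "v (T, x) \<le> lowlim (T, x)" for x using uplim_terminal[of x] lowlim_ge_g[OF cT, of x] by (simp add: v_def)
  \<comment> \<open>Terminal ordering holds because the obstacle lies between the two: the upper
    limit is at most \<open>g\<close> at \<open>T\<close>, the lower one at least
    \<open>g\<close>.\<close>
  then have le: "\<forall>z\<in>cylinder T. v z \<le> lowlim z"
    using cmp[unfolded comparison_bounded_def, rule_format, of v lowlim] vb lb uplim_interior_subsolution lowlim_interior_supersolution
    by (simp add: v_def)
  have eq: "lowlim z = v z" if z: "z \<in> cylinder T" for z
    using lowlim_le_uplim[OF z] bspec[OF le z] by (simp add: v_def)
  have usc: "usc_on (cylinder T) v" unfolding v_def by (rule up.usc_uplim)
  \<comment> \<open>The two limits agree only on the cylinder, so semicontinuity, and touching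
    below, are transferred by congruence on that set.\<close>
  have lsc: "lsc_on (cylinder T) v"
    by (rule lsc_on_cong[OF conjunct1[OF lowlim_interior_supersolution[unfolded interior_supersolution_def]] eq])
  have cont: "continuous_on (cylinder T) v" by (rule continuous_on_if_usc_lsc[OF usc lsc])
  have vT: "v (T, x) = g (T, x)" for x
    using uplim_terminal[of x] lowlim_ge_g[OF cT, of x] eq[OF cT, of x] by (simp add: v_def)
  have sup: "interior_supersolution T \<mu> \<sigma> F g v"
    unfolding interior_supersolution_def
  proof (intro conjI lsc ballI allI impI)
    fix z \<phi> assume z: "z \<in> {0..<T} \<times> UNIV" and \<phi>: "smooth \<phi> \<and> touches_below T \<phi> v z"
    have "z \<in> cylinder T" using z by auto
    moreover have "v z - \<phi> z = 0" "\<forall>y\<in>cylinder T. v y - \<phi> y \<ge> v z - \<phi> z"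
      using conjunct2[OF \<phi>] unfolding touches_below_def by blast+
    ultimately have "touches_below T \<phi> lowlim z"
      unfolding touches_below_def by (intro conjI ballI) (metis eq)+
    then show "obstacle_op \<mu> \<sigma> F g \<phi> z \<ge> 0"
      using conjunct2[OF lowlim_interior_supersolution[unfolded interior_supersolution_def]] z \<phi> by blast
  qed
  show "bounded (uplim T vh ` cylinder T)" using vb by (simp add: v_def)
  show vs: "viscosity_solution T \<mu> \<sigma> F g (uplim T vh)"
    using uplim_interior_subsolution sup vT
    unfolding viscosity_solution_def viscosity_subsolution_def viscosity_supersolution_def v_def by simp
  show "grid_locally_uniform_limit T vh (uplim T vh)"
    unfolding grid_locally_uniform_limit_def v_def[symmetric]
  proof (intro allI impI)
    fix C :: "(real \<times> (real^'d)) set" and e :: real assume C: "compact C \<and> C \<subseteq> cylinder T" and e: "e > 0"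
    have vc: "continuous_on C v" using cont C by (auto intro: continuous_on_subset)
    have c1: "continuous_on C (\<lambda>z. v z + e)" and c2: "continuous_on C (\<lambda>z. - v z + e)" by (intro continuous_intros vc)+
    \<comment> \<open>On a compact set both relaxed limits are strictly below the continuous
      functions \<open>v + e\<close> and \<open>-v + e\<close>; \<open>uplim_compact\<close> turns
      this into the uniform estimate.\<close>
    have l1: "uplim T vh z < v z + e" if "z \<in> C" for z using e by (simp add: v_def)
    have l2: "uplim T (\<lambda>n z. - vh n z) z < - v z + e" if "z \<in> C" for z
    proof -
      have "lowlim z = v z" using eq C that by blast
      then show ?thesis using e by (simp add: lowlim_def)
    qed
    obtain N1 where N1: "\<And>n y. n \<ge> N1 \<Longrightarrow> y \<in> grid_pts T n \<Longrightarrow> y \<in> C \<Longrightarrow> vh n y < v y + e"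
      using up.uplim_compact[OF conjunct1[OF C] conjunct2[OF C] c1 l1] by metis
    obtain N2 where N2: "\<And>n y. n \<ge> N2 \<Longrightarrow> y \<in> grid_pts T n \<Longrightarrow> y \<in> C \<Longrightarrow> - vh n y < - v y + e"
      using lo.uplim_compact[OF conjunct1[OF C] conjunct2[OF C] c2 l2] by metis
    show "\<forall>\<^sub>F n in sequentially. \<forall>i\<le>n. \<forall>x. (grid T n i, x) \<in> C \<longrightarrow> \<bar>vh n (grid T n i, x) - v (grid T n i, x)\<bar> < e"
      unfolding eventually_sequentially
    proof (intro exI[of _ "max N1 N2"] allI impI)
      fix n i x assume n: "max N1 N2 \<le> n" and i: "i \<le> n" and x: "(grid T n i, x) \<in> C"
      have y: "(grid T n i, x) \<in> grid_pts T n" using i by (auto simp: grid_pts_def)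
      show "\<bar>vh n (grid T n i, x) - v (grid T n i, x)\<bar> < e"
        using N1[OF _ y x] N2[OF _ y x] n by auto
    qed
  qed
  fix w assume w: "bounded (w ` cylinder T) \<and> viscosity_solution T \<mu> \<sigma> F g w"
  \<comment> \<open>With equal terminal values comparison can be applied in both directions.\<close>
  have wT: "w (T, x) = v (T, x)" for x using viscosity_terminal w vT by simp
  have "interior_subsolution T \<mu> \<sigma> F g w" "interior_supersolution T \<mu> \<sigma> F g w"
    using w unfolding viscosity_solution_def viscosity_subsolution_def viscosity_supersolution_def by auto
  moreover have "interior_subsolution T \<mu> \<sigma> F g v" using uplim_interior_subsolution by (simp add: v_def)
  ultimately have "\<forall>z\<in>cylinder T. w z \<le> v z" "\<forall>z\<in>cylinder T. v z \<le> w z"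
    using cmp[unfolded comparison_bounded_def, THEN spec, THEN spec, THEN mp, of w v]
      cmp[unfolded comparison_bounded_def, THEN spec, THEN spec, THEN mp, of v w] w vb sup wT by simp_all
  then show "\<forall>z\<in>cylinder T. w z = uplim T vh z" unfolding v_def by (blast intro: antisym)
qed

end

text \<open>\<open>vh\<close> is an arbitrary family satisfying the recursion at grid times.
  Continuity of \<open>F\<close> in time is stated as \<open>F_cont\<close>, beside the Lipschitz
  condition in the other variables; it lets \<open>F\<close> pass to the limit along times tending
  to the touching time.\<close>

theorem theorem3p4:
  fixes T :: real
    and \<mu> :: "real \<times> (real^'d) \<Rightarrow> real^'d"
    and \<sigma> :: "real \<times> (real^'d) \<Rightarrow> real^'d^'d"
    and F :: "'d nonlin"
    and g :: "real \<times> (real^'d) \<Rightarrow> real"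
    and M :: "'w measure"
    and W :: "real \<Rightarrow> 'w \<Rightarrow> real^'d"
    and vh :: "nat \<Rightarrow> real \<times> (real^'d) \<Rightarrow> real"
  assumes T: "T > 0"
    and W: "brownian_motion M W"
    and F: "assumption_F T \<mu> \<sigma> F"
    and F_cont: "\<And>x r p \<gamma>. \<gamma> \<in> sym_mats \<Longrightarrow> continuous_on {0..T} (\<lambda>t. F (t, x) r p \<gamma>)"
    and comparison: "comparison_bounded T \<mu> \<sigma> F g"
    and g_bounded: "bounded (g ` cylinder T)"
    and g_regular: "par_seminorm T g < \<infinity>"
    and scheme: "\<And>n. n \<ge> 1 \<Longrightarrow> backward_scheme M W T \<mu> \<sigma> F g n (vh n)"
  shows "\<exists>v. bounded (v ` cylinder T) \<and>
    grid_locally_uniform_limit T vh v \<and>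
    viscosity_solution T \<mu> \<sigma> F g v \<and>
    (\<forall>w. bounded (w ` cylinder T) \<and> viscosity_solution T \<mu> \<sigma> F g w \<longrightarrow>
       (\<forall>z\<in>cylinder T. w z = v z))"
proof -
  obtain K L where
      Lip: "\<forall>t\<in>{0..T}. L-lipschitz_on (UNIV \<times> UNIV \<times> UNIV \<times> sym_mats) (\<lambda>(x, r, p, \<gamma>). F (t, x) r p \<gamma>)"
    and F0: "sup_norm T (\<lambda>z. F z 0 0 0) < ereal K"
    and inv: "\<forall>z\<in>cylinder T. invertible (\<sigma> z)"
    and norms: "par_norm T \<mu> + par_norm T \<sigma> < \<infinity>"
    and ell: "\<forall>z\<in>cylinder T. \<forall>r p. \<forall>\<gamma>\<in>sym_mats. \<forall>\<gamma>'\<in>sym_mats.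
        (\<forall>y. y \<bullet> (\<gamma> *v y) \<le> y \<bullet> (\<gamma>' *v y)) \<longrightarrow> F z r p \<gamma> \<le> F z r p \<gamma>'"
    and tr: "\<forall>z\<in>cylinder T. \<forall>r p. \<forall>\<gamma>\<in>sym_mats. \<forall>G. has_F_gamma F z r p \<gamma> G \<longrightarrow> matrix_inv (diffusion \<sigma> z) \<bullet> G \<le> 1"
    and im: "\<forall>z\<in>cylinder T. \<forall>r p. \<forall>\<gamma>\<in>sym_mats. \<forall>P G.
        has_F_p F z r p \<gamma> P \<and> has_F_gamma F z r p \<gamma> G \<longrightarrow> P \<in> range (\<lambda>y. G *v y)"
    and sg: "\<forall>z\<in>cylinder T. \<forall>r p. \<forall>\<gamma>\<in>sym_mats. \<forall>R P G.
        has_F_r F z r p \<gamma> R \<and> has_F_p F z r p \<gamma> P \<and> has_F_gamma F z r p \<gamma> G \<longrightarrow>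
        R - 1 / 4 * (P \<bullet> (pseudo_inv G *v P)) \<ge> 0"
    using F unfolding assumption_F_def by (elim exE conjE) (rule that; assumption)
  have "par_norm T \<mu> < \<infinity>" "par_norm T \<sigma> < \<infinity>" using norms by (auto simp: less_top[symmetric])
  then have "par_seminorm T \<mu> < \<infinity>" "par_seminorm T \<sigma> < \<infinity>" unfolding par_norm_def by (auto simp: less_top[symmetric])
  then have cont: "continuous_on (cylinder T) \<mu>" "continuous_on (cylinder T) \<sigma>" by (simp_all add: par_seminorm_continuous)
  have F0': "\<bar>F z 0 0 0\<bar> \<le> K" if "z \<in> cylinder T" for z
  proof -
    have "ereal (norm (F z 0 0 0)) \<le> sup_norm T (\<lambda>z. F z 0 0 0)" unfolding sup_norm_def using that by (intro SUP_upper)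
    then have "ereal (norm (F z 0 0 0)) < ereal K" using F0 by (rule le_less_trans)
    then show ?thesis by simp
  qed
  interpret obstacle_scheme_values T \<mu> \<sigma> F g M W K L vh
  proof
    show "L-lipschitz_on (UNIV \<times> UNIV \<times> UNIV \<times> sym_mats) (\<lambda>(x, r, p, \<gamma>). F (t, x) r p \<gamma>)"
      if "t \<in> {0..T}" for t using Lip that by (rule bspec)
    show "continuous_on (cylinder T) g" by (rule par_seminorm_continuous[OF g_regular])
    show "F z r p \<gamma> \<le> F z r p \<gamma>'"
      if "z \<in> cylinder T" "\<gamma> \<in> sym_mats" "\<gamma>' \<in> sym_mats" "\<And>y. y \<bullet> (\<gamma> *v y) \<le> y \<bullet> (\<gamma>' *v y)" for z r p \<gamma> \<gamma>'
      using ell[THEN bspec, OF that(1), THEN spec, THEN spec, THEN bspec, OF that(2), THEN bspec, OF that(3)] that(4) by blast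
    show "matrix_inv (diffusion \<sigma> z) \<bullet> G \<le> 1"
      if "z \<in> cylinder T" "\<gamma> \<in> sym_mats" "has_F_gamma F z r p \<gamma> G" for z r p \<gamma> G using tr that by blast
    show "P \<in> range (\<lambda>y. G *v y)"
      if "z \<in> cylinder T" "\<gamma> \<in> sym_mats" "has_F_p F z r p \<gamma> P" "has_F_gamma F z r p \<gamma> G" for z r p \<gamma> P G
      using im that by blast
    show "R - 1 / 4 * (P \<bullet> (pseudo_inv G *v P)) \<ge> 0"
      if "z \<in> cylinder T" "\<gamma> \<in> sym_mats" "has_F_r F z r p \<gamma> R" "has_F_p F z r p \<gamma> P" "has_F_gamma F z r p \<gamma> G"
      for z r p \<gamma> R P G using sg that by blast
    show "invertible (\<sigma> z)" if "z \<in> cylinder T" for z using inv that by (rule bspec)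
  qed (fact T W F0' cont F_cont g_bounded scheme)+
  show ?thesis by (rule scheme_converges[OF comparison])
qed

end
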